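(* Suppose $(f,\Phi)$ satisfies Assumption (A2) of the context. If $u^1$ and $u^2$ are two classical solutions of the path-dependent master equation $$\begin{cases}\partial_tu(t,\gamma,\mu)+\frac12\mathrm{Tr}[\partial^2_\omega u(t,\gamma,\mu)]+\frac12\mathrm{Tr}\Big[\int_{\mathbb C}\partial_{\tilde\omega}\partial_\mu u(t,\gamma,\mu,\tilde\omega)\,\mu(d\tilde\omega)\Big]\\ \qquad+f\big(t,\gamma,u(t,\gamma,\mu),\partial_\omega u(t,\gamma,\mu),\mu,\mathcal L_{u(t,W^\mu,\mu)}\big)=0,\\ u(T,\gamma,\mu)=\Phi(\gamma_T,\mu_T),\qquad(t,\gamma,\mu)\in[0,T]\times\mathbb C\times\mathcal P_2^C,\end{cases}$$ where $W^\mu$ is the canonical process under $\mu$, then $u^1=u^2$.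
   Context: Fix $T>0$, $d\ge 1$. $\mathbb C=C([0,T],\mathbb R^d)$ and $\mathbb D=D([0,T],\mathbb R^d)$ (càdlàg paths), both with the sup norm $\|\cdot\|$. For a path $\omega$, $\omega(t)$ is its value at $t$, $\omega_t:=\omega(\cdot\wedge t)$ the path stopped at $t$. $\mathcal P_2^D$ (resp. $\mathcal P_2^C$): probability measures $\mu$ on $\mathbb D$ (resp. $\mathbb C$) with $|||\mu|||^2:=\mathbb E^\mu[\|W\|^2]<\infty$, $W$ the canonical process; $\mu_t$ is the law of $W_t$ under $\mu$; $W_2$ is the 2-Wasserstein distance for $\|\cdot\|$; $\mathcal P_2(\mathbb R)$ carries its 2-Wasserstein distance. $\hat{\mathbb D}=[0,T]\times\mathbb D\times\mathcal P_2^D$, $\hat{\mathbb C}=[0,T]\times\mathbb C\times\mathcal P_2^C$. $\mathcal L_\xi$ is the law of $\xi$. $(\Omega,\mathcal F,P)$ is an atomless probability space with a $d$-dimensional Brownian motion $B$ and a complete filtration $(\mathcal F_t)$ for which $B$ is a Brownian motion, rich enough that each $\mu\in\mathcal P_2^D$ is the law of an adapted càdlàg process. Derivatives. $f:\hat{\mathbb D}\to\mathbb R$ is non-anticipative if $f(t,\omega,\mu)=f(t,\omega_t,\mu_t)$. Horizontal derivative: $\partial_tf(t,\omega,\mu)=\lim_{h\to0^+}\frac1h[f(t+h,\omega_t,\mu_t)-f(t,\omega_t,\mu_t)]$. For $\tau\le t$, the strong vertical derivative (SVD) in the path at $(\tau,t,\omega)$ is $\partial_{\omega_\tau}f(t,\omega,\mu)\in\mathbb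 R^d$ with $f(t,\omega+x1_{[\tau,T]},\mu)=f(t,\omega,\mu)+\partial_{\omega_\tau}f(t,\omega,\mu)x+o(|x|)$; the SVD in the measure at $(\tau,t,\mu)$ is a non-anticipative jointly measurable $\partial_{\mu_\tau}f(t,\omega,\mu,\tilde\omega)$, $\tilde\omega\in\mathbb D$, with $f(t,\omega,\mathcal L_{\eta+\xi1_{[\tau,T]}})=f(t,\omega,\mathcal L_\eta)+\mathbb E^P[\partial_{\mu_\tau}f(t,\omega,\mu,\eta)\xi]+o(\|\xi\|_{L^2})$ for $\mathcal L_\eta=\mu$, $\xi\in L^2(\mathcal F_\tau;\mathbb R^d)$. $\partial^2_{\omega_\tau}f$ and $\partial_{\tilde\omega_\tau}\partial_{\mu_\tau}f$ are the SVDs at $(\tau,t,\omega)$ of $\partial_{\omega_\tau}f(t,\cdot,\mu)$ and at $(\tau,t,\tilde\omega)$ of $\partial_{\mu_\tau}f(t,\omega,\mu,\cdot)$. Vertical derivatives $\partial_\omega,\partial_\omega^2,\partial_\mu,\partial_{\tilde\omega}\partial_\mu$ are the case $\tau=t$. Continuity is with respect to $|t-t'|+\|\omega_t-\omega'_{t'}\|+W_2(\mu_t,\mu'_{t'})$, adding $|\tau-\tau'|$ for SVDs, $\|\tilde\omega_t-\tilde\omega'_{t'}\|$ when $\tilde\omega$ occurs, and the natural distances in further variables. Classical solutions. $\mathscr C^{1,2,1,1}_p(\hat{\mathbb D})$: continuous non-anticipative $F$ with $\partial_tF,\partial_\omega F,\partial^2_\omega F,\partial_\mu F,\partial_{\tilde\omega}\partial_\mu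 F$ existing, continuous and, for some $k\in\mathbb Z^+$ and all $K>0$, $|\phi|\le C_K(1+\|\omega_t\|^k)$ for $\phi\in\{F,\partial_tF,\partial_\omega F,\partial^2_\omega F\}$, $|\psi|\le C_K(1+\|\omega_t\|^k+\|\tilde\omega_t\|^k)$ for $\psi\in\{\partial_\mu F,\partial_{\tilde\omega}\partial_\mu F\}$ whenever $|||\mu_t|||\le K$. $\mathscr C^{1,2,1,1}_p(\hat{\mathbb C})$ is the set of $u:\hat{\mathbb C}\to\mathbb R$ having an extension $F\in\mathscr C^{1,2,1,1}_p(\hat{\mathbb D})$; derivatives of $u$ on $\hat{\mathbb C}$ are by definition those of $F$ (only the symmetric part of $\partial_{\tilde\omega}\partial_\mu u$ enters the equation). A classical solution is a $u\in\mathscr C^{1,2,1,1}_p(\hat{\mathbb C})$ satisfying the equation. Assumption (A2): $\Phi:\mathbb C\times\mathcal P_2^C\to\mathbb R$ and $f:[0,T]\times\mathbb C\times\mathbb R\times\mathbb R^d\times\mathcal P_2^C\times\mathcal P_2(\mathbb R)\to\mathbb R$ are the restrictions of some $\Phi'$ and $f'$ satisfying (H2): (i) $\Phi':\mathbb D\times\mathcal P_2^D\to\mathbb R$ is Lipschitz; its SVDs (as a functional at time $T$) $\partial_{\omega_\tau}\Phi',\partial_{\mu_\tau}\Phi',\partial^2_{\omega_\tau}\Phi',\partial_{\tilde\omega_\tau}\partial_{\mu_\tau}\Phi'$, $\tau\in[0,T]$, exist, are continuous (for $|\tau-\tau'|+\|\omega-\omega'\|+W_2(\mu,\mu')$, plus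 $\|\tilde\omega-\tilde\omega'\|$ where relevant), and are Lipschitz in $(\omega,\mu)$, resp. $(\omega,\mu,\tilde\omega)$, uniformly in $\tau$. (ii) $f'(t,\omega,y,z,\mu,\nu)$ on $[0,T]\times\mathbb D\times\mathbb R\times\mathbb R^d\times\mathcal P_2^D\times\mathcal P_2(\mathbb R)$ is non-anticipative and continuous; it is differentiable in $(y,z,\nu)$ with bounded derivatives ($\partial_\nu f'(\cdot,\nu,\tilde y)$ is Lions' derivative, $\tilde y\in\mathbb R$), and strongly vertically differentiable in $\omega_t$ and in $\mu_t$; $\partial_{(y,z,\nu,\omega_\tau,\mu_\tau)}f'$ is continuous; for $\tau\le t$, $f'(t,\cdot)$ and these derivatives are Lipschitz uniformly in $(\tau,t)$. Moreover $\partial_yf',\partial_zf'$ are differentiable in $(y,z)$ and strongly vertically differentiable in $\omega_t$; $\partial_{\omega_\tau}f'$ is strongly vertically differentiable at $(\tau,t,\omega)$; $\partial_\nu f'$ is differentiable in $\tilde y$; $\partial_{\mu_\tau}f'(\ldots,\tilde\omega)$ is strongly vertically differentiable at $(\tau,t,\tilde\omega)$; all second-order derivatives are continuous and $(\partial_y^2,\partial_y\partial_z,\partial_z^2,\partial^2_{\omega_\tau},\partial_{\tilde y}\partial_\nu,\partial_{\tilde\omega_\tau}\partial_{\mu_\tau})f'(t,\cdot)$ is uniformly Lipschitz. *)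

theory Defs
  imports "HOL-Probability.Probability"
begin

section \<open>Paths and laws\<close>

text \<open>Paths on \<open>[0,T]\<close> are represented by functions on the reals that vanish off \<open>[0,T]\<close>,
  so that equality of paths is equality of functions and paths can be added pointwise.\<close>

type_synonym 'd path = "real \<Rightarrow> real ^ 'd"
type_synonym 'd law = "'d path measure"

definition cadlag :: "real \<Rightarrow> ('d::finite) path set" where
  "cadlag T = {\<omega>. (\<forall>t\<in>{0..<T}. continuous (at_right t) \<omega>) \<and>
                    (\<forall>t\<in>{0<..T}. \<exists>l. (\<omega> \<longlongrightarrow> l) (at_left t)) \<and>
                    (\<forall>t. t \<notin> {0..T} \<longrightarrow> \<omega> t = 0)}"

definition cpaths :: "real \<Rightarrow> ('d::finite) path set" where
  "cpaths T = {\<omega>. continuous_on {0..T} \<omega> \<and> (\<forall>t. t \<notin> {0..T} \<longrightarrow> \<omega> t = 0)}"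

definition sup_norm :: "real \<Rightarrow> ('d::finite) path \<Rightarrow> real" where
  "sup_norm T \<omega> = (SUP s\<in>{0..T}. norm (\<omega> s))"

definition stop :: "real \<Rightarrow> real \<Rightarrow> ('d::finite) path \<Rightarrow> 'd path" where
  "stop T t \<omega> = (\<lambda>s. if s \<in> {0..T} then \<omega> (min s t) else 0)"

text \<open>\<open>shift T \<tau> x \<omega>\<close> is the path \<open>\<omega> + x 1\<^bsub>[\<tau>,T]\<^esub>\<close>.\<close>

definition shift :: "real \<Rightarrow> real \<Rightarrow> real ^ 'd \<Rightarrow> ('d::finite) path \<Rightarrow> 'd path" where
  "shift T \<tau> x \<omega> = (\<lambda>s. \<omega> s + indicator {\<tau>..T} s *\<^sub>R x)"

text \<open>Laws live on the \<open>\<sigma>\<close>-algebra generated by the coordinate maps. For continuous paths it is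
  the Borel \<open>\<sigma>\<close>-algebra of the sup norm; for cadlag paths it is strictly smaller.\<close>

definition path_space :: "('d::finite) path set \<Rightarrow> 'd law" where
  "path_space S = restrict_space (\<Pi>\<^sub>M t\<in>UNIV. borel) S"

definition P2 :: "real \<Rightarrow> ('d::finite) path set \<Rightarrow> 'd law set" where
  "P2 T S = {\<mu>. prob_space \<mu> \<and> sets \<mu> = sets (path_space S) \<and>
                 integrable \<mu> (\<lambda>\<omega>. (sup_norm T \<omega>)\<^sup>2)}"

abbreviation P2D :: "real \<Rightarrow> ('d::finite) law set" where
  "P2D T \<equiv> P2 T (cadlag T)"

abbreviation P2C :: "real \<Rightarrow> ('d::finite) law set" where
  "P2C T \<equiv> P2 T (cpaths T)"

definition P2R :: "real measure set" where
  "P2R = {\<nu>. prob_space \<nu> \<and> sets \<nu> = sets borel \<and> integrable \<nu> (\<lambda>y. y\<^sup>2)}"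

definition law_norm :: "real \<Rightarrow> ('d::finite) law \<Rightarrow> real" where
  "law_norm T \<mu> = sqrt (\<integral>\<omega>. (sup_norm T \<omega>)\<^sup>2 \<partial>\<mu>)"

definition stop_law :: "real \<Rightarrow> real \<Rightarrow> ('d::finite) law \<Rightarrow> 'd law" where
  "stop_law T t \<mu> = distr \<mu> \<mu> (stop T t)"

text \<open>A law on continuous paths, seen as a law on cadlag paths.\<close>

definition embed_law :: "real \<Rightarrow> ('d::finite) law \<Rightarrow> 'd law" where
  "embed_law T \<mu> = distr \<mu> (path_space (cadlag T)) (\<lambda>\<omega>. \<omega>)"

definition couplings :: "'a measure \<Rightarrow> 'a measure \<Rightarrow> ('a \<times> 'a) measure set" where
  "couplings \<mu> \<nu> = {\<pi>. sets \<pi> = sets (\<mu> \<Otimes>\<^sub>M \<nu>) \<and> distr \<pi> \<mu> fst = \<mu> \<and> distr \<pi> \<nu> snd = \<nu>}"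

definition wasserstein2 :: "('a \<Rightarrow> 'a \<Rightarrow> real) \<Rightarrow> 'a measure \<Rightarrow> 'a measure \<Rightarrow> real" where
  "wasserstein2 d \<mu> \<nu> =
     sqrt (enn2real (INF \<pi>\<in>couplings \<mu> \<nu>. \<integral>\<^sup>+ p. ennreal ((d (fst p) (snd p))\<^sup>2) \<partial>\<pi>))"

definition W2 :: "real \<Rightarrow> ('d::finite) law \<Rightarrow> 'd law \<Rightarrow> real" where
  "W2 T = wasserstein2 (\<lambda>\<omega> \<omega>'. sup_norm T (\<lambda>s. \<omega> s - \<omega>' s))"

definition W2R :: "real measure \<Rightarrow> real measure \<Rightarrow> real" where
  "W2R = wasserstein2 dist"

text \<open>The Borel \<open>\<sigma>\<close>-algebra of a set \<open>X\<close> under a distance \<open>d\<close>; it is used on sets of laws.\<close>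

definition borel_of :: "('a \<Rightarrow> 'a \<Rightarrow> real) \<Rightarrow> 'a set \<Rightarrow> 'a measure" where
  "borel_of d X = sigma X {U. U \<subseteq> X \<and> (\<forall>p\<in>U. \<exists>e>0. \<forall>q\<in>X. d p q < e \<longrightarrow> q \<in> U)}"

section \<open>The probability space\<close>

definition adapted_cadlag ::
  "real \<Rightarrow> 'w measure \<Rightarrow> (real \<Rightarrow> 'w measure) \<Rightarrow> ('w \<Rightarrow> ('d::finite) path) \<Rightarrow> bool" where
  "adapted_cadlag T M Fil \<eta> \<longleftrightarrow>
     (\<forall>w\<in>space M. \<eta> w \<in> cadlag T) \<and> (\<forall>s\<in>{0..T}. (\<lambda>w. \<eta> w s) \<in> borel_measurable (Fil s))"

definition path_law :: "real \<Rightarrow> 'w measure \<Rightarrow> ('w \<Rightarrow> ('d::finite) path) \<Rightarrow> 'd law" where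
  "path_law T M \<eta> = distr M (path_space (cadlag T)) \<eta>"

text \<open>Only the values of the filtration and of the Brownian motion on \<open>[0,T]\<close> matter.\<close>

locale stochastic_basis = prob_space M + filtration "space M" Fil
  for T :: real and M :: "'w measure" and Fil :: "real \<Rightarrow> 'w measure"
    and B :: "real \<Rightarrow> 'w \<Rightarrow> real ^ ('d::finite)" +
  assumes atomless:
      "\<And>A. A \<in> events \<Longrightarrow> 0 < prob A \<Longrightarrow> \<exists>A'\<in>events. A' \<subseteq> A \<and> 0 < prob A' \<and> prob A' < prob A"
    and subalg: "\<And>t. t \<in> {0..T} \<Longrightarrow> subalgebra M (Fil t)"
    and complete_filtration: "\<And>N A. N \<in> null_sets M \<Longrightarrow> A \<subseteq> N \<Longrightarrow> A \<in> sets (Fil 0)"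
    and B_zero: "AE w in M. B 0 w = 0"
    and B_continuous: "AE w in M. continuous_on {0..T} (\<lambda>t. B t w)"
    and B_adapted: "\<And>t. t \<in> {0..T} \<Longrightarrow> B t \<in> borel_measurable (Fil t)"
    and B_indep_past: "\<And>s t. 0 \<le> s \<Longrightarrow> s < t \<Longrightarrow> t \<le> T \<Longrightarrow>
      indep_set (sets (Fil s)) {(\<lambda>w. B t w - B s w) -` A \<inter> space M |A. A \<in> sets borel}"
    and B_indep_components: "\<And>s t. 0 \<le> s \<Longrightarrow> s < t \<Longrightarrow> t \<le> T \<Longrightarrow>
      indep_vars (\<lambda>_. borel) (\<lambda>i w. (B t w - B s w) $ i) (UNIV :: 'd set)"
    and B_normal: "\<And>s t i. 0 \<le> s \<Longrightarrow> s < t \<Longrightarrow> t \<le> T \<Longrightarrow>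
      distributed M lborel (\<lambda>w. (B t w - B s w) $ i) (normal_density 0 (sqrt (t - s)))"
    and rich: "\<And>\<mu> :: 'd law. \<mu> \<in> P2D T \<Longrightarrow>
      \<exists>\<eta>. adapted_cadlag T M Fil \<eta> \<and> path_law T M \<eta> = \<mu>"

section \<open>Continuity, Lipschitz conditions, derivatives\<close>

definition cont_wrt :: "('a \<Rightarrow> 'a \<Rightarrow> real) \<Rightarrow> 'a set \<Rightarrow> ('a \<Rightarrow> 'b::metric_space) \<Rightarrow> bool" where
  "cont_wrt d X g \<longleftrightarrow>
     (\<forall>p\<in>X. \<forall>e>0. \<exists>\<delta>>0. \<forall>q\<in>X. d p q < \<delta> \<longrightarrow> dist (g q) (g p) < e)"

text \<open>Lipschitz on every member of a family of sets, with a common constant. The members will be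
  the sets on which the time parameters are fixed.\<close>

definition unif_lip :: "('a \<Rightarrow> 'a \<Rightarrow> real) \<Rightarrow> 'a set set \<Rightarrow> ('a \<Rightarrow> 'b::metric_space) \<Rightarrow> bool" where
  "unif_lip d \<X> g \<longleftrightarrow> (\<exists>L. \<forall>X\<in>\<X>. \<forall>p\<in>X. \<forall>q\<in>X. dist (g p) (g q) \<le> L * d p q)"

definition path_dist :: "real \<Rightarrow> real \<Rightarrow> ('d::finite) path \<Rightarrow> real \<Rightarrow> 'd path \<Rightarrow> real" where
  "path_dist T t \<omega> t' \<omega>' = sup_norm T (\<lambda>s. stop T t \<omega> s - stop T t' \<omega>' s)"

definition dist_hat :: "real \<Rightarrow> real \<times> ('d::finite) path \<times> 'd law \<Rightarrow> real \<times> 'd path \<times> 'd law \<Rightarrow> real"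
  where "dist_hat T = (\<lambda>(t, \<omega>, \<mu>) (t', \<omega>', \<mu>').
     \<bar>t - t'\<bar> + path_dist T t \<omega> t' \<omega>' + W2 T (stop_law T t \<mu>) (stop_law T t' \<mu>'))"

definition has_path_svd ::
  "real \<Rightarrow> real \<Rightarrow> (('d::finite) path \<Rightarrow> 'b::real_normed_vector) \<Rightarrow> 'd path \<Rightarrow> (real ^ 'd \<Rightarrow> 'b) \<Rightarrow> bool"
  where "has_path_svd T \<tau> g \<omega> L \<longleftrightarrow> ((\<lambda>x. g (shift T \<tau> x \<omega>)) has_derivative L) (at 0)"

definition L2 :: "'w measure \<Rightarrow> 'w measure \<Rightarrow> ('w \<Rightarrow> 'b::euclidean_space) set" where
  "L2 M N = {\<xi> \<in> borel_measurable N. integrable M (\<lambda>w. (norm (\<xi> w))\<^sup>2)}"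

definition L2_norm :: "'w measure \<Rightarrow> ('w \<Rightarrow> 'b::euclidean_space) \<Rightarrow> real" where
  "L2_norm M \<xi> = sqrt (\<integral>w. (norm (\<xi> w))\<^sup>2 \<partial>M)"

text \<open>\<open>J \<xi> = c + E[G \<xi>] + o(\<parallel>\<xi>\<parallel>)\<close> over the \<open>N\<close>-measurable square-integrable \<open>\<xi>\<close>. The integrability
  clause says that the expectation exists (the Bochner integral is 0 otherwise).\<close>

definition L2_expansion ::
  "'w measure \<Rightarrow> 'w measure \<Rightarrow> (('w \<Rightarrow> 'b::euclidean_space) \<Rightarrow> real) \<Rightarrow> real \<Rightarrow> ('w \<Rightarrow> 'b) \<Rightarrow> bool" where
  "L2_expansion M N J c G \<longleftrightarrow>
     (\<forall>\<xi>\<in>L2 M N. integrable M (\<lambda>w. G w \<bullet> \<xi> w)) \<and>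
     (\<forall>e>0. \<exists>\<delta>>0. \<forall>\<xi>\<in>L2 M N. L2_norm M \<xi> < \<delta> \<longrightarrow>
        \<bar>J \<xi> - c - (\<integral>w. G w \<bullet> \<xi> w \<partial>M)\<bar> \<le> e * L2_norm M \<xi>)"

text \<open>The expansion is required along every adapted cadlag \<open>\<eta>\<close> with law \<open>\<mu>\<close>.\<close>

definition has_law_svd ::
  "real \<Rightarrow> 'w measure \<Rightarrow> (real \<Rightarrow> 'w measure) \<Rightarrow> real \<Rightarrow> (('d::finite) law \<Rightarrow> real) \<Rightarrow> 'd law \<Rightarrow>
     ('d path \<Rightarrow> real ^ 'd) \<Rightarrow> bool" where
  "has_law_svd T M Fil \<tau> g \<mu> D \<longleftrightarrow>
     (\<forall>\<eta>. adapted_cadlag T M Fil \<eta> \<and> path_law T M \<eta> = \<mu> \<longrightarrow>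
        L2_expansion M (Fil \<tau>) (\<lambda>\<xi>. g (path_law T M (\<lambda>w. shift T \<tau> (\<xi> w) (\<eta> w)))) (g \<mu>)
          (\<lambda>w. D (\<eta> w)))"

definition has_lions_derivative ::
  "'w measure \<Rightarrow> (real measure \<Rightarrow> real) \<Rightarrow> real measure \<Rightarrow> (real \<Rightarrow> real) \<Rightarrow> bool" where
  "has_lions_derivative M g \<nu> D \<longleftrightarrow> D \<in> borel_measurable borel \<and>
     (\<forall>Y\<in>L2 M M. distr M borel Y = \<nu> \<longrightarrow>
        L2_expansion M M (\<lambda>\<zeta>. g (distr M borel (\<lambda>w. Y w + \<zeta> w))) (g \<nu>) (\<lambda>w. D (Y w)))"

section \<open>Classical solutions\<close>

text \<open>\<open>F\<close> belongs to \<open>\<C>\<^sub>p\<^bsup>1,2,1,1\<^esup>\<close> on cadlag paths, with \<open>Ft\<close>, \<open>Fw\<close>, \<open>Fww\<close>, \<open>Fm\<close>, \<open>Fwm\<close> in the roles of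
  \<open>\<partial>\<^sub>t F\<close>, \<open>\<partial>\<^sub>\<omega> F\<close>, \<open>\<partial>\<^sup>2\<^sub>\<omega> F\<close>, \<open>\<partial>\<^sub>\<mu> F\<close> and the path derivative of \<open>\<partial>\<^sub>\<mu> F\<close> in its last argument. They are
  arguments, since \<open>\<partial>\<^sub>\<mu> F\<close> is not determined off the support of \<open>\<mu>\<close>. At \<open>t = T\<close>, where the limit
  defining \<open>\<partial>\<^sub>t F\<close> is meaningless, \<open>Ft\<close> is the continuous extension.\<close>

definition C1211p ::
  "real \<Rightarrow> 'w measure \<Rightarrow> (real \<Rightarrow> 'w measure) \<Rightarrow>
   (real \<Rightarrow> ('d::finite) path \<Rightarrow> 'd law \<Rightarrow> real) \<Rightarrow>
   (real \<Rightarrow> 'd path \<Rightarrow> 'd law \<Rightarrow> real) \<Rightarrow>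
   (real \<Rightarrow> 'd path \<Rightarrow> 'd law \<Rightarrow> real ^ 'd) \<Rightarrow>
   (real \<Rightarrow> 'd path \<Rightarrow> 'd law \<Rightarrow> real ^ 'd ^ 'd) \<Rightarrow>
   (real \<Rightarrow> 'd path \<Rightarrow> 'd law \<Rightarrow> 'd path \<Rightarrow> real ^ 'd) \<Rightarrow>
   (real \<Rightarrow> 'd path \<Rightarrow> 'd law \<Rightarrow> 'd path \<Rightarrow> real ^ 'd ^ 'd) \<Rightarrow> bool" where
  "C1211p T M Fil F Ft Fw Fww Fm Fwm \<longleftrightarrow>
     (let D = cadlag T; P = P2D T;
          X = {0..T} \<times> D \<times> P; X' = {0..T} \<times> D \<times> P \<times> D;
          d = dist_hat T;
          d' = (\<lambda>(t, \<omega>, \<mu>, v) (t', \<omega>', \<mu>', v'). d (t, \<omega>, \<mu>) (t', \<omega>', \<mu>') + path_dist T t v t' v')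
      in
      (\<forall>t\<in>{0..T}. \<forall>\<omega>\<in>D. \<forall>\<mu>\<in>P.
         F t \<omega> \<mu> = F t (stop T t \<omega>) (stop_law T t \<mu>) \<and>
         (t < T \<longrightarrow> ((\<lambda>h. (F (t + h) (stop T t \<omega>) (stop_law T t \<mu>)
                             - F t (stop T t \<omega>) (stop_law T t \<mu>)) / h) \<longlongrightarrow> Ft t \<omega> \<mu>) (at_right 0)) \<and>
         has_path_svd T t (\<lambda>\<omega>. F t \<omega> \<mu>) \<omega> (\<lambda>x. Fw t \<omega> \<mu> \<bullet> x) \<and>
         has_path_svd T t (\<lambda>\<omega>. Fw t \<omega> \<mu>) \<omega> (\<lambda>x. Fww t \<omega> \<mu> *v x) \<and>
         has_law_svd T M Fil t (F t \<omega>) \<mu> (Fm t \<omega> \<mu>) \<and>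
         (\<forall>v\<in>D. Fm t \<omega> \<mu> v = Fm t (stop T t \<omega>) (stop_law T t \<mu>) (stop T t v) \<and>
                has_path_svd T t (Fm t \<omega> \<mu>) v (\<lambda>x. Fwm t \<omega> \<mu> v *v x))) \<and>
      (\<lambda>(t, \<omega>, \<mu>, v). Fm t \<omega> \<mu> v) \<in> borel_measurable
         (restrict_space borel {0..T} \<Otimes>\<^sub>M path_space D \<Otimes>\<^sub>M borel_of (W2 T) P \<Otimes>\<^sub>M path_space D) \<and>
      cont_wrt d X (\<lambda>(t, \<omega>, \<mu>). F t \<omega> \<mu>) \<and>
      cont_wrt d X (\<lambda>(t, \<omega>, \<mu>). Ft t \<omega> \<mu>) \<and>
      cont_wrt d X (\<lambda>(t, \<omega>, \<mu>). Fw t \<omega> \<mu>) \<and>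
      cont_wrt d X (\<lambda>(t, \<omega>, \<mu>). Fww t \<omega> \<mu>) \<and>
      cont_wrt d' X' (\<lambda>(t, \<omega>, \<mu>, v). Fm t \<omega> \<mu> v) \<and>
      cont_wrt d' X' (\<lambda>(t, \<omega>, \<mu>, v). Fwm t \<omega> \<mu> v) \<and>
      (\<exists>k::nat. 0 < k \<and> (\<forall>K>0. \<exists>C. \<forall>t\<in>{0..T}. \<forall>\<omega>\<in>D. \<forall>\<mu>\<in>P. law_norm T (stop_law T t \<mu>) \<le> K \<longrightarrow>
         \<bar>F t \<omega> \<mu>\<bar> \<le> C * (1 + sup_norm T (stop T t \<omega>) ^ k) \<and>
         \<bar>Ft t \<omega> \<mu>\<bar> \<le> C * (1 + sup_norm T (stop T t \<omega>) ^ k) \<and>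
         norm (Fw t \<omega> \<mu>) \<le> C * (1 + sup_norm T (stop T t \<omega>) ^ k) \<and>
         norm (Fww t \<omega> \<mu>) \<le> C * (1 + sup_norm T (stop T t \<omega>) ^ k) \<and>
         (\<forall>v\<in>D.
           norm (Fm t \<omega> \<mu> v) \<le> C * (1 + sup_norm T (stop T t \<omega>) ^ k + sup_norm T (stop T t v) ^ k) \<and>
           norm (Fwm t \<omega> \<mu> v) \<le> C * (1 + sup_norm T (stop T t \<omega>) ^ k + sup_norm T (stop T t v) ^ k)))))"

text \<open>The integrability of \<open>Fwm\<close> and the membership in \<open>P2R\<close> say that the terms of the equation are
  defined: polynomial growth of arbitrary order does not give this for laws that only have second
  moments.\<close>

definition classical_solution ::
  "real \<Rightarrow> 'w measure \<Rightarrow> (real \<Rightarrow> 'w measure) \<Rightarrow>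
   (real \<Rightarrow> ('d::finite) path \<Rightarrow> real \<Rightarrow> real ^ 'd \<Rightarrow> 'd law \<Rightarrow> real measure \<Rightarrow> real) \<Rightarrow>
   ('d path \<Rightarrow> 'd law \<Rightarrow> real) \<Rightarrow>
   (real \<Rightarrow> 'd path \<Rightarrow> 'd law \<Rightarrow> real) \<Rightarrow> bool" where
  "classical_solution T M Fil f \<Phi> u \<longleftrightarrow>
     (\<exists>F Ft Fw Fww Fm Fwm.
        C1211p T M Fil F Ft Fw Fww Fm Fwm \<and>
        (\<forall>t\<in>{0..T}. \<forall>\<gamma>\<in>cpaths T. \<forall>\<mu>\<in>P2C T.
           u t \<gamma> \<mu> = F t \<gamma> (embed_law T \<mu>) \<and>
           integrable \<mu> (Fwm t \<gamma> (embed_law T \<mu>)) \<and>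
           distr \<mu> borel (\<lambda>\<omega>. u t \<omega> \<mu>) \<in> P2R \<and>
           Ft t \<gamma> (embed_law T \<mu>)
             + 1/2 * trace (Fww t \<gamma> (embed_law T \<mu>))
             + 1/2 * trace (\<integral>v. Fwm t \<gamma> (embed_law T \<mu>) v \<partial>\<mu>)
             + f t \<gamma> (u t \<gamma> \<mu>) (Fw t \<gamma> (embed_law T \<mu>)) \<mu> (distr \<mu> borel (\<lambda>\<omega>. u t \<omega> \<mu>)) = 0) \<and>
        (\<forall>\<gamma>\<in>cpaths T. \<forall>\<mu>\<in>P2C T. u T \<gamma> \<mu> = \<Phi> (stop T T \<gamma>) (stop_law T T \<mu>)))"

section \<open>Assumptions on the data\<close>

definition H2_terminal ::
  "real \<Rightarrow> 'w measure \<Rightarrow> (real \<Rightarrow> 'w measure) \<Rightarrow> (('d::finite) path \<Rightarrow> 'd law \<Rightarrow> real) \<Rightarrow> bool" where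
  "H2_terminal T M Fil \<Phi> \<longleftrightarrow>
     (let D = cadlag T; P = P2D T;
          d = (\<lambda>(\<omega>, \<mu>) (\<omega>', \<mu>'). sup_norm T (\<lambda>s. \<omega> s - \<omega>' s) + W2 T \<mu> \<mu>');
          d1 = (\<lambda>(\<tau>, p) (\<tau>', p'). \<bar>\<tau> - \<tau>'\<bar> + d p p');
          d2 = (\<lambda>(\<tau>, p, v) (\<tau>', p', v'). \<bar>\<tau> - \<tau>'\<bar> + d p p' + sup_norm T (\<lambda>s. v s - v' s));
          \<X>1 = {{\<tau>} \<times> (D \<times> P) |\<tau>. \<tau> \<in> {0..T}};
          \<X>2 = {{\<tau>} \<times> (D \<times> P) \<times> D |\<tau>. \<tau> \<in> {0..T}}
      in
      unif_lip d {D \<times> P} (\<lambda>(\<omega>, \<mu>). \<Phi> \<omega> \<mu>) \<and>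
      (\<exists>(\<Phi>w :: real \<Rightarrow> 'd path \<Rightarrow> 'd law \<Rightarrow> real ^ 'd)
         (\<Phi>m :: real \<Rightarrow> 'd path \<Rightarrow> 'd law \<Rightarrow> 'd path \<Rightarrow> real ^ 'd)
         (\<Phi>ww :: real \<Rightarrow> 'd path \<Rightarrow> 'd law \<Rightarrow> real ^ 'd ^ 'd)
         (\<Phi>wm :: real \<Rightarrow> 'd path \<Rightarrow> 'd law \<Rightarrow> 'd path \<Rightarrow> real ^ 'd ^ 'd).
        (\<forall>\<tau>\<in>{0..T}.
           (\<forall>\<omega>\<in>D. \<forall>\<mu>\<in>P.
              has_path_svd T \<tau> (\<lambda>\<omega>. \<Phi> \<omega> \<mu>) \<omega> (\<lambda>x. \<Phi>w \<tau> \<omega> \<mu> \<bullet> x) \<and>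
              has_law_svd T M Fil \<tau> (\<Phi> \<omega>) \<mu> (\<Phi>m \<tau> \<omega> \<mu>) \<and>
              has_path_svd T \<tau> (\<lambda>\<omega>. \<Phi>w \<tau> \<omega> \<mu>) \<omega> (\<lambda>x. \<Phi>ww \<tau> \<omega> \<mu> *v x) \<and>
              (\<forall>v\<in>D. has_path_svd T \<tau> (\<Phi>m \<tau> \<omega> \<mu>) v (\<lambda>x. \<Phi>wm \<tau> \<omega> \<mu> v *v x))) \<and>
           (\<lambda>(\<omega>, \<mu>, v). \<Phi>m \<tau> \<omega> \<mu> v) \<in> borel_measurable
              (path_space D \<Otimes>\<^sub>M borel_of (W2 T) P \<Otimes>\<^sub>M path_space D)) \<and>
        cont_wrt d1 (\<Union>\<X>1) (\<lambda>(\<tau>, \<omega>, \<mu>). \<Phi>w \<tau> \<omega> \<mu>) \<and>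
        cont_wrt d2 (\<Union>\<X>2) (\<lambda>(\<tau>, (\<omega>, \<mu>), v). \<Phi>m \<tau> \<omega> \<mu> v) \<and>
        cont_wrt d1 (\<Union>\<X>1) (\<lambda>(\<tau>, \<omega>, \<mu>). \<Phi>ww \<tau> \<omega> \<mu>) \<and>
        cont_wrt d2 (\<Union>\<X>2) (\<lambda>(\<tau>, (\<omega>, \<mu>), v). \<Phi>wm \<tau> \<omega> \<mu> v) \<and>
        unif_lip d1 \<X>1 (\<lambda>(\<tau>, \<omega>, \<mu>). \<Phi>w \<tau> \<omega> \<mu>) \<and>
        unif_lip d2 \<X>2 (\<lambda>(\<tau>, (\<omega>, \<mu>), v). \<Phi>m \<tau> \<omega> \<mu> v) \<and>
        unif_lip d1 \<X>1 (\<lambda>(\<tau>, \<omega>, \<mu>). \<Phi>ww \<tau> \<omega> \<mu>) \<and>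
        unif_lip d2 \<X>2 (\<lambda>(\<tau>, (\<omega>, \<mu>), v). \<Phi>wm \<tau> \<omega> \<mu> v)))"

text \<open>In the next definition \<open>fy\<close>, \<open>fz\<close>, \<open>fn\<close>, \<open>fw\<close>, \<open>fm\<close> are the derivatives in \<open>y\<close>, \<open>z\<close>, \<open>\<nu>\<close>, \<open>\<omega>\<^sub>\<tau>\<close>, \<open>\<mu>\<^sub>\<tau>\<close>;
  \<open>fyw\<close>, \<open>fzw\<close>, \<open>fww\<close> are the path derivatives of \<open>fy\<close>, \<open>fz\<close>, \<open>fw\<close>; \<open>fyn\<close> and \<open>fwm\<close> are the
  derivatives of \<open>fn\<close> and \<open>fm\<close> in their last argument. A single \<open>fyz\<close> serves for both mixed
  derivatives in \<open>(y, z)\<close>, which agree by the symmetry of second derivatives. The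
  Lipschitz conditions are for the distances of stopped paths and laws at equal times; by
  non-anticipativity this is the same as for the unstopped ones.\<close>

definition H2_driver ::
  "real \<Rightarrow> 'w measure \<Rightarrow> (real \<Rightarrow> 'w measure) \<Rightarrow>
   (real \<Rightarrow> ('d::finite) path \<Rightarrow> real \<Rightarrow> real ^ 'd \<Rightarrow> 'd law \<Rightarrow> real measure \<Rightarrow> real) \<Rightarrow> bool" where
  "H2_driver T M Fil f \<longleftrightarrow>
     (let D = cadlag T; P = P2D T;
          S = (\<lambda>t. {t} \<times> D \<times> (UNIV :: real set) \<times> (UNIV :: (real ^ 'd) set) \<times> P \<times> P2R);
          d = (\<lambda>(t, \<omega>, y, z, \<mu>, \<nu>) (t', \<omega>', y', z', \<mu>', \<nu>').
                 dist_hat T (t, \<omega>, \<mu>) (t', \<omega>', \<mu>') + \<bar>y - y'\<bar> + norm (z - z') + W2R \<nu> \<nu>');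
          dy = (\<lambda>(p, a) (p', a'). d p p' + \<bar>a - a'\<bar>);
          d1 = (\<lambda>(\<tau>, p) (\<tau>', p'). \<bar>\<tau> - \<tau>'\<bar> + d p p');
          d2 = (\<lambda>(\<tau>, p, v) (\<tau>', p', v').
                  \<bar>\<tau> - \<tau>'\<bar> + d p p' + path_dist T (fst p) v (fst p') v');
          \<X> = {S t |t. t \<in> {0..T}};
          \<X>y = {S t \<times> (UNIV :: real set) |t. t \<in> {0..T}};
          \<X>1 = {{\<tau>} \<times> S t |\<tau> t. t \<in> {0..T} \<and> \<tau> \<in> {0..t}};
          \<X>2 = {{\<tau>} \<times> S t \<times> D |\<tau> t. t \<in> {0..T} \<and> \<tau> \<in> {0..t}}
      in
      (\<forall>t\<in>{0..T}. \<forall>\<omega>\<in>D. \<forall>y z. \<forall>\<mu>\<in>P. \<forall>\<nu>\<in>P2R.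
         f t \<omega> y z \<mu> \<nu> = f t (stop T t \<omega>) y z (stop_law T t \<mu>) \<nu>) \<and>
      cont_wrt d (\<Union>\<X>) (\<lambda>(t, \<omega>, y, z, \<mu>, \<nu>). f t \<omega> y z \<mu> \<nu>) \<and>
      unif_lip d \<X> (\<lambda>(t, \<omega>, y, z, \<mu>, \<nu>). f t \<omega> y z \<mu> \<nu>) \<and>
      (\<exists>(fy :: real \<Rightarrow> 'd path \<Rightarrow> real \<Rightarrow> real ^ 'd \<Rightarrow> 'd law \<Rightarrow> real measure \<Rightarrow> real)
         (fz :: real \<Rightarrow> 'd path \<Rightarrow> real \<Rightarrow> real ^ 'd \<Rightarrow> 'd law \<Rightarrow> real measure \<Rightarrow> real ^ 'd)
         (fn :: real \<Rightarrow> 'd path \<Rightarrow> real \<Rightarrow> real ^ 'd \<Rightarrow> 'd law \<Rightarrow> real measure \<Rightarrow> real \<Rightarrow> real)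
         (fw :: real \<Rightarrow> real \<Rightarrow> 'd path \<Rightarrow> real \<Rightarrow> real ^ 'd \<Rightarrow> 'd law \<Rightarrow> real measure \<Rightarrow> real ^ 'd)
         (fm :: real \<Rightarrow> real \<Rightarrow> 'd path \<Rightarrow> real \<Rightarrow> real ^ 'd \<Rightarrow> 'd law \<Rightarrow> real measure \<Rightarrow> 'd path
                 \<Rightarrow> real ^ 'd)
         (fyy :: real \<Rightarrow> 'd path \<Rightarrow> real \<Rightarrow> real ^ 'd \<Rightarrow> 'd law \<Rightarrow> real measure \<Rightarrow> real)
         (fyz :: real \<Rightarrow> 'd path \<Rightarrow> real \<Rightarrow> real ^ 'd \<Rightarrow> 'd law \<Rightarrow> real measure \<Rightarrow> real ^ 'd)
         (fzz :: real \<Rightarrow> 'd path \<Rightarrow> real \<Rightarrow> real ^ 'd \<Rightarrow> 'd law \<Rightarrow> real measure \<Rightarrow> real ^ 'd ^ 'd)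
         (fyw :: real \<Rightarrow> real \<Rightarrow> 'd path \<Rightarrow> real \<Rightarrow> real ^ 'd \<Rightarrow> 'd law \<Rightarrow> real measure \<Rightarrow> real ^ 'd)
         (fzw :: real \<Rightarrow> real \<Rightarrow> 'd path \<Rightarrow> real \<Rightarrow> real ^ 'd \<Rightarrow> 'd law \<Rightarrow> real measure \<Rightarrow> real ^ 'd ^ 'd)
         (fww :: real \<Rightarrow> real \<Rightarrow> 'd path \<Rightarrow> real \<Rightarrow> real ^ 'd \<Rightarrow> 'd law \<Rightarrow> real measure \<Rightarrow> real ^ 'd ^ 'd)
         (fyn :: real \<Rightarrow> 'd path \<Rightarrow> real \<Rightarrow> real ^ 'd \<Rightarrow> 'd law \<Rightarrow> real measure \<Rightarrow> real \<Rightarrow> real)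
         (fwm :: real \<Rightarrow> real \<Rightarrow> 'd path \<Rightarrow> real \<Rightarrow> real ^ 'd \<Rightarrow> 'd law \<Rightarrow> real measure \<Rightarrow> 'd path
                 \<Rightarrow> real ^ 'd ^ 'd).
        (\<forall>t\<in>{0..T}. \<forall>\<omega>\<in>D. \<forall>y z. \<forall>\<mu>\<in>P. \<forall>\<nu>\<in>P2R.
           ((\<lambda>(y, z). f t \<omega> y z \<mu> \<nu>) has_derivative
              (\<lambda>(a, b). fy t \<omega> y z \<mu> \<nu> * a + fz t \<omega> y z \<mu> \<nu> \<bullet> b)) (at (y, z)) \<and>
           ((\<lambda>(y, z). fy t \<omega> y z \<mu> \<nu>) has_derivative
              (\<lambda>(a, b). fyy t \<omega> y z \<mu> \<nu> * a + fyz t \<omega> y z \<mu> \<nu> \<bullet> b)) (at (y, z)) \<and>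
           ((\<lambda>(y, z). fz t \<omega> y z \<mu> \<nu>) has_derivative
              (\<lambda>(a, b). a *\<^sub>R fyz t \<omega> y z \<mu> \<nu> + fzz t \<omega> y z \<mu> \<nu> *v b)) (at (y, z)) \<and>
           has_lions_derivative M (f t \<omega> y z \<mu>) \<nu> (fn t \<omega> y z \<mu> \<nu>) \<and>
           (\<forall>a. (fn t \<omega> y z \<mu> \<nu> has_real_derivative fyn t \<omega> y z \<mu> \<nu> a) (at a)) \<and>
           (\<forall>\<tau>\<in>{0..t}.
              has_path_svd T \<tau> (\<lambda>\<omega>. f t \<omega> y z \<mu> \<nu>) \<omega> (\<lambda>x. fw \<tau> t \<omega> y z \<mu> \<nu> \<bullet> x) \<and>
              has_path_svd T \<tau> (\<lambda>\<omega>. fy t \<omega> y z \<mu> \<nu>) \<omega> (\<lambda>x. fyw \<tau> t \<omega> y z \<mu> \<nu> \<bullet> x) \<and>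
              has_path_svd T \<tau> (\<lambda>\<omega>. fz t \<omega> y z \<mu> \<nu>) \<omega> (\<lambda>x. fzw \<tau> t \<omega> y z \<mu> \<nu> *v x) \<and>
              has_path_svd T \<tau> (\<lambda>\<omega>. fw \<tau> t \<omega> y z \<mu> \<nu>) \<omega> (\<lambda>x. fww \<tau> t \<omega> y z \<mu> \<nu> *v x) \<and>
              has_law_svd T M Fil \<tau> (\<lambda>\<mu>. f t \<omega> y z \<mu> \<nu>) \<mu> (fm \<tau> t \<omega> y z \<mu> \<nu>) \<and>
              (\<forall>v\<in>D.
                 fm \<tau> t \<omega> y z \<mu> \<nu> v = fm \<tau> t (stop T t \<omega>) y z (stop_law T t \<mu>) \<nu> (stop T t v) \<and>
                 has_path_svd T \<tau> (fm \<tau> t \<omega> y z \<mu> \<nu>) v (\<lambda>x. fwm \<tau> t \<omega> y z \<mu> \<nu> v *v x)))) \<and>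
        (\<forall>\<tau>\<in>{0..T}.
           (\<lambda>(t, \<omega>, y, z, \<mu>, \<nu>, v). fm \<tau> t \<omega> y z \<mu> \<nu> v) \<in> borel_measurable
             (restrict_space borel {\<tau>..T} \<Otimes>\<^sub>M path_space D \<Otimes>\<^sub>M borel \<Otimes>\<^sub>M borel \<Otimes>\<^sub>M
              borel_of (W2 T) P \<Otimes>\<^sub>M borel_of W2R P2R \<Otimes>\<^sub>M path_space D)) \<and>
        (\<exists>C. \<forall>t\<in>{0..T}. \<forall>\<omega>\<in>D. \<forall>y z. \<forall>\<mu>\<in>P. \<forall>\<nu>\<in>P2R.
           \<bar>fy t \<omega> y z \<mu> \<nu>\<bar> \<le> C \<and> norm (fz t \<omega> y z \<mu> \<nu>) \<le> C \<and> (\<forall>a. \<bar>fn t \<omega> y z \<mu> \<nu> a\<bar> \<le> C)) \<and>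
        cont_wrt d (\<Union>\<X>) (\<lambda>(t, \<omega>, y, z, \<mu>, \<nu>). fy t \<omega> y z \<mu> \<nu>) \<and>
        cont_wrt d (\<Union>\<X>) (\<lambda>(t, \<omega>, y, z, \<mu>, \<nu>). fz t \<omega> y z \<mu> \<nu>) \<and>
        cont_wrt dy (\<Union>\<X>y) (\<lambda>((t, \<omega>, y, z, \<mu>, \<nu>), a). fn t \<omega> y z \<mu> \<nu> a) \<and>
        cont_wrt d1 (\<Union>\<X>1) (\<lambda>(\<tau>, t, \<omega>, y, z, \<mu>, \<nu>). fw \<tau> t \<omega> y z \<mu> \<nu>) \<and>
        cont_wrt d2 (\<Union>\<X>2) (\<lambda>(\<tau>, (t, \<omega>, y, z, \<mu>, \<nu>), v). fm \<tau> t \<omega> y z \<mu> \<nu> v) \<and>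
        cont_wrt d (\<Union>\<X>) (\<lambda>(t, \<omega>, y, z, \<mu>, \<nu>). fyy t \<omega> y z \<mu> \<nu>) \<and>
        cont_wrt d (\<Union>\<X>) (\<lambda>(t, \<omega>, y, z, \<mu>, \<nu>). fyz t \<omega> y z \<mu> \<nu>) \<and>
        cont_wrt d (\<Union>\<X>) (\<lambda>(t, \<omega>, y, z, \<mu>, \<nu>). fzz t \<omega> y z \<mu> \<nu>) \<and>
        cont_wrt d1 (\<Union>\<X>1) (\<lambda>(\<tau>, t, \<omega>, y, z, \<mu>, \<nu>). fyw \<tau> t \<omega> y z \<mu> \<nu>) \<and>
        cont_wrt d1 (\<Union>\<X>1) (\<lambda>(\<tau>, t, \<omega>, y, z, \<mu>, \<nu>). fzw \<tau> t \<omega> y z \<mu> \<nu>) \<and>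
        cont_wrt d1 (\<Union>\<X>1) (\<lambda>(\<tau>, t, \<omega>, y, z, \<mu>, \<nu>). fww \<tau> t \<omega> y z \<mu> \<nu>) \<and>
        cont_wrt dy (\<Union>\<X>y) (\<lambda>((t, \<omega>, y, z, \<mu>, \<nu>), a). fyn t \<omega> y z \<mu> \<nu> a) \<and>
        cont_wrt d2 (\<Union>\<X>2) (\<lambda>(\<tau>, (t, \<omega>, y, z, \<mu>, \<nu>), v). fwm \<tau> t \<omega> y z \<mu> \<nu> v) \<and>
        unif_lip d \<X> (\<lambda>(t, \<omega>, y, z, \<mu>, \<nu>). fy t \<omega> y z \<mu> \<nu>) \<and>
        unif_lip d \<X> (\<lambda>(t, \<omega>, y, z, \<mu>, \<nu>). fz t \<omega> y z \<mu> \<nu>) \<and>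
        unif_lip dy \<X>y (\<lambda>((t, \<omega>, y, z, \<mu>, \<nu>), a). fn t \<omega> y z \<mu> \<nu> a) \<and>
        unif_lip d1 \<X>1 (\<lambda>(\<tau>, t, \<omega>, y, z, \<mu>, \<nu>). fw \<tau> t \<omega> y z \<mu> \<nu>) \<and>
        unif_lip d2 \<X>2 (\<lambda>(\<tau>, (t, \<omega>, y, z, \<mu>, \<nu>), v). fm \<tau> t \<omega> y z \<mu> \<nu> v) \<and>
        unif_lip d \<X> (\<lambda>(t, \<omega>, y, z, \<mu>, \<nu>). fyy t \<omega> y z \<mu> \<nu>) \<and>
        unif_lip d \<X> (\<lambda>(t, \<omega>, y, z, \<mu>, \<nu>). fyz t \<omega> y z \<mu> \<nu>) \<and>
        unif_lip d \<X> (\<lambda>(t, \<omega>, y, z, \<mu>, \<nu>). fzz t \<omega> y z \<mu> \<nu>) \<and>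
        unif_lip d1 \<X>1 (\<lambda>(\<tau>, t, \<omega>, y, z, \<mu>, \<nu>). fww \<tau> t \<omega> y z \<mu> \<nu>) \<and>
        unif_lip dy \<X>y (\<lambda>((t, \<omega>, y, z, \<mu>, \<nu>), a). fyn t \<omega> y z \<mu> \<nu> a) \<and>
        unif_lip d2 \<X>2 (\<lambda>(\<tau>, (t, \<omega>, y, z, \<mu>, \<nu>), v). fwm \<tau> t \<omega> y z \<mu> \<nu> v)))"

definition assumption_A2 ::
  "real \<Rightarrow> 'w measure \<Rightarrow> (real \<Rightarrow> 'w measure) \<Rightarrow>
   (real \<Rightarrow> ('d::finite) path \<Rightarrow> real \<Rightarrow> real ^ 'd \<Rightarrow> 'd law \<Rightarrow> real measure \<Rightarrow> real) \<Rightarrow>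
   ('d path \<Rightarrow> 'd law \<Rightarrow> real) \<Rightarrow> bool" where
  "assumption_A2 T M Fil f \<Phi> \<longleftrightarrow>
     (\<exists>f' \<Phi>'. H2_driver T M Fil f' \<and> H2_terminal T M Fil \<Phi>' \<and>
        (\<forall>t\<in>{0..T}. \<forall>\<gamma>\<in>cpaths T. \<forall>y z. \<forall>\<mu>\<in>P2C T. \<forall>\<nu>\<in>P2R.
           f t \<gamma> y z \<mu> \<nu> = f' t \<gamma> y z (embed_law T \<mu>) \<nu>) \<and>
        (\<forall>\<gamma>\<in>cpaths T. \<forall>\<mu>\<in>P2C T. \<Phi> \<gamma> \<mu> = \<Phi>' \<gamma> (embed_law T \<mu>)))"

end

(* The difference v = F1 - F2 of the two extensions is tested along X = (continuous initial segment up to time t)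
   + B - B_t. Replacing X by step processes on a grid, Taylor expansion at each grid point uses only the
   vertical derivatives in the path and in the measure; in the limit this gives, for the functional v^2,
     E v^2(T, X, L_X) - E v^2(r, X, L_X) = integral over [r,T] of E[(d_t + 1/2 Tr d_w^2 + 1/2 Tr d_w d_mu) v^2],
   where the measure derivative is integrated against an independent copy. The expansion of v^2
   contributes |d_w v|^2, which absorbs the dependence of f on the gradient, so the equation, the Lipschitz
   property of f and the backward Gronwall lemma yield v(t, X, L_X) = 0 almost surely. Since t and the initial
   law are arbitrary, giving the prescribed path a small mass and letting this mass tend to 0 shows that v
   vanishes everywhere on continuous paths. *)
theory Submission
  imports Defs
begin

section \<open>Regularity and closure properties of cadlag paths\<close>

section \<open>Cadlag paths\<close>

text \<open>Two mismatches shape the proof. First, a classical solution may grow like any power of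
  the path, whereas the laws have only second moments. The expansion is therefore run for processes
  that are bounded up to the starting time, whose running maximum has all moments; general initial
  laws return at the very end, by radial truncation and continuity in W2. Second, the coordinate
  sigma-algebra on cadlag paths is smaller than the Borel sets of the sup norm, so measurability of
  a continuous functional of a process is never automatic; it is carried along as a property of the
  process, stable under jumps and uniform limits. The step processes are frozen between grid points
  because the horizontal derivative only sees frozen paths and laws, while each jump is one vertical
  shift. The derivatives come with no modulus of continuity, so the limits are taken by dominated
  convergence at a fixed time. The dependence on the law of u closes in E v^2, since evaluating both
  solutions along the same process couples the two laws of values.\<close>

lemma cadlagD:
  assumes "\<omega> \<in> cadlag T"
  shows "\<And>t. 0 \<le> t \<Longrightarrow> t < T \<Longrightarrow> continuous (at_right t) \<omega>"
    and "\<And>t. 0 < t \<Longrightarrow> t \<le> T \<Longrightarrow> \<exists>l. (\<omega> \<longlongrightarrow> l) (at_left t)"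
    and "\<And>t. t \<notin> {0..T} \<Longrightarrow> \<omega> t = 0"
  using assms unfolding cadlag_def by auto

lemma tendsto_imp_locally_bounded:
  fixes f :: "real \<Rightarrow> 'a::real_normed_vector"
  assumes "(f \<longlongrightarrow> l) F"
  shows "\<forall>\<^sub>F x in F. norm (f x) \<le> norm l + 1"
proof -
  have "\<forall>\<^sub>F x in F. dist (f x) l < 1" using assms by (rule tendstoD) simp
  then show ?thesis
  proof eventually_elim
    case (elim x)
    then show ?case using norm_triangle_sub[of "f x" l] by (simp add: dist_norm)
  qed
qed

text \<open>One-sided limits bound the path near each time, and compactness of [0,T] leaves finitely
  many bounds. Without boundedness the real supremum in \<open>sup_norm\<close> would carry no
  information.\<close>

lemma cadlag_bounded:
  assumes \<omega>: "\<omega> \<in> cadlag T"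
  shows "bounded (\<omega> ` {0..T})"
proof -
  have loc: "\<exists>e>0. \<exists>C. \<forall>s\<in>{0..T} \<inter> ball t e. norm (\<omega> s) \<le> C" if t: "t \<in> {0..T}" for t
  proof -
    have R: "\<exists>b>t. \<exists>C. \<forall>s\<in>{0..T}. t < s \<and> s < b \<longrightarrow> norm (\<omega> s) \<le> C"
    proof (cases "t < T")
      case True
      then have "(\<omega> \<longlongrightarrow> \<omega> t) (at_right t)"
        using cadlagD(1)[OF \<omega>, of t] t by (simp add: continuous_within)
      from tendsto_imp_locally_bounded[OF this] show ?thesis
        unfolding eventually_at_right_field by blast
    next
      case False
      \<comment> \<open>Here t = T, and no time of [0,T] lies to the right of it.\<close>
      then show ?thesis using t by (intro exI[of _ "t+1"]) auto
    qed
    have L: "\<exists>a<t. \<exists>C. \<forall>s\<in>{0..T}. a < s \<and> s < t \<longrightarrow> norm (\<omega> s) \<le> C"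
    proof (cases "0 < t")
      case True
      then obtain l where "(\<omega> \<longlongrightarrow> l) (at_left t)"
        using cadlagD(2)[OF \<omega>, of t] t by auto
      from tendsto_imp_locally_bounded[OF this] show ?thesis
        unfolding eventually_at_left_field by blast
    next
      case False
      then show ?thesis using t by (intro exI[of _ "t-1"]) auto
    qed
    from R obtain b C1 where b: "b > t" "\<forall>s\<in>{0..T}. t < s \<and> s < b \<longrightarrow> norm (\<omega> s) \<le> C1" by blast
    from L obtain a C2 where a: "a < t" "\<forall>s\<in>{0..T}. a < s \<and> s < t \<longrightarrow> norm (\<omega> s) \<le> C2" by blast
    have "norm (\<omega> s) \<le> max (norm (\<omega> t)) (max C1 C2)" if "s \<in> {0..T} \<inter> ball t (min (b - t) (t - a))" for s
    proof -
      consider "s = t" | "t < s" | "s < t" by linarith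
      then show ?thesis
      proof cases
        case 2
        then have "norm (\<omega> s) \<le> C1" using that b(2) by (auto simp: dist_real_def)
        then show ?thesis by simp
      next
        case 3
        then have "norm (\<omega> s) \<le> C2" using that a(2) by (auto simp: dist_real_def)
        then show ?thesis by simp
      qed simp
    qed
    then have "\<exists>C. \<forall>s\<in>{0..T} \<inter> ball t (min (b - t) (t - a)). norm (\<omega> s) \<le> C" by blast
    then show ?thesis using a(1) b(1) by (meson diff_gt_0_iff_gt min_less_iff_conj)
  qed
  then obtain e C where eC: "\<And>t. t \<in> {0..T} \<Longrightarrow> e t > 0"
     "\<And>t s. t \<in> {0..T} \<Longrightarrow> s \<in> {0..T} \<inter> ball t (e t) \<Longrightarrow> norm (\<omega> s) \<le> C t"
    by metis
  have "{0..T} \<subseteq> (\<Union>t\<in>{0..T}. ball t (e t))" using eC(1) by auto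
  then obtain S where S: "S \<subseteq> {0..T}" "finite S" "{0..T} \<subseteq> (\<Union>t\<in>S. ball t (e t))"
    by (rule compactE_image[OF compact_Icc open_ball])
  show ?thesis
  proof (cases "S = {}")
    case True
    then show ?thesis using S by simp
  next
    case False
    have "norm (\<omega> s) \<le> Max (C ` S)" if "s \<in> {0..T}" for s
    proof -
      obtain t where t: "t \<in> S" "s \<in> ball t (e t)" using S(3) \<open>s \<in> {0..T}\<close> by auto
      then have "norm (\<omega> s) \<le> C t" using eC(2)[of t s] S(1) that by auto
      also have "\<dots> \<le> Max (C ` S)" using t S by simp
      finally show ?thesis .
    qed
    then show ?thesis unfolding bounded_iff by blast
  qed
qed

lemma cadlag_bdd:
  assumes "\<omega> \<in> cadlag T" shows "bdd_above ((\<lambda>s. norm (\<omega> s)) ` {0..T})"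
proof -
  from cadlag_bounded[OF assms] obtain C where "\<forall>s\<in>{0..T}. norm (\<omega> s) \<le> C"
    by (auto simp: bounded_iff)
  then show ?thesis by (intro bdd_aboveI[of _ C]) auto
qed

lemma cadlag_zero [simp]: "(\<lambda>_. 0) \<in> cadlag T"
  unfolding cadlag_def by auto

lemma cadlag_add:
  assumes "\<omega> \<in> cadlag T" "\<omega>' \<in> cadlag T"
  shows "(\<lambda>s. \<omega> s + \<omega>' s) \<in> cadlag T"
  unfolding cadlag_def
proof (intro CollectI conjI ballI allI impI)
  fix t assume "t \<in> {0<..T}"
  then obtain l l' where "(\<omega> \<longlongrightarrow> l) (at_left t)" "(\<omega>' \<longlongrightarrow> l') (at_left t)"
    using cadlagD(2)[OF assms(1), of t] cadlagD(2)[OF assms(2), of t] by auto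
  then show "\<exists>l. ((\<lambda>s. \<omega> s + \<omega>' s) \<longlongrightarrow> l) (at_left t)" using tendsto_add by blast
qed (use cadlagD[OF assms(1)] cadlagD[OF assms(2)] in \<open>auto intro!: continuous_intros\<close>)

lemma cadlag_diff:
  assumes "\<omega> \<in> cadlag T" "\<omega>' \<in> cadlag T"
  shows "(\<lambda>s. \<omega> s - \<omega>' s) \<in> cadlag T"
  unfolding cadlag_def
proof (intro CollectI conjI ballI allI impI)
  fix t assume "t \<in> {0<..T}"
  then obtain l l' where "(\<omega> \<longlongrightarrow> l) (at_left t)" "(\<omega>' \<longlongrightarrow> l') (at_left t)"
    using cadlagD(2)[OF assms(1), of t] cadlagD(2)[OF assms(2), of t] by auto
  then show "\<exists>l. ((\<lambda>s. \<omega> s - \<omega>' s) \<longlongrightarrow> l) (at_left t)" using tendsto_diff by blast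
qed (use cadlagD[OF assms(1)] cadlagD[OF assms(2)] in \<open>auto intro!: continuous_intros\<close>)

lemma cadlag_indicator:
  fixes x :: "real ^ 'd::finite"
  assumes "0 \<le> \<tau>"
  shows "(\<lambda>s. indicator {\<tau>..T} s *\<^sub>R x) \<in> cadlag T"
  unfolding cadlag_def
proof (intro CollectI conjI ballI allI impI)
  fix t assume t: "t \<in> {0..<T}"
  show "continuous (at_right t) (\<lambda>s. indicator {\<tau>..T} s *\<^sub>R x)"
  proof (cases "\<tau> \<le> t")
    case True
    have "\<forall>\<^sub>F s in at_right t. indicator {\<tau>..T} t *\<^sub>R x = indicator {\<tau>..T} s *\<^sub>R x"
      unfolding eventually_at_right_field using t True by (intro exI[of _ T]) auto
    then have "((\<lambda>s. indicator {\<tau>..T} s *\<^sub>R x) \<longlongrightarrow> indicator {\<tau>..T} t *\<^sub>R x) (at_right t)"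
      by (rule Lim_transform_eventually[OF tendsto_const])
    then show ?thesis by (simp add: continuous_within)
  next
    case False
    have "\<forall>\<^sub>F s in at_right t. indicator {\<tau>..T} t *\<^sub>R x = indicator {\<tau>..T} s *\<^sub>R x"
      unfolding eventually_at_right_field using t False by (intro exI[of _ \<tau>]) auto
    then have "((\<lambda>s. indicator {\<tau>..T} s *\<^sub>R x) \<longlongrightarrow> indicator {\<tau>..T} t *\<^sub>R x) (at_right t)"
      by (rule Lim_transform_eventually[OF tendsto_const])
    then show ?thesis by (simp add: continuous_within)
  qed
next
  fix t assume t: "t \<in> {0<..T}"
  show "\<exists>l. ((\<lambda>s. indicator {\<tau>..T} s *\<^sub>R x) \<longlongrightarrow> l) (at_left t)"
  proof (cases "\<tau> < t")
    case True
    have "\<forall>\<^sub>F s in at_left t. x = indicator {\<tau>..T} s *\<^sub>R x"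
      unfolding eventually_at_left_field using t True by (intro exI[of _ \<tau>]) auto
    then show ?thesis by (intro exI[of _ "x"]) (rule Lim_transform_eventually[OF tendsto_const])
  next
    case False
    have "\<forall>\<^sub>F s in at_left t. 0 = indicator {\<tau>..T} s *\<^sub>R x"
      unfolding eventually_at_left_field using t False by (intro exI[of _ 0]) auto
    then show ?thesis by (intro exI[of _ "0"]) (rule Lim_transform_eventually[OF tendsto_const])
  qed
qed (use assms in auto)

lemma cadlag_shift:
  assumes "\<omega> \<in> cadlag T" "0 \<le> \<tau>"
  shows "shift T \<tau> x \<omega> \<in> cadlag T"
  unfolding shift_def by (intro cadlag_add cadlag_indicator assms)

lemma cadlag_stop:
  assumes \<omega>: "\<omega> \<in> cadlag T" and t: "t \<in> {0..T}"
  shows "stop T t \<omega> \<in> cadlag T"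
  unfolding cadlag_def
proof (intro CollectI conjI ballI allI impI)
  fix u assume u: "u \<in> {0..<T}"
  show "continuous (at_right u) (stop T t \<omega>)"
  proof (cases "u < t")
    case True
    have "(\<omega> \<longlongrightarrow> \<omega> u) (at_right u)"
      using cadlagD(1)[OF \<omega>, of u] u by (simp add: continuous_within)
    moreover have "\<forall>\<^sub>F s in at_right u. \<omega> s = stop T t \<omega> s"
      unfolding eventually_at_right_field stop_def using True t u
      by (intro exI[of _ t]) auto
    ultimately have "(stop T t \<omega> \<longlongrightarrow> \<omega> u) (at_right u)" by (rule Lim_transform_eventually)
    then show ?thesis using u True t by (simp add: continuous_within stop_def min_def)
  next
    case False
    have "\<forall>\<^sub>F s in at_right u. \<omega> t = stop T t \<omega> s"
      unfolding eventually_at_right_field stop_def using False t u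
      by (intro exI[of _ T]) auto
    then have "(stop T t \<omega> \<longlongrightarrow> \<omega> t) (at_right u)"
      by (rule Lim_transform_eventually[OF tendsto_const])
    moreover have "stop T t \<omega> u = \<omega> t" using u False t by (simp add: stop_def)
    ultimately show ?thesis by (simp add: continuous_within)
  qed
next
  fix u assume u: "u \<in> {0<..T}"
  show "\<exists>l. (stop T t \<omega> \<longlongrightarrow> l) (at_left u)"
  proof (cases "u \<le> t")
    case True
    obtain l where "(\<omega> \<longlongrightarrow> l) (at_left u)" using cadlagD(2)[OF \<omega>, of u] u by auto
    moreover have "\<forall>\<^sub>F s in at_left u. \<omega> s = stop T t \<omega> s"
      unfolding eventually_at_left_field stop_def using True t u
      by (intro exI[of _ 0]) auto
    ultimately show ?thesis by (intro exI[of _ l]) (rule Lim_transform_eventually)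
  next
    case False
    have "\<forall>\<^sub>F s in at_left u. \<omega> t = stop T t \<omega> s"
      unfolding eventually_at_left_field stop_def using False t u
      by (intro exI[of _ t]) auto
    then show ?thesis by (intro exI[of _ "\<omega> t"]) (rule Lim_transform_eventually[OF tendsto_const])
  qed
qed (auto simp: stop_def)

lemma cpaths_cadlag: "\<omega> \<in> cpaths T \<Longrightarrow> \<omega> \<in> cadlag T"
proof -
  assume "\<omega> \<in> cpaths T"
  then have c: "continuous_on {0..T} \<omega>" and z: "\<forall>t. t \<notin> {0..T} \<longrightarrow> \<omega> t = 0"
    by (auto simp: cpaths_def)
  show ?thesis unfolding cadlag_def
  proof (intro CollectI conjI ballI z)
    fix t assume t: "t \<in> {0..<T}"
    then have "(\<omega> \<longlongrightarrow> \<omega> t) (at t within {0..T})" using c by (auto simp: continuous_on_def)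
    then have "(\<omega> \<longlongrightarrow> \<omega> t) (at t within {t..T})" by (rule tendsto_within_subset) (use t in auto)
    then show "continuous (at_right t) \<omega>"
      using t by (simp add: continuous_within at_within_Icc_at_right)
  next
    fix t assume t: "t \<in> {0<..T}"
    then have "(\<omega> \<longlongrightarrow> \<omega> t) (at t within {0..T})" using c by (auto simp: continuous_on_def)
    then have "(\<omega> \<longlongrightarrow> \<omega> t) (at t within {0..t})" by (rule tendsto_within_subset) (use t in auto)
    then show "\<exists>l. (\<omega> \<longlongrightarrow> l) (at_left t)" using t by (auto simp: at_within_Icc_at_left)
  qed
qed

lemma cpaths_stop:
  assumes \<omega>: "\<omega> \<in> cpaths T" and t: "t \<in> {0..T}"
  shows "stop T t \<omega> \<in> cpaths T"
proof -
  have "continuous_on {0..T} (\<lambda>s. \<omega> (min s t))"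
    by (rule continuous_on_compose2[of "{0..T}" \<omega>])
       (use assms in \<open>auto simp: cpaths_def intro!: continuous_intros\<close>)
  moreover have "continuous_on {0..T} (stop T t \<omega>) = continuous_on {0..T} (\<lambda>s. \<omega> (min s t))"
    by (rule continuous_on_cong) (auto simp: stop_def)
  ultimately show ?thesis by (auto simp: cpaths_def stop_def)
qed

lemma stop_stop:
  assumes "0 \<le> t" "0 \<le> t'"
  shows "stop T t (stop T t' \<omega>) = stop T (min t t') \<omega>"
  unfolding stop_def using assms by (auto simp: fun_eq_iff min_def)

lemma stop_stopped:
  assumes "stop T a \<omega> = \<omega>" "0 \<le> a" "a \<le> t"
  shows "stop T t \<omega> = \<omega>"
  using stop_stop[of t a T \<omega>] assms by (simp add: min_def)

lemma stop_T: "\<omega> \<in> cadlag T \<Longrightarrow> stop T T \<omega> = \<omega>"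
  unfolding stop_def using cadlagD(3)[of \<omega> T] by (auto simp: fun_eq_iff min_def)

text \<open>A jump at b leaves the path frozen after b, so a step process stays frozen after its
  last jump.\<close>

lemma stop_shift:
  assumes "stop T a \<omega> = \<omega>" "0 \<le> a" "a \<le> b"
  shows "stop T b (shift T b x \<omega>) = shift T b x \<omega>"
proof -
  have "stop T b \<omega> = \<omega>" using assms stop_stopped by blast
  then have *: "(if s \<in> {0..T} then \<omega> (min s b) else 0) = \<omega> s" for s
    unfolding stop_def fun_eq_iff by blast
  show ?thesis unfolding fun_eq_iff
  proof
    fix s
    show "stop T b (shift T b x \<omega>) s = shift T b x \<omega> s"
      unfolding stop_def shift_def using *[of s] assms
      by (cases "s \<in> {0..T}"; cases "s \<le> b") (auto simp: indicator_def)
  qed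
qed

section \<open>The sup norm and its reduction to countably many times\<close>

section \<open>The sup norm\<close>

lemma sup_norm_ge:
  assumes "\<omega> \<in> cadlag T" "s \<in> {0..T}"
  shows "norm (\<omega> s) \<le> sup_norm T \<omega>"
  unfolding sup_norm_def by (rule cSUP_upper[OF assms(2) cadlag_bdd[OF assms(1)]])

lemma sup_norm_le:
  assumes "0 \<le> T" "\<And>s. s \<in> {0..T} \<Longrightarrow> norm (\<omega> s) \<le> C"
  shows "sup_norm T \<omega> \<le> C"
  unfolding sup_norm_def by (rule cSUP_least) (use assms in auto)

lemma sup_norm_nonneg:
  assumes "\<omega> \<in> cadlag T" "0 \<le> T"
  shows "0 \<le> sup_norm T \<omega>"
  using order_trans[OF norm_ge_zero sup_norm_ge[OF assms(1), of 0]] assms(2) by simp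

lemma sup_norm_zero [simp]: "0 \<le> T \<Longrightarrow> sup_norm T (\<lambda>s. 0) = 0"
  unfolding sup_norm_def by simp

lemma sup_norm_minus_commute: "sup_norm T (\<lambda>s. \<omega> s - \<omega>' s) = sup_norm T (\<lambda>s. \<omega>' s - \<omega> s)"
proof -
  have eq: "\<And>s. norm (\<omega> s - \<omega>' s) = norm (\<omega>' s - \<omega> s)"
    by (rule norm_minus_commute)
  show ?thesis unfolding sup_norm_def by (rule SUP_cong[OF refl eq])
qed

lemma sup_norm_triangle:
  assumes "\<omega> \<in> cadlag T" "\<omega>' \<in> cadlag T" "0 \<le> T"
  shows "sup_norm T (\<lambda>s. \<omega> s + \<omega>' s) \<le> sup_norm T \<omega> + sup_norm T \<omega>'"
  by (rule sup_norm_le[OF assms(3)])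
     (use sup_norm_ge[OF assms(1)] sup_norm_ge[OF assms(2)] in \<open>smt (verit) norm_triangle_ineq\<close>)

lemma sup_norm_triangle_diff:
  assumes "\<omega> \<in> cadlag T" "\<omega>' \<in> cadlag T" "0 \<le> T"
  shows "sup_norm T (\<lambda>s. \<omega> s - \<omega>' s) \<le> sup_norm T \<omega> + sup_norm T \<omega>'"
  by (rule sup_norm_le[OF assms(3)])
     (use sup_norm_ge[OF assms(1)] sup_norm_ge[OF assms(2)] in \<open>smt (verit) norm_triangle_ineq4\<close>)

lemma sup_norm_stop_le:
  assumes "\<omega> \<in> cadlag T" "0 \<le> t" "0 \<le> T"
  shows "sup_norm T (stop T t \<omega>) \<le> sup_norm T \<omega>"
proof (rule sup_norm_le[OF assms(3)])
  fix s assume s: "s \<in> {0..T}"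
  then have "min s t \<in> {0..T}" using assms by auto
  from sup_norm_ge[OF assms(1) this] show "norm (stop T t \<omega> s) \<le> sup_norm T \<omega>"
    using s by (simp add: stop_def)
qed

lemma sup_norm_indicator_le:
  fixes x :: "real ^ 'd::finite"
  assumes "0 \<le> T"
  shows "sup_norm T (\<lambda>s. indicator A s *\<^sub>R x) \<le> norm x"
  by (rule sup_norm_le[OF assms]) (auto simp: indicator_def)

lemma sup_norm_shift_le:
  fixes x :: "real ^ 'd::finite"
  assumes "\<omega> \<in> cadlag T" "0 \<le> \<tau>" "0 \<le> T"
  shows "sup_norm T (shift T \<tau> x \<omega>) \<le> sup_norm T \<omega> + norm x"
  using sup_norm_triangle[OF assms(1) cadlag_indicator[OF assms(2)] assms(3), of x]
    sup_norm_indicator_le[OF assms(3), of "{\<tau>..T}" x]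
  unfolding shift_def by linarith

text \<open>Right-continuity lets rationals to the right of a time stand in for it; T has no time to
  its right and is added by hand.\<close>

definition time_grid :: "real \<Rightarrow> real set" where
  "time_grid T = insert T (\<rat> \<inter> {0..T})"

lemma countable_time_grid: "countable (time_grid T)"
  unfolding time_grid_def using countable_rat by (auto intro: countable_subset[of _ "\<rat>"])

lemma time_grid_subset: "0 \<le> T \<Longrightarrow> time_grid T \<subseteq> {0..T}"
  unfolding time_grid_def by auto

text \<open>The position of q is recorded along with the value there: the sup norm uses the value,
  and the characterisation \<open>cpaths_eq\<close> of continuous paths also needs q close to
  s.\<close>

lemma cadlag_approx_grid:
  assumes \<omega>: "\<omega> \<in> cadlag T" and s: "s \<in> {0..T}" and e: "e > 0"
  shows "\<exists>q\<in>time_grid T. dist (\<omega> q) (\<omega> s) < e \<and> s \<le> q \<and> q < s + e"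
proof (cases "s = T")
  case True
  then show ?thesis using e by (auto simp: time_grid_def)
next
  case False
  then have "s < T" using s by auto
  then have "(\<omega> \<longlongrightarrow> \<omega> s) (at_right s)"
    using cadlagD(1)[OF \<omega>, of s] s by (simp add: continuous_within)
  then have "\<forall>\<^sub>F x in at_right s. dist (\<omega> x) (\<omega> s) < e" using e by (rule tendstoD)
  then obtain b where b: "b > s" "\<And>y. s < y \<Longrightarrow> y < b \<Longrightarrow> dist (\<omega> y) (\<omega> s) < e"
    unfolding eventually_at_right_field by blast
  obtain q where q: "q \<in> \<rat>" "s < q" "q < min b (min T (s+e))"
    using Rats_dense_in_real[of s "min b (min T (s+e))"] b \<open>s < T\<close> e by auto
  then show ?thesis using b s by (intro bexI[of _ q]) (auto simp: time_grid_def)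
qed

lemma sup_norm_countable:
  assumes \<omega>: "\<omega> \<in> cadlag T" and T: "0 \<le> T"
  shows "sup_norm T \<omega> = (SUP s\<in>time_grid T. norm (\<omega> s))"
proof (rule antisym)
  have bdd: "bdd_above ((\<lambda>s. norm (\<omega> s)) ` time_grid T)"
    using cadlag_bdd[OF \<omega>] time_grid_subset[OF T] by (meson bdd_above_mono image_mono)
  have ne: "time_grid T \<noteq> {}" by (auto simp: time_grid_def)
  show "sup_norm T \<omega> \<le> (SUP s\<in>time_grid T. norm (\<omega> s))"
  proof (rule sup_norm_le[OF T])
    fix s assume s: "s \<in> {0..T}"
    show "norm (\<omega> s) \<le> (SUP s\<in>time_grid T. norm (\<omega> s))"
    proof (rule field_le_epsilon)
      fix e :: real assume "e > 0"
      from cadlag_approx_grid[OF \<omega> s this] obtain q where q: "q \<in> time_grid T" "dist (\<omega> q) (\<omega> s) < e"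
        by blast
      have "norm (\<omega> s) \<le> norm (\<omega> q) + e"
        using q(2) norm_triangle_sub[of "\<omega> s" "\<omega> q"] by (simp add: dist_norm norm_minus_commute)
      also have "norm (\<omega> q) \<le> (SUP s\<in>time_grid T. norm (\<omega> s))" using q bdd by (intro cSUP_upper)
      finally show "norm (\<omega> s) \<le> (SUP s\<in>time_grid T. norm (\<omega> s)) + e" by simp
    qed
  qed
  show "(SUP s\<in>time_grid T. norm (\<omega> s)) \<le> sup_norm T \<omega>"
    by (rule cSUP_least[OF ne]) (use sup_norm_ge[OF \<omega>] time_grid_subset[OF T] in auto)
qed

lemma sup_norm_measurable:
  assumes "\<And>w. w \<in> space N \<Longrightarrow> Z w \<in> cadlag T" "0 \<le> T"
    and m: "\<And>s. s \<in> {0..T} \<Longrightarrow> (\<lambda>w. Z w s) \<in> borel_measurable N"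
  shows "(\<lambda>w. sup_norm T (Z w)) \<in> borel_measurable N"
proof -
  have "(\<lambda>w. SUP s\<in>time_grid T. norm (Z w s)) \<in> borel_measurable N"
  proof (rule borel_measurable_cSUP[OF countable_time_grid])
    fix s assume "s \<in> time_grid T"
    then show "(\<lambda>w. norm (Z w s)) \<in> borel_measurable N"
      using time_grid_subset[OF assms(2)] m by auto
  next
    fix w assume "w \<in> space N"
    then show "bdd_above ((\<lambda>s. norm (Z w s)) ` time_grid T)"
      using cadlag_bdd[OF assms(1)] time_grid_subset[OF assms(2)] by (meson bdd_above_mono image_mono)
  qed
  then show ?thesis
    by (subst measurable_cong[where g = "\<lambda>w. SUP s\<in>time_grid T. norm (Z w s)"])
       (auto simp: sup_norm_countable assms)
qed

section \<open>Path-valued maps and the coordinate sigma-algebra\<close>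

section \<open>Measurability of path-valued maps\<close>

lemma space_path_space [simp]: "space (path_space S) = S"
  by (simp add: path_space_def space_restrict_space space_PiM)

lemma measurable_path_space:
  assumes "\<And>w. w \<in> space N \<Longrightarrow> Z w \<in> S" "\<And>s. (\<lambda>w. Z w s) \<in> borel_measurable N"
  shows "Z \<in> measurable N (path_space S)"
  unfolding path_space_def
  by (intro measurable_restrict_space2 measurable_PiM_single') (use assms in auto)

lemma measurable_path_coord: "(\<lambda>\<omega>. \<omega> s) \<in> borel_measurable (path_space S)"
  unfolding path_space_def
  by (intro measurable_restrict_space1) simp

lemma measurable_path_coordD:
  assumes "Z \<in> measurable N (path_space S)"
  shows "(\<lambda>w. Z w s) \<in> borel_measurable N"
  using measurable_compose[OF assms measurable_path_coord] .

lemma stop_measurable: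
  assumes "\<And>\<omega>. \<omega> \<in> S \<Longrightarrow> stop T t \<omega> \<in> S"
  shows "stop T t \<in> measurable (path_space S) (path_space S)"
proof (rule measurable_path_space)
  fix s
  show "(\<lambda>w. stop T t w s) \<in> borel_measurable (path_space S)"
  proof (cases "s \<in> {0..T}")
    case False
    then have "(\<lambda>w. stop T t w s) = (\<lambda>w. 0)" by (auto simp: stop_def fun_eq_iff)
    show ?thesis unfolding \<open>(\<lambda>w. stop T t w s) = (\<lambda>w. 0)\<close> by simp
  qed (simp add: stop_def measurable_path_coord)
qed (use assms in simp)

lemma squeeze_zero:
  fixes f g :: "nat \<Rightarrow> real"
  assumes "\<And>n. 0 \<le> f n" "\<And>n. f n \<le> g n" "g \<longlonglongrightarrow> 0"
  shows "f \<longlonglongrightarrow> 0"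
  by (rule tendsto_sandwich[OF _ _ tendsto_const assms(3)]) (use assms in auto)

section \<open>Laws of processes and upper bounds on their Wasserstein distance\<close>

section \<open>Laws of processes\<close>

locale basis = stochastic_basis T M Fil B
  for T :: real and M :: "'w measure" and Fil :: "real \<Rightarrow> 'w measure"
    and B :: "real \<Rightarrow> 'w \<Rightarrow> real ^ ('d::finite)" +
  assumes T_pos: "0 < T"
begin

abbreviation D :: "'d path set" where "D \<equiv> cadlag T"
abbreviation PD :: "'d law" where "PD \<equiv> path_space (cadlag T)"
abbreviation PL :: "'d law set" where "PL \<equiv> P2D T"
abbreviation law :: "('w \<Rightarrow> 'd path) \<Rightarrow> 'd law" where "law \<equiv> path_law T M"

lemma T_nonneg: "0 \<le> T" using T_pos by simp

lemma borel_Fil: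
  assumes "g \<in> borel_measurable (Fil t)" "t \<in> {0..T}"
  shows "g \<in> borel_measurable M"
  using measurable_from_subalg[OF subalg[OF assms(2)] assms(1)] .

lemma borel_Fil_mono:
  assumes "g \<in> borel_measurable (Fil s)" "s \<le> t"
  shows "g \<in> borel_measurable (Fil t)"
  using assms(1) measurable_mono[of borel borel "Fil s" "Fil t"] sets_F_mono[OF assms(2)] space_F by auto

lemma adapted_measurable:
  assumes "adapted_cadlag T M Fil Z"
  shows "Z \<in> measurable M PD"
proof (rule measurable_path_space)
  fix w assume "w \<in> space M"
  then show "Z w \<in> D" using assms by (auto simp: adapted_cadlag_def)
next
  fix s
  show "(\<lambda>w. Z w s) \<in> borel_measurable M"
  proof (cases "s \<in> {0..T}")
    case True
    then show ?thesis using assms by (intro borel_Fil[OF _ True]) (auto simp: adapted_cadlag_def)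
  next
    case False
    then have "Z w s = 0" if "w \<in> space M" for w
      using assms that cadlagD(3)[of "Z w" T s] by (auto simp: adapted_cadlag_def)
    then show ?thesis by (subst measurable_cong[where g = "\<lambda>_. 0"]) auto
  qed
qed

lemma measurable_PD_cadlag: "Z \<in> measurable M PD \<Longrightarrow> w \<in> space M \<Longrightarrow> Z w \<in> D"
  using measurable_space[of Z M PD w] by simp

lemma sup_norm_PD [measurable]: "sup_norm T \<in> borel_measurable PD"
  by (rule sup_norm_measurable) (auto simp: T_nonneg measurable_path_coord)

lemma sup_norm_diff_measurable:
  assumes "Z \<in> measurable N PD" "Z' \<in> measurable N PD"
  shows "(\<lambda>w. sup_norm T (\<lambda>s. Z w s - Z' w s)) \<in> borel_measurable N"
proof (rule sup_norm_measurable)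
  fix w assume w: "w \<in> space N"
  have "Z w \<in> D" "Z' w \<in> D" using measurable_space[OF assms(1) w] measurable_space[OF assms(2) w] by auto
  then show "(\<lambda>s. Z w s - Z' w s) \<in> D" by (rule cadlag_diff)
next
  fix s show "(\<lambda>w. Z w s - Z' w s) \<in> borel_measurable N"
    using measurable_path_coordD[OF assms(1), of s] measurable_path_coordD[OF assms(2), of s] by simp
qed (rule T_nonneg)

lemma sets_law [simp]: "sets (law Z) = sets PD" by (simp add: path_law_def)
lemma space_law [simp]: "space (law Z) = D" by (simp add: path_law_def)

lemma law_in_P2D:
  assumes "Z \<in> measurable M PD" "integrable M (\<lambda>w. (sup_norm T (Z w))\<^sup>2)"
  shows "law Z \<in> PL"
  unfolding P2_def path_law_def
  using assms by (auto intro!: prob_space_distr simp: integrable_distr_eq)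

lemma law_norm_law:
  assumes "Z \<in> measurable M PD"
  shows "law_norm T (law Z) = sqrt (\<integral>w. (sup_norm T (Z w))\<^sup>2 \<partial>M)"
  unfolding law_norm_def path_law_def by (subst integral_distr[OF assms]) auto

lemma stop_measurable_PD: "t \<in> {0..T} \<Longrightarrow> stop T t \<in> measurable PD PD"
  by (rule stop_measurable) (rule cadlag_stop)

lemma stop_law_law:
  assumes "Z \<in> measurable M PD" "t \<in> {0..T}"
  shows "stop_law T t (law Z) = law (\<lambda>w. stop T t (Z w))"
proof -
  have "stop_law T t (law Z) = distr (distr M PD Z) PD (stop T t)"
    unfolding stop_law_def path_law_def by (rule distr_cong) auto
  also have "\<dots> = distr M PD (stop T t \<circ> Z)"
    by (rule distr_distr[OF stop_measurable_PD[OF assms(2)] assms(1)])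
  finally show ?thesis by (simp add: path_law_def comp_def)
qed

lemma law_cong: "(\<And>w. w \<in> space M \<Longrightarrow> Z w = Z' w) \<Longrightarrow> law Z = law Z'"
  unfolding path_law_def by (rule distr_cong) auto

text \<open>The joint law of the two processes is one of the couplings over which the infimum is
  taken. Integrability keeps the Bochner integral on the right from being the default value
  0.\<close>

lemma W2_law_le:
  assumes Z: "Z \<in> measurable M PD" and Z': "Z' \<in> measurable M PD"
    and int: "integrable M (\<lambda>w. (sup_norm T (\<lambda>s. Z w s - Z' w s))\<^sup>2)"
  shows "W2 T (law Z) (law Z') \<le> sqrt (\<integral>w. (sup_norm T (\<lambda>s. Z w s - Z' w s))\<^sup>2 \<partial>M)"
proof -
  let ?d = "\<lambda>\<omega> \<omega>'. sup_norm T (\<lambda>s. \<omega> s - \<omega>' s)"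
  let ?\<pi> = "distr M (PD \<Otimes>\<^sub>M PD) (\<lambda>w. (Z w, Z' w))"
  have m: "(\<lambda>w. (Z w, Z' w)) \<in> measurable M (PD \<Otimes>\<^sub>M PD)" using Z Z' by simp
  have s: "sets (law Z \<Otimes>\<^sub>M law Z') = sets (PD \<Otimes>\<^sub>M PD)"
    by (rule sets_pair_measure_cong) auto
  have "distr ?\<pi> (law Z) fst = distr ?\<pi> PD fst" by (rule distr_cong) auto
  also have "\<dots> = law Z" using m by (simp add: distr_distr comp_def path_law_def)
  finally have f: "distr ?\<pi> (law Z) fst = law Z" .
  have "distr ?\<pi> (law Z') snd = distr ?\<pi> PD snd" by (rule distr_cong) auto
  also have "\<dots> = law Z'" using m by (simp add: distr_distr comp_def path_law_def)
  finally have g: "distr ?\<pi> (law Z') snd = law Z'" .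
  have c: "?\<pi> \<in> couplings (law Z) (law Z')"
    unfolding couplings_def using s f g by auto
  have md: "(\<lambda>p. ?d (fst p) (snd p)) \<in> borel_measurable (PD \<Otimes>\<^sub>M PD)"
    by (rule sup_norm_diff_measurable) auto
  have "(INF \<pi>\<in>couplings (law Z) (law Z'). \<integral>\<^sup>+ p. ennreal ((?d (fst p) (snd p))\<^sup>2) \<partial>\<pi>)
     \<le> (\<integral>\<^sup>+ p. ennreal ((?d (fst p) (snd p))\<^sup>2) \<partial>?\<pi>)"
    by (rule INF_lower[OF c])
  also have "\<dots> = (\<integral>\<^sup>+ w. ennreal ((?d (Z w) (Z' w))\<^sup>2) \<partial>M)"
    using m md by (subst nn_integral_distr) auto
  also have "\<dots> = ennreal (\<integral>w. (?d (Z w) (Z' w))\<^sup>2 \<partial>M)"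
    using int by (intro nn_integral_eq_integral) auto
  finally have "enn2real (INF \<pi>\<in>couplings (law Z) (law Z'). \<integral>\<^sup>+ p. ennreal ((?d (fst p) (snd p))\<^sup>2) \<partial>\<pi>)
     \<le> (\<integral>w. (?d (Z w) (Z' w))\<^sup>2 \<partial>M)"
    by (intro enn2real_leI) auto
  then show ?thesis unfolding W2_def wasserstein2_def by simp
qed

lemma W2_nonneg: "0 \<le> W2 T \<mu> \<nu>"
  unfolding W2_def wasserstein2_def by simp

lemma W2_law_refl:
  assumes "Z \<in> measurable M PD"
  shows "W2 T (law Z) (law Z) = 0"
  using W2_law_le[OF assms assms] W2_nonneg[of "law Z" "law Z"] by (simp add: T_nonneg)

section \<open>Measurability of sup-norm continuous functionals of a process\<close>

section \<open>Composition with path functionals\<close>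

definition path_continuous :: "('d path \<Rightarrow> real) \<Rightarrow> bool" where
  "path_continuous H \<longleftrightarrow> (\<forall>\<omega>\<in>D. \<forall>\<omega>n. (\<forall>n::nat. \<omega>n n \<in> D) \<longrightarrow>
     (\<lambda>n. sup_norm T (\<lambda>s. \<omega>n n s - \<omega> s)) \<longlonglongrightarrow> 0 \<longrightarrow> (\<lambda>n. H (\<omega>n n)) \<longlonglongrightarrow> H \<omega>)"

lemma path_continuousD:
  assumes "path_continuous H" "\<omega> \<in> D" "\<And>n::nat. \<omega>n n \<in> D"
    "(\<lambda>n. sup_norm T (\<lambda>s. \<omega>n n s - \<omega> s)) \<longlonglongrightarrow> 0"
  shows "(\<lambda>n. H (\<omega>n n)) \<longlonglongrightarrow> H \<omega>"
  using assms unfolding path_continuous_def by blast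

text \<open>The coordinate \<open>\<sigma>\<close>-algebra on cadlag paths is smaller than the Borel \<open>\<sigma>\<close>-algebra of the sup
  norm, so composition with continuous functionals has to be secured separately.\<close>

definition tame :: "'v measure \<Rightarrow> ('v \<Rightarrow> 'd path) \<Rightarrow> bool" where
  "tame N Z \<longleftrightarrow> (\<forall>w\<in>space N. Z w \<in> D) \<and>
     (\<forall>H. path_continuous H \<longrightarrow> (\<lambda>w. H (Z w)) \<in> borel_measurable N)"

lemma tameD: "tame N Z \<Longrightarrow> path_continuous H \<Longrightarrow> (\<lambda>w. H (Z w)) \<in> borel_measurable N"
  unfolding tame_def by blast

lemma tame_const: "\<omega> \<in> D \<Longrightarrow> tame N (\<lambda>_. \<omega>)"
  by (simp add: tame_def)

lemma tame_cong:
  assumes "tame N Z" "\<And>w. w \<in> space N \<Longrightarrow> Z w = Z' w"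
  shows "tame N Z'"
proof -
  have "(\<lambda>w. H (Z' w)) \<in> borel_measurable N" if "path_continuous H" for H
    using assms that unfolding tame_def
    by (subst measurable_cong[where g = "\<lambda>w. H (Z w)"]) auto
  then show ?thesis using assms unfolding tame_def by auto
qed

text \<open>This is how tameness passes from step processes to continuous ones: a pointwise limit of
  real measurable functions is measurable, whatever sigma-algebra the paths carry.\<close>

lemma tame_limit:
  assumes Zn: "\<And>n::nat. tame N (Zn n)" and Z: "\<And>w. w \<in> space N \<Longrightarrow> Z w \<in> D"
    and lim: "\<And>w. w \<in> space N \<Longrightarrow> (\<lambda>n. sup_norm T (\<lambda>s. Zn n w s - Z w s)) \<longlonglongrightarrow> 0"
  shows "tame N Z"
  unfolding tame_def
proof (intro conjI ballI allI impI Z)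
  fix H assume H: "path_continuous H"
  show "(\<lambda>w. H (Z w)) \<in> borel_measurable N"
  proof (rule borel_measurable_LIMSEQ_real)
    fix w assume w: "w \<in> space N"
    show "(\<lambda>n. H (Zn n w)) \<longlonglongrightarrow> H (Z w)"
      by (rule path_continuousD[OF H Z[OF w] _ lim[OF w]]) (use Zn w in \<open>auto simp: tame_def\<close>)
  next
    fix n show "(\<lambda>w. H (Zn n w)) \<in> borel_measurable N" using Zn H by (simp add: tame_def)
  qed
qed

text \<open>For a fixed jump x, composing H with the shift by x is again continuous. A simple jump
  glues finitely many such cases, and a general jump is a limit of simple ones, uniformly in time
  for each w.\<close>

lemma tame_shift:
  assumes Z: "tame N Z" and \<xi>: "\<xi> \<in> borel_measurable N" and \<tau>: "0 \<le> \<tau>"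
  shows "tame N (\<lambda>w. shift T \<tau> (\<xi> w) (Z w))"
proof -
  obtain S where S: "\<And>i. simple_function N (S i)" "\<And>w. w \<in> space N \<Longrightarrow> (\<lambda>i. S i w) \<longlonglongrightarrow> \<xi> w"
    using borel_measurable_implies_sequence_metric[OF \<xi>, of 0] by blast
  show ?thesis
  proof (rule tame_limit)
    fix i
    show "tame N (\<lambda>w. shift T \<tau> (S i w) (Z w))"
      unfolding tame_def
    proof (intro conjI ballI allI impI)
      fix w assume "w \<in> space N" then show "shift T \<tau> (S i w) (Z w) \<in> D"
        using Z \<tau> by (auto simp: tame_def intro: cadlag_shift)
    next
      fix H assume H: "path_continuous H"
      have fin: "finite (S i ` space N)" using S(1) by (rule simple_functionD)
      show "(\<lambda>w. H (shift T \<tau> (S i w) (Z w))) \<in> borel_measurable N"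
      proof (rule measurable_compose_countable'[where f = "\<lambda>x w. H (shift T \<tau> x (Z w))" and g = "S i"])
        fix x
        have "path_continuous (\<lambda>\<omega>. H (shift T \<tau> x \<omega>))"
          unfolding path_continuous_def
        proof (intro ballI allI impI)
          fix \<omega> \<omega>n assume a: "\<omega> \<in> D" "\<forall>n::nat. \<omega>n n \<in> D" "(\<lambda>n. sup_norm T (\<lambda>s. \<omega>n n s - \<omega> s)) \<longlonglongrightarrow> 0"
          have "(\<lambda>s. shift T \<tau> x (\<omega>n n) s - shift T \<tau> x \<omega> s) = (\<lambda>s. \<omega>n n s - \<omega> s)" for n
            by (simp add: shift_def fun_eq_iff)
          then have "(\<lambda>n. sup_norm T (\<lambda>s. shift T \<tau> x (\<omega>n n) s - shift T \<tau> x \<omega> s)) \<longlonglongrightarrow> 0"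
            using a(3) by simp
          then show "(\<lambda>n. H (shift T \<tau> x (\<omega>n n))) \<longlonglongrightarrow> H (shift T \<tau> x \<omega>)"
            by (intro path_continuousD[OF H]) (use a cadlag_shift[OF _ \<tau>] in auto)
        qed
        then show "(\<lambda>w. H (shift T \<tau> x (Z w))) \<in> borel_measurable N"
          by (rule tameD[OF Z])
      next
        show "S i \<in> measurable N (count_space (S i ` space N))"
          using S(1)[of i] fin by (auto simp: measurable_count_space_eq2 simple_function_def)
      qed (use fin countable_finite in auto)
    qed
  next
    fix w assume w: "w \<in> space N"
    then have D: "Z w \<in> D" using Z by (simp add: tame_def)
    show "shift T \<tau> (\<xi> w) (Z w) \<in> D" using cadlag_shift[OF D \<tau>] .
    have "(\<lambda>i. norm (S i w - \<xi> w)) \<longlonglongrightarrow> 0"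
      using S(2)[OF w] LIM_zero tendsto_norm_zero by blast
    then show "(\<lambda>i. sup_norm T (\<lambda>s. shift T \<tau> (S i w) (Z w) s - shift T \<tau> (\<xi> w) (Z w) s)) \<longlonglongrightarrow> 0"
    proof (rule squeeze_zero[rotated 2])
      fix i
      show "sup_norm T (\<lambda>s. shift T \<tau> (S i w) (Z w) s - shift T \<tau> (\<xi> w) (Z w) s) \<le> norm (S i w - \<xi> w)"
      by (rule sup_norm_le[OF T_nonneg]) (auto simp: shift_def indicator_def)
      show "0 \<le> sup_norm T (\<lambda>s. shift T \<tau> (S i w) (Z w) s - shift T \<tau> (\<xi> w) (Z w) s)"
      by (rule sup_norm_nonneg[OF cadlag_diff[OF cadlag_shift[OF D \<tau>] cadlag_shift[OF D \<tau>]] T_nonneg])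
    qed
  qed
qed

lemma tame_mono:
  assumes "tame (Fil s) Z" "s \<le> t" shows "tame (Fil t) Z"
  using assms borel_Fil_mono[OF _ assms(2)] by (auto simp: tame_def space_F)

lemma tame_M: "tame (Fil s) Z \<Longrightarrow> s \<in> {0..T} \<Longrightarrow> tame M Z"
  using borel_Fil by (auto simp: tame_def space_F)

end

section \<open>Step-function approximation of a path on a grid\<close>

section \<open>Discretised paths\<close>

text \<open>There is one jump per grid point, so that a step of the recursion is a single vertical
  shift, to which the vertical derivatives apply. Before \<tau> 0 the path itself is kept.\<close>

primrec disc :: "real \<Rightarrow> (nat \<Rightarrow> real) \<Rightarrow> ('d::finite) path \<Rightarrow> nat \<Rightarrow> 'd path" where
  "disc T \<tau> X 0 = stop T (\<tau> 0) X"
| "disc T \<tau> X (Suc i) = shift T (\<tau> (Suc i)) (X (\<tau> (Suc i)) - X (\<tau> i)) (disc T \<tau> X i)"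

text \<open>The increments telescope: past \<tau> 0 the value is X at the latest grid point reached.
  The upper bound on s is absent only for the last grid point, whose value is kept from then
  on.\<close>

lemma disc_value:
  assumes "mono \<tau>" "0 \<le> \<tau> 0" "s \<in> {0..T}"
  shows "(s < \<tau> 0 \<and> disc T \<tau> X i s = X s) \<or>
     (\<exists>j\<le>i. \<tau> j \<le> s \<and> disc T \<tau> X i s = X (\<tau> j) \<and> (j < i \<longrightarrow> s < \<tau> (Suc j)))"
proof (induction i)
  case 0
  then show ?case using assms by (auto simp: stop_def min_def)
next
  case (Suc i)
  show ?case
  proof (cases "\<tau> (Suc i) \<le> s")
    case True
    have "\<tau> 0 \<le> \<tau> (Suc i)" using assms(1) by (simp add: monoD)
    with True Suc obtain j where j: "j \<le> i" "\<tau> j \<le> s" "disc T \<tau> X i s = X (\<tau> j)" "j < i \<longrightarrow> s < \<tau> (Suc j)"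
      by auto
    \<comment> \<open>Past \<tau> (Suc i) every earlier cell has ended, so the current value belongs
      to the last grid point and the new increment telescopes with it.\<close>
    have "j = i"
    proof (rule ccontr)
      assume "j \<noteq> i"
      then have "\<tau> (Suc j) \<le> \<tau> (Suc i)" "s < \<tau> (Suc j)" using j assms(1) by (auto intro: monoD)
      then show False using True by simp
    qed
    then have "disc T \<tau> X (Suc i) s = X (\<tau> (Suc i))"
      using True assms(3) j by (simp add: shift_def)
    then show ?thesis using True by (intro disjI2 exI[of _ "Suc i"]) auto
  next
    case False
    then have eq: "disc T \<tau> X (Suc i) s = disc T \<tau> X i s" by (simp add: shift_def)
    from Suc show ?thesis
    proof
      assume "\<exists>j\<le>i. \<tau> j \<le> s \<and> disc T \<tau> X i s = X (\<tau> j) \<and> (j < i \<longrightarrow> s < \<tau> (Suc j))"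
      then obtain j where "j \<le> i" "\<tau> j \<le> s" "disc T \<tau> X i s = X (\<tau> j)" "j < i \<longrightarrow> s < \<tau> (Suc j)" by blast
      then show ?thesis using False eq
        by (intro disjI2 exI[of _ j]) (auto simp: less_Suc_eq dest: le_neq_implies_less)
    qed (use eq in simp)
  qed
qed

text \<open>The comparison is with X stopped at \<tau> i because both paths are frozen from there
  on; before that they differ by an oscillation of X over one cell.\<close>

lemma disc_near:
  assumes \<tau>: "mono \<tau>" "0 \<le> \<tau> 0" "\<tau> i \<le> T" and mesh: "\<And>j. \<tau> (Suc j) \<le> \<tau> j + h" and "0 < h"
    and osc: "\<And>u v. u \<in> {0..T} \<Longrightarrow> v \<in> {0..T} \<Longrightarrow> \<bar>u - v\<bar> \<le> h \<Longrightarrow> norm (X u - X v) \<le> e"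
    and T: "0 \<le> T"
  shows "sup_norm T (\<lambda>s. disc T \<tau> X i s - stop T (\<tau> i) X s) \<le> e"
proof (rule sup_norm_le[OF T])
  fix s assume s: "s \<in> {0..T}"
  have ti: "\<tau> 0 \<le> \<tau> i" using \<tau> by (simp add: monoD)
  have st: "stop T (\<tau> i) X s = X (min s (\<tau> i))" using s by (simp add: stop_def)
  have e0: "norm (X s - X s) \<le> e" using osc[OF s s] \<open>0 < h\<close> by simp
  from disc_value[OF \<tau>(1,2) s, of X i]
  show "norm (disc T \<tau> X i s - stop T (\<tau> i) X s) \<le> e"
  proof
    assume "s < \<tau> 0 \<and> disc T \<tau> X i s = X s"
    then show ?thesis using st ti e0 by (simp add: min_def)
  next
    assume "\<exists>j\<le>i. \<tau> j \<le> s \<and> disc T \<tau> X i s = X (\<tau> j) \<and> (j < i \<longrightarrow> s < \<tau> (Suc j))"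
    then obtain j where j: "j \<le> i" "\<tau> j \<le> s" "disc T \<tau> X i s = X (\<tau> j)" "j < i \<longrightarrow> s < \<tau> (Suc j)" by blast
    show ?thesis
    proof (cases "j = i")
      case True
      then show ?thesis using st j e0 by (simp add: min_absorb2)
    next
      case False
      then have "j < i" using j by simp
      then have "\<tau> (Suc j) \<le> \<tau> i" using \<tau>(1) by (simp add: monoD)
      moreover have "s < \<tau> (Suc j)" using j \<open>j < i\<close> by simp
      moreover have "0 \<le> \<tau> j" using \<tau> monoD[OF \<tau>(1), of 0 j] by simp
      ultimately have "norm (X (\<tau> j) - X s) \<le> e" using mesh[of j] j s \<tau>(3) by (intro osc) auto
      then show ?thesis using st j \<open>s < \<tau> (Suc j)\<close> \<open>\<tau> (Suc j) \<le> \<tau> i\<close> by simp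
    qed
  qed
qed

lemma cpaths_uniform:
  assumes "X \<in> cpaths T" "0 < e"
  obtains h where "0 < h" "\<And>u v. u \<in> {0..T} \<Longrightarrow> v \<in> {0..T} \<Longrightarrow> \<bar>u - v\<bar> \<le> h \<Longrightarrow> norm (X u - X v) \<le> e"
proof -
  have "uniformly_continuous_on {0..T} X"
    using assms by (intro compact_uniformly_continuous) (auto simp: cpaths_def)
  then obtain d where d: "d > 0" "\<And>u v. u \<in> {0..T} \<Longrightarrow> v \<in> {0..T} \<Longrightarrow> dist u v < d \<Longrightarrow> dist (X u) (X v) < e"
    using assms(2) unfolding uniformly_continuous_on_def by metis
  show ?thesis
  proof (rule that[of "d/2"])
    fix u v assume "u \<in> {0..T}" "v \<in> {0..T}" "\<bar>u - v\<bar> \<le> d / 2"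
    then show "norm (X u - X v) \<le> e" using d(2)[of u v] d(1) by (simp add: dist_norm)
  qed (use d(1) in simp)
qed

lemma disc_cadlag:
  assumes "X \<in> cadlag T" "\<And>i. 0 \<le> \<tau> i" "\<tau> 0 \<le> T"
  shows "disc T \<tau> X i \<in> cadlag T"
  using assms by (induction i) (auto intro: cadlag_stop cadlag_shift)

text \<open>All values of \<open>disc\<close> are values of X. Adding up the norms of the jumps
  would give a bound that grows with the number of grid points.\<close>

lemma disc_norm_le:
  assumes "X \<in> cadlag T" "mono \<tau>" "0 \<le> \<tau> 0" "\<And>j. j \<le> i \<Longrightarrow> \<tau> j \<le> T" "0 \<le> T"
  shows "sup_norm T (disc T \<tau> X i) \<le> sup_norm T X"
proof (rule sup_norm_le[OF assms(5)])
  fix s assume s: "s \<in> {0..T}"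
  have "0 \<le> \<tau> j" for j using assms monoD[OF assms(2), of 0 j] by simp
  with disc_value[OF assms(2,3) s, of X i] show "norm (disc T \<tau> X i s) \<le> sup_norm T X"
    using sup_norm_ge[OF assms(1)] assms(4) s by force
qed

context basis
begin

text \<open>A continuous path is the uniform limit of its discretisations, and each of these arises
  from the zero path by finitely many measurable jumps. For continuous paths, coordinate
  measurability is thus enough.\<close>

lemma tame_cpaths:
  assumes X: "\<And>w. w \<in> space N \<Longrightarrow> X w \<in> cpaths T"
    and m: "\<And>s. s \<in> {0..T} \<Longrightarrow> (\<lambda>w. X w s) \<in> borel_measurable N"
  shows "tame N X"
proof (rule tame_limit[where Zn = "\<lambda>n w. disc T (\<lambda>j. min T (real j * (T / real (Suc n)))) (X w) (Suc n)"])
  fix n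
  let ?t = "\<lambda>j. min T (real j * (T / real (Suc n)))"
  have "tame N (\<lambda>w. disc T ?t (X w) i)" for i
  proof (induction i)
    case 0
    \<comment> \<open>Stopping at time 0 leaves the constant path with value X 0, which is the zero
      path with a jump at time 0.\<close>
    have "disc T ?t (X w) 0 = shift T 0 (X w 0) (\<lambda>_. 0)" if "w \<in> space N" for w
    proof
      fix s
      have "min T (real 0 * (T / real (Suc n))) = 0" using T_nonneg by simp
      then show "disc T ?t (X w) 0 s = shift T 0 (X w 0) (\<lambda>_. 0) s"
        unfolding disc.simps(1) by (cases "s \<in> {0..T}") (auto simp: stop_def shift_def)
    qed
    note eq = this
    have "tame N (\<lambda>w. shift T 0 (X w 0) (\<lambda>_. 0))"
      by (rule tame_shift[OF tame_const[OF cadlag_zero] m]) (use T_nonneg in auto)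
    then show ?case by (rule tame_cong) (rule eq[symmetric])
  next
    case (Suc i)
    have "(\<lambda>w. X w (?t (Suc i)) - X w (?t i)) \<in> borel_measurable N"
      using T_nonneg by (intro borel_measurable_diff m) auto
    then show ?case using tame_shift[OF Suc, of _ "?t (Suc i)"] T_nonneg by simp
  qed
  then show "tame N (\<lambda>w. disc T ?t (X w) (Suc n))" .
next
  fix w assume w: "w \<in> space N"
  then show XD: "X w \<in> D" using X cpaths_cadlag by blast
  let ?t = "\<lambda>n j. min T (real j * (T / real (Suc n)))"
  have mono: "mono (?t n)" for n
    using T_nonneg by (intro monoI min.mono mult_right_mono) auto
  show "(\<lambda>n. sup_norm T (\<lambda>s. disc T (?t n) (X w) (Suc n) s - X w s)) \<longlonglongrightarrow> 0"
  proof (rule LIMSEQ_I)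
    fix e :: real assume e: "0 < e"
    obtain h where h: "0 < h" "\<And>u v. u \<in> {0..T} \<Longrightarrow> v \<in> {0..T} \<Longrightarrow> \<bar>u - v\<bar> \<le> h \<Longrightarrow> norm (X w u - X w v) \<le> e/2"
      using cpaths_uniform[OF X[OF w], of "e/2"] e by auto
    obtain N0 :: nat where N0: "T / h < real N0" using reals_Archimedean2 by blast
    have "norm (sup_norm T (\<lambda>s. disc T (?t n) (X w) (Suc n) s - X w s) - 0) < e" if n: "n \<ge> N0" for n
    proof -
      have TT: "?t n (Suc n) = T" by simp
      have small: "T / real (Suc n) \<le> h"
        using N0 n h(1) by (simp add: field_simps) (smt (verit, best) mult_left_mono of_nat_mono)
      have "sup_norm T (\<lambda>s. disc T (?t n) (X w) (Suc n) s - stop T (?t n (Suc n)) (X w) s) \<le> e/2"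
      proof (rule disc_near[OF mono _ _ _ h T_nonneg])
        fix j show "?t n (Suc j) \<le> ?t n j + h"
          using small h(1) by (simp add: add_divide_distrib distrib_right min_def)
      qed (use T_nonneg in auto)
      then have "sup_norm T (\<lambda>s. disc T (?t n) (X w) (Suc n) s - X w s) \<le> e/2"
        unfolding TT using stop_T[OF XD] by simp
      moreover have "0 \<le> sup_norm T (\<lambda>s. disc T (?t n) (X w) (Suc n) s - X w s)"
      proof (rule sup_norm_nonneg[OF cadlag_diff[OF _ XD] T_nonneg])
        show "disc T (?t n) (X w) (Suc n) \<in> D" using T_nonneg by (intro disc_cadlag[OF XD]) auto
      qed
      ultimately show ?thesis using e by simp
    qed
    then show "\<exists>no. \<forall>n\<ge>no. norm (sup_norm T (\<lambda>s. disc T (?t n) (X w) (Suc n) s - X w s) - 0) < e" by blast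
  qed
qed

end

section \<open>The class of functionals that is expanded, and its closure under differences and
  squares\<close>

section \<open>Smooth functionals\<close>

lemma shift_zero [simp]: "shift T \<tau> 0 \<omega> = \<omega>"
  by (simp add: shift_def)

lemma cont_wrt_seqD:
  assumes "cont_wrt d X g" "p \<in> X" "\<And>n::nat. q n \<in> X" "(\<lambda>n. d p (q n)) \<longlonglongrightarrow> 0"
  shows "(\<lambda>n. g (q n)) \<longlonglongrightarrow> g p"
proof (rule tendstoI)
  fix e :: real assume "0 < e"
  then obtain \<delta> where \<delta>: "\<delta> > 0" "\<And>q. q \<in> X \<Longrightarrow> d p q < \<delta> \<Longrightarrow> dist (g q) (g p) < e"
    using assms(1,2) unfolding cont_wrt_def by blast
  have "\<forall>\<^sub>F n in sequentially. d p (q n) < \<delta>" using assms(4) \<delta>(1) by (rule order_tendstoD)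
  then show "\<forall>\<^sub>F n in sequentially. dist (g (q n)) (g p) < e"
    by eventually_elim (use \<delta>(2) assms(3) in auto)
qed

lemma one_plus_power_le:
  fixes x :: real assumes "0 \<le> x" shows "1 + x ^ k \<le> 2 * (1 + x) ^ k"
proof -
  have "1 \<le> (1+x)^k" using assms by (auto intro: one_le_power)
  moreover have "x^k \<le> (1+x)^k" using assms by (auto intro: power_mono)
  ultimately show ?thesis by linarith
qed

lemma one_plus_power_power_le:
  fixes x y :: real assumes "0 \<le> x" "0 \<le> y"
  shows "1 + x ^ k + y ^ k \<le> 3 * ((1 + x) ^ k * (1 + y) ^ k)"
proof -
  have "1 \<le> (1+x)^k" "1 \<le> (1+y)^k" using assms by (auto intro: one_le_power)
  moreover have "x^k \<le> (1+x)^k" "y^k \<le> (1+y)^k" using assms by (auto intro: power_mono)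
  moreover have "(1+x)^k \<le> (1+x)^k * (1+y)^k" "(1+y)^k \<le> (1+x)^k * (1+y)^k" 
    using mult_left_mono[OF calculation(2), of "(1+x)^k"] mult_right_mono[OF calculation(1), of "(1+y)^k"] assms by auto
  ultimately show ?thesis by linarith
qed

text \<open>The rank-one matrix a b^T. It is the extra term that appears when the gradient 2 v (grad
  v) of v^2 is differentiated once more.\<close>

definition outer :: "real ^ 'd \<Rightarrow> real ^ 'd \<Rightarrow> real ^ 'd ^ ('d::finite)" where
  "outer a b = (\<chi> i. a $ i *\<^sub>R b)"

lemma outer_vector: "outer a b *v x = (b \<bullet> x) *\<^sub>R a"
  by (simp add: outer_def vec_eq_iff matrix_vector_mult_def inner_vec_def sum_distrib_right algebra_simps)
     (simp add: sum_distrib_left algebra_simps)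

lemma trace_outer: "trace (outer a b) = a \<bullet> b"
  by (simp add: outer_def trace_def inner_vec_def)

lemma norm_outer: "norm (outer a b) \<le> norm a * norm b"
proof -
  have "norm (outer a b) = L2_set (\<lambda>i. \<bar>a $ i\<bar> * norm b) UNIV" unfolding norm_vec_def[of "outer a b"] by (simp add: outer_def)
  also have "\<dots> = L2_set (\<lambda>i. \<bar>a $ i\<bar>) UNIV * norm b"
    by (rule L2_set_left_distrib[symmetric]) simp
  also have "\<dots> = norm a * norm b" by (simp add: norm_vec_def)
  finally show ?thesis by simp
qed

lemma tendsto_outer:
  assumes "(a \<longlongrightarrow> l) F" "(b \<longlongrightarrow> l') F"
  shows "((\<lambda>x. outer (a x) (b x)) \<longlongrightarrow> outer l l') F"
  unfolding outer_def by (intro vec_tendstoI) (simp, intro tendsto_intros assms)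

context basis
begin

text \<open>Continuity is used along sequences, which is the form that dominated convergence asks
  for; membership of the limit and of the sequence is built in.\<close>

definition hat_conv ::
  "(nat \<Rightarrow> real) \<Rightarrow> (nat \<Rightarrow> 'd path) \<Rightarrow> (nat \<Rightarrow> 'd law) \<Rightarrow> real \<Rightarrow> 'd path \<Rightarrow> 'd law \<Rightarrow> bool" where
  "hat_conv tn \<omega>n \<mu>n t \<omega> \<mu> \<longleftrightarrow> t \<in> {0..T} \<and> \<omega> \<in> D \<and> \<mu> \<in> PL \<and>
     (\<forall>n. tn n \<in> {0..T} \<and> \<omega>n n \<in> D \<and> \<mu>n n \<in> PL) \<and>
     (\<lambda>n. dist_hat T (t, \<omega>, \<mu>) (tn n, \<omega>n n, \<mu>n n)) \<longlonglongrightarrow> 0"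

definition seq_cont3 :: "(real \<Rightarrow> 'd path \<Rightarrow> 'd law \<Rightarrow> 'b::topological_space) \<Rightarrow> bool" where
  "seq_cont3 H \<longleftrightarrow> (\<forall>tn \<omega>n \<mu>n t \<omega> \<mu>. hat_conv tn \<omega>n \<mu>n t \<omega> \<mu> \<longrightarrow>
     (\<lambda>n. H (tn n) (\<omega>n n) (\<mu>n n)) \<longlonglongrightarrow> H t \<omega> \<mu>)"

definition seq_cont4 :: "(real \<Rightarrow> 'd path \<Rightarrow> 'd law \<Rightarrow> 'd path \<Rightarrow> 'b::topological_space) \<Rightarrow> bool" where
  "seq_cont4 H \<longleftrightarrow> (\<forall>tn \<omega>n \<mu>n vn t \<omega> \<mu> v. hat_conv tn \<omega>n \<mu>n t \<omega> \<mu> \<longrightarrow> v \<in> D \<longrightarrow> (\<forall>n. vn n \<in> D) \<longrightarrow>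
     (\<lambda>n. path_dist T t v (tn n) (vn n)) \<longlonglongrightarrow> 0 \<longrightarrow>
     (\<lambda>n. H (tn n) (\<omega>n n) (\<mu>n n) (vn n)) \<longlonglongrightarrow> H t \<omega> \<mu> v)"

text \<open>Powers of 1 + norm multiply to powers of the same kind, so this form of polynomial
  growth survives products.\<close>

definition growth3 :: "(real \<Rightarrow> 'd path \<Rightarrow> 'd law \<Rightarrow> 'b::real_normed_vector) \<Rightarrow> bool" where
  "growth3 H \<longleftrightarrow> (\<forall>K. \<exists>C k. 0 \<le> C \<and> (\<forall>t\<in>{0..T}. \<forall>\<omega>\<in>D. \<forall>\<mu>\<in>PL. law_norm T (stop_law T t \<mu>) \<le> K \<longrightarrow>
     norm (H t \<omega> \<mu>) \<le> C * (1 + sup_norm T \<omega>) ^ k))"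

definition growth4 :: "(real \<Rightarrow> 'd path \<Rightarrow> 'd law \<Rightarrow> 'd path \<Rightarrow> 'b::real_normed_vector) \<Rightarrow> bool" where
  "growth4 H \<longleftrightarrow> (\<forall>K. \<exists>C k. 0 \<le> C \<and> (\<forall>t\<in>{0..T}. \<forall>\<omega>\<in>D. \<forall>\<mu>\<in>PL. \<forall>v\<in>D. law_norm T (stop_law T t \<mu>) \<le> K \<longrightarrow>
     norm (H t \<omega> \<mu> v) \<le> C * ((1 + sup_norm T \<omega>) ^ k * (1 + sup_norm T v) ^ k)))"

text \<open>The measure derivative is only required along lines \<open>\<theta> \<mapsto> \<eta> + \<theta> \<xi> 1\<^bsub>[t,T]\<^esub>\<close>: this is what Taylor
  expansion needs, and it is stable under products without a dual characterisation of \<open>L\<^sup>2\<close>.\<close>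

definition law_line_deriv ::
  "(real \<Rightarrow> 'd path \<Rightarrow> 'd law \<Rightarrow> real) \<Rightarrow> (real \<Rightarrow> 'd path \<Rightarrow> 'd law \<Rightarrow> 'd path \<Rightarrow> real ^ 'd) \<Rightarrow> bool" where
  "law_line_deriv G Gm \<longleftrightarrow> (\<forall>t\<in>{0..T}. \<forall>\<omega>\<in>D. \<forall>\<eta>. \<forall>\<xi>\<in>L2 M (Fil t).
     adapted_cadlag T M Fil \<eta> \<longrightarrow> law \<eta> \<in> PL \<longrightarrow>
     integrable M (\<lambda>w. Gm t \<omega> (law \<eta>) (\<eta> w) \<bullet> \<xi> w) \<and>
     ((\<lambda>\<theta>. G t \<omega> (law (\<lambda>w. shift T t (\<theta> *\<^sub>R \<xi> w) (\<eta> w)))) has_real_derivative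
        (\<integral>w. Gm t \<omega> (law \<eta>) (\<eta> w) \<bullet> \<xi> w \<partial>M)) (at 0))"

text \<open>Restricted to arguments already stopped at t, which is the situation of a step process
  between two jumps.\<close>

definition right_time_deriv ::
  "(real \<Rightarrow> 'd path \<Rightarrow> 'd law \<Rightarrow> real) \<Rightarrow> (real \<Rightarrow> 'd path \<Rightarrow> 'd law \<Rightarrow> real) \<Rightarrow> bool" where
  "right_time_deriv G Gt \<longleftrightarrow> (\<forall>t\<in>{0..<T}. \<forall>\<omega>\<in>D. \<forall>\<mu>\<in>PL. stop T t \<omega> = \<omega> \<longrightarrow> stop_law T t \<mu> = \<mu> \<longrightarrow>
     ((\<lambda>h. (G (t + h) \<omega> \<mu> - G t \<omega> \<mu>) / h) \<longlongrightarrow> Gt t \<omega> \<mu>) (at_right 0))"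

text \<open>What the one-step expansion takes from the solution class, in a form that passes to
  differences and squares.\<close>

definition smooth ::
  "(real \<Rightarrow> 'd path \<Rightarrow> 'd law \<Rightarrow> real) \<Rightarrow> (real \<Rightarrow> 'd path \<Rightarrow> 'd law \<Rightarrow> real) \<Rightarrow>
   (real \<Rightarrow> 'd path \<Rightarrow> 'd law \<Rightarrow> real ^ 'd) \<Rightarrow> (real \<Rightarrow> 'd path \<Rightarrow> 'd law \<Rightarrow> real ^ 'd ^ 'd) \<Rightarrow>
   (real \<Rightarrow> 'd path \<Rightarrow> 'd law \<Rightarrow> 'd path \<Rightarrow> real ^ 'd) \<Rightarrow>
   (real \<Rightarrow> 'd path \<Rightarrow> 'd law \<Rightarrow> 'd path \<Rightarrow> real ^ 'd ^ 'd) \<Rightarrow> bool" where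
  "smooth G Gt Gw Gww Gm Gwm \<longleftrightarrow>
     right_time_deriv G Gt \<and> law_line_deriv G Gm \<and>
     (\<forall>t\<in>{0..T}. \<forall>\<omega>\<in>D. \<forall>\<mu>\<in>PL.
        has_path_svd T t (\<lambda>\<omega>. G t \<omega> \<mu>) \<omega> (\<lambda>x. Gw t \<omega> \<mu> \<bullet> x) \<and>
        has_path_svd T t (\<lambda>\<omega>. Gw t \<omega> \<mu>) \<omega> (\<lambda>x. Gww t \<omega> \<mu> *v x) \<and>
        (\<forall>v\<in>D. has_path_svd T t (Gm t \<omega> \<mu>) v (\<lambda>x. Gwm t \<omega> \<mu> v *v x))) \<and>
     seq_cont3 G \<and> seq_cont3 Gt \<and> seq_cont3 Gw \<and> seq_cont3 Gww \<and> seq_cont4 Gm \<and> seq_cont4 Gwm \<and>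
     growth3 G \<and> growth3 Gt \<and> growth3 Gw \<and> growth3 Gww \<and> growth4 Gm \<and> growth4 Gwm"

lemma path_dist_zero: "\<omega> \<in> D \<Longrightarrow> t \<in> {0..T} \<Longrightarrow> path_dist T t \<omega> t \<omega> = 0"
  by (simp add: path_dist_def T_nonneg)

lemma growth3I:
  assumes "\<And>K. 0 < K \<Longrightarrow> \<exists>C. \<forall>t\<in>{0..T}. \<forall>\<omega>\<in>D. \<forall>\<mu>\<in>PL. law_norm T (stop_law T t \<mu>) \<le> K \<longrightarrow>
     norm (H t \<omega> \<mu>) \<le> C * (1 + sup_norm T (stop T t \<omega>) ^ k)"
  shows "growth3 H"
  unfolding growth3_def
proof
  fix K :: real
  obtain C where C: "\<And>t \<omega> \<mu>. t\<in>{0..T} \<Longrightarrow> \<omega>\<in>D \<Longrightarrow> \<mu>\<in>PL \<Longrightarrow> law_norm T (stop_law T t \<mu>) \<le> max K 1 \<Longrightarrow>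
     norm (H t \<omega> \<mu>) \<le> C * (1 + sup_norm T (stop T t \<omega>) ^ k)"
    using assms[of "max K 1"] unfolding Ball_def by (metis less_max_iff_disj zero_less_one)
  show "\<exists>C k. 0 \<le> C \<and> (\<forall>t\<in>{0..T}. \<forall>\<omega>\<in>D. \<forall>\<mu>\<in>PL. law_norm T (stop_law T t \<mu>) \<le> K \<longrightarrow>
     norm (H t \<omega> \<mu>) \<le> C * (1 + sup_norm T \<omega>) ^ k)"
  proof (intro exI conjI ballI impI)
    show "0 \<le> 2 * \<bar>C\<bar>" by simp
    fix t \<omega> \<mu> assume t: "t\<in>{0..T}" and \<omega>: "\<omega>\<in>D" and \<mu>: "\<mu>\<in>PL" and K: "law_norm T (stop_law T t \<mu>) \<le> K"
    have s0: "0 \<le> sup_norm T (stop T t \<omega>)" by (rule sup_norm_nonneg[OF cadlag_stop[OF \<omega> t] T_nonneg])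
    have s1: "sup_norm T (stop T t \<omega>) \<le> sup_norm T \<omega>" using sup_norm_stop_le[OF \<omega> _ T_nonneg] t by simp
    have "norm (H t \<omega> \<mu>) \<le> C * (1 + sup_norm T (stop T t \<omega>) ^ k)" using C[OF t \<omega> \<mu>] K by simp
    also have "\<dots> \<le> \<bar>C\<bar> * (1 + sup_norm T (stop T t \<omega>) ^ k)" using s0 by (intro mult_right_mono) auto
    also have "\<dots> \<le> \<bar>C\<bar> * (2 * (1 + sup_norm T (stop T t \<omega>)) ^ k)"
      by (intro mult_left_mono one_plus_power_le s0) auto
    also have "\<dots> \<le> \<bar>C\<bar> * (2 * (1 + sup_norm T \<omega>) ^ k)"
      using s0 s1 by (intro mult_left_mono power_mono) auto
    finally show "norm (H t \<omega> \<mu>) \<le> 2 * \<bar>C\<bar> * (1 + sup_norm T \<omega>) ^ k" by simp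
  qed
qed

lemma growth4I:
  assumes "\<And>K. 0 < K \<Longrightarrow> \<exists>C. \<forall>t\<in>{0..T}. \<forall>\<omega>\<in>D. \<forall>\<mu>\<in>PL. law_norm T (stop_law T t \<mu>) \<le> K \<longrightarrow> (\<forall>v\<in>D.
     norm (H t \<omega> \<mu> v) \<le> C * (1 + sup_norm T (stop T t \<omega>) ^ k + sup_norm T (stop T t v) ^ k))"
  shows "growth4 H"
  unfolding growth4_def
proof
  fix K :: real
  obtain C where C: "\<And>t \<omega> \<mu> v. t\<in>{0..T} \<Longrightarrow> \<omega>\<in>D \<Longrightarrow> \<mu>\<in>PL \<Longrightarrow> law_norm T (stop_law T t \<mu>) \<le> max K 1 \<Longrightarrow> v \<in> D \<Longrightarrow>
     norm (H t \<omega> \<mu> v) \<le> C * (1 + sup_norm T (stop T t \<omega>) ^ k + sup_norm T (stop T t v) ^ k)"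
    using assms[of "max K 1"] unfolding Ball_def by (metis less_max_iff_disj zero_less_one)
  show "\<exists>C k. 0 \<le> C \<and> (\<forall>t\<in>{0..T}. \<forall>\<omega>\<in>D. \<forall>\<mu>\<in>PL. \<forall>v\<in>D. law_norm T (stop_law T t \<mu>) \<le> K \<longrightarrow>
     norm (H t \<omega> \<mu> v) \<le> C * ((1 + sup_norm T \<omega>) ^ k * (1 + sup_norm T v) ^ k))"
  proof (intro exI conjI ballI impI)
    show "0 \<le> 3 * \<bar>C\<bar>" by simp
    fix t \<omega> \<mu> v assume t: "t\<in>{0..T}" and \<omega>: "\<omega>\<in>D" and \<mu>: "\<mu>\<in>PL" and v: "v \<in> D"
      and K: "law_norm T (stop_law T t \<mu>) \<le> K"
    let ?a = "sup_norm T (stop T t \<omega>)" and ?b = "sup_norm T (stop T t v)"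
    have s0: "0 \<le> ?a" "0 \<le> ?b" by (auto intro!: sup_norm_nonneg[OF cadlag_stop T_nonneg] \<omega> v t)
    have s1: "?a \<le> sup_norm T \<omega>" "?b \<le> sup_norm T v"
      using sup_norm_stop_le[OF \<omega> _ T_nonneg] sup_norm_stop_le[OF v _ T_nonneg] t by auto
    have "norm (H t \<omega> \<mu> v) \<le> C * (1 + ?a ^ k + ?b ^ k)" using C[OF t \<omega> \<mu> _ v] K by simp
    also have "\<dots> \<le> \<bar>C\<bar> * (1 + ?a ^ k + ?b ^ k)" using s0 by (intro mult_right_mono) auto
    also have "\<dots> \<le> \<bar>C\<bar> * (3 * ((1 + ?a) ^ k * (1 + ?b) ^ k))"
      by (intro mult_left_mono one_plus_power_power_le s0) auto
    also have "\<dots> \<le> \<bar>C\<bar> * (3 * ((1 + sup_norm T \<omega>) ^ k * (1 + sup_norm T v) ^ k))"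
      using s0 s1 by (intro mult_left_mono mult_mono power_mono) auto
    finally show "norm (H t \<omega> \<mu> v) \<le> 3 * \<bar>C\<bar> * ((1 + sup_norm T \<omega>) ^ k * (1 + sup_norm T v) ^ k)" by simp
  qed
qed

text \<open>Applying the L2 expansion to \<theta> \<xi> and dividing by \<theta> gives the
  derivative along the line; the rest translates one set of notions into the other.\<close>

lemma C1211p_smooth:
  assumes "C1211p T M Fil F Ft Fw Fww Fm Fwm"
  shows "smooth F Ft Fw Fww Fm Fwm"
proof -
  let ?X = "{0..T} \<times> D \<times> PL" and ?X' = "{0..T} \<times> D \<times> PL \<times> D"
  let ?d' = "\<lambda>(t, \<omega>, \<mu>, v) (t', \<omega>', \<mu>', v'). dist_hat T (t, \<omega>, \<mu>) (t', \<omega>', \<mu>') + path_dist T t v t' v'"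
  note A = assms[unfolded C1211p_def Let_def]
  have pt: "\<And>t \<omega> \<mu>. t\<in>{0..T} \<Longrightarrow> \<omega>\<in>D \<Longrightarrow> \<mu>\<in>PL \<Longrightarrow>
         (t < T \<longrightarrow> ((\<lambda>h. (F (t + h) (stop T t \<omega>) (stop_law T t \<mu>)
                             - F t (stop T t \<omega>) (stop_law T t \<mu>)) / h) \<longlongrightarrow> Ft t \<omega> \<mu>) (at_right 0)) \<and>
         has_path_svd T t (\<lambda>\<omega>. F t \<omega> \<mu>) \<omega> (\<lambda>x. Fw t \<omega> \<mu> \<bullet> x) \<and>
         has_path_svd T t (\<lambda>\<omega>. Fw t \<omega> \<mu>) \<omega> (\<lambda>x. Fww t \<omega> \<mu> *v x) \<and>
         has_law_svd T M Fil t (F t \<omega>) \<mu> (Fm t \<omega> \<mu>) \<and>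
         (\<forall>v\<in>D. has_path_svd T t (Fm t \<omega> \<mu>) v (\<lambda>x. Fwm t \<omega> \<mu> v *v x))"
    using A by blast
  have c3: "seq_cont3 H" if "cont_wrt (dist_hat T) ?X (\<lambda>(t, \<omega>, \<mu>). H t \<omega> \<mu>)" 
    for H :: "real \<Rightarrow> 'd path \<Rightarrow> 'd law \<Rightarrow> 'b::metric_space"
    unfolding seq_cont3_def hat_conv_def
  proof (intro allI impI, elim conjE)
    fix tn \<omega>n \<mu>n t \<omega> \<mu>
    assume h: "t \<in> {0..T}" "\<omega> \<in> D" "\<mu> \<in> PL" "\<forall>n. tn n \<in> {0..T} \<and> \<omega>n n \<in> D \<and> \<mu>n n \<in> PL"
      "(\<lambda>n. dist_hat T (t, \<omega>, \<mu>) (tn n, \<omega>n n, \<mu>n n)) \<longlonglongrightarrow> 0"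
    show "(\<lambda>n. H (tn n) (\<omega>n n) (\<mu>n n)) \<longlonglongrightarrow> H t \<omega> \<mu>"
      using cont_wrt_seqD[OF that, of "(t,\<omega>,\<mu>)" "\<lambda>n. (tn n, \<omega>n n, \<mu>n n)"] h by auto
  qed
  have c4: "seq_cont4 H" if "cont_wrt ?d' ?X' (\<lambda>(t, \<omega>, \<mu>, v). H t \<omega> \<mu> v)" 
    for H :: "real \<Rightarrow> 'd path \<Rightarrow> 'd law \<Rightarrow> 'd path \<Rightarrow> 'b::metric_space"
    unfolding seq_cont4_def hat_conv_def
  proof (intro allI impI, elim conjE)
    fix tn \<omega>n \<mu>n vn t \<omega> \<mu> v
    assume h: "t \<in> {0..T}" "\<omega> \<in> D" "\<mu> \<in> PL" "\<forall>n. tn n \<in> {0..T} \<and> \<omega>n n \<in> D \<and> \<mu>n n \<in> PL"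
      "v \<in> D" "\<forall>n. vn n \<in> D"
      and l: "(\<lambda>n. dist_hat T (t, \<omega>, \<mu>) (tn n, \<omega>n n, \<mu>n n)) \<longlonglongrightarrow> 0"
      "(\<lambda>n. path_dist T t v (tn n) (vn n)) \<longlonglongrightarrow> 0"
    show "(\<lambda>n. H (tn n) (\<omega>n n) (\<mu>n n) (vn n)) \<longlonglongrightarrow> H t \<omega> \<mu> v"
      using cont_wrt_seqD[OF that, of "(t,\<omega>,\<mu>,v)" "\<lambda>n. (tn n, \<omega>n n, \<mu>n n, vn n)"] h tendsto_add[OF l] by auto
  qed
  from A obtain k :: nat where k: "\<And>K. 0 < K \<Longrightarrow> \<exists>C. \<forall>t\<in>{0..T}. \<forall>\<omega>\<in>D. \<forall>\<mu>\<in>PL. law_norm T (stop_law T t \<mu>) \<le> K \<longrightarrow>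
         \<bar>F t \<omega> \<mu>\<bar> \<le> C * (1 + sup_norm T (stop T t \<omega>) ^ k) \<and>
         \<bar>Ft t \<omega> \<mu>\<bar> \<le> C * (1 + sup_norm T (stop T t \<omega>) ^ k) \<and>
         norm (Fw t \<omega> \<mu>) \<le> C * (1 + sup_norm T (stop T t \<omega>) ^ k) \<and>
         norm (Fww t \<omega> \<mu>) \<le> C * (1 + sup_norm T (stop T t \<omega>) ^ k) \<and>
         (\<forall>v\<in>D.
           norm (Fm t \<omega> \<mu> v) \<le> C * (1 + sup_norm T (stop T t \<omega>) ^ k + sup_norm T (stop T t v) ^ k) \<and>
           norm (Fwm t \<omega> \<mu> v) \<le> C * (1 + sup_norm T (stop T t \<omega>) ^ k + sup_norm T (stop T t v) ^ k))"
    by (elim conjE exE) blast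
  have g: "growth3 F" "growth3 Ft" "growth3 Fw" "growth3 Fww"
    by (rule growth3I[of _ k], drule k, elim exE, rule exI, fastforce)+
  have g': "growth4 Fm" "growth4 Fwm"
    by (rule growth4I[of _ k], drule k, elim exE, rule exI, fastforce)+
  have rt: "right_time_deriv F Ft"
    unfolding right_time_deriv_def
  proof (intro ballI impI)
    fix t \<omega> \<mu> assume h: "t \<in> {0..<T}" "\<omega> \<in> D" "\<mu> \<in> PL" "stop T t \<omega> = \<omega>" "stop_law T t \<mu> = \<mu>"
    then show "((\<lambda>h. (F (t + h) \<omega> \<mu> - F t \<omega> \<mu>) / h) \<longlongrightarrow> Ft t \<omega> \<mu>) (at_right 0)"
      using pt[of t \<omega> \<mu>] by simp
  qed
  have ll: "law_line_deriv F Fm"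
    unfolding law_line_deriv_def
  proof (intro ballI allI impI)
    fix t \<omega> \<eta> and \<xi> :: "'w \<Rightarrow> real ^ 'd" assume t: "t \<in> {0..T}" and \<omega>: "\<omega> \<in> D" and \<xi>: "\<xi> \<in> L2 M (Fil t)"
      and \<eta>: "adapted_cadlag T M Fil \<eta>" "law \<eta> \<in> PL"
    let ?J = "\<lambda>\<xi>. F t \<omega> (law (\<lambda>w. shift T t (\<xi> w) (\<eta> w)))"
    let ?E = "\<integral>w. Fm t \<omega> (law \<eta>) (\<eta> w) \<bullet> \<xi> w \<partial>M"
    have "has_law_svd T M Fil t (F t \<omega>) (law \<eta>) (Fm t \<omega> (law \<eta>))" using pt[OF t \<omega> \<eta>(2)] by blast
    then have X: "L2_expansion M (Fil t) ?J (F t \<omega> (law \<eta>)) (\<lambda>w. Fm t \<omega> (law \<eta>) (\<eta> w))"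
      unfolding has_law_svd_def using \<eta> by blast
    then have int: "integrable M (\<lambda>w. Fm t \<omega> (law \<eta>) (\<eta> w) \<bullet> \<xi> w)"
      using \<xi> by (auto simp: L2_expansion_def)
    have L2: "(\<lambda>w. \<theta> *\<^sub>R \<xi> w) \<in> L2 M (Fil t)" for \<theta>
      using \<xi> by (auto simp: L2_def power_mult_distrib)
    have nrm: "L2_norm M (\<lambda>w. \<theta> *\<^sub>R \<xi> w) = \<bar>\<theta>\<bar> * L2_norm M \<xi>" for \<theta>
      by (simp add: L2_norm_def power_mult_distrib real_sqrt_mult)
    have nn: "0 \<le> L2_norm M \<xi>" by (simp add: L2_norm_def)
    have "((\<lambda>\<theta>. ?J (\<lambda>w. \<theta> *\<^sub>R \<xi> w)) has_real_derivative ?E) (at 0)"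
      unfolding DERIV_def
    proof (rule LIM_I)
      fix e :: real assume e: "0 < e"
      \<comment> \<open>The 1 in the denominator covers a \<xi> of norm 0, and the factor 2 turns a
        non-strict bound into the strict one required.\<close>
      define e' where "e' = e / (2 * (L2_norm M \<xi> + 1))"
      have e': "0 < e'" using e nn by (simp add: e'_def)
      obtain \<delta> where \<delta>: "\<delta> > 0" "\<And>\<zeta>. \<zeta> \<in> L2 M (Fil t) \<Longrightarrow> L2_norm M \<zeta> < \<delta> \<Longrightarrow>
        \<bar>?J \<zeta> - F t \<omega> (law \<eta>) - (\<integral>w. Fm t \<omega> (law \<eta>) (\<eta> w) \<bullet> \<zeta> w \<partial>M)\<bar> \<le> e' * L2_norm M \<zeta>"
        using X e' unfolding L2_expansion_def by blast
      show "\<exists>s>0. \<forall>h. h \<noteq> 0 \<and> norm (h - 0) < s \<longrightarrow>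
         norm ((?J (\<lambda>w. (0 + h) *\<^sub>R \<xi> w) - ?J (\<lambda>w. 0 *\<^sub>R \<xi> w)) / h - ?E) < e"
      proof (intro exI conjI allI impI)
        show "0 < \<delta> / (L2_norm M \<xi> + 1)" using \<delta>(1) nn by simp
        fix h :: real assume h: "h \<noteq> 0 \<and> norm (h - 0) < \<delta> / (L2_norm M \<xi> + 1)"
        then have "\<bar>h\<bar> * (L2_norm M \<xi> + 1) < \<delta>" using nn by (simp add: field_simps)
        then have "L2_norm M (\<lambda>w. h *\<^sub>R \<xi> w) < \<delta>" unfolding nrm by (simp add: distrib_left)
        from \<delta>(2)[OF L2 this]
        have "\<bar>?J (\<lambda>w. h *\<^sub>R \<xi> w) - F t \<omega> (law \<eta>) - h * ?E\<bar> \<le> e' * (\<bar>h\<bar> * L2_norm M \<xi>)"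
          by (simp add: nrm)
        also have "e' * (\<bar>h\<bar> * L2_norm M \<xi>) \<le> \<bar>h\<bar> * (e / 2)"
        proof -
          have "e' * L2_norm M \<xi> \<le> e / 2" unfolding e'_def using e nn by (simp add: field_simps)
          then show ?thesis using mult_left_mono[of "e' * L2_norm M \<xi>" "e/2" "\<bar>h\<bar>"] by (simp add: mult_ac)
        qed
        finally have b: "\<bar>?J (\<lambda>w. h *\<^sub>R \<xi> w) - F t \<omega> (law \<eta>) - h * ?E\<bar> \<le> \<bar>h\<bar> * (e / 2)" .
        have "(?J (\<lambda>w. (0 + h) *\<^sub>R \<xi> w) - ?J (\<lambda>w. 0 *\<^sub>R \<xi> w)) / h - ?E
           = (?J (\<lambda>w. h *\<^sub>R \<xi> w) - F t \<omega> (law \<eta>) - h * ?E) / h"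
          using h by (simp add: field_simps)
        then have "norm ((?J (\<lambda>w. (0 + h) *\<^sub>R \<xi> w) - ?J (\<lambda>w. 0 *\<^sub>R \<xi> w)) / h - ?E) \<le> e / 2"
          using b h by (simp add: field_simps abs_mult)
        then show "norm ((?J (\<lambda>w. (0 + h) *\<^sub>R \<xi> w) - ?J (\<lambda>w. 0 *\<^sub>R \<xi> w)) / h - ?E) < e" using e by linarith
      qed
    qed
    then show "integrable M (\<lambda>w. Fm t \<omega> (law \<eta>) (\<eta> w) \<bullet> \<xi> w) \<and>
       ((\<lambda>\<theta>. ?J (\<lambda>w. \<theta> *\<^sub>R \<xi> w)) has_real_derivative ?E) (at 0)" using int by blast
  qed
  have cc: "seq_cont3 F" "seq_cont3 Ft" "seq_cont3 Fw" "seq_cont3 Fww" "seq_cont4 Fm" "seq_cont4 Fwm"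
    using A by (auto intro!: c3 c4)
  show ?thesis unfolding smooth_def using rt ll pt cc g g' by blast
qed

lemma growth3_bilinear:
  assumes "growth3 H1" "growth3 H2"
    and le: "\<And>t \<omega> \<mu>. norm (H t \<omega> \<mu>) \<le> c * (norm (H1 t \<omega> \<mu>) * norm (H2 t \<omega> \<mu>))" and c: "0 \<le> c"
  shows "growth3 H"
  unfolding growth3_def
proof
  fix K
  obtain C1 k1 where 1: "0 \<le> C1" "\<And>t \<omega> \<mu>. t\<in>{0..T} \<Longrightarrow> \<omega>\<in>D \<Longrightarrow> \<mu>\<in>PL \<Longrightarrow> law_norm T (stop_law T t \<mu>) \<le> K \<Longrightarrow>
     norm (H1 t \<omega> \<mu>) \<le> C1 * (1 + sup_norm T \<omega>) ^ k1" using assms(1) unfolding growth3_def by meson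
  obtain C2 k2 where 2: "0 \<le> C2" "\<And>t \<omega> \<mu>. t\<in>{0..T} \<Longrightarrow> \<omega>\<in>D \<Longrightarrow> \<mu>\<in>PL \<Longrightarrow> law_norm T (stop_law T t \<mu>) \<le> K \<Longrightarrow>
     norm (H2 t \<omega> \<mu>) \<le> C2 * (1 + sup_norm T \<omega>) ^ k2" using assms(2) unfolding growth3_def by meson
  show "\<exists>C k. 0 \<le> C \<and> (\<forall>t\<in>{0..T}. \<forall>\<omega>\<in>D. \<forall>\<mu>\<in>PL. law_norm T (stop_law T t \<mu>) \<le> K \<longrightarrow>
     norm (H t \<omega> \<mu>) \<le> C * (1 + sup_norm T \<omega>) ^ k)"
  proof (intro exI conjI ballI impI)
    show "0 \<le> c * (C1 * C2)" using c 1 2 by simp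
    fix t \<omega> \<mu> assume h: "t\<in>{0..T}" "\<omega>\<in>D" "\<mu>\<in>PL" "law_norm T (stop_law T t \<mu>) \<le> K"
    have "norm (H t \<omega> \<mu>) \<le> c * (norm (H1 t \<omega> \<mu>) * norm (H2 t \<omega> \<mu>))" by (rule le)
    also have "\<dots> \<le> c * ((C1 * (1 + sup_norm T \<omega>) ^ k1) * (C2 * (1 + sup_norm T \<omega>) ^ k2))"
      using c 1(1) sup_norm_nonneg[OF h(2) T_nonneg]
      by (intro mult_left_mono mult_mono 1(2)[OF h] 2(2)[OF h]) auto
    finally show "norm (H t \<omega> \<mu>) \<le> c * (C1 * C2) * (1 + sup_norm T \<omega>) ^ (k1 + k2)"
      by (simp add: power_add mult_ac)
  qed
qed

lemma growth4_scale:
  assumes "growth3 H1" "growth4 H2"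
    and le: "\<And>t \<omega> \<mu> v. norm (H t \<omega> \<mu> v) \<le> c * (norm (H1 t \<omega> \<mu>) * norm (H2 t \<omega> \<mu> v))" and c: "0 \<le> c"
  shows "growth4 H"
  unfolding growth4_def
proof
  fix K
  obtain C1 k1 where 1: "0 \<le> C1" "\<And>t \<omega> \<mu>. t\<in>{0..T} \<Longrightarrow> \<omega>\<in>D \<Longrightarrow> \<mu>\<in>PL \<Longrightarrow> law_norm T (stop_law T t \<mu>) \<le> K \<Longrightarrow>
     norm (H1 t \<omega> \<mu>) \<le> C1 * (1 + sup_norm T \<omega>) ^ k1" using assms(1) unfolding growth3_def by meson
  obtain C2 k2 where 2: "0 \<le> C2" "\<And>t \<omega> \<mu> v. t\<in>{0..T} \<Longrightarrow> \<omega>\<in>D \<Longrightarrow> \<mu>\<in>PL \<Longrightarrow> v \<in> D \<Longrightarrow> law_norm T (stop_law T t \<mu>) \<le> K \<Longrightarrow>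
     norm (H2 t \<omega> \<mu> v) \<le> C2 * ((1 + sup_norm T \<omega>) ^ k2 * (1 + sup_norm T v) ^ k2)" using assms(2) unfolding growth4_def by meson
  show "\<exists>C k. 0 \<le> C \<and> (\<forall>t\<in>{0..T}. \<forall>\<omega>\<in>D. \<forall>\<mu>\<in>PL. \<forall>v\<in>D. law_norm T (stop_law T t \<mu>) \<le> K \<longrightarrow>
     norm (H t \<omega> \<mu> v) \<le> C * ((1 + sup_norm T \<omega>) ^ k * (1 + sup_norm T v) ^ k))"
  proof (intro exI conjI ballI impI)
    show "0 \<le> c * (C1 * C2)" using c 1 2 by simp
    fix t \<omega> \<mu> v assume h: "t\<in>{0..T}" "\<omega>\<in>D" "\<mu>\<in>PL" and v: "v \<in> D" and K: "law_norm T (stop_law T t \<mu>) \<le> K"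
    have s: "0 \<le> sup_norm T \<omega>" "0 \<le> sup_norm T v" by (auto intro: sup_norm_nonneg h v T_nonneg)
    have "norm (H t \<omega> \<mu> v) \<le> c * (norm (H1 t \<omega> \<mu>) * norm (H2 t \<omega> \<mu> v))" by (rule le)
    also have "\<dots> \<le> c * ((C1 * (1 + sup_norm T \<omega>) ^ k1) * (C2 * ((1 + sup_norm T \<omega>) ^ k2 * (1 + sup_norm T v) ^ k2)))"
      using c 1(1) s by (intro mult_left_mono mult_mono 1(2)[OF h K] 2(2)[OF h v K]) auto
    \<comment> \<open>One exponent has to serve both path arguments, hence k1 + k2 for the second as
      well.\<close>
    also have "\<dots> \<le> c * ((C1 * (1 + sup_norm T \<omega>) ^ k1) * (C2 * ((1 + sup_norm T \<omega>) ^ k2 * (1 + sup_norm T v) ^ (k1 + k2))))"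
      using c 1(1) 2(1) s by (intro mult_left_mono power_increasing mult_nonneg_nonneg) auto
    finally show "norm (H t \<omega> \<mu> v) \<le> c * (C1 * C2) * ((1 + sup_norm T \<omega>) ^ (k1 + k2) * (1 + sup_norm T v) ^ (k1 + k2))"
      by (simp add: power_add mult_ac)
  qed
qed

lemma growth3_le_add:
  assumes "growth3 H1" "growth3 H2"
    and le: "\<And>t \<omega> \<mu>. norm (H t \<omega> \<mu>) \<le> norm (H1 t \<omega> \<mu>) + norm (H2 t \<omega> \<mu>)"
  shows "growth3 H"
  unfolding growth3_def
proof
  fix K
  obtain C1 k1 where 1: "0 \<le> C1" "\<And>t \<omega> \<mu>. t\<in>{0..T} \<Longrightarrow> \<omega>\<in>D \<Longrightarrow> \<mu>\<in>PL \<Longrightarrow> law_norm T (stop_law T t \<mu>) \<le> K \<Longrightarrow>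
     norm (H1 t \<omega> \<mu>) \<le> C1 * (1 + sup_norm T \<omega>) ^ k1" using assms(1) unfolding growth3_def by meson
  obtain C2 k2 where 2: "0 \<le> C2" "\<And>t \<omega> \<mu>. t\<in>{0..T} \<Longrightarrow> \<omega>\<in>D \<Longrightarrow> \<mu>\<in>PL \<Longrightarrow> law_norm T (stop_law T t \<mu>) \<le> K \<Longrightarrow>
     norm (H2 t \<omega> \<mu>) \<le> C2 * (1 + sup_norm T \<omega>) ^ k2" using assms(2) unfolding growth3_def by meson
  show "\<exists>C k. 0 \<le> C \<and> (\<forall>t\<in>{0..T}. \<forall>\<omega>\<in>D. \<forall>\<mu>\<in>PL. law_norm T (stop_law T t \<mu>) \<le> K \<longrightarrow>
     norm (H t \<omega> \<mu>) \<le> C * (1 + sup_norm T \<omega>) ^ k)"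
  proof (intro exI conjI ballI impI)
    show "0 \<le> C1 + C2" using 1 2 by simp
    fix t \<omega> \<mu> assume h: "t\<in>{0..T}" "\<omega>\<in>D" "\<mu>\<in>PL" "law_norm T (stop_law T t \<mu>) \<le> K"
    have s: "0 \<le> sup_norm T \<omega>" by (intro sup_norm_nonneg h T_nonneg)
    have "norm (H t \<omega> \<mu>) \<le> C1 * (1 + sup_norm T \<omega>) ^ k1 + C2 * (1 + sup_norm T \<omega>) ^ k2"
      using le[of t \<omega> \<mu>] 1(2)[OF h] 2(2)[OF h] by linarith
    also have "\<dots> \<le> C1 * (1 + sup_norm T \<omega>) ^ (k1 + k2) + C2 * (1 + sup_norm T \<omega>) ^ (k1 + k2)"
      using s 1(1) 2(1) by (intro add_mono mult_left_mono power_increasing) auto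
    finally show "norm (H t \<omega> \<mu>) \<le> (C1 + C2) * (1 + sup_norm T \<omega>) ^ (k1 + k2)"
      by (simp add: distrib_right)
  qed
qed

lemma growth4_le_add:
  assumes "growth4 H1" "growth4 H2"
    and le: "\<And>t \<omega> \<mu> v. norm (H t \<omega> \<mu> v) \<le> norm (H1 t \<omega> \<mu> v) + norm (H2 t \<omega> \<mu> v)"
  shows "growth4 H"
  unfolding growth4_def
proof
  fix K
  obtain C1 k1 where 1: "0 \<le> C1" "\<And>t \<omega> \<mu> v. t\<in>{0..T} \<Longrightarrow> \<omega>\<in>D \<Longrightarrow> \<mu>\<in>PL \<Longrightarrow> v \<in> D \<Longrightarrow> law_norm T (stop_law T t \<mu>) \<le> K \<Longrightarrow>
     norm (H1 t \<omega> \<mu> v) \<le> C1 * ((1 + sup_norm T \<omega>) ^ k1 * (1 + sup_norm T v) ^ k1)" using assms(1) unfolding growth4_def by meson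
  obtain C2 k2 where 2: "0 \<le> C2" "\<And>t \<omega> \<mu> v. t\<in>{0..T} \<Longrightarrow> \<omega>\<in>D \<Longrightarrow> \<mu>\<in>PL \<Longrightarrow> v \<in> D \<Longrightarrow> law_norm T (stop_law T t \<mu>) \<le> K \<Longrightarrow>
     norm (H2 t \<omega> \<mu> v) \<le> C2 * ((1 + sup_norm T \<omega>) ^ k2 * (1 + sup_norm T v) ^ k2)" using assms(2) unfolding growth4_def by meson
  show "\<exists>C k. 0 \<le> C \<and> (\<forall>t\<in>{0..T}. \<forall>\<omega>\<in>D. \<forall>\<mu>\<in>PL. \<forall>v\<in>D. law_norm T (stop_law T t \<mu>) \<le> K \<longrightarrow>
     norm (H t \<omega> \<mu> v) \<le> C * ((1 + sup_norm T \<omega>) ^ k * (1 + sup_norm T v) ^ k))"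
  proof (intro exI conjI ballI impI)
    show "0 \<le> C1 + C2" using 1 2 by simp
    fix t \<omega> \<mu> v assume h: "t\<in>{0..T}" "\<omega>\<in>D" "\<mu>\<in>PL" "v \<in> D" "law_norm T (stop_law T t \<mu>) \<le> K"
    have s: "0 \<le> sup_norm T \<omega>" "0 \<le> sup_norm T v" by (auto intro: sup_norm_nonneg h T_nonneg)
    have "norm (H t \<omega> \<mu> v) \<le> C1 * ((1 + sup_norm T \<omega>) ^ k1 * (1 + sup_norm T v) ^ k1) + C2 * ((1 + sup_norm T \<omega>) ^ k2 * (1 + sup_norm T v) ^ k2)"
      using le[of t \<omega> \<mu> v] 1(2)[OF h] 2(2)[OF h] by linarith
    also have "\<dots> \<le> C1 * ((1 + sup_norm T \<omega>) ^ (k1+k2) * (1 + sup_norm T v) ^ (k1+k2)) + C2 * ((1 + sup_norm T \<omega>) ^ (k1+k2) * (1 + sup_norm T v) ^ (k1+k2))"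
      using s 1(1) 2(1) by (intro add_mono mult_left_mono mult_mono power_increasing) auto
    finally show "norm (H t \<omega> \<mu> v) \<le> (C1 + C2) * ((1 + sup_norm T \<omega>) ^ (k1 + k2) * (1 + sup_norm T v) ^ (k1 + k2))"
      by (simp add: distrib_right)
  qed
qed

lemma smooth_diff:
  assumes 1: "smooth F Ft Fw Fww Fm Fwm" and 2: "smooth F' Ft' Fw' Fww' Fm' Fwm'"
  shows "smooth (\<lambda>t \<omega> \<mu>. F t \<omega> \<mu> - F' t \<omega> \<mu>) (\<lambda>t \<omega> \<mu>. Ft t \<omega> \<mu> - Ft' t \<omega> \<mu>)
     (\<lambda>t \<omega> \<mu>. Fw t \<omega> \<mu> - Fw' t \<omega> \<mu>) (\<lambda>t \<omega> \<mu>. Fww t \<omega> \<mu> - Fww' t \<omega> \<mu>)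
     (\<lambda>t \<omega> \<mu> v. Fm t \<omega> \<mu> v - Fm' t \<omega> \<mu> v) (\<lambda>t \<omega> \<mu> v. Fwm t \<omega> \<mu> v - Fwm' t \<omega> \<mu> v)"
  unfolding smooth_def
proof (intro conjI)
  note A = 1[unfolded smooth_def] and A' = 2[unfolded smooth_def]
  show "right_time_deriv (\<lambda>t \<omega> \<mu>. F t \<omega> \<mu> - F' t \<omega> \<mu>) (\<lambda>t \<omega> \<mu>. Ft t \<omega> \<mu> - Ft' t \<omega> \<mu>)"
    unfolding right_time_deriv_def
  proof (intro ballI impI)
    fix t \<omega> \<mu> assume h: "t \<in> {0..<T}" "\<omega> \<in> D" "\<mu> \<in> PL" "stop T t \<omega> = \<omega>" "stop_law T t \<mu> = \<mu>"
    have "((\<lambda>h. (F (t + h) \<omega> \<mu> - F t \<omega> \<mu>) / h) \<longlongrightarrow> Ft t \<omega> \<mu>) (at_right 0)"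
      "((\<lambda>h. (F' (t + h) \<omega> \<mu> - F' t \<omega> \<mu>) / h) \<longlongrightarrow> Ft' t \<omega> \<mu>) (at_right 0)"
      using A A' h unfolding right_time_deriv_def by blast+
    from tendsto_diff[OF this]
    show "((\<lambda>h. (F (t + h) \<omega> \<mu> - F' (t + h) \<omega> \<mu> - (F t \<omega> \<mu> - F' t \<omega> \<mu>)) / h) \<longlongrightarrow> Ft t \<omega> \<mu> - Ft' t \<omega> \<mu>) (at_right 0)"
      by (simp add: diff_divide_distrib add_divide_distrib algebra_simps)
  qed
  show "law_line_deriv (\<lambda>t \<omega> \<mu>. F t \<omega> \<mu> - F' t \<omega> \<mu>) (\<lambda>t \<omega> \<mu> v. Fm t \<omega> \<mu> v - Fm' t \<omega> \<mu> v)"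
    unfolding law_line_deriv_def
  proof (intro ballI allI impI)
    fix t \<omega> \<eta> and \<xi> :: "'w \<Rightarrow> real ^ 'd" assume h: "t \<in> {0..T}" "\<omega> \<in> D" "\<xi> \<in> L2 M (Fil t)" "adapted_cadlag T M Fil \<eta>" "law \<eta> \<in> PL"
    have a: "integrable M (\<lambda>w. Fm t \<omega> (law \<eta>) (\<eta> w) \<bullet> \<xi> w)"
      "((\<lambda>\<theta>. F t \<omega> (law (\<lambda>w. shift T t (\<theta> *\<^sub>R \<xi> w) (\<eta> w)))) has_real_derivative
        (\<integral>w. Fm t \<omega> (law \<eta>) (\<eta> w) \<bullet> \<xi> w \<partial>M)) (at 0)"
      using A h unfolding law_line_deriv_def by blast+
    have a': "integrable M (\<lambda>w. Fm' t \<omega> (law \<eta>) (\<eta> w) \<bullet> \<xi> w)"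
      "((\<lambda>\<theta>. F' t \<omega> (law (\<lambda>w. shift T t (\<theta> *\<^sub>R \<xi> w) (\<eta> w)))) has_real_derivative
        (\<integral>w. Fm' t \<omega> (law \<eta>) (\<eta> w) \<bullet> \<xi> w \<partial>M)) (at 0)"
      using A' h unfolding law_line_deriv_def by blast+
    show "integrable M (\<lambda>w. (Fm t \<omega> (law \<eta>) (\<eta> w) - Fm' t \<omega> (law \<eta>) (\<eta> w)) \<bullet> \<xi> w) \<and>
      ((\<lambda>\<theta>. F t \<omega> (law (\<lambda>w. shift T t (\<theta> *\<^sub>R \<xi> w) (\<eta> w))) - F' t \<omega> (law (\<lambda>w. shift T t (\<theta> *\<^sub>R \<xi> w) (\<eta> w)))) has_real_derivative
        (\<integral>w. (Fm t \<omega> (law \<eta>) (\<eta> w) - Fm' t \<omega> (law \<eta>) (\<eta> w)) \<bullet> \<xi> w \<partial>M)) (at 0)"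
      using Bochner_Integration.integrable_diff[OF a(1) a'(1)] DERIV_diff[OF a(2) a'(2)]
        Bochner_Integration.integral_diff[OF a(1) a'(1)] by (simp add: inner_diff_left)
  qed
  show "\<forall>t\<in>{0..T}. \<forall>\<omega>\<in>D. \<forall>\<mu>\<in>PL.
        has_path_svd T t (\<lambda>\<omega>. F t \<omega> \<mu> - F' t \<omega> \<mu>) \<omega> (\<lambda>x. (Fw t \<omega> \<mu> - Fw' t \<omega> \<mu>) \<bullet> x) \<and>
        has_path_svd T t (\<lambda>\<omega>. Fw t \<omega> \<mu> - Fw' t \<omega> \<mu>) \<omega> (\<lambda>x. (Fww t \<omega> \<mu> - Fww' t \<omega> \<mu>) *v x) \<and>
        (\<forall>v\<in>D. has_path_svd T t (\<lambda>v. Fm t \<omega> \<mu> v - Fm' t \<omega> \<mu> v) v (\<lambda>x. (Fwm t \<omega> \<mu> v - Fwm' t \<omega> \<mu> v) *v x))"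
  proof (intro ballI)
    fix t \<omega> \<mu> assume h: "t\<in>{0..T}" "\<omega>\<in>D" "\<mu>\<in>PL"
    have p: "has_path_svd T t (\<lambda>\<omega>. F t \<omega> \<mu>) \<omega> (\<lambda>x. Fw t \<omega> \<mu> \<bullet> x)"
      "has_path_svd T t (\<lambda>\<omega>. Fw t \<omega> \<mu>) \<omega> (\<lambda>x. Fww t \<omega> \<mu> *v x)"
      "\<And>v. v\<in>D \<Longrightarrow> has_path_svd T t (Fm t \<omega> \<mu>) v (\<lambda>x. Fwm t \<omega> \<mu> v *v x)"
      using A h by blast+
    have p': "has_path_svd T t (\<lambda>\<omega>. F' t \<omega> \<mu>) \<omega> (\<lambda>x. Fw' t \<omega> \<mu> \<bullet> x)"
      "has_path_svd T t (\<lambda>\<omega>. Fw' t \<omega> \<mu>) \<omega> (\<lambda>x. Fww' t \<omega> \<mu> *v x)"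
      "\<And>v. v\<in>D \<Longrightarrow> has_path_svd T t (Fm' t \<omega> \<mu>) v (\<lambda>x. Fwm' t \<omega> \<mu> v *v x)"
      using A' h by blast+
    show "has_path_svd T t (\<lambda>\<omega>. F t \<omega> \<mu> - F' t \<omega> \<mu>) \<omega> (\<lambda>x. (Fw t \<omega> \<mu> - Fw' t \<omega> \<mu>) \<bullet> x) \<and>
        has_path_svd T t (\<lambda>\<omega>. Fw t \<omega> \<mu> - Fw' t \<omega> \<mu>) \<omega> (\<lambda>x. (Fww t \<omega> \<mu> - Fww' t \<omega> \<mu>) *v x) \<and>
        (\<forall>v\<in>D. has_path_svd T t (\<lambda>v. Fm t \<omega> \<mu> v - Fm' t \<omega> \<mu> v) v (\<lambda>x. (Fwm t \<omega> \<mu> v - Fwm' t \<omega> \<mu> v) *v x))"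
      using p p' unfolding has_path_svd_def inner_diff_left matrix_vector_mult_diff_rdistrib
      by (intro conjI ballI has_derivative_diff) blast+
  qed
  show "growth3 (\<lambda>t \<omega> \<mu>. F t \<omega> \<mu> - F' t \<omega> \<mu>)" "growth3 (\<lambda>t \<omega> \<mu>. Ft t \<omega> \<mu> - Ft' t \<omega> \<mu>)"
    "growth3 (\<lambda>t \<omega> \<mu>. Fw t \<omega> \<mu> - Fw' t \<omega> \<mu>)" "growth3 (\<lambda>t \<omega> \<mu>. Fww t \<omega> \<mu> - Fww' t \<omega> \<mu>)"
    using growth3_le_add[OF _ _ norm_triangle_ineq4] A A' by blast+
  show "growth4 (\<lambda>t \<omega> \<mu> v. Fm t \<omega> \<mu> v - Fm' t \<omega> \<mu> v)" "growth4 (\<lambda>t \<omega> \<mu> v. Fwm t \<omega> \<mu> v - Fwm' t \<omega> \<mu> v)"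
    using growth4_le_add[OF _ _ norm_triangle_ineq4] A A' by blast+
qed (use 1[unfolded smooth_def] 2[unfolded smooth_def] in \<open>auto simp: seq_cont3_def seq_cont4_def intro!: tendsto_diff\<close>)

text \<open>The product rule. The path direction produces a rank-one term in the gradient; the
  measure direction produces none, because only the last argument of the measure derivative is
  differentiated and the factor 2 F does not depend on it.\<close>

lemma smooth_square:
  assumes 1: "smooth F Ft Fw Fww Fm Fwm"
  shows "smooth (\<lambda>t \<omega> \<mu>. (F t \<omega> \<mu>)\<^sup>2) (\<lambda>t \<omega> \<mu>. 2 * F t \<omega> \<mu> * Ft t \<omega> \<mu>)
     (\<lambda>t \<omega> \<mu>. (2 * F t \<omega> \<mu>) *\<^sub>R Fw t \<omega> \<mu>)
     (\<lambda>t \<omega> \<mu>. (2::real) *\<^sub>R outer (Fw t \<omega> \<mu>) (Fw t \<omega> \<mu>) + (2 * F t \<omega> \<mu>) *\<^sub>R Fww t \<omega> \<mu>)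
     (\<lambda>t \<omega> \<mu> v. (2 * F t \<omega> \<mu>) *\<^sub>R Fm t \<omega> \<mu> v) (\<lambda>t \<omega> \<mu> v. (2 * F t \<omega> \<mu>) *\<^sub>R Fwm t \<omega> \<mu> v)"
proof -
  note A = 1[unfolded smooth_def]
  have c: "seq_cont3 F" "seq_cont3 Ft" "seq_cont3 Fw" "seq_cont3 Fww" "seq_cont4 Fm" "seq_cont4 Fwm"
    and g: "growth3 F" "growth3 Ft" "growth3 Fw" "growth3 Fww" "growth4 Fm" "growth4 Fwm"
    using A by blast+
  have p: "has_path_svd T t (\<lambda>\<omega>. F t \<omega> \<mu>) \<omega> (\<lambda>x. Fw t \<omega> \<mu> \<bullet> x)"
      "has_path_svd T t (\<lambda>\<omega>. Fw t \<omega> \<mu>) \<omega> (\<lambda>x. Fww t \<omega> \<mu> *v x)"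
      "\<And>v. v\<in>D \<Longrightarrow> has_path_svd T t (Fm t \<omega> \<mu>) v (\<lambda>x. Fwm t \<omega> \<mu> v *v x)"
    if "t\<in>{0..T}" "\<omega>\<in>D" "\<mu>\<in>PL" for t \<omega> \<mu> using A that by blast+
  show ?thesis unfolding smooth_def
  proof (intro conjI ballI)
    show "right_time_deriv (\<lambda>t \<omega> \<mu>. (F t \<omega> \<mu>)\<^sup>2) (\<lambda>t \<omega> \<mu>. 2 * F t \<omega> \<mu> * Ft t \<omega> \<mu>)"
      unfolding right_time_deriv_def
    proof (intro ballI impI)
      fix t \<omega> \<mu> assume h: "t \<in> {0..<T}" "\<omega> \<in> D" "\<mu> \<in> PL" "stop T t \<omega> = \<omega>" "stop_law T t \<mu> = \<mu>"
      let ?q = "\<lambda>h. (F (t + h) \<omega> \<mu> - F t \<omega> \<mu>) / h"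
      have q: "(?q \<longlongrightarrow> Ft t \<omega> \<mu>) (at_right 0)"
        using A h unfolding right_time_deriv_def by blast
      have h0: "((\<lambda>h::real. h) \<longlongrightarrow> 0) (at_right 0)" by (rule tendsto_ident_at)
      \<comment> \<open>With q the difference quotient of F, that of the square is q (2 F + h q),
        and h q vanishes in the limit.\<close>
      have "((\<lambda>h. ?q h * (2 * F t \<omega> \<mu> + h * ?q h)) \<longlongrightarrow> Ft t \<omega> \<mu> * (2 * F t \<omega> \<mu> + 0 * Ft t \<omega> \<mu>)) (at_right 0)"
        by (intro tendsto_intros q h0)
      moreover have "\<forall>\<^sub>F h in at_right 0. ?q h * (2 * F t \<omega> \<mu> + h * ?q h) = ((F (t + h) \<omega> \<mu>)\<^sup>2 - (F t \<omega> \<mu>)\<^sup>2) / h"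
        unfolding eventually_at_right_field by (intro exI[of _ 1]) (auto simp: field_simps power2_eq_square)
      ultimately show "((\<lambda>h. ((F (t + h) \<omega> \<mu>)\<^sup>2 - (F t \<omega> \<mu>)\<^sup>2) / h) \<longlongrightarrow> 2 * F t \<omega> \<mu> * Ft t \<omega> \<mu>) (at_right 0)"
        by (auto simp: mult_ac elim: Lim_transform_eventually)
    qed
    show "law_line_deriv (\<lambda>t \<omega> \<mu>. (F t \<omega> \<mu>)\<^sup>2) (\<lambda>t \<omega> \<mu> v. (2 * F t \<omega> \<mu>) *\<^sub>R Fm t \<omega> \<mu> v)"
      unfolding law_line_deriv_def
    proof (intro ballI allI impI)
      fix t \<omega> \<eta> and \<xi> :: "'w \<Rightarrow> real ^ 'd" assume h: "t \<in> {0..T}" "\<omega> \<in> D" "\<xi> \<in> L2 M (Fil t)" "adapted_cadlag T M Fil \<eta>" "law \<eta> \<in> PL"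
      have a: "integrable M (\<lambda>w. Fm t \<omega> (law \<eta>) (\<eta> w) \<bullet> \<xi> w)"
        "((\<lambda>\<theta>. F t \<omega> (law (\<lambda>w. shift T t (\<theta> *\<^sub>R \<xi> w) (\<eta> w)))) has_real_derivative
          (\<integral>w. Fm t \<omega> (law \<eta>) (\<eta> w) \<bullet> \<xi> w \<partial>M)) (at 0)"
        using A h unfolding law_line_deriv_def by blast+
      show "integrable M (\<lambda>w. ((2 * F t \<omega> (law \<eta>)) *\<^sub>R Fm t \<omega> (law \<eta>) (\<eta> w)) \<bullet> \<xi> w) \<and>
        ((\<lambda>\<theta>. (F t \<omega> (law (\<lambda>w. shift T t (\<theta> *\<^sub>R \<xi> w) (\<eta> w))))\<^sup>2) has_real_derivative
          (\<integral>w. ((2 * F t \<omega> (law \<eta>)) *\<^sub>R Fm t \<omega> (law \<eta>) (\<eta> w)) \<bullet> \<xi> w \<partial>M)) (at 0)"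
        using a(1) DERIV_power[OF a(2), of 2] by (simp add: mult_ac)
    qed
    fix t \<omega> \<mu> assume h: "t\<in>{0..T}" "\<omega>\<in>D" "\<mu>\<in>PL"
    show "has_path_svd T t (\<lambda>\<omega>. (F t \<omega> \<mu>)\<^sup>2) \<omega> (\<lambda>x. ((2 * F t \<omega> \<mu>) *\<^sub>R Fw t \<omega> \<mu>) \<bullet> x)"
      unfolding has_path_svd_def
      by (rule has_derivative_eq_rhs[OF has_derivative_power[OF p(1)[OF h, unfolded has_path_svd_def], of 2]])
         (simp add: fun_eq_iff)
    have "((\<lambda>x. (2 * F t (shift T t x \<omega>) \<mu>) *\<^sub>R Fw t (shift T t x \<omega>) \<mu>) has_derivative
       (\<lambda>x. (2 * F t (shift T t 0 \<omega>) \<mu>) *\<^sub>R (Fww t \<omega> \<mu> *v x) + (2 * (Fw t \<omega> \<mu> \<bullet> x)) *\<^sub>R Fw t (shift T t 0 \<omega>) \<mu>)) (at 0)"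
      by (rule has_derivative_scaleR[OF has_derivative_mult_right[OF p(1)[OF h, unfolded has_path_svd_def]]
            p(2)[OF h, unfolded has_path_svd_def]])
    then show "has_path_svd T t (\<lambda>\<omega>. (2 * F t \<omega> \<mu>) *\<^sub>R Fw t \<omega> \<mu>) \<omega>
       (\<lambda>x. ((2::real) *\<^sub>R outer (Fw t \<omega> \<mu>) (Fw t \<omega> \<mu>) + (2 * F t \<omega> \<mu>) *\<^sub>R Fww t \<omega> \<mu>) *v x)"
      unfolding has_path_svd_def
      by (rule has_derivative_eq_rhs)
         (simp add: fun_eq_iff matrix_vector_mult_add_rdistrib scaleR_matrix_vector_assoc[symmetric] outer_vector add.commute)
    fix v assume v: "v \<in> D"
    show "has_path_svd T t (\<lambda>v. (2 * F t \<omega> \<mu>) *\<^sub>R Fm t \<omega> \<mu> v) v (\<lambda>x. ((2 * F t \<omega> \<mu>) *\<^sub>R Fwm t \<omega> \<mu> v) *v x)"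
      unfolding has_path_svd_def
      by (rule has_derivative_eq_rhs[OF has_derivative_scaleR_right[OF p(3)[OF h v, unfolded has_path_svd_def]]])
         (simp add: fun_eq_iff scaleR_matrix_vector_assoc[symmetric])
  next
    show "seq_cont3 (\<lambda>t \<omega> \<mu>. (F t \<omega> \<mu>)\<^sup>2)" "seq_cont3 (\<lambda>t \<omega> \<mu>. 2 * F t \<omega> \<mu> * Ft t \<omega> \<mu>)"
      "seq_cont3 (\<lambda>t \<omega> \<mu>. (2 * F t \<omega> \<mu>) *\<^sub>R Fw t \<omega> \<mu>)"
      "seq_cont3 (\<lambda>t \<omega> \<mu>. (2::real) *\<^sub>R outer (Fw t \<omega> \<mu>) (Fw t \<omega> \<mu>) + (2 * F t \<omega> \<mu>) *\<^sub>R Fww t \<omega> \<mu>)"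
      using c unfolding seq_cont3_def by (auto intro!: tendsto_intros tendsto_outer)
    show "seq_cont4 (\<lambda>t \<omega> \<mu> v. (2 * F t \<omega> \<mu>) *\<^sub>R Fm t \<omega> \<mu> v)" "seq_cont4 (\<lambda>t \<omega> \<mu> v. (2 * F t \<omega> \<mu>) *\<^sub>R Fwm t \<omega> \<mu> v)"
      using c unfolding seq_cont3_def seq_cont4_def by (auto intro!: tendsto_intros)
    show "growth3 (\<lambda>t \<omega> \<mu>. (F t \<omega> \<mu>)\<^sup>2)"
      by (rule growth3_bilinear[OF g(1) g(1), of _ 1]) (auto simp: power2_eq_square abs_mult)
    show "growth3 (\<lambda>t \<omega> \<mu>. 2 * F t \<omega> \<mu> * Ft t \<omega> \<mu>)"
      by (rule growth3_bilinear[OF g(1) g(2), of _ 2]) (auto simp: abs_mult)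
    show "growth3 (\<lambda>t \<omega> \<mu>. (2 * F t \<omega> \<mu>) *\<^sub>R Fw t \<omega> \<mu>)"
      by (rule growth3_bilinear[OF g(1) g(3), of _ 2]) (auto simp: abs_mult)
    have "growth3 (\<lambda>t \<omega> \<mu>. (2::real) *\<^sub>R outer (Fw t \<omega> \<mu>) (Fw t \<omega> \<mu>))"
      by (rule growth3_bilinear[OF g(3) g(3), of _ 2]) (auto simp: norm_outer)
    moreover have "growth3 (\<lambda>t \<omega> \<mu>. (2 * F t \<omega> \<mu>) *\<^sub>R Fww t \<omega> \<mu>)"
      by (rule growth3_bilinear[OF g(1) g(4), of _ 2]) (auto simp: abs_mult)
    ultimately show "growth3 (\<lambda>t \<omega> \<mu>. (2::real) *\<^sub>R outer (Fw t \<omega> \<mu>) (Fw t \<omega> \<mu>) + (2 * F t \<omega> \<mu>) *\<^sub>R Fww t \<omega> \<mu>)"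
      by (rule growth3_le_add) (rule norm_triangle_ineq)
    show "growth4 (\<lambda>t \<omega> \<mu> v. (2 * F t \<omega> \<mu>) *\<^sub>R Fm t \<omega> \<mu> v)"
      by (rule growth4_scale[OF g(1) g(5), of _ 2]) (auto simp: abs_mult)
    show "growth4 (\<lambda>t \<omega> \<mu> v. (2 * F t \<omega> \<mu>) *\<^sub>R Fwm t \<omega> \<mu> v)"
      by (rule growth4_scale[OF g(1) g(6), of _ 2]) (auto simp: abs_mult)
  qed
qed

end

section \<open>Moments of Brownian increments and their independence of the past\<close>

section \<open>Brownian increments\<close>

lemma sum_power_le:
  fixes y :: "'i::finite \<Rightarrow> real"
  assumes "\<And>i. 0 \<le> y i"
  shows "(\<Sum>i\<in>UNIV. y i) ^ q \<le> real CARD('i) ^ q * (\<Sum>i\<in>UNIV. y i ^ q)"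
proof -
  have "Max (range y) \<in> range y" by (intro Max_in) auto
  then obtain m where m: "y m = Max (range y)" by (metis imageE)
  have "(\<Sum>i\<in>UNIV. y i) \<le> real CARD('i) * y m"
    using sum_bounded_above[of UNIV y "y m"] m by simp
  then have "(\<Sum>i\<in>UNIV. y i) ^ q \<le> (real CARD('i) * y m) ^ q"
    by (intro power_mono sum_nonneg assms)
  also have "\<dots> = real CARD('i) ^ q * y m ^ q" by (simp add: power_mult_distrib)
  also have "y m ^ q \<le> (\<Sum>i\<in>UNIV. y i ^ q)"
    by (rule member_le_sum) (use assms in auto)
  finally show ?thesis by (simp add: mult_left_mono)
qed

lemma norm_power_le:
  fixes x :: "real ^ 'd::finite"
  shows "norm x ^ (2 * q) \<le> real CARD('d) ^ q * (\<Sum>i\<in>UNIV. (x $ i) ^ (2 * q))"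
proof -
  have "norm x ^ (2 * q) = (\<Sum>i\<in>UNIV. (x $ i)\<^sup>2) ^ q"
    unfolding power_mult by (simp add: norm_vec_def L2_set_def sum_nonneg)
  also have "\<dots> \<le> real CARD('d) ^ q * (\<Sum>i\<in>UNIV. ((x $ i)\<^sup>2) ^ q)"
    by (rule sum_power_le) simp
  finally show ?thesis by (simp add: power_mult)
qed

lemma vec_nth_measurable:
  "f \<in> borel_measurable N \<Longrightarrow> (\<lambda>x. (f x :: real ^ 'd::finite) $ i) \<in> borel_measurable N"
  by (rule measurable_compose[OF _ borel_measurable_continuous_onI]) (auto intro: continuous_intros)

context basis
begin

lemma dB_measurable:
  assumes "0 \<le> a" "a < b" "b \<le> T"
  shows "(\<lambda>w. B b w - B a w) \<in> borel_measurable M"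
  using borel_Fil[OF B_adapted, of a] borel_Fil[OF B_adapted, of b] assms by auto

lemma dB_even:
  assumes "0 \<le> a" "a < b" "b \<le> T"
  shows "integrable M (\<lambda>w. ((B b w - B a w) $ i) ^ (2 * q))"
    and "(\<integral>w. ((B b w - B a w) $ i) ^ (2 * q) \<partial>M) = fact (2 * q) / (2 ^ q * fact q) * (b - a) ^ q"
proof -
  let ?s = "sqrt (b - a)"
  have s: "0 < ?s" using assms by simp
  have D: "distributed M lborel (\<lambda>w. (B b w - B a w) $ i) (normal_density 0 ?s)"
    by (rule B_normal[OF assms])
  have h: "has_bochner_integral lborel (\<lambda>x. normal_density 0 ?s x * (x - 0) ^ (2 * q))
    (fact (2 * q) / ((2 / ?s\<^sup>2) ^ q * fact q))"
    by (rule normal_moment_even[OF s])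
  then have "integrable lborel (\<lambda>x. normal_density 0 ?s x * x ^ (2 * q))"
    by (simp add: has_bochner_integral_iff)
  then show "integrable M (\<lambda>w. ((B b w - B a w) $ i) ^ (2 * q))"
    using distributed_integrable[OF D, of "\<lambda>x. x ^ (2*q)"] by simp
  have "(\<integral>w. ((B b w - B a w) $ i) ^ (2 * q) \<partial>M) = (\<integral>x. normal_density 0 ?s x * x ^ (2 * q) \<partial>lborel)"
    using distributed_integral[OF D, of "\<lambda>x. x ^ (2*q)"] by simp
  also have "\<dots> = fact (2 * q) / ((2 / ?s\<^sup>2) ^ q * fact q)"
    using h by (simp add: has_bochner_integral_iff)
  also have "\<dots> = fact (2 * q) / (2 ^ q * fact q) * (b - a) ^ q"
    using assms by (simp add: power_divide)
  finally show "(\<integral>w. ((B b w - B a w) $ i) ^ (2 * q) \<partial>M) = fact (2 * q) / (2 ^ q * fact q) * (b - a) ^ q" .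
qed

lemma dB_mean:
  assumes "0 \<le> a" "a < b" "b \<le> T"
  shows "integrable M (\<lambda>w. (B b w - B a w) $ i)" "(\<integral>w. (B b w - B a w) $ i \<partial>M) = 0"
proof -
  let ?s = "sqrt (b - a)"
  have s: "0 < ?s" using assms by simp
  have D: "distributed M lborel (\<lambda>w. (B b w - B a w) $ i) (normal_density 0 ?s)"
    by (rule B_normal[OF assms])
  have h: "has_bochner_integral lborel (\<lambda>x. normal_density 0 ?s x * (x - 0) ^ (2 * 0 + 1)) 0"
    by (rule normal_moment_odd[OF s])
  then show "integrable M (\<lambda>w. (B b w - B a w) $ i)"
    using distributed_integrable[OF D, of "\<lambda>x. x"] by (simp add: has_bochner_integral_iff)
  show "(\<integral>w. (B b w - B a w) $ i \<partial>M) = 0"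
    using distributed_integral[OF D, of "\<lambda>x. x"] h by (simp add: has_bochner_integral_iff)
qed

lemma dB_norm_moment:
  "\<exists>C\<ge>0. \<forall>a b. 0 \<le> a \<longrightarrow> a < b \<longrightarrow> b \<le> T \<longrightarrow>
     integrable M (\<lambda>w. norm (B b w - B a w) ^ (2 * q)) \<and>
     (\<integral>w. norm (B b w - B a w) ^ (2 * q) \<partial>M) \<le> C * (b - a) ^ q"
proof (intro exI conjI allI impI)
  let ?c = "fact (2 * q) / (2 ^ q * fact q) :: real"
  let ?C = "real CARD('d) ^ q * (real CARD('d) * ?c)"
  show "0 \<le> ?C" by simp
  fix a b assume ab: "0 \<le> a" "a < b" "b \<le> T"
  let ?g = "\<lambda>w. real CARD('d) ^ q * (\<Sum>i\<in>UNIV. ((B b w - B a w) $ i) ^ (2 * q))"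
  have g: "integrable M ?g"
    by (rule integrable_mult_right, rule Bochner_Integration.integrable_sum, rule dB_even[OF ab])
  show "integrable M (\<lambda>w. norm (B b w - B a w) ^ (2 * q))"
  proof (rule Bochner_Integration.integrable_bound[OF g])
    show "(\<lambda>w. norm (B b w - B a w) ^ (2 * q)) \<in> borel_measurable M"
      by (rule borel_measurable_power[OF measurable_compose[OF dB_measurable[OF ab] borel_measurable_norm]])
    show "AE w in M. norm (norm (B b w - B a w) ^ (2 * q)) \<le> norm (?g w)"
    proof (rule AE_I2)
      fix w
      show "norm (norm (B b w - B a w) ^ (2 * q)) \<le> norm (?g w)"
        unfolding real_norm_def by (rule order_trans[OF _ abs_ge_self[of "?g w"]])
          (use norm_power_le[of "B b w - B a w" q] in \<open>simp only: power_abs abs_norm_cancel\<close>)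
    qed
  qed
  then have "(\<integral>w. norm (B b w - B a w) ^ (2 * q) \<partial>M) \<le> (\<integral>w. ?g w \<partial>M)"
    by (intro integral_mono g norm_power_le)
  also have "\<dots> = ?C * (b - a) ^ q"
    using dB_even[OF ab] by (simp add: Bochner_Integration.integral_sum)
  finally show "(\<integral>w. norm (B b w - B a w) ^ (2 * q) \<partial>M) \<le> ?C * (b - a) ^ q" .
qed

text \<open>Both variables generate sigma-algebras inside two families that are independent by
  assumption: the past \<open>Fil a\<close> and the events determined by the increment.\<close>

lemma dB_indep:
  fixes \<xi> :: "'w \<Rightarrow> real" and g :: "real ^ 'd \<Rightarrow> real"
  assumes ab: "0 \<le> a" "a < b" "b \<le> T" and \<xi>: "\<xi> \<in> borel_measurable (Fil a)" and g: "g \<in> borel_measurable borel"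
  shows "indep_var borel \<xi> borel (\<lambda>w. g (B b w - B a w))"
proof -
  have \<xi>M: "\<xi> \<in> borel_measurable M" using borel_Fil[OF \<xi>] ab by auto
  let ?S = "{(\<lambda>w. B b w - B a w) -` A \<inter> space M |A. A \<in> sets borel}"
  have gM: "(\<lambda>w. g (B b w - B a w)) \<in> borel_measurable M"
    using measurable_compose[OF dB_measurable[OF ab] g] .
  have I: "indep_set (sets (Fil a)) ?S" by (rule B_indep_past[OF ab])
  have s1: "sigma_sets (space M) {\<xi> -` A \<inter> space M |A. A \<in> sets borel} \<subseteq> sets (Fil a)"
  proof -
    have "{\<xi> -` A \<inter> space M |A. A \<in> sets borel} \<subseteq> sets (Fil a)"
      using measurable_sets[OF \<xi>] by (auto simp: space_F)
    from sets.sigma_sets_subset[OF this] show ?thesis by (simp add: space_F)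
  qed
  have s2: "sigma_sets (space M) {(\<lambda>w. g (B b w - B a w)) -` A \<inter> space M |A. A \<in> sets borel} \<subseteq> ?S"
  proof -
    \<comment> \<open>The increment events already form a sigma-algebra, so the one generated by g
      of the increment stays inside them.\<close>
    let ?V = "vimage_algebra (space M) (\<lambda>w. B b w - B a w) (borel :: (real^'d) measure)"
    have V: "sets ?V = ?S" by (rule sets_vimage_algebra2) simp
    have "sigma_sets (space ?V) {(\<lambda>w. g (B b w - B a w)) -` A \<inter> space M |A. A \<in> sets borel} \<subseteq> sets ?V"
    proof (rule sets.sigma_sets_subset, unfold V)
      show "{(\<lambda>w. g (B b w - B a w)) -` A \<inter> space M |A. A \<in> sets borel} \<subseteq> ?S"
      proof clarify
        fix A :: "real set" assume "A \<in> sets borel"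
        then have "g -` A \<in> sets borel" using measurable_sets[OF g, of A] by simp
        then show "\<exists>A'. (\<lambda>w. g (B b w - B a w)) -` A \<inter> space M = (\<lambda>w. B b w - B a w) -` A' \<inter> space M \<and> A' \<in> sets borel"
          by (intro exI[of _ "g -` A"]) auto
      qed
    qed
    then show ?thesis unfolding V by simp
  qed
  show ?thesis unfolding indep_var_eq
  proof (intro conjI \<xi>M gM)
    show "indep_set (sigma_sets (space M) {\<xi> -` A \<inter> space M |A. A \<in> sets borel})
      (sigma_sets (space M) {(\<lambda>w. g (B b w - B a w)) -` A \<inter> space M |A. A \<in> sets borel})"
      using I unfolding indep_set_def
      by (rule indep_sets_mono_sets) (use s1 s2 in \<open>auto split: bool.splits\<close>)
  qed
qed

lemma dB_product:
  fixes \<xi> :: "'w \<Rightarrow> real"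
  assumes ab: "0 \<le> a" "a < b" "b \<le> T" and i: "i \<noteq> j"
  shows "(\<integral>w. (B b w - B a w) $ i * (B b w - B a w) $ j \<partial>M) = 0"
proof -
  have fin: "finite {i, j}" by simp
  have "indep_vars (\<lambda>_. borel) (\<lambda>i w. (B b w - B a w) $ i) {i, j}"
    by (rule indep_vars_subset[OF B_indep_components[OF ab]]) auto
  from indep_vars_lebesgue_integral[OF fin this dB_mean(1)[OF ab]]
  have "(\<integral>w. (\<Prod>k\<in>{i,j}. (B b w - B a w) $ k) \<partial>M) = (\<Prod>k\<in>{i,j}. \<integral>w. (B b w - B a w) $ k \<partial>M)" .
  moreover have "(\<Prod>k\<in>{i,j}. (B b w - B a w) $ k) = (B b w - B a w) $ i * (B b w - B a w) $ j" for w
    using i by (subst prod.insert) auto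
  ultimately show ?thesis using i dB_mean(2)[OF ab] by simp
qed

lemma dB_second_integrable:
  assumes ab: "0 \<le> a" "a < b" "b \<le> T"
  shows "integrable M (\<lambda>w. (B b w - B a w) $ i * (B b w - B a w) $ j)"
proof (rule Bochner_Integration.integrable_bound)
  show "integrable M (\<lambda>w. ((B b w - B a w) $ i) ^ 2 + ((B b w - B a w) $ j) ^ 2)"
    using dB_even(1)[OF ab, of _ 1] by simp
  show "(\<lambda>w. (B b w - B a w) $ i * (B b w - B a w) $ j) \<in> borel_measurable M"
    by (rule borel_measurable_times) (rule borel_measurable_integrable[OF dB_mean(1)[OF ab]])+
  show "AE w in M. norm ((B b w - B a w) $ i * (B b w - B a w) $ j)
     \<le> norm (((B b w - B a w) $ i) ^ 2 + ((B b w - B a w) $ j) ^ 2)"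
  proof (rule AE_I2)
    fix w
    have "\<bar>x * y\<bar> \<le> x\<^sup>2 + y\<^sup>2" for x y :: real
    proof -
      have "2 * (\<bar>x\<bar> * \<bar>y\<bar>) \<le> x\<^sup>2 + y\<^sup>2" using sum_squares_bound[of "\<bar>x\<bar>" "\<bar>y\<bar>"] by simp
      moreover have "0 \<le> \<bar>x\<bar> * \<bar>y\<bar>" by simp
      ultimately show ?thesis unfolding abs_mult by linarith
    qed
    then show "norm ((B b w - B a w) $ i * (B b w - B a w) $ j)
     \<le> norm (((B b w - B a w) $ i) ^ 2 + ((B b w - B a w) $ j) ^ 2)" by simp
  qed
qed

text \<open>Equality with the Brownian increment holds only almost everywhere, since the processes
  constructed later are altered on a null set to make every path continuous.\<close>

definition increment :: "real \<Rightarrow> real \<Rightarrow> ('w \<Rightarrow> real ^ 'd) \<Rightarrow> bool" where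
  "increment a b \<Delta> \<longleftrightarrow> 0 \<le> a \<and> a < b \<and> b \<le> T \<and> \<Delta> \<in> borel_measurable (Fil b) \<and>
     (AE w in M. \<Delta> w = B b w - B a w)"

lemma incrementD:
  assumes "increment a b \<Delta>"
  shows "0 \<le> a" "a < b" "b \<le> T" "\<Delta> \<in> borel_measurable (Fil b)" "AE w in M. \<Delta> w = B b w - B a w"
  using assms unfolding increment_def by blast+

lemma increment_measurable: "increment a b \<Delta> \<Longrightarrow> \<Delta> \<in> borel_measurable M"
proof -
  assume "increment a b \<Delta>"
  from incrementD[OF this] have "\<Delta> \<in> borel_measurable (Fil b)" "b \<in> {0..T}" by simp_all
  then show ?thesis by (rule borel_Fil)
qed

text \<open>V is known at time a, and the increment is independent of that past with mean
  zero.\<close>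

lemma increment_mean:
  fixes V :: "'w \<Rightarrow> real ^ 'd"
  assumes \<Delta>: "increment a b \<Delta>" and V: "\<And>i. (\<lambda>w. V w $ i) \<in> borel_measurable (Fil a)"
    and int: "\<And>i. integrable M (\<lambda>w. V w $ i)"
  shows "integrable M (\<lambda>w. V w \<bullet> \<Delta> w)" "(\<integral>w. V w \<bullet> \<Delta> w \<partial>M) = 0"
proof -
  note ab = incrementD(1-3)[OF \<Delta>]
  have ind: "indep_var borel (\<lambda>w. V w $ i) borel (\<lambda>w. (B b w - B a w) $ i)" for i
    by (rule dB_indep[OF ab V]) simp
  have I: "integrable M (\<lambda>w. V w $ i * (B b w - B a w) $ i)" for i
    by (rule indep_var_integrable[OF ind int dB_mean(1)[OF ab]])
  have E: "(\<integral>w. V w $ i * (B b w - B a w) $ i \<partial>M) = 0" for i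
    using indep_var_lebesgue_integral[OF ind int dB_mean(1)[OF ab]] dB_mean(2)[OF ab] by simp
  have S: "integrable M (\<lambda>w. \<Sum>i\<in>UNIV. V w $ i * (B b w - B a w) $ i)" using I by simp
  have ae: "AE w in M. (\<Sum>i\<in>UNIV. V w $ i * (B b w - B a w) $ i) = V w \<bullet> \<Delta> w"
    using incrementD(5)[OF \<Delta>] by eventually_elim (simp add: inner_vec_def)
  have m: "(\<lambda>w. V w \<bullet> \<Delta> w) \<in> borel_measurable M"
    unfolding inner_vec_def
    using int vec_nth_measurable[OF increment_measurable[OF \<Delta>]] by (intro borel_measurable_sum) (auto intro!: borel_measurable_times)
  show "integrable M (\<lambda>w. V w \<bullet> \<Delta> w)"
    by (rule integrable_cong_AE_imp[OF S m]) (use ae in auto)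
  have "(\<integral>w. V w \<bullet> \<Delta> w \<partial>M) = (\<integral>w. (\<Sum>i\<in>UNIV. V w $ i * (B b w - B a w) $ i) \<partial>M)"
    by (rule integral_cong_AE[OF m]) (use S ae in auto)
  also have "\<dots> = 0" using I E by simp
  finally show "(\<integral>w. V w \<bullet> \<Delta> w \<partial>M) = 0" .
qed

text \<open>Independence of the past factors each entry. The off-diagonal products of components
  have mean zero and the squares have mean b - a, which leaves the trace.\<close>

lemma increment_quadratic:
  fixes A :: "'w \<Rightarrow> real ^ 'd ^ 'd"
  assumes \<Delta>: "increment a b \<Delta>" and A: "\<And>i j. (\<lambda>w. A w $ i $ j) \<in> borel_measurable (Fil a)"
    and int: "\<And>i j. integrable M (\<lambda>w. A w $ i $ j)"
  shows "integrable M (\<lambda>w. \<Delta> w \<bullet> (A w *v \<Delta> w))" 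
    "(\<integral>w. \<Delta> w \<bullet> (A w *v \<Delta> w) \<partial>M) = (b - a) * (\<integral>w. trace (A w) \<partial>M)"
proof -
  note ab = incrementD(1-3)[OF \<Delta>]
  let ?d = "\<lambda>w. B b w - B a w"
  have ind: "indep_var borel (\<lambda>w. A w $ i $ j) borel (\<lambda>w. ?d w $ i * ?d w $ j)" for i j
    by (rule dB_indep[OF ab A]) simp
  have I: "integrable M (\<lambda>w. A w $ i $ j * (?d w $ i * ?d w $ j))" for i j
    by (rule indep_var_integrable[OF ind int dB_second_integrable[OF ab]])
  have E: "(\<integral>w. A w $ i $ j * (?d w $ i * ?d w $ j) \<partial>M) = (if i = j then (b - a) * (\<integral>w. A w $ i $ j \<partial>M) else 0)" for i j
    using indep_var_lebesgue_integral[OF ind int dB_second_integrable[OF ab]] dB_product[OF ab, of i j]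
      dB_even(2)[OF ab, of i 1] by (auto simp: power2_eq_square)
  have eq: "x \<bullet> (Q *v x) = (\<Sum>i\<in>UNIV. \<Sum>j\<in>UNIV. Q $ i $ j * (x $ i * x $ j))" for x :: "real ^ 'd" and Q
    by (simp add: inner_vec_def matrix_vector_mult_def sum_distrib_left mult_ac)
  have S: "integrable M (\<lambda>w. \<Sum>i\<in>UNIV. \<Sum>j\<in>UNIV. A w $ i $ j * (?d w $ i * ?d w $ j))" using I by simp
  have ae: "AE w in M. (\<Sum>i\<in>UNIV. \<Sum>j\<in>UNIV. A w $ i $ j * (?d w $ i * ?d w $ j)) = \<Delta> w \<bullet> (A w *v \<Delta> w)"
    using incrementD(5)[OF \<Delta>] by eventually_elim (simp add: eq)
  have m: "(\<lambda>w. \<Delta> w \<bullet> (A w *v \<Delta> w)) \<in> borel_measurable M"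
    unfolding eq
    using int vec_nth_measurable[OF increment_measurable[OF \<Delta>]] by (intro borel_measurable_sum) (auto intro!: borel_measurable_times)
  show "integrable M (\<lambda>w. \<Delta> w \<bullet> (A w *v \<Delta> w))"
    by (rule integrable_cong_AE_imp[OF S m]) (use ae in auto)
  have "(\<integral>w. \<Delta> w \<bullet> (A w *v \<Delta> w) \<partial>M) = (\<integral>w. (\<Sum>i\<in>UNIV. \<Sum>j\<in>UNIV. A w $ i $ j * (?d w $ i * ?d w $ j)) \<partial>M)"
    by (rule integral_cong_AE[OF m]) (use S ae in auto)
  also have "\<dots> = (\<Sum>i\<in>UNIV. \<Sum>j\<in>UNIV. if i = j then (b - a) * (\<integral>w. A w $ i $ j \<partial>M) else 0)"
    using I E by simp
  also have "\<dots> = (b - a) * (\<integral>w. trace (A w) \<partial>M)"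
    using int by (simp add: trace_def sum_distrib_left)
  finally show "(\<integral>w. \<Delta> w \<bullet> (A w *v \<Delta> w) \<partial>M) = (b - a) * (\<integral>w. trace (A w) \<partial>M)" .
qed

lemma increment_moment:
  "\<exists>C\<ge>0. \<forall>a b \<Delta>. increment a b \<Delta> \<longrightarrow>
     integrable M (\<lambda>w. norm (\<Delta> w) ^ (2 * q)) \<and> (\<integral>w. norm (\<Delta> w) ^ (2 * q) \<partial>M) \<le> C * (b - a) ^ q"
proof -
  from dB_norm_moment[of q] obtain C where C: "C \<ge> 0" "\<And>a b. 0 \<le> a \<Longrightarrow> a < b \<Longrightarrow> b \<le> T \<Longrightarrow>
     integrable M (\<lambda>w. norm (B b w - B a w) ^ (2 * q)) \<and>
     (\<integral>w. norm (B b w - B a w) ^ (2 * q) \<partial>M) \<le> C * (b - a) ^ q" by blast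
  show ?thesis
  proof (intro exI[of _ C] conjI allI impI C(1))
    fix a b \<Delta> assume \<Delta>: "increment a b \<Delta>"
    note ab = incrementD(1-3)[OF \<Delta>]
    have m: "(\<lambda>w. norm (\<Delta> w) ^ (2 * q)) \<in> borel_measurable M"
      using increment_measurable[OF \<Delta>] by simp
    have ae: "AE w in M. norm (B b w - B a w) ^ (2 * q) = norm (\<Delta> w) ^ (2 * q)"
      using incrementD(5)[OF \<Delta>] by eventually_elim simp
    show "integrable M (\<lambda>w. norm (\<Delta> w) ^ (2 * q))"
      by (rule integrable_cong_AE_imp[OF _ m]) (use C(2)[OF ab] ae in auto)
    have "(\<integral>w. norm (\<Delta> w) ^ (2 * q) \<partial>M) = (\<integral>w. norm (B b w - B a w) ^ (2 * q) \<partial>M)"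
      by (rule integral_cong_AE[OF m]) (use C(2)[OF ab] ae in auto)
    then show "(\<integral>w. norm (\<Delta> w) ^ (2 * q) \<partial>M) \<le> C * (b - a) ^ q" using C(2)[OF ab] by simp
  qed
qed

end

section \<open>All moments of the running maximum, by dyadic chaining\<close>

section \<open>Moments of the running maximum\<close>

lemma le_one_plus_power:
  fixes x :: real assumes "0 \<le> x" "p \<le> q" shows "x ^ p \<le> 1 + x ^ q"
proof (cases "x \<le> 1")
  case True
  then have "x ^ p \<le> 1" using assms by (simp add: power_le_one)
  then show ?thesis using zero_le_power[OF assms(1), of q] by linarith
next
  case False
  then have "x ^ p \<le> x ^ q" using assms by (intro power_increasing) auto
  then show ?thesis by simp
qed

lemma add_power_le:
  fixes x y :: real assumes "0 \<le> x" "0 \<le> y" shows "(x + y) ^ p \<le> 2 ^ p * (x ^ p + y ^ p)"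
proof -
  have "(x + y) ^ p \<le> (2 * max x y) ^ p" using assms by (intro power_mono) auto
  also have "\<dots> = 2 ^ p * max x y ^ p" by (simp add: power_mult_distrib)
  also have "\<dots> \<le> 2 ^ p * (x ^ p + y ^ p)"
    using zero_le_power[OF assms(1), of p] zero_le_power[OF assms(2), of p]
    by (intro mult_left_mono) (auto simp: max_def)
  finally show ?thesis .
qed

text \<open>Dyadic chaining: each point of level \<open>n + 1\<close> is one increment away from level \<open>n\<close>.\<close>

lemma dyadic_chaining:
  fixes x :: "real \<Rightarrow> 'a::real_normed_vector"
  assumes \<kappa>: "\<And>n j. j < 2 ^ n \<Longrightarrow>
      norm (x (t + real (Suc j) * (l / 2 ^ n)) - x (t + real j * (l / 2 ^ n))) \<le> \<kappa> * c ^ n"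
  shows "j \<le> 2 ^ N \<Longrightarrow> norm (x (t + real j * (l / 2 ^ N)) - x t) \<le> \<kappa> * (\<Sum>n\<le>N. c ^ n)"
proof (induction N arbitrary: j)
  case 0
  have "0 \<le> \<kappa>" using order_trans[OF norm_ge_zero \<kappa>[of 0 0]] by simp
  moreover from 0 have "j = 0 \<or> j = 1" by auto
  ultimately show ?case using \<kappa>[of 0 0] by auto
next
  case (Suc N)
  have "0 \<le> \<kappa> * c ^ Suc N" using order_trans[OF norm_ge_zero \<kappa>[of 0 "Suc N"]] by simp
  show ?case
  proof (cases "even j")
    case True
    then obtain i where i: "j = 2 * i" by blast
    then have eq: "real j * (l / 2 ^ Suc N) = real i * (l / 2 ^ N)" by simp
    have "i \<le> 2 ^ N" using Suc.prems i by simp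
    from Suc.IH[OF this] show ?thesis unfolding eq
      using \<open>0 \<le> \<kappa> * c ^ Suc N\<close> by (simp add: distrib_left)
  next
    case False
    then obtain i where i: "j = Suc (2 * i)" using oddE by (metis Suc_eq_plus1)
    then have eq: "real (2 * i) * (l / 2 ^ Suc N) = real i * (l / 2 ^ N)" by simp
    have i2: "i \<le> 2 ^ N" "2 * i < 2 ^ Suc N" using Suc.prems i by auto
    let ?a = "x (t + real j * (l / 2 ^ Suc N))" and ?b = "x (t + real (2 * i) * (l / 2 ^ Suc N))"
    have a: "norm (?a - ?b) \<le> \<kappa> * c ^ Suc N" using \<kappa>[OF i2(2)] unfolding i .
    have b: "norm (?b - x t) \<le> \<kappa> * (\<Sum>n\<le>N. c ^ n)" using Suc.IH[OF i2(1)] unfolding eq .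
    have "?a - x t = (?a - ?b) + (?b - x t)" by simp
    then have "norm (?a - x t) \<le> norm (?a - ?b) + norm (?b - x t)"
      by (metis norm_triangle_ineq)
    also have "\<dots> \<le> \<kappa> * c ^ Suc N + \<kappa> * (\<Sum>n\<le>N. c ^ n)"
      by (rule add_mono[OF a b])
    finally show ?thesis by (simp add: distrib_left)
  qed
qed

text \<open>Every s is the limit of the dyadic points just below it, so continuity carries a bound
  at dyadic points to the whole interval.\<close>

lemma dyadic_bound:
  fixes x :: "real \<Rightarrow> 'a::real_normed_vector"
  assumes x: "continuous_on {t..t + l} x" and l: "0 < l" and C: "\<And>N j. j \<le> 2 ^ N \<Longrightarrow> norm (x (t + real j * (l / 2 ^ N)) - x t) \<le> C"
    and s: "s \<in> {t..t + l}"
  shows "norm (x s - x t) \<le> C"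
proof -
  define j where "j N = nat \<lfloor>(s - t) * 2 ^ N / l\<rfloor>" for N :: nat
  define g where "g N = t + real (j N) * (l / 2 ^ N)" for N
  have r: "0 \<le> (s - t) * 2 ^ N / l" for N :: nat using s l by simp
  have j1: "real (j N) \<le> (s - t) * 2 ^ N / l" for N unfolding j_def using r[of N] by simp
  have j2: "(s - t) * 2 ^ N / l < real (j N) + 1" for N unfolding j_def using r[of N] by linarith
  have g1: "g N \<le> s" for N unfolding g_def using j1[of N] l by (simp add: field_simps)
  have g2: "s \<le> g N + l / 2 ^ N" for N
  proof -
    have "(s - t) * 2 ^ N < (real (j N) + 1) * l" using j2[of N] l by (simp add: field_simps)
    then show ?thesis unfolding g_def using l by (simp add: field_simps)
  qed
  have jN: "j N \<le> 2 ^ N" for N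
  proof -
    have "(s - t) * 2 ^ N \<le> l * 2 ^ N" using s by (intro mult_right_mono) auto
    then have "(s - t) * 2 ^ N / l \<le> 2 ^ N" using l by (simp add: pos_divide_le_eq mult.commute)
    then have "real (j N) \<le> 2 ^ N" using j1[of N] by (rule order_trans[rotated])
    then have "real (j N) \<le> real (2 ^ N)" by (metis of_nat_numeral of_nat_power)
    then show ?thesis by (simp only: of_nat_le_iff)
  qed
  have gs: "g \<longlonglongrightarrow> s"
  proof (rule tendsto_sandwich)
    have "(\<lambda>N. s - l * (1/2) ^ N) \<longlonglongrightarrow> s - l * 0" by (intro tendsto_intros LIMSEQ_power_zero) simp
    then show "(\<lambda>N. s - l * (1/2) ^ N) \<longlonglongrightarrow> s" by simp
    show "\<forall>\<^sub>F N in sequentially. s - l * (1/2) ^ N \<le> g N"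
    proof (intro always_eventually allI)
      fix N show "s - l * (1/2) ^ N \<le> g N" using g2[of N] by (simp add: power_one_over)
    qed
    show "\<forall>\<^sub>F N in sequentially. g N \<le> s" using g1 by simp
  qed simp
  have "g N \<in> {t..t + l}" for N using g1[of N] s l unfolding g_def by auto
  then have "(\<lambda>N. x (g N)) \<longlonglongrightarrow> x s"
    using x s gs unfolding continuous_on_sequentially by (auto simp: comp_def)
  then have "(\<lambda>N. norm (x (g N) - x t)) \<longlonglongrightarrow> norm (x s - x t)" by (intro tendsto_intros)
  then show ?thesis
    by (rule LIMSEQ_le_const2) (use C[OF jN] g_def in auto)
qed

context basis
begin

text \<open>The uniform bound up to t is what gives X all moments. Continuity is demanded of every
  path, so that pathwise limits may be taken on the whole space.\<close>

definition brownian_after :: "real \<Rightarrow> ('w \<Rightarrow> 'd path) \<Rightarrow> bool" where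
  "brownian_after t X \<longleftrightarrow> t \<in> {0..T} \<and> (\<forall>w\<in>space M. X w \<in> cpaths T) \<and>
     (\<forall>s\<in>{0..T}. (\<lambda>w. X w s) \<in> borel_measurable (Fil s)) \<and>
     (\<exists>R. \<forall>w\<in>space M. \<forall>s\<in>{0..t}. norm (X w s) \<le> R) \<and>
     (\<forall>a b. t \<le> a \<longrightarrow> a < b \<longrightarrow> b \<le> T \<longrightarrow> (AE w in M. X w b - X w a = B b w - B a w))"

lemma brownian_after_increment:
  assumes X: "brownian_after t X" and ab: "t \<le> a" "a < b" "b \<le> T"
  shows "increment a b (\<lambda>w. X w b - X w a)"
proof -
  have t: "0 \<le> t" using X by (auto simp: brownian_after_def)
  have "(\<lambda>w. X w b) \<in> borel_measurable (Fil b)" "(\<lambda>w. X w a) \<in> borel_measurable (Fil b)"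
    using X ab t borel_Fil_mono[of "\<lambda>w. X w a" a b] unfolding brownian_after_def by auto
  moreover have "AE w in M. X w b - X w a = B b w - B a w"
    using X ab unfolding brownian_after_def by blast
  ultimately show ?thesis using ab t unfolding increment_def by auto
qed

lemma brownian_after_adapted: "brownian_after t X \<Longrightarrow> adapted_cadlag T M Fil X"
  unfolding brownian_after_def adapted_cadlag_def using cpaths_cadlag by blast

text \<open>A suitably weighted sum of 2q-th powers of increments over all dyadic levels has finite
  mean. Its 2q-th root bounds the increments of level n by a multiple of (4/5)^n, and chaining adds
  these up to a bound on the path.\<close>

lemma brownian_sup_moment_even:
  assumes X: "brownian_after t X" and q: "3 \<le> q" and tT: "t < T"
  shows "integrable M (\<lambda>w. sup_norm T (X w) ^ (2 * q))"
proof -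
  obtain R where R: "\<And>w s. w \<in> space M \<Longrightarrow> s \<in> {0..t} \<Longrightarrow> norm (X w s) \<le> R"
    using X unfolding brownian_after_def by blast
  have t: "0 \<le> t" using X by (auto simp: brownian_after_def)
  have R0: "0 \<le> R"
  proof -
    obtain w where "w \<in> space M" using not_empty by blast
    from order_trans[OF norm_ge_zero R[OF this, of 0]] show ?thesis using t by simp
  qed
  define l where "l = T - t"
  have l: "0 < l" using tT by (simp add: l_def)
  define g where "g n j = t + real j * (l / 2 ^ n)" for n j :: nat
  \<comment> \<open>The weight is ((5/4)^n)^(2q), so a bound on U n bounds each increment of level n
    by a multiple of (4/5)^n.\<close>
  define U where "U n w = (25/16) ^ (q * n) * (\<Sum>j<2^n. norm (X w (g n (Suc j)) - X w (g n j)) ^ (2 * q))" for n w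
  obtain C where C: "C \<ge> 0" "\<And>a b \<Delta>. increment a b \<Delta> \<Longrightarrow>
     integrable M (\<lambda>w. norm (\<Delta> w) ^ (2 * q)) \<and> (\<integral>w. norm (\<Delta> w) ^ (2 * q) \<partial>M) \<le> C * (b - a) ^ q"
    using increment_moment[of q] by blast
  have gb: "increment (g n j) (g n (Suc j)) (\<lambda>w. X w (g n (Suc j)) - X w (g n j))" if j: "j < 2 ^ n" for n j
  proof (rule brownian_after_increment[OF X])
    show "t \<le> g n j" "g n j < g n (Suc j)" using l by (auto simp: g_def field_simps)
    have "real (Suc j) \<le> 2 ^ n" using j by (metis Suc_leI of_nat_le_iff of_nat_numeral of_nat_power)
    then have "real (Suc j) * (l / 2 ^ n) \<le> 2 ^ n * (l / 2 ^ n)" using l by (intro mult_right_mono) auto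
    then show "g n (Suc j) \<le> T" by (simp add: g_def l_def)
  qed
  \<comment> \<open>The geometric ratio in n of the bounds on the means of U n: 2^n increments, each
    with 2q-th moment of order 2^(-nq), times (25/16)^(nq). At q = 3 it is about 0.95, at q = 2 it
    exceeds 1; this is the origin of 3 \<le> q.\<close>
  define r :: real where "r = 2 * (25/32) ^ q"
  have r: "0 \<le> r" "r < 1"
  proof -
    have "(25/32::real) ^ q \<le> (25/32) ^ 3" using q by (intro power_decreasing) auto
    then show "r < 1" unfolding r_def by (simp add: power3_eq_cube)
  qed (simp add: r_def)
  have U_int: "integrable M (U n)" for n
    unfolding U_def using C(2)[OF gb] by (intro integrable_mult_right Bochner_Integration.integrable_sum) auto
  have U_nn: "0 \<le> U n w" for n w unfolding U_def by (intro mult_nonneg_nonneg sum_nonneg) auto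
  have U_E: "(\<integral>w. U n w \<partial>M) \<le> C * l ^ q * r ^ n" for n
  proof -
    have "(\<integral>w. U n w \<partial>M) = (25/16) ^ (q * n) * (\<Sum>j<2^n. \<integral>w. norm (X w (g n (Suc j)) - X w (g n j)) ^ (2 * q) \<partial>M)"
      unfolding U_def using C(2)[OF gb] by (simp add: Bochner_Integration.integral_sum)
    also have "\<dots> \<le> (25/16) ^ (q * n) * (\<Sum>j<2^n::nat. C * (l / 2 ^ n) ^ q)"
    proof (intro mult_left_mono sum_mono)
      fix j assume "j \<in> {..<2^n::nat}"
      then have "(\<integral>w. norm (X w (g n (Suc j)) - X w (g n j)) ^ (2 * q) \<partial>M) \<le> C * (g n (Suc j) - g n j) ^ q"
        using C(2)[OF gb[of j n]] by auto
      also have "g n (Suc j) - g n j = l / 2 ^ n" by (simp add: g_def algebra_simps add_divide_distrib[symmetric])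
      finally show "(\<integral>w. norm (X w (g n (Suc j)) - X w (g n j)) ^ (2 * q) \<partial>M) \<le> C * (l / 2 ^ n) ^ q" .
    qed simp
    also have "\<dots> = C * l ^ q * ((25/16) ^ (q * n) * (2 ^ n * (1 / 2 ^ n) ^ q))"
      by (simp add: power_divide)
    also have "(25/16) ^ (q * n) * (2 ^ n * (1 / 2 ^ n) ^ q) = r ^ n"
    proof -
      have "((1::real) / 2 ^ n) ^ q = (1/2) ^ (q * n)" by (simp add: power_divide power_mult[symmetric] mult.commute)
      then have "(25/16) ^ (q * n) * (2 ^ n * ((1::real) / 2 ^ n) ^ q) = 2 ^ n * ((25/16) * (1/2)) ^ (q * n)"
        by (simp add: power_mult_distrib[symmetric])
      also have "\<dots> = r ^ n" by (simp add: r_def power_mult power_mult_distrib)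
      finally show ?thesis .
    qed
    finally show ?thesis .
  qed
  \<comment> \<open>Summed in the extended reals, the series has a finite integral and is therefore
    finite almost everywhere.\<close>
  define V where "V w = (\<Sum>n. ennreal (U n w))" for w
  have V_m: "V \<in> borel_measurable M" unfolding V_def using U_int by measurable
  have "(\<integral>\<^sup>+w. V w \<partial>M) = (\<Sum>n. \<integral>\<^sup>+w. ennreal (U n w) \<partial>M)"
    unfolding V_def using U_int by (intro nn_integral_suminf) auto
  also have "\<dots> = (\<Sum>n. ennreal (\<integral>w. U n w \<partial>M))"
    by (intro suminf_cong nn_integral_eq_integral U_int AE_I2 U_nn)
  also have "\<dots> \<le> (\<Sum>n. ennreal (C * l ^ q * r ^ n))"
    by (intro suminf_le ennreal_leI U_E) auto
  also have "\<dots> < \<infinity>"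
  proof -
    have "summable (\<lambda>n. C * l ^ q * r ^ n)" using r by (intro summable_mult summable_geometric) simp
    then have "(\<Sum>n. ennreal (C * l ^ q * r ^ n)) = ennreal (\<Sum>n. C * l ^ q * r ^ n)"
      using C(1) l r by (intro suminf_ennreal2) auto
    then show ?thesis by simp
  qed
  finally have V_fin: "(\<integral>\<^sup>+w. V w \<partial>M) < \<infinity>" .
  then have V_ae: "AE w in M. V w \<noteq> \<infinity>" using V_m by (intro nn_integral_PInf_AE) auto
  define v where "v w = enn2real (V w)" for w
  have v_int: "integrable M v"
  proof (rule integrableI_nonneg)
    show "v \<in> borel_measurable M" unfolding v_def using V_m by measurable
    have "(\<integral>\<^sup>+w. ennreal (v w) \<partial>M) = (\<integral>\<^sup>+w. V w \<partial>M)"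
      by (rule nn_integral_cong_AE) (use V_ae in \<open>auto simp: v_def less_top\<close>)
    then show "(\<integral>\<^sup>+w. ennreal (v w) \<partial>M) < \<infinity>" using V_fin by simp
  qed (auto simp: v_def)
  have bound: "sup_norm T (X w) ^ (2 * q) \<le> 2 ^ (2 * q) * (R ^ (2 * q) + 5 ^ (2 * q) * v w)"
    if w: "w \<in> space M" and Vw: "V w \<noteq> \<infinity>" for w
  proof -
    define \<kappa> where "\<kappa> = root (2 * q) (v w)"
    have v0: "0 \<le> v w" by (simp add: v_def)
    have q0: "0 < 2 * q" using q by simp
    have \<kappa>: "0 \<le> \<kappa>" "\<kappa> ^ (2 * q) = v w" unfolding \<kappa>_def using v0 q0 by auto
    have U_le: "U n w \<le> v w" for n
    proof -
      have "ennreal (U n w) \<le> V w" unfolding V_def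
        using sum_le_suminf[of "\<lambda>n. ennreal (U n w)" "{n}"] by simp
      also have "V w = ennreal (v w)" using Vw by (simp add: v_def less_top)
      finally show ?thesis using v0 by simp
    qed
    have D: "norm (X w (t + real (Suc j) * (l / 2 ^ n)) - X w (t + real j * (l / 2 ^ n))) \<le> \<kappa> * (4/5) ^ n"
      if j: "j < 2 ^ n" for n j
    proof -
      let ?x = "norm (X w (g n (Suc j)) - X w (g n j))"
      have "(?x * (5/4) ^ n) ^ (2 * q) = (25/16) ^ (q * n) * ?x ^ (2 * q)"
      proof -
        have "((5/4::real) ^ n) ^ (2 * q) = ((5/4)\<^sup>2) ^ (q * n)" by (simp only: power_mult[symmetric] mult_ac)
        then show ?thesis by (simp add: power_mult_distrib power2_eq_square)
      qed
      also have "\<dots> \<le> U n w" unfolding U_def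
        using j by (intro mult_left_mono member_le_sum) auto
      also have "\<dots> \<le> \<kappa> ^ (2 * q)" using U_le \<kappa> by simp
      finally have "?x * (5/4) ^ n \<le> \<kappa>" using \<kappa>(1) q0 by (simp add: power_mono_iff)
      then have "?x * (5/4) ^ n * (4/5) ^ n \<le> \<kappa> * (4/5) ^ n" by (intro mult_right_mono) auto
      then have "?x \<le> \<kappa> * (4/5) ^ n" by (simp add: mult.assoc power_mult_distrib[symmetric])
      then show ?thesis by (simp add: g_def)
    qed
    have ch: "norm (X w (t + real j * (l / 2 ^ N)) - X w t) \<le> 5 * \<kappa>" if "j \<le> 2 ^ N" for N j
    proof -
      have "(\<Sum>n\<le>N. (4/5::real) ^ n) \<le> 5"
      proof -
        have "(\<Sum>n\<le>N. (4/5::real) ^ n) = (\<Sum>n<Suc N. (4/5::real) ^ n)" by (simp add: lessThan_Suc_atMost)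
        also have "\<dots> \<le> (\<Sum>n. (4/5::real) ^ n)" by (intro sum_le_suminf summable_geometric) auto
        also have "\<dots> = 5" by (subst suminf_geometric) auto
        finally show ?thesis .
      qed
      then have "\<kappa> * (\<Sum>n\<le>N. (4/5) ^ n) \<le> \<kappa> * 5" using \<kappa>(1) by (intro mult_left_mono)
      then show ?thesis using dyadic_chaining[OF D that] by linarith
    qed
    have cont: "continuous_on {t..t + l} (X w)"
    proof -
      have "continuous_on {0..T} (X w)" using X w by (auto simp: brownian_after_def cpaths_def)
      then show ?thesis by (rule continuous_on_subset) (use t in \<open>auto simp: l_def\<close>)
    qed
    have "sup_norm T (X w) \<le> R + 5 * \<kappa>"
    proof (rule sup_norm_le[OF T_nonneg])
      fix s assume s: "s \<in> {0..T}"
      show "norm (X w s) \<le> R + 5 * \<kappa>"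
      proof (cases "s \<le> t")
        case True
        then show ?thesis using R[OF w, of s] s \<kappa>(1) by auto
      next
        case False
        then have "norm (X w s - X w t) \<le> 5 * \<kappa>"
          using dyadic_bound[OF cont l ch, of s] s by (auto simp: l_def)
        moreover have "norm (X w t) \<le> R" using R[OF w, of t] t by simp
        ultimately show ?thesis using norm_triangle_sub[of "X w s" "X w t"] by linarith
      qed
    qed
    then have "sup_norm T (X w) ^ (2 * q) \<le> (R + 5 * \<kappa>) ^ (2 * q)"
      using X w sup_norm_nonneg[OF cpaths_cadlag T_nonneg] by (intro power_mono) (auto simp: brownian_after_def)
    also have "\<dots> \<le> 2 ^ (2 * q) * (R ^ (2 * q) + (5 * \<kappa>) ^ (2 * q))"
      using R0 \<kappa> by (intro add_power_le) auto
    finally show ?thesis using \<kappa>(2) by (simp add: power_mult_distrib)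
  qed
  have X_m: "X \<in> measurable M PD" by (rule adapted_measurable[OF brownian_after_adapted[OF X]])
  show ?thesis
  proof (rule Bochner_Integration.integrable_bound)
    show "integrable M (\<lambda>w. 2 ^ (2 * q) * (R ^ (2 * q) + 5 ^ (2 * q) * v w))"
      using v_int by (intro integrable_mult_right Bochner_Integration.integrable_add) auto
    show "(\<lambda>w. sup_norm T (X w) ^ (2 * q)) \<in> borel_measurable M"
      using measurable_compose[OF X_m sup_norm_PD] by simp
    show "AE w in M. norm (sup_norm T (X w) ^ (2 * q)) \<le> norm (2 ^ (2 * q) * (R ^ (2 * q) + 5 ^ (2 * q) * v w))"
      using V_ae
    proof (rule AE_mp, intro AE_I2 impI)
      fix w assume w: "w \<in> space M" "V w \<noteq> \<infinity>"
      have "0 \<le> sup_norm T (X w)" using X w sup_norm_nonneg[OF cpaths_cadlag T_nonneg] by (auto simp: brownian_after_def)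
      then show "norm (sup_norm T (X w) ^ (2 * q)) \<le> norm (2 ^ (2 * q) * (R ^ (2 * q) + 5 ^ (2 * q) * v w))"
        using bound[OF w] by (simp add: power_abs)
    qed
  qed
qed

lemma brownian_sup_moment:
  assumes X: "brownian_after t X"
  shows "integrable M (\<lambda>w. sup_norm T (X w) ^ p)"
proof -
  have X_m: "X \<in> measurable M PD" by (rule adapted_measurable[OF brownian_after_adapted[OF X]])
  have m: "(\<lambda>w. sup_norm T (X w) ^ p) \<in> borel_measurable M"
    using measurable_compose[OF X_m sup_norm_PD] by simp
  have nn: "0 \<le> sup_norm T (X w)" if "w \<in> space M" for w
    using X that sup_norm_nonneg[OF cpaths_cadlag T_nonneg] by (auto simp: brownian_after_def)
  show ?thesis
  proof (cases "t < T")
    case True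
    \<comment> \<open>Adding 3 meets the lower bound on q, and the resulting power 2 (p + 3) exceeds
      p.\<close>
    have i: "integrable M (\<lambda>w. 1 + sup_norm T (X w) ^ (2 * (p + 3)))"
      using brownian_sup_moment_even[OF X _ True, of "p+3"] by simp
    show ?thesis
    proof (rule Bochner_Integration.integrable_bound[OF i m], intro AE_I2)
      fix w assume "w \<in> space M"
      from le_one_plus_power[OF nn[OF this], of p "2 * (p + 3)"] nn[OF this]
      show "norm (sup_norm T (X w) ^ p) \<le> norm (1 + sup_norm T (X w) ^ (2 * (p + 3)))"
        by (simp add: power_abs)
    qed
  next
    case False
    then have "t = T" using X by (auto simp: brownian_after_def)
    then obtain R where R: "\<And>w s. w \<in> space M \<Longrightarrow> s \<in> {0..T} \<Longrightarrow> norm (X w s) \<le> R"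
      using X unfolding brownian_after_def by blast
    have i: "integrable M (\<lambda>w. R ^ p)" by simp
    show ?thesis
    proof (rule Bochner_Integration.integrable_bound[OF i m], intro AE_I2)
      fix w assume w: "w \<in> space M"
      have "sup_norm T (X w) ^ p \<le> R ^ p" using sup_norm_le[OF T_nonneg R[OF w]] nn[OF w] by (intro power_mono) auto
      also have "R ^ p \<le> norm (R ^ p)" by simp
      finally show "norm (sup_norm T (X w) ^ p) \<le> norm (R ^ p)" using nn[OF w] by (simp add: power_abs)
    qed
  qed
qed

end

section \<open>Mean value and Taylor estimates, and the size of quadratic remainders\<close>

section \<open>Elementary estimates\<close>

lemma norm_matrix_vector_le:
  fixes Q :: "real ^ 'd ^ 'e"
  shows "norm (Q *v x) \<le> norm Q * norm x"
proof -
  have "norm (Q *v x) = L2_set (\<lambda>i. \<bar>Q $ i \<bullet> x\<bar>) UNIV"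
    by (simp add: norm_vec_def matrix_mult_dot)
  also have "\<dots> \<le> L2_set (\<lambda>i. norm (Q $ i) * norm x) UNIV"
    by (intro L2_set_mono Cauchy_Schwarz_ineq2) simp
  also have "\<dots> = L2_set (\<lambda>i. norm (Q $ i)) UNIV * norm x"
    by (rule L2_set_left_distrib[symmetric]) simp
  finally show ?thesis by (simp add: norm_vec_def[of Q])
qed

lemma quadratic_form_le:
  fixes Q :: "real ^ 'd ^ 'd"
  shows "\<bar>x \<bullet> (Q *v x)\<bar> \<le> norm Q * (norm x)\<^sup>2"
proof -
  have "\<bar>x \<bullet> (Q *v x)\<bar> \<le> norm x * norm (Q *v x)" by (rule Cauchy_Schwarz_ineq2)
  also have "\<dots> \<le> norm x * (norm Q * norm x)" by (intro mult_left_mono norm_matrix_vector_le) simp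
  finally show ?thesis by (simp add: power2_eq_square mult_ac)
qed

lemma abs_trace_le:
  fixes Q :: "real ^ 'd ^ 'd::finite"
  shows "\<bar>trace Q\<bar> \<le> real CARD('d) * norm Q"
proof -
  have "\<bar>trace Q\<bar> \<le> (\<Sum>i\<in>UNIV. \<bar>Q $ i $ i\<bar>)" unfolding trace_def by (rule sum_abs)
  also have "\<dots> \<le> (\<Sum>i\<in>(UNIV::'d set). norm Q)"
    by (intro sum_mono order_trans[OF component_le_norm_cart Finite_Cartesian_Product.norm_nth_le])
  finally show ?thesis by simp
qed

lemma tendsto_trace:
  fixes Q :: "'a \<Rightarrow> real ^ 'd ^ 'd::finite"
  assumes "(Q \<longlongrightarrow> l) F" shows "((\<lambda>x. trace (Q x)) \<longlongrightarrow> trace l) F"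
  unfolding trace_def by (intro tendsto_sum tendsto_vec_nth assms)

text \<open>Take the largest u with phi(u) - phi(a) \<le> m (u - a). If it were before b, the right
  derivative there, being below m, would extend the inequality further to the right.\<close>

lemma right_deriv_le:
  fixes \<phi> :: "real \<Rightarrow> real"
  assumes ab: "a \<le> b" and c: "continuous_on {a..b} \<phi>"
    and d: "\<And>s. a \<le> s \<Longrightarrow> s < b \<Longrightarrow> ((\<lambda>h. (\<phi> (s + h) - \<phi> s) / h) \<longlongrightarrow> D s) (at_right 0)"
    and m: "\<And>s. a \<le> s \<Longrightarrow> s < b \<Longrightarrow> D s < m"
  shows "\<phi> b - \<phi> a \<le> m * (b - a)"
proof (rule ccontr)
  assume neg: "\<not> \<phi> b - \<phi> a \<le> m * (b - a)"
  define \<psi> where "\<psi> u = \<phi> u - \<phi> a - m * (u - a)" for u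
  have c\<psi>: "continuous_on {a..b} \<psi>" unfolding \<psi>_def by (intro continuous_intros c)
  define K where "K = {u \<in> {a..b}. \<psi> u \<le> 0}"
  have "closed K" unfolding K_def
    using continuous_closed_preimage[OF c\<psi> closed_atLeastAtMost closed_atMost[of 0]]
    by (simp add: vimage_def Int_def)
  moreover have "bounded K" by (rule bounded_subset[of "{a..b}"]) (auto simp: K_def)
  ultimately have "compact K" by (simp add: compact_eq_bounded_closed)
  moreover have "a \<in> K" using ab by (simp add: K_def \<psi>_def)
  ultimately obtain s where s: "s \<in> K" "\<And>u. u \<in> K \<Longrightarrow> u \<le> s"
    using compact_attains_sup[of K] by blast
  have "s \<noteq> b" using s(1) neg by (auto simp: K_def \<psi>_def)
  then have sb: "a \<le> s" "s < b" using s(1) by (auto simp: K_def)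
  have "\<forall>\<^sub>F h in at_right 0. (\<phi> (s + h) - \<phi> s) / h < m"
    by (rule order_tendstoD(2)[OF d[OF sb] m[OF sb]])
  then obtain e where e: "0 < e" "\<And>h. 0 < h \<Longrightarrow> h < e \<Longrightarrow> (\<phi> (s + h) - \<phi> s) / h < m"
    unfolding eventually_at_right_field by auto
  define h where "h = min (e / 2) (b - s)"
  have h: "0 < h" "h < e" "s + h \<le> b" unfolding h_def using e(1) sb by auto
  have "\<phi> (s + h) - \<phi> s < m * h" using e(2)[OF h(1,2)] h(1) by (simp add: field_simps)
  moreover have "\<psi> s \<le> 0" using s(1) by (simp add: K_def)
  ultimately have "\<psi> (s + h) \<le> 0" by (simp add: \<psi>_def algebra_simps)
  then have "s + h \<in> K" using h sb by (simp add: K_def)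
  from s(2)[OF this] h(1) show False by simp
qed

text \<open>A mean value inequality for right derivatives; the slack \<open>\<eta>\<close> replaces the missing intermediate point.\<close>

lemma right_deriv_mean_value:
  fixes \<phi> :: "real \<Rightarrow> real"
  assumes ab: "a < b" and c: "continuous_on {a..b} \<phi>"
    and d: "\<And>s. a \<le> s \<Longrightarrow> s < b \<Longrightarrow> ((\<lambda>h. (\<phi> (s + h) - \<phi> s) / h) \<longlongrightarrow> D s) (at_right 0)"
    and \<eta>: "0 < \<eta>"
  shows "\<exists>r. a \<le> r \<and> r < b \<and> \<bar>(\<phi> b - \<phi> a) / (b - a) - k\<bar> \<le> \<bar>D r - k\<bar> + \<eta>"
proof (rule ccontr)
  assume neg: "\<not> ?thesis"
  define q where "q = \<bar>(\<phi> b - \<phi> a) / (b - a) - k\<bar>"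
  have D: "\<bar>D r - k\<bar> < q - \<eta>" if "a \<le> r" "r < b" for r
    using neg that unfolding q_def by (meson less_diff_eq not_le)
  have "\<phi> b - \<phi> a \<le> (k + (q - \<eta>)) * (b - a)"
    by (rule right_deriv_le[OF less_imp_le[OF ab] c d]) (use D in \<open>auto simp: abs_less_iff\<close>, fastforce)
  moreover have "(- \<phi> b) - (- \<phi> a) \<le> (- k + (q - \<eta>)) * (b - a)"
  proof (rule right_deriv_le[OF less_imp_le[OF ab], where D = "\<lambda>s. - D s"])
    show "continuous_on {a..b} (\<lambda>s. - \<phi> s)" by (intro continuous_intros c)
    fix s assume s: "a \<le> s" "s < b"
    have "(\<lambda>h. (- \<phi> (s + h) - - \<phi> s) / h) = (\<lambda>h. - ((\<phi> (s + h) - \<phi> s) / h))"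
      by (rule ext) (simp add: minus_divide_left)
    then show "((\<lambda>h. (- \<phi> (s + h) - - \<phi> s) / h) \<longlongrightarrow> - D s) (at_right 0)"
      using tendsto_minus[OF d[OF s]] by simp
    show "- D s < - k + (q - \<eta>)" using D[OF s] by (simp add: abs_less_iff) 
  qed
  ultimately have "(\<phi> b - \<phi> a) / (b - a) \<le> k + (q - \<eta>)" "- k + (q - \<eta>) \<ge> - ((\<phi> b - \<phi> a) / (b - a))"
    using ab by (simp_all add: field_simps)
  then have "q \<le> q - \<eta>" unfolding q_def by linarith
  then show False using \<eta> by simp
qed

lemma shift_shift: "shift T \<tau> x (shift T \<tau> y \<omega>) = shift T \<tau> (x + y) \<omega>"
  by (simp add: shift_def fun_eq_iff scaleR_add_right)

text \<open>Two shifts at the same time add up, so the vertical derivative at a shifted path is a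
  derivative along the line.\<close>

lemma path_line_deriv:
  assumes "has_path_svd T \<tau> g (shift T \<tau> (\<theta> *\<^sub>R y) \<omega>) L"
  shows "((\<lambda>\<theta>. g (shift T \<tau> (\<theta> *\<^sub>R y) \<omega>)) has_vector_derivative L y) (at \<theta>)"
proof -
  let ?f = "\<lambda>x. g (shift T \<tau> x (shift T \<tau> (\<theta> *\<^sub>R y) \<omega>))"
  have L: "(?f has_derivative L) (at 0)" using assms by (simp add: has_path_svd_def)
  then have lin: "linear L" by (rule has_derivative_linear)
  have "((\<lambda>\<theta>'. (\<theta>' - \<theta>) *\<^sub>R y) has_derivative (\<lambda>h. h *\<^sub>R y)) (at \<theta>)"
    by (auto intro!: derivative_eq_intros)
  then have "((\<lambda>\<theta>'. ?f ((\<theta>' - \<theta>) *\<^sub>R y)) has_derivative (\<lambda>h. L (h *\<^sub>R y))) (at \<theta>)"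
    using has_derivative_compose[of "\<lambda>\<theta>'. (\<theta>' - \<theta>) *\<^sub>R y" "\<lambda>h. h *\<^sub>R y" \<theta> UNIV ?f L] L by simp
  moreover have "?f ((\<theta>' - \<theta>) *\<^sub>R y) = g (shift T \<tau> (\<theta>' *\<^sub>R y) \<omega>)" for \<theta>'
    by (simp add: shift_shift scaleR_diff_left)
  ultimately show ?thesis
    by (simp add: has_vector_derivative_def linear_cmul[OF lin])
qed

lemma path_taylor:
  assumes 1: "\<And>\<theta>. has_path_svd T \<tau> g (shift T \<tau> (\<theta> *\<^sub>R y) \<omega>) (\<lambda>x. g1 (shift T \<tau> (\<theta> *\<^sub>R y) \<omega>) \<bullet> x)"
    and 2: "\<And>\<theta>. has_path_svd T \<tau> g1 (shift T \<tau> (\<theta> *\<^sub>R y) \<omega>) (\<lambda>x. g2 (shift T \<tau> (\<theta> *\<^sub>R y) \<omega>) *v x)"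
  shows "\<exists>\<theta>. 0 < \<theta> \<and> \<theta> < 1 \<and> g (shift T \<tau> y \<omega>) - g \<omega> - g1 \<omega> \<bullet> y = 1/2 * (y \<bullet> (g2 (shift T \<tau> (\<theta> *\<^sub>R y) \<omega>) *v y))"
proof -
  define p where "p \<theta> = shift T \<tau> (\<theta> *\<^sub>R y) \<omega>" for \<theta>
  define df where "df m \<theta> = (if m = 0 then g (p \<theta>) else if m = Suc 0 then g1 (p \<theta>) \<bullet> y else (g2 (p \<theta>) *v y) \<bullet> y)" for m :: nat and \<theta>
  have d0: "((\<lambda>\<theta>. g (p \<theta>)) has_real_derivative g1 (p \<theta>) \<bullet> y) (at \<theta>)" for \<theta>
    using path_line_deriv[OF 1[of \<theta>]] unfolding p_def by (simp add: has_real_derivative_iff_has_vector_derivative)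
  have d1: "((\<lambda>\<theta>. g1 (p \<theta>) \<bullet> y) has_real_derivative (g2 (p \<theta>) *v y) \<bullet> y) (at \<theta>)" for \<theta>
  proof -
    have "((\<lambda>\<theta>. g1 (p \<theta>)) has_vector_derivative g2 (p \<theta>) *v y) (at \<theta>)"
      using path_line_deriv[OF 2[of \<theta>]] unfolding p_def .
    then have "((\<lambda>\<theta>. g1 (p \<theta>) \<bullet> y) has_vector_derivative (g2 (p \<theta>) *v y) \<bullet> y) (at \<theta>)"
      by (rule bounded_linear.has_vector_derivative[OF bounded_linear_inner_left])
    then show ?thesis by (simp add: has_real_derivative_iff_has_vector_derivative)
  qed
  have "\<exists>\<theta>>0. \<theta> < 1 \<and> g (p 1) = (\<Sum>m<2. df m 0 / fact m * 1 ^ m) + df 2 \<theta> / fact 2 * 1 ^ 2"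
  proof (rule Maclaurin)
    show "df 0 = (\<lambda>\<theta>. g (p \<theta>))" by (simp add: df_def fun_eq_iff)
    show "\<forall>m \<theta>. m < 2 \<and> 0 \<le> \<theta> \<and> \<theta> \<le> 1 \<longrightarrow> (df m has_real_derivative df (Suc m) \<theta>) (at \<theta>)"
    proof (intro allI impI)
      fix m :: nat and \<theta> :: real assume "m < 2 \<and> 0 \<le> \<theta> \<and> \<theta> \<le> 1"
      then consider "m = 0" | "m = 1" by linarith
      then show "(df m has_real_derivative df (Suc m) \<theta>) (at \<theta>)"
        using d0[of \<theta>] d1[of \<theta>] unfolding df_def by cases simp_all
    qed
  qed simp_all
  then obtain \<theta> where \<theta>: "0 < \<theta>" "\<theta> < 1" "g (p 1) = (\<Sum>m<2. df m 0 / fact m * 1 ^ m) + df 2 \<theta> / fact 2 * 1 ^ 2" by blast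
  then have "g (p 1) = g (p 0) + g1 (p 0) \<bullet> y + (g2 (p \<theta>) *v y) \<bullet> y / 2"
    by (simp add: df_def numeral_2_eq_2)
  then show ?thesis using \<theta>(1,2) by (intro exI[of _ \<theta>]) (simp add: p_def inner_commute)
qed

text \<open>Pairing with y makes the function scalar; a vector-valued function has in general no
  single intermediate point.\<close>

lemma path_mean_value:
  assumes 1: "\<And>\<theta>. has_path_svd T \<tau> g (shift T \<tau> (\<theta> *\<^sub>R y) \<omega>) (\<lambda>x. g1 (shift T \<tau> (\<theta> *\<^sub>R y) \<omega>) *v x)"
    and \<theta>: "0 < \<theta>"
  shows "\<exists>\<theta>'. 0 < \<theta>' \<and> \<theta>' < \<theta> \<and> (g (shift T \<tau> (\<theta> *\<^sub>R y) \<omega>) - g \<omega>) \<bullet> y = \<theta> * (y \<bullet> (g1 (shift T \<tau> (\<theta>' *\<^sub>R y) \<omega>) *v y))"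
proof -
  define p where "p \<theta> = shift T \<tau> (\<theta> *\<^sub>R y) \<omega>" for \<theta>
  have d1: "((\<lambda>\<theta>. g (p \<theta>) \<bullet> y) has_real_derivative (g1 (p \<theta>) *v y) \<bullet> y) (at \<theta>)" for \<theta>
  proof -
    have "((\<lambda>\<theta>. g (p \<theta>)) has_vector_derivative g1 (p \<theta>) *v y) (at \<theta>)"
      using path_line_deriv[OF 1[of \<theta>]] unfolding p_def .
    then have "((\<lambda>\<theta>. g (p \<theta>) \<bullet> y) has_vector_derivative (g1 (p \<theta>) *v y) \<bullet> y) (at \<theta>)"
      by (rule bounded_linear.has_vector_derivative[OF bounded_linear_inner_left])
    then show ?thesis by (simp add: has_real_derivative_iff_has_vector_derivative)
  qed
  obtain z where "0 < z" "z < \<theta>" "g (p \<theta>) \<bullet> y - g (p 0) \<bullet> y = (\<theta> - 0) * ((g1 (p z) *v y) \<bullet> y)"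
    using MVT2[OF \<theta>, of "\<lambda>\<theta>. g (p \<theta>) \<bullet> y" "\<lambda>\<theta>. (g1 (p \<theta>) *v y) \<bullet> y"] d1 by blast
  then show ?thesis by (intro exI[of _ z]) (simp add: p_def inner_diff_left, simp add: inner_commute)
qed

context basis
begin

lemma seq_cont3D:
  assumes "seq_cont3 H" "hat_conv tn \<omega>n \<mu>n u \<omega> \<mu>"
  shows "(\<lambda>n. H (tn n) (\<omega>n n) (\<mu>n n)) \<longlonglongrightarrow> H u \<omega> \<mu>"
  using assms(1)[unfolded seq_cont3_def, rule_format, OF assms(2)] .

lemma seq_cont4D:
  assumes "seq_cont4 H" "hat_conv tn \<omega>n \<mu>n u \<omega> \<mu>" "v \<in> D" "\<And>n. vn n \<in> D"
    "(\<lambda>n. path_dist T u v (tn n) (vn n)) \<longlonglongrightarrow> 0"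
  shows "(\<lambda>n. H (tn n) (\<omega>n n) (\<mu>n n) (vn n)) \<longlonglongrightarrow> H u \<omega> \<mu> v"
  using assms(1)[unfolded seq_cont4_def, rule_format, OF assms(2-5)] .

text \<open>With h = b - a, the product |e| |\<Delta>|^2 is at most \<rho> h e^2 + |\<Delta>|^4 /
  (\<rho> h), and the fourth moment of \<Delta> is of order h^2. C is common to all steps, and
  \<rho> stays free: it is taken large in \<open>remainder_tendsto\<close> and matched to the size
  of the path in \<open>law_bound\<close>.\<close>

lemma remainder_bound:
  "\<exists>C\<ge>0. \<forall>a b \<Delta> e Y \<rho>. increment a b \<Delta> \<longrightarrow> e \<in> borel_measurable M \<longrightarrow> integrable M (\<lambda>w. (Y w)\<^sup>2) \<longrightarrow>
     (\<forall>w\<in>space M. \<bar>e w\<bar> \<le> Y w) \<longrightarrow> 0 < \<rho> \<longrightarrow>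
     integrable M (\<lambda>w. (e w)\<^sup>2) \<and> integrable M (\<lambda>w. e w * (norm (\<Delta> w))\<^sup>2) \<and>
     \<bar>\<integral>w. e w * (norm (\<Delta> w))\<^sup>2 \<partial>M\<bar> \<le> (b - a) * (\<rho> * (\<integral>w. (e w)\<^sup>2 \<partial>M) + C / \<rho>)"
proof -
  obtain C where C: "C \<ge> 0" "\<And>a b \<Delta>. increment a b \<Delta> \<Longrightarrow>
     integrable M (\<lambda>w. norm (\<Delta> w) ^ (2 * 2)) \<and> (\<integral>w. norm (\<Delta> w) ^ (2 * 2) \<partial>M) \<le> C * (b - a) ^ 2"
    using increment_moment[of 2] by blast
  show ?thesis
  proof (intro exI[of _ C] conjI allI impI C(1))
    fix a b \<Delta> and e Y :: "'w \<Rightarrow> real" and \<rho> :: real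
    assume \<Delta>: "increment a b \<Delta>" and e: "e \<in> borel_measurable M" and Y: "integrable M (\<lambda>w. (Y w)\<^sup>2)"
      and eY: "\<forall>w\<in>space M. \<bar>e w\<bar> \<le> Y w" and \<rho>: "0 < \<rho>"
    define h where "h = b - a"
    have h: "0 < h" using incrementD(2)[OF \<Delta>] by (simp add: h_def)
    show e2: "integrable M (\<lambda>w. (e w)\<^sup>2)"
    proof (rule Bochner_Integration.integrable_bound[OF Y], use e in measurable, intro AE_I2)
      fix w assume "w \<in> space M"
      then have "\<bar>e w\<bar>\<^sup>2 \<le> (Y w)\<^sup>2" using eY by (intro power_mono) auto
      then show "norm ((e w)\<^sup>2) \<le> norm ((Y w)\<^sup>2)" by simp
    qed
    note D4 = C(2)[OF \<Delta>]
    let ?g = "\<lambda>w. \<rho> * h * (e w)\<^sup>2 + norm (\<Delta> w) ^ (2 * 2) / (\<rho> * h)"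
    have g: "integrable M ?g" using e2 D4 by (intro Bochner_Integration.integrable_add) auto
    have le: "\<bar>e w * (norm (\<Delta> w))\<^sup>2\<bar> \<le> ?g w" for w
    proof -
      define x where "x = \<rho> * h * \<bar>e w\<bar>"
      define y where "y = (norm (\<Delta> w))\<^sup>2"
      have "0 \<le> x" "0 \<le> y" using \<rho> h by (auto simp: x_def y_def)
      then have "x * y \<le> x\<^sup>2 + y\<^sup>2" using sum_squares_bound[of x y] mult_nonneg_nonneg[of x y] by linarith
      then have "(x * y) / (\<rho> * h) \<le> (x\<^sup>2 + y\<^sup>2) / (\<rho> * h)" using \<rho> h by (intro divide_right_mono) auto
      moreover have "(x * y) / (\<rho> * h) = \<bar>e w * (norm (\<Delta> w))\<^sup>2\<bar>" using \<rho> h by (simp add: x_def y_def abs_mult)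
      moreover have "(x\<^sup>2 + y\<^sup>2) / (\<rho> * h) = ?g w"
      proof -
        have "x\<^sup>2 = (\<rho> * h) * (\<rho> * h * (e w)\<^sup>2)"
          unfolding x_def power_mult_distrib power2_abs by (simp add: power2_eq_square)
        moreover have "y\<^sup>2 = norm (\<Delta> w) ^ (2 * 2)" unfolding y_def by (simp only: power_mult)
        ultimately show ?thesis using \<rho> h by (simp add: add_divide_distrib)
      qed
      ultimately show ?thesis by simp
    qed
    have m: "(\<lambda>w. e w * (norm (\<Delta> w))\<^sup>2) \<in> borel_measurable M"
      using e increment_measurable[OF \<Delta>] by measurable
    show i: "integrable M (\<lambda>w. e w * (norm (\<Delta> w))\<^sup>2)"
      by (rule Bochner_Integration.integrable_bound[OF g m], intro AE_I2)
         (metis abs_ge_self le order_trans real_norm_def)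
    have "\<bar>\<integral>w. e w * (norm (\<Delta> w))\<^sup>2 \<partial>M\<bar> \<le> (\<integral>w. \<bar>e w * (norm (\<Delta> w))\<^sup>2\<bar> \<partial>M)"
      by (rule integral_abs_bound)
    also have "\<dots> \<le> (\<integral>w. ?g w \<partial>M)" using i g le by (intro integral_mono) auto
    also have "\<dots> = \<rho> * h * (\<integral>w. (e w)\<^sup>2 \<partial>M) + (\<integral>w. norm (\<Delta> w) ^ (2 * 2) \<partial>M) / (\<rho> * h)"
      using e2 D4 by simp
    also have "(\<integral>w. norm (\<Delta> w) ^ (2 * 2) \<partial>M) / (\<rho> * h) \<le> C * h ^ 2 / (\<rho> * h)"
      using D4 \<rho> h by (intro divide_right_mono) (auto simp: h_def)
    also have "\<rho> * h * (\<integral>w. (e w)\<^sup>2 \<partial>M) + C * h ^ 2 / (\<rho> * h) = h * (\<rho> * (\<integral>w. (e w)\<^sup>2 \<partial>M) + C / \<rho>)"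
      using \<rho> h by (simp add: field_simps power2_eq_square)
    finally show "\<bar>\<integral>w. e w * (norm (\<Delta> w))\<^sup>2 \<partial>M\<bar> \<le> (b - a) * (\<rho> * (\<integral>w. (e w)\<^sup>2 \<partial>M) + C / \<rho>)"
      by (simp add: h_def)
  qed
qed

lemma remainder_tendsto:
  assumes \<Delta>: "\<And>n::nat. increment (a n) (b n) (\<Delta> n)" and e: "\<And>n. e n \<in> borel_measurable M"
    and Y: "integrable M (\<lambda>w. (Y w)\<^sup>2)" and eY: "\<And>n w. w \<in> space M \<Longrightarrow> \<bar>e n w\<bar> \<le> Y w"
    and lim: "\<And>w. w \<in> space M \<Longrightarrow> (\<lambda>n. e n w) \<longlonglongrightarrow> 0"
  shows "(\<lambda>n. (\<integral>w. e n w * (norm (\<Delta> n w))\<^sup>2 \<partial>M) / (b n - a n)) \<longlonglongrightarrow> 0"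
proof -
  obtain C where C: "C \<ge> 0" and C2: "\<forall>a b \<Delta> e Y \<rho>. increment a b \<Delta> \<longrightarrow> e \<in> borel_measurable M \<longrightarrow> integrable M (\<lambda>w. (Y w)\<^sup>2) \<longrightarrow>
     (\<forall>w\<in>space M. \<bar>e w\<bar> \<le> Y w) \<longrightarrow> 0 < \<rho> \<longrightarrow>
     integrable M (\<lambda>w. (e w)\<^sup>2) \<and> integrable M (\<lambda>w. e w * (norm (\<Delta> w))\<^sup>2) \<and>
     \<bar>\<integral>w. e w * (norm (\<Delta> w))\<^sup>2 \<partial>M\<bar> \<le> (b - a) * (\<rho> * (\<integral>w. (e w)\<^sup>2 \<partial>M) + C / \<rho>)"
    using remainder_bound by (elim exE conjE) (rule that)
  have E: "(\<lambda>n. \<integral>w. (e n w)\<^sup>2 \<partial>M) \<longlonglongrightarrow> (\<integral>w. 0 \<partial>M)"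
  proof (rule integral_dominated_convergence[where w = "\<lambda>w. (Y w)\<^sup>2"])
    show "AE w in M. (\<lambda>n. (e n w)\<^sup>2) \<longlonglongrightarrow> 0"
      using tendsto_power[OF lim, of _ 2] by (intro AE_I2) simp
    fix n show "AE w in M. norm ((e n w)\<^sup>2) \<le> (Y w)\<^sup>2"
    proof (intro AE_I2)
      fix w assume "w \<in> space M"
      then have "\<bar>e n w\<bar>\<^sup>2 \<le> (Y w)\<^sup>2" using eY by (intro power_mono) auto
      then show "norm ((e n w)\<^sup>2) \<le> (Y w)\<^sup>2" by simp
    qed
  qed (use e Y in auto)
  show ?thesis
  proof (rule LIMSEQ_I)
    fix r :: real assume r: "0 < r"
    \<comment> \<open>This puts C / \<rho> below r / 2; the 1 keeps \<rho> positive when C = 0. The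
      other half is left to the mean square of e, which tends to 0 while \<rho> is fixed.\<close>
    define \<rho> where "\<rho> = 2 * (C + 1) / r"
    have \<rho>: "0 < \<rho>" using r C by (simp add: \<rho>_def)
    have Cl: "C / \<rho> < r / 2" using r C by (simp add: \<rho>_def field_simps)
    have "(\<lambda>n. \<rho> * (\<integral>w. (e n w)\<^sup>2 \<partial>M)) \<longlonglongrightarrow> \<rho> * 0" using tendsto_mult_left[OF E, of \<rho>] by simp
    then have "\<forall>\<^sub>F n in sequentially. \<rho> * (\<integral>w. (e n w)\<^sup>2 \<partial>M) < r / 2"
      using r by (intro order_tendstoD(2)[of _ "\<rho> * 0"]) auto
    then obtain N where N: "\<And>n. n \<ge> N \<Longrightarrow> \<rho> * (\<integral>w. (e n w)\<^sup>2 \<partial>M) < r / 2"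
      unfolding eventually_sequentially by blast
    have "norm ((\<integral>w. e n w * (norm (\<Delta> n w))\<^sup>2 \<partial>M) / (b n - a n) - 0) < r" if "n \<ge> N" for n
    proof -
      have h: "0 < b n - a n" using incrementD(2)[OF \<Delta>] by simp
      have "\<bar>\<integral>w. e n w * (norm (\<Delta> n w))\<^sup>2 \<partial>M\<bar> \<le> (b n - a n) * (\<rho> * (\<integral>w. (e n w)\<^sup>2 \<partial>M) + C / \<rho>)"
        using C2[rule_format, OF \<Delta> e Y eY \<rho>] by blast
      then have "\<bar>\<integral>w. e n w * (norm (\<Delta> n w))\<^sup>2 \<partial>M\<bar> / (b n - a n) \<le> \<rho> * (\<integral>w. (e n w)\<^sup>2 \<partial>M) + C / \<rho>"
        using h by (simp add: pos_divide_le_eq mult.commute)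
      also have "\<dots> < r" using N[OF that] Cl by linarith
      finally show ?thesis using h by (simp add: abs_divide)
    qed
    then show "\<exists>no. \<forall>n\<ge>no. norm ((\<integral>w. e n w * (norm (\<Delta> n w))\<^sup>2 \<partial>M) / (b n - a n) - 0) < r" by blast
  qed
qed

end

section \<open>Processes controlled by the running maximum, and convergence of step
  processes\<close>

section \<open>Approximation of a Brownian process by step processes\<close>

locale brownian_process = basis T M Fil B
  for T :: real and M :: "'w measure" and Fil :: "real \<Rightarrow> 'w measure"
    and B :: "real \<Rightarrow> 'w \<Rightarrow> real ^ ('d::finite)" +
  fixes t :: real and X :: "'w \<Rightarrow> 'd path"
  assumes X: "brownian_after t X"
begin

definition S :: "'w \<Rightarrow> real" where "S w = sup_norm T (X w)"

lemma X_cpaths: "w \<in> space M \<Longrightarrow> X w \<in> cpaths T"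
  using X by (simp add: brownian_after_def)

lemma X_D: "w \<in> space M \<Longrightarrow> X w \<in> D"
  using X_cpaths cpaths_cadlag by blast

lemma t_range: "t \<in> {0..T}" using X by (simp add: brownian_after_def)

lemma X_measurable: "X \<in> measurable M PD"
  by (rule adapted_measurable[OF brownian_after_adapted[OF X]])

lemma S_nonneg: "w \<in> space M \<Longrightarrow> 0 \<le> S w"
  unfolding S_def by (rule sup_norm_nonneg[OF X_D T_nonneg])

lemma S_measurable: "S \<in> borel_measurable M"
  unfolding S_def[abs_def] by (rule measurable_compose[OF X_measurable sup_norm_PD])

lemma S_moment: "integrable M (\<lambda>w. S w ^ p)"
  unfolding S_def by (rule brownian_sup_moment[OF X])

lemma S_poly: "integrable M (\<lambda>w. (1 + 3 * S w) ^ p)"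
proof (rule Bochner_Integration.integrable_bound)
  show "integrable M (\<lambda>w. 2 ^ p * (1 + 3 ^ p * S w ^ p))"
    using S_moment by (intro integrable_mult_right Bochner_Integration.integrable_add) auto
  show "(\<lambda>w. (1 + 3 * S w) ^ p) \<in> borel_measurable M" using S_measurable by measurable
  show "AE w in M. norm ((1 + 3 * S w) ^ p) \<le> norm (2 ^ p * (1 + 3 ^ p * S w ^ p))"
  proof (rule AE_I2)
    fix w assume "w \<in> space M"
    then have "0 \<le> S w" by (rule S_nonneg)
    then have "(1 + 3 * S w) ^ p \<le> 2 ^ p * (1 ^ p + (3 * S w) ^ p)" by (intro add_power_le) auto
    then show "norm ((1 + 3 * S w) ^ p) \<le> norm (2 ^ p * (1 + 3 ^ p * S w ^ p))"
      using \<open>0 \<le> S w\<close> by (simp add: power_mult_distrib)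
  qed
qed

text \<open>The factor 3 makes room for a step process of norm at most S and one further jump, an
  increment of X of norm at most 2 S.\<close>

definition dominated :: "('w \<Rightarrow> 'd path) \<Rightarrow> bool" where
  "dominated Z \<longleftrightarrow> Z \<in> measurable M PD \<and> (\<forall>w\<in>space M. sup_norm T (Z w) \<le> 3 * S w)"

lemma dominated_X: "dominated X"
  unfolding dominated_def using X_measurable S_nonneg by (auto simp: S_def)

lemma dominatedD:
  assumes "dominated Z"
  shows "Z \<in> measurable M PD" "\<And>w. w \<in> space M \<Longrightarrow> Z w \<in> D" "\<And>w. w \<in> space M \<Longrightarrow> sup_norm T (Z w) \<le> 3 * S w"
  using assms measurable_PD_cadlag unfolding dominated_def by blast+

lemma dominated_power:
  assumes "dominated Z" "w \<in> space M"
  shows "(1 + sup_norm T (Z w)) ^ k \<le> (1 + 3 * S w) ^ k"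
  using dominatedD[OF assms(1)] assms(2) sup_norm_nonneg[OF _ T_nonneg, of "Z w"] by (intro power_mono) auto

lemma dominated_sq_integrable:
  assumes "dominated Z" shows "integrable M (\<lambda>w. (sup_norm T (Z w))\<^sup>2)"
proof (rule Bochner_Integration.integrable_bound[OF S_poly[of 2]])
  show "(\<lambda>w. (sup_norm T (Z w))\<^sup>2) \<in> borel_measurable M"
    using measurable_compose[OF dominatedD(1)[OF assms] sup_norm_PD] by simp
  show "AE w in M. norm ((sup_norm T (Z w))\<^sup>2) \<le> norm ((1 + 3 * S w)\<^sup>2)"
  proof (rule AE_I2)
    fix w assume w: "w \<in> space M"
    have "0 \<le> sup_norm T (Z w)" by (rule sup_norm_nonneg[OF dominatedD(2)[OF assms w] T_nonneg])
    then have "(sup_norm T (Z w))\<^sup>2 \<le> (1 + 3 * S w)\<^sup>2"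
      using dominatedD(3)[OF assms w] by (intro power_mono) auto
    then show "norm ((sup_norm T (Z w))\<^sup>2) \<le> norm ((1 + 3 * S w)\<^sup>2)" by simp
  qed
qed

lemma dominated_law: "dominated Z \<Longrightarrow> law Z \<in> PL"
  by (rule law_in_P2D[OF dominatedD(1) dominated_sq_integrable])

text \<open>One bound on the norms of all laws of dominated processes, so that the growth constants
  of a functional can be fixed once.\<close>

definition Kbound :: real where "Kbound = sqrt (\<integral>w. (3 * S w)\<^sup>2 \<partial>M)"

lemma dominated_stop:
  assumes "dominated Z" "u \<in> {0..T}" shows "dominated (\<lambda>w. stop T u (Z w))"
  unfolding dominated_def
proof (intro conjI ballI)
  show "(\<lambda>w. stop T u (Z w)) \<in> measurable M PD"
    by (rule measurable_compose[OF dominatedD(1)[OF assms(1)] stop_measurable_PD[OF assms(2)]])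
  fix w assume w: "w \<in> space M"
  show "sup_norm T (stop T u (Z w)) \<le> 3 * S w"
    using sup_norm_stop_le[OF dominatedD(2)[OF assms(1) w], of u] dominatedD(3)[OF assms(1) w] assms(2) T_nonneg by auto
qed

lemma dominated_law_norm:
  assumes "dominated Z" "u \<in> {0..T}"
  shows "law_norm T (stop_law T u (law Z)) \<le> Kbound"
proof -
  let ?Z = "\<lambda>w. stop T u (Z w)"
  have d: "dominated ?Z" by (rule dominated_stop[OF assms])
  have i: "integrable M (\<lambda>w. (3 * S w)\<^sup>2)" using S_moment[of 2] by (simp add: power_mult_distrib)
  have "law_norm T (stop_law T u (law Z)) = sqrt (\<integral>w. (sup_norm T (?Z w))\<^sup>2 \<partial>M)"
    unfolding stop_law_law[OF dominatedD(1)[OF assms(1)] assms(2)] by (rule law_norm_law[OF dominatedD(1)[OF d]])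
  also have "\<dots> \<le> Kbound" unfolding Kbound_def
  proof (intro real_sqrt_le_mono integral_mono dominated_sq_integrable[OF d] i)
    fix w assume w: "w \<in> space M"
    show "(sup_norm T (?Z w))\<^sup>2 \<le> (3 * S w)\<^sup>2"
      using dominatedD(3)[OF d w] sup_norm_nonneg[OF dominatedD(2)[OF d w] T_nonneg] by (intro power_mono) auto
  qed
  finally show ?thesis .
qed

lemma growth3_bound:
  assumes "growth3 H"
  obtains C k where "0 \<le> C" "\<And>u \<omega> Z. u \<in> {0..T} \<Longrightarrow> \<omega> \<in> D \<Longrightarrow> dominated Z \<Longrightarrow>
     norm (H u \<omega> (law Z)) \<le> C * (1 + sup_norm T \<omega>) ^ k"
proof -
  obtain C k where C: "0 \<le> C" "\<forall>t\<in>{0..T}. \<forall>\<omega>\<in>D. \<forall>\<mu>\<in>PL. law_norm T (stop_law T t \<mu>) \<le> Kbound \<longrightarrow>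
     norm (H t \<omega> \<mu>) \<le> C * (1 + sup_norm T \<omega>) ^ k"
    using assms unfolding growth3_def by blast
  show ?thesis by (rule that[OF C(1)]) (use C(2) dominated_law dominated_law_norm in blast)
qed

lemma growth4_bound:
  assumes "growth4 H"
  obtains C k where "0 \<le> C" "\<And>u \<omega> Z v. u \<in> {0..T} \<Longrightarrow> \<omega> \<in> D \<Longrightarrow> dominated Z \<Longrightarrow> v \<in> D \<Longrightarrow>
     norm (H u \<omega> (law Z) v) \<le> C * ((1 + sup_norm T \<omega>) ^ k * (1 + sup_norm T v) ^ k)"
proof -
  obtain C k where C: "0 \<le> C" "\<forall>t\<in>{0..T}. \<forall>\<omega>\<in>D. \<forall>\<mu>\<in>PL. \<forall>v\<in>D. law_norm T (stop_law T t \<mu>) \<le> Kbound \<longrightarrow>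
     norm (H t \<omega> \<mu> v) \<le> C * ((1 + sup_norm T \<omega>) ^ k * (1 + sup_norm T v) ^ k)"
    using assms unfolding growth4_def by blast
  show ?thesis by (rule that[OF C(1)]) (use C(2) dominated_law dominated_law_norm in blast)
qed

text \<open>The processes themselves provide the coupling, and dominated convergence under (6 S)^2
  turns pathwise convergence into convergence of the laws.\<close>

lemma hat_conv_law:
  assumes u: "u \<in> {0..T}" "\<And>n. un n \<in> {0..T}" "un \<longlonglongrightarrow> u"
    and \<omega>: "\<omega> \<in> D" "\<And>n. \<omega>n n \<in> D" "(\<lambda>n. path_dist T u \<omega> (un n) (\<omega>n n)) \<longlonglongrightarrow> 0"
    and Z: "dominated Z" "\<And>n. dominated (Zn n)"
    and lim: "\<And>w. w \<in> space M \<Longrightarrow> (\<lambda>n. path_dist T u (Z w) (un n) (Zn n w)) \<longlonglongrightarrow> 0"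
  shows "hat_conv un \<omega>n (\<lambda>n. law (Zn n)) u \<omega> (law Z)"
proof -
  let ?d = "\<lambda>n w. path_dist T u (Z w) (un n) (Zn n w)"
  have Zs: "dominated (\<lambda>w. stop T u (Z w))" "dominated (\<lambda>w. stop T (un n) (Zn n w))" for n
    by (intro dominated_stop Z u)+
  note m = dominatedD(1)[OF Zs(1)] dominatedD(1)[OF Zs(2)]
  have dm: "?d n \<in> borel_measurable M" for n
    unfolding path_dist_def by (rule sup_norm_diff_measurable[OF m])
  have le: "0 \<le> ?d n w \<and> ?d n w \<le> 6 * S w" if w: "w \<in> space M" for n w
    unfolding path_dist_def
    using sup_norm_triangle_diff[OF dominatedD(2)[OF Zs(1) w] dominatedD(2)[OF Zs(2) w] T_nonneg, of n]
      dominatedD(3)[OF Zs(1) w] dominatedD(3)[OF Zs(2) w, of n]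
      sup_norm_nonneg[OF cadlag_diff[OF dominatedD(2)[OF Zs(1) w] dominatedD(2)[OF Zs(2) w]] T_nonneg, of n]
    by linarith
  have le2: "(?d n w)\<^sup>2 \<le> (6 * S w)\<^sup>2" if w: "w \<in> space M" for n w
    using le[OF w, of n] by (intro power_mono) auto
  have i6: "integrable M (\<lambda>w. (6 * S w)\<^sup>2)" using S_moment[of 2] by (simp add: power_mult_distrib)
  have di: "integrable M (\<lambda>w. (?d n w)\<^sup>2)" for n
    by (rule Bochner_Integration.integrable_bound[OF i6]) (use dm le2 in \<open>auto intro!: AE_I2\<close>)
  have "(\<lambda>n. \<integral>w. (?d n w)\<^sup>2 \<partial>M) \<longlonglongrightarrow> (\<integral>w. 0 \<partial>M)"
  proof (rule integral_dominated_convergence[where w = "\<lambda>w. (6 * S w)\<^sup>2"])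
    show "AE w in M. (\<lambda>n. (?d n w)\<^sup>2) \<longlonglongrightarrow> 0"
      using tendsto_power[OF lim, of _ 2] by (intro AE_I2) simp
    fix n show "AE w in M. norm ((?d n w)\<^sup>2) \<le> (6 * S w)\<^sup>2" using le2 by (intro AE_I2) auto
  qed (use i6 dm in auto)
  then have sq: "(\<lambda>n. sqrt (\<integral>w. (?d n w)\<^sup>2 \<partial>M)) \<longlonglongrightarrow> 0" using tendsto_real_sqrt by fastforce
  have W: "(\<lambda>n. W2 T (stop_law T u (law Z)) (stop_law T (un n) (law (Zn n)))) \<longlonglongrightarrow> 0"
  proof (rule squeeze_zero[OF W2_nonneg _ sq])
    fix n
    show "W2 T (stop_law T u (law Z)) (stop_law T (un n) (law (Zn n))) \<le> sqrt (\<integral>w. (?d n w)\<^sup>2 \<partial>M)"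
      unfolding stop_law_law[OF dominatedD(1)[OF Z(1)] u(1)] stop_law_law[OF dominatedD(1)[OF Z(2)] u(2)] path_dist_def
      by (rule W2_law_le[OF m di[unfolded path_dist_def]])
  qed
  have "(\<lambda>n. \<bar>u - un n\<bar>) \<longlonglongrightarrow> 0"
    using tendsto_rabs[OF tendsto_diff[OF tendsto_const[of u] u(3)]] by simp
  from tendsto_add[OF tendsto_add[OF this \<omega>(3)] W]
  have "(\<lambda>n. dist_hat T (u, \<omega>, law Z) (un n, \<omega>n n, law (Zn n))) \<longlonglongrightarrow> 0"
    by (simp add: dist_hat_def)
  then show ?thesis unfolding hat_conv_def using u \<omega> Z dominated_law by auto
qed

lemma path_dist_const_le:
  assumes "\<omega> \<in> D" "\<omega>' \<in> D" "u \<in> {0..T}"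
  shows "path_dist T u \<omega> u \<omega>' \<le> sup_norm T (\<lambda>s. \<omega>' s - \<omega> s)" "0 \<le> path_dist T u \<omega> u \<omega>'"
proof -
  have "(\<lambda>s. stop T u \<omega> s - stop T u \<omega>' s) = stop T u (\<lambda>s. \<omega> s - \<omega>' s)" by (simp add: stop_def fun_eq_iff)
  then have "path_dist T u \<omega> u \<omega>' \<le> sup_norm T (\<lambda>s. \<omega> s - \<omega>' s)"
    unfolding path_dist_def using sup_norm_stop_le[OF cadlag_diff[OF assms(1,2)], of u] assms(3) T_nonneg by simp
  then show "path_dist T u \<omega> u \<omega>' \<le> sup_norm T (\<lambda>s. \<omega>' s - \<omega> s)"
    using sup_norm_minus_commute[of T \<omega> \<omega>'] by (rule ord_le_eq_trans)
  show "0 \<le> path_dist T u \<omega> u \<omega>'" unfolding path_dist_def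
    by (intro sup_norm_nonneg[OF cadlag_diff] cadlag_stop assms T_nonneg)
qed

text \<open>This is the link to \<open>tame\<close>: with time and law fixed, the functional may be
  composed with a tame process without losing measurability.\<close>

lemma seq_cont3_sup:
  assumes H: "seq_cont3 H" and u: "u \<in> {0..T}" and Z: "dominated Z"
  shows "path_continuous (\<lambda>\<omega>. H u \<omega> (law Z))"
  unfolding path_continuous_def
proof (intro ballI allI impI)
  fix \<omega> and \<omega>n :: "nat \<Rightarrow> 'd path" assume w: "\<omega> \<in> D" "\<forall>n. \<omega>n n \<in> D" "(\<lambda>n. sup_norm T (\<lambda>s. \<omega>n n s - \<omega> s)) \<longlonglongrightarrow> 0"
  have "hat_conv (\<lambda>_. u) \<omega>n (\<lambda>n. law Z) u \<omega> (law Z)"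
  proof (rule hat_conv_law)
    show "(\<lambda>n. path_dist T u \<omega> u (\<omega>n n)) \<longlonglongrightarrow> 0"
      by (rule squeeze_zero[OF _ _ w(3)]) (use path_dist_const_le[OF w(1) _ u] w(2) in auto)
    show "(\<lambda>n. path_dist T u (Z v) u (Z v)) \<longlonglongrightarrow> 0" if "v \<in> space M" for v
      using path_dist_zero[OF dominatedD(2)[OF Z that] u] by simp
  qed (use u w Z in auto)
  then show "(\<lambda>n. H u (\<omega>n n) (law Z)) \<longlonglongrightarrow> H u \<omega> (law Z)"
    by (rule seq_cont3D[OF H])
qed

lemma seq_cont4_sup:
  assumes H: "seq_cont4 H" and u: "u \<in> {0..T}" and Z: "dominated Z" and \<omega>: "\<omega> \<in> D"
  shows "path_continuous (\<lambda>v. H u \<omega> (law Z) v)"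
  unfolding path_continuous_def
proof (intro ballI allI impI)
  fix v and vn :: "nat \<Rightarrow> 'd path" assume w: "v \<in> D" "\<forall>n. vn n \<in> D" "(\<lambda>n. sup_norm T (\<lambda>s. vn n s - v s)) \<longlonglongrightarrow> 0"
  have "hat_conv (\<lambda>_. u) (\<lambda>_. \<omega>) (\<lambda>n. law Z) u \<omega> (law Z)"
  proof (rule hat_conv_law)
    show "(\<lambda>n::nat. path_dist T u \<omega> u \<omega>) \<longlonglongrightarrow> 0" using path_dist_zero[OF \<omega> u] by simp
    show "(\<lambda>n::nat. path_dist T u (Z v) u (Z v)) \<longlonglongrightarrow> 0" if "v \<in> space M" for v
      using path_dist_zero[OF dominatedD(2)[OF Z that] u] by simp
  qed (use u \<omega> Z in auto)
  moreover have "(\<lambda>n. path_dist T u v u (vn n)) \<longlonglongrightarrow> 0"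
    by (rule squeeze_zero[OF _ _ w(3)]) (use path_dist_const_le[OF w(1) _ u] w(2) in auto)
  ultimately show "(\<lambda>n. H u \<omega> (law Z) (vn n)) \<longlonglongrightarrow> H u \<omega> (law Z) v"
    by (intro seq_cont4D[OF H]) (use w(1,2) in auto)
qed

end

context basis
begin

lemma growth3_one: "growth3 (\<lambda>u \<omega> \<mu>. 1 :: real)"
  unfolding growth3_def by (rule allI, rule exI[of _ 1], rule exI[of _ 0]) simp

lemma growth3_comp:
  assumes "growth3 H" "\<And>u \<omega> \<mu>. norm (H' u \<omega> \<mu>) \<le> c * norm (H u \<omega> \<mu>)" "0 \<le> c"
  shows "growth3 H'"
proof -
  from growth3_bilinear[OF assms(1) growth3_one, of H' c] show ?thesis using assms(2,3) by simp
qed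

lemma growth4_comp:
  assumes "growth4 H" "\<And>u \<omega> \<mu> v. norm (H' u \<omega> \<mu> v) \<le> c * norm (H u \<omega> \<mu> v)" "0 \<le> c"
  shows "growth4 H'"
proof -
  from growth4_scale[OF growth3_one assms(1), of H' c] show ?thesis using assms(2,3) by simp
qed

lemma growth3_nth: "growth3 (H :: real \<Rightarrow> 'd path \<Rightarrow> 'd law \<Rightarrow> ('b::real_normed_vector) ^ 'e) \<Longrightarrow> growth3 (\<lambda>u \<omega> \<mu>. H u \<omega> \<mu> $ i)"
  by (erule growth3_comp[where c = 1]) (simp_all add: Finite_Cartesian_Product.norm_nth_le)

lemma growth4_nth: "growth4 (H :: real \<Rightarrow> 'd path \<Rightarrow> 'd law \<Rightarrow> 'd path \<Rightarrow> ('b::real_normed_vector) ^ 'e) \<Longrightarrow> growth4 (\<lambda>u \<omega> \<mu> v. H u \<omega> \<mu> v $ i)"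
  by (erule growth4_comp[where c = 1]) (simp_all add: Finite_Cartesian_Product.norm_nth_le)

lemma seq_cont3_nth: "seq_cont3 (H :: real \<Rightarrow> 'd path \<Rightarrow> 'd law \<Rightarrow> ('b::topological_space) ^ 'e) \<Longrightarrow> seq_cont3 (\<lambda>u \<omega> \<mu>. H u \<omega> \<mu> $ i)"
  unfolding seq_cont3_def by (intro allI impI tendsto_vec_nth) blast

lemma seq_cont4_nth: "seq_cont4 (H :: real \<Rightarrow> 'd path \<Rightarrow> 'd law \<Rightarrow> 'd path \<Rightarrow> ('b::topological_space) ^ 'e) \<Longrightarrow> seq_cont4 (\<lambda>u \<omega> \<mu> v. H u \<omega> \<mu> v $ i)"
  unfolding seq_cont4_def by (intro allI impI tendsto_vec_nth) blast

lemma growth3_trace: "growth3 H \<Longrightarrow> growth3 (\<lambda>u \<omega> \<mu>. trace (H u \<omega> \<mu> :: real ^ 'd ^ 'd))"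
  by (erule growth3_comp[where c = "real CARD('d)"]) (simp_all add: abs_trace_le)

lemma growth4_trace: "growth4 H \<Longrightarrow> growth4 (\<lambda>u \<omega> \<mu> v. trace (H u \<omega> \<mu> v :: real ^ 'd ^ 'd))"
  by (erule growth4_comp[where c = "real CARD('d)"]) (simp_all add: abs_trace_le)

lemma seq_cont3_trace: "seq_cont3 H \<Longrightarrow> seq_cont3 (\<lambda>u \<omega> \<mu>. trace (H u \<omega> \<mu> :: real ^ 'd ^ 'd))"
  unfolding seq_cont3_def by (intro allI impI tendsto_trace) blast

lemma seq_cont4_trace: "seq_cont4 H \<Longrightarrow> seq_cont4 (\<lambda>u \<omega> \<mu> v. trace (H u \<omega> \<mu> v :: real ^ 'd ^ 'd))"
  unfolding seq_cont4_def by (intro allI impI tendsto_trace) blast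

end

context brownian_process
begin

lemma integrable3:
  assumes H: "seq_cont3 H" "growth3 H" and u: "u \<in> {0..T}" and Z: "tame M Z" "dominated Z" and Z': "dominated Z'"
  shows "integrable M (\<lambda>w. H u (Z w) (law Z') :: real)"
proof -
  obtain C k where C: "0 \<le> C" "\<And>u \<omega> Z. u \<in> {0..T} \<Longrightarrow> \<omega> \<in> D \<Longrightarrow> dominated Z \<Longrightarrow>
     norm (H u \<omega> (law Z)) \<le> C * (1 + sup_norm T \<omega>) ^ k" using growth3_bound[OF H(2)] by blast
  show ?thesis
  proof (rule Bochner_Integration.integrable_bound[OF integrable_mult_right[OF S_poly[of k], of C]])
    show "(\<lambda>w. H u (Z w) (law Z')) \<in> borel_measurable M"
      by (rule tameD[OF Z(1) seq_cont3_sup[OF H(1) u Z']])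
    show "AE w in M. norm (H u (Z w) (law Z')) \<le> norm (C * (1 + 3 * S w) ^ k)"
    proof (rule AE_I2)
      fix w assume w: "w \<in> space M"
      have "norm (H u (Z w) (law Z')) \<le> C * (1 + sup_norm T (Z w)) ^ k"
        by (rule C(2)[OF u dominatedD(2)[OF Z(2) w] Z'])
      also have "\<dots> \<le> C * (1 + 3 * S w) ^ k" by (intro mult_left_mono dominated_power[OF Z(2) w] C(1))
      finally show "norm (H u (Z w) (law Z')) \<le> norm (C * (1 + 3 * S w) ^ k)" by (simp add: abs_le_iff)
    qed
  qed
qed

lemma integrable4:
  assumes H: "seq_cont4 H" "growth4 H" and u: "u \<in> {0..T}" and x: "x \<in> D"
    and Z: "tame M Z" "dominated Z" and Z': "dominated Z'"
  shows "integrable M (\<lambda>w. H u x (law Z') (Z w) :: real)"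
proof -
  obtain C k where C: "0 \<le> C" "\<And>u \<omega> Z v. u \<in> {0..T} \<Longrightarrow> \<omega> \<in> D \<Longrightarrow> dominated Z \<Longrightarrow> v \<in> D \<Longrightarrow>
     norm (H u \<omega> (law Z) v) \<le> C * ((1 + sup_norm T \<omega>) ^ k * (1 + sup_norm T v) ^ k)"
    using growth4_bound[OF H(2)] by blast
  have x0: "0 \<le> sup_norm T x" by (rule sup_norm_nonneg[OF x T_nonneg])
  show ?thesis
  proof (rule Bochner_Integration.integrable_bound[OF integrable_mult_right[OF S_poly[of k], of "C * (1 + sup_norm T x) ^ k"]])
    show "(\<lambda>w. H u x (law Z') (Z w)) \<in> borel_measurable M"
      by (rule tameD[OF Z(1) seq_cont4_sup[OF H(1) u Z' x]])
    show "AE w in M. norm (H u x (law Z') (Z w)) \<le> norm (C * (1 + sup_norm T x) ^ k * (1 + 3 * S w) ^ k)"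
    proof (rule AE_I2)
      fix w assume w: "w \<in> space M"
      have "norm (H u x (law Z') (Z w)) \<le> C * ((1 + sup_norm T x) ^ k * (1 + sup_norm T (Z w)) ^ k)"
        by (rule C(2)[OF u x Z' dominatedD(2)[OF Z(2) w]])
      also have "\<dots> \<le> C * ((1 + sup_norm T x) ^ k * (1 + 3 * S w) ^ k)"
        using x0 by (intro mult_left_mono dominated_power[OF Z(2) w] C(1)) auto
      finally show "norm (H u x (law Z') (Z w)) \<le> norm (C * (1 + sup_norm T x) ^ k * (1 + 3 * S w) ^ k)"
        by (simp add: mult.assoc abs_le_iff)
    qed
  qed
qed

text \<open>The state of a step process at time a: frozen from a on and known at time a. The bound
  is S rather than 3 S, so that one more jump still gives a dominated process.\<close>

definition stepper :: "real \<Rightarrow> ('w \<Rightarrow> 'd path) \<Rightarrow> bool" where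
  "stepper a P \<longleftrightarrow> t \<le> a \<and> a \<le> T \<and> adapted_cadlag T M Fil P \<and> tame (Fil a) P \<and>
     (\<forall>w\<in>space M. stop T a (P w) = P w \<and> sup_norm T (P w) \<le> S w)"

definition inc :: "real \<Rightarrow> real \<Rightarrow> 'w \<Rightarrow> real ^ 'd" where "inc a b w = X w b - X w a"

text \<open>\<theta> interpolates between the states before (0) and after (1) the jump. The
  increment gathered over [a,b] is added in one jump at b, where the vertical derivatives at time b
  act.\<close>

definition push :: "real \<Rightarrow> real \<Rightarrow> ('w \<Rightarrow> 'd path) \<Rightarrow> real \<Rightarrow> 'w \<Rightarrow> 'd path" where
  "push a b P \<theta> w = shift T b (\<theta> *\<^sub>R inc a b w) (P w)"

lemma inc_increment: "t \<le> a \<Longrightarrow> a < b \<Longrightarrow> b \<le> T \<Longrightarrow> increment a b (inc a b)"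
  unfolding inc_def by (rule brownian_after_increment[OF X])

lemma inc_le:
  assumes "w \<in> space M" "t \<le> a" "a < b" "b \<le> T" shows "norm (inc a b w) \<le> 2 * S w"
proof -
  have "norm (inc a b w) \<le> norm (X w b) + norm (X w a)" unfolding inc_def by (rule norm_triangle_ineq4)
  also have "\<dots> \<le> S w + S w" unfolding S_def
    using assms t_range by (intro add_mono sup_norm_ge[OF X_D]) auto
  finally show ?thesis by simp
qed

lemma stepperD:
  assumes "stepper a P"
  shows "t \<le> a" "a \<le> T" "a \<in> {0..T}" "adapted_cadlag T M Fil P" "tame (Fil a) P" "tame M P"
    "\<And>w. w \<in> space M \<Longrightarrow> P w \<in> D" "\<And>w. w \<in> space M \<Longrightarrow> stop T a (P w) = P w"
    "\<And>w. w \<in> space M \<Longrightarrow> sup_norm T (P w) \<le> S w"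
proof -
  show 1: "t \<le> a" "a \<le> T" "adapted_cadlag T M Fil P" "tame (Fil a) P"
    "\<And>w. w \<in> space M \<Longrightarrow> stop T a (P w) = P w" "\<And>w. w \<in> space M \<Longrightarrow> sup_norm T (P w) \<le> S w"
    using assms unfolding stepper_def by blast+
  show 2: "a \<in> {0..T}" using 1(1,2) t_range by auto
  show "tame M P" by (rule tame_M[OF 1(4) 2])
  show "\<And>w. w \<in> space M \<Longrightarrow> P w \<in> D" using 1(3) unfolding adapted_cadlag_def by blast
qed

lemma stepper_dominated:
  assumes "stepper a P" shows "dominated P"
  unfolding dominated_def
proof (intro conjI ballI)
  show "P \<in> measurable M PD" by (rule adapted_measurable[OF stepperD(4)[OF assms]])
  fix w assume w: "w \<in> space M"
  show "sup_norm T (P w) \<le> 3 * S w" using stepperD(9)[OF assms w] S_nonneg[OF w] by linarith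
qed

lemma stepper_stop:
  assumes "stepper a P" "w \<in> space M" "a \<le> r" shows "stop T r (P w) = P w"
  using stop_stopped[OF stepperD(8)[OF assms(1,2)] _ assms(3)] stepperD(3)[OF assms(1)] by simp

context
  fixes a b P assumes P: "stepper a P" and ab: "a < b" "b \<le> T"
begin

lemma ab_range: "0 \<le> a" "0 \<le> b" "b \<in> {0..T}" "t \<le> a" "t \<le> b"
  using stepperD(1,3)[OF P] ab by auto

lemma push_D: "w \<in> space M \<Longrightarrow> push a b P \<theta> w \<in> D"
  unfolding push_def by (rule cadlag_shift[OF stepperD(7)[OF P] ab_range(2)])

lemma push_sup_le:
  assumes "w \<in> space M" "0 \<le> \<theta>" "\<theta> \<le> 1" shows "sup_norm T (push a b P \<theta> w) \<le> 3 * S w"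
proof -
  have "sup_norm T (push a b P \<theta> w) \<le> sup_norm T (P w) + norm (\<theta> *\<^sub>R inc a b w)"
    unfolding push_def by (rule sup_norm_shift_le[OF stepperD(7)[OF P assms(1)] ab_range(2) T_nonneg])
  also have "norm (\<theta> *\<^sub>R inc a b w) \<le> 1 * (2 * S w)"
    unfolding norm_scaleR using assms inc_le[OF assms(1) ab_range(4) ab] by (intro mult_mono) auto
  finally show ?thesis using stepperD(9)[OF P assms(1)] by linarith
qed

lemma inc_Fil: "(\<lambda>w. \<theta> *\<^sub>R inc a b w) \<in> borel_measurable (Fil b)"
  using incrementD(4)[OF inc_increment[OF ab_range(4) ab]] by simp

lemma push_tame: "tame (Fil b) (push a b P \<theta>)"
  unfolding push_def[abs_def]
  by (rule tame_shift[OF tame_mono[OF stepperD(5)[OF P]] inc_Fil ab_range(2)]) (use ab in simp)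

lemma push_tame_M: "tame M (push a b P \<theta>)"
  by (rule tame_M[OF push_tame ab_range(3)])

lemma push_adapted: "adapted_cadlag T M Fil (push a b P \<theta>)"
  unfolding adapted_cadlag_def
proof (intro conjI ballI push_D)
  fix s assume s: "s \<in> {0..T}"
  have Ps: "(\<lambda>w. P w s) \<in> borel_measurable (Fil s)"
    using stepperD(4)[OF P] s by (simp add: adapted_cadlag_def)
  show "(\<lambda>w. push a b P \<theta> w s) \<in> borel_measurable (Fil s)"
  proof (cases "b \<le> s")
    case True
    have "(\<lambda>w. P w s + indicator {b..T} s *\<^sub>R (\<theta> *\<^sub>R inc a b w)) \<in> borel_measurable (Fil s)"
      by (intro borel_measurable_add Ps borel_measurable_scaleR borel_measurable_const borel_Fil_mono[OF inc_Fil True])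
    then show ?thesis unfolding push_def shift_def .
  next
    case False
    then have "(\<lambda>w. push a b P \<theta> w s) = (\<lambda>w. P w s)" by (simp add: push_def shift_def fun_eq_iff)
    then show ?thesis using Ps by simp
  qed
qed

lemma push_dominated: "0 \<le> \<theta> \<Longrightarrow> \<theta> \<le> 1 \<Longrightarrow> dominated (push a b P \<theta>)"
  unfolding dominated_def using adapted_measurable[OF push_adapted] push_sup_le by blast

lemma push_zero: "push a b P 0 = P" by (simp add: push_def fun_eq_iff)

lemma push_add: "shift T b (\<theta> *\<^sub>R inc a b w) (push a b P \<theta>' w) = push a b P (\<theta> + \<theta>') w"
  by (simp add: push_def shift_shift scaleR_add_left)

lemma push_stop: "w \<in> space M \<Longrightarrow> stop T b (push a b P \<theta> w) = push a b P \<theta> w"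
  unfolding push_def by (rule stop_shift[OF stepperD(8)[OF P]]) (use ab_range ab in auto)

lemma inc_L2: "inc a b \<in> L2 M (Fil b)"
proof -
  have "inc a b \<in> borel_measurable (Fil b)" by (rule incrementD(4)[OF inc_increment[OF ab_range(4) ab]])
  moreover have "integrable M (\<lambda>w. (norm (inc a b w))\<^sup>2)"
    using increment_moment[of 1] inc_increment[OF ab_range(4) ab] by auto
  ultimately show ?thesis by (simp add: L2_def)
qed

end

text \<open>A fixed time s seen from ever finer grids: [a n, b n] is the relevant cell and P n the
  step process at its left end.\<close>

definition approx :: "real \<Rightarrow> (nat \<Rightarrow> real) \<Rightarrow> (nat \<Rightarrow> real) \<Rightarrow> (nat \<Rightarrow> 'w \<Rightarrow> 'd path) \<Rightarrow> bool" where
  "approx s a b P \<longleftrightarrow> s \<in> {t..T} \<and> (\<forall>n. a n < b n \<and> b n \<le> T) \<and> a \<longlonglongrightarrow> s \<and> b \<longlonglongrightarrow> s \<and>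
     (\<forall>n. stepper (a n) (P n)) \<and>
     (\<forall>w\<in>space M. (\<lambda>n. sup_norm T (\<lambda>u. P n w u - stop T (a n) (X w) u)) \<longlonglongrightarrow> 0)"

lemma X_stop_conv:
  assumes w: "w \<in> space M" and r: "\<And>n. r n \<in> {0..T}" "s \<in> {0..T}" "r \<longlonglongrightarrow> s"
  shows "(\<lambda>n. sup_norm T (\<lambda>u. stop T s (X w) u - stop T (r n) (X w) u)) \<longlonglongrightarrow> 0"
proof (rule LIMSEQ_I)
  fix e :: real assume e: "0 < e"
  obtain h where h: "0 < h" "\<And>u v. u \<in> {0..T} \<Longrightarrow> v \<in> {0..T} \<Longrightarrow> \<bar>u - v\<bar> \<le> h \<Longrightarrow> norm (X w u - X w v) \<le> e/2"
    using cpaths_uniform[OF X_cpaths[OF w], of "e/2"] e by auto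
  obtain N where N: "\<And>n. n \<ge> N \<Longrightarrow> norm (r n - s) < h" using LIMSEQ_D[OF r(3) h(1)] by blast
  have "norm (sup_norm T (\<lambda>u. stop T s (X w) u - stop T (r n) (X w) u) - 0) < e" if n: "n \<ge> N" for n
  proof -
    have "sup_norm T (\<lambda>u. stop T s (X w) u - stop T (r n) (X w) u) \<le> e / 2"
    proof (rule sup_norm_le[OF T_nonneg])
      fix u assume u: "u \<in> {0..T}"
      have m: "min u s \<in> {0..T}" "min u (r n) \<in> {0..T}" using u r(1)[of n] r(2) by auto
      have "\<bar>min u s - min u (r n)\<bar> \<le> h" using N[OF n] by (auto simp: min_def)
      from h(2)[OF m this] show "norm (stop T s (X w) u - stop T (r n) (X w) u) \<le> e / 2"
        using u by (simp add: stop_def)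
    qed
    moreover have "0 \<le> sup_norm T (\<lambda>u. stop T s (X w) u - stop T (r n) (X w) u)"
      by (rule sup_norm_nonneg[OF cadlag_diff[OF cadlag_stop[OF X_D[OF w] r(2)] cadlag_stop[OF X_D[OF w] r(1)]] T_nonneg])
    ultimately show ?thesis using e by simp
  qed
  then show "\<exists>no. \<forall>n\<ge>no. norm (sup_norm T (\<lambda>u. stop T s (X w) u - stop T (r n) (X w) u) - 0) < e" by blast
qed

context
  fixes s a b P assumes A: "approx s a b P"
begin

lemma approxD:
  "s \<in> {t..T}" "s \<in> {0..T}" "a n < b n" "b n \<le> T" "a \<longlonglongrightarrow> s" "b \<longlonglongrightarrow> s" "stepper (a n) (P n)"
  "w \<in> space M \<Longrightarrow> (\<lambda>n. sup_norm T (\<lambda>u. P n w u - stop T (a n) (X w) u)) \<longlonglongrightarrow> 0"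
proof -
  show 1: "s \<in> {t..T}" using A by (simp add: approx_def)
  then show "s \<in> {0..T}" using t_range by auto
  show "a n < b n" "b n \<le> T" "a \<longlonglongrightarrow> s" "b \<longlonglongrightarrow> s" "stepper (a n) (P n)"
    "w \<in> space M \<Longrightarrow> (\<lambda>n. sup_norm T (\<lambda>u. P n w u - stop T (a n) (X w) u)) \<longlonglongrightarrow> 0"
    using A unfolding approx_def by blast+
qed

lemma a_range: "a n \<in> {0..T}" and b_range: "b n \<in> {0..T}"
  using ab_range(1,3)[OF approxD(7,3,4)] stepperD(3)[OF approxD(7)] by auto

lemma inc_conv:
  assumes "w \<in> space M" shows "(\<lambda>n. norm (inc (a n) (b n) w)) \<longlonglongrightarrow> 0"
proof -
  have c: "continuous_on {0..T} (X w)" using X_cpaths[OF assms] by (simp add: cpaths_def)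
  have "(\<lambda>n. X w (a n)) \<longlonglongrightarrow> X w s"
    using continuous_on_tendsto_compose[OF c approxD(5) approxD(2)] a_range by simp
  moreover have "(\<lambda>n. X w (b n)) \<longlonglongrightarrow> X w s"
    using continuous_on_tendsto_compose[OF c approxD(6) approxD(2)] b_range by simp
  ultimately have "(\<lambda>n. norm (X w (b n) - X w (a n))) \<longlonglongrightarrow> norm (X w s - X w s)" by (intro tendsto_intros)
  then show ?thesis by (simp add: inc_def)
qed

lemma approx_sup:
  assumes w: "w \<in> space M"
  shows "(\<lambda>n. sup_norm T (\<lambda>u. stop T s (X w) u - P n w u)) \<longlonglongrightarrow> 0"
proof (rule squeeze_zero)
  fix n
  have c: "stop T s (X w) \<in> D" "stop T (a n) (X w) \<in> D" "P n w \<in> D"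
    using cadlag_stop[OF X_D[OF w] approxD(2)] cadlag_stop[OF X_D[OF w] a_range] stepperD(7)[OF approxD(7) w] by auto
  show "0 \<le> sup_norm T (\<lambda>u. stop T s (X w) u - P n w u)" by (rule sup_norm_nonneg[OF cadlag_diff[OF c(1,3)] T_nonneg])
  have "sup_norm T (\<lambda>u. (stop T s (X w) u - stop T (a n) (X w) u) - (P n w u - stop T (a n) (X w) u))
    \<le> sup_norm T (\<lambda>u. stop T s (X w) u - stop T (a n) (X w) u) + sup_norm T (\<lambda>u. P n w u - stop T (a n) (X w) u)"
    by (rule sup_norm_triangle_diff[OF cadlag_diff[OF c(1,2)] cadlag_diff[OF c(3,2)] T_nonneg])
  then show "sup_norm T (\<lambda>u. stop T s (X w) u - P n w u)
    \<le> sup_norm T (\<lambda>u. stop T s (X w) u - stop T (a n) (X w) u) + sup_norm T (\<lambda>u. P n w u - stop T (a n) (X w) u)"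
    by simp
next
  show "(\<lambda>n. sup_norm T (\<lambda>u. stop T s (X w) u - stop T (a n) (X w) u) + sup_norm T (\<lambda>u. P n w u - stop T (a n) (X w) u)) \<longlonglongrightarrow> 0"
    using tendsto_add[OF X_stop_conv[OF w a_range approxD(2) approxD(5)] approxD(8)[OF w]] by simp
qed

lemma approx_path:
  assumes w: "w \<in> space M" and r: "\<And>n. a n \<le> r n"
  shows "(\<lambda>n. path_dist T s (X w) (r n) (P n w)) \<longlonglongrightarrow> 0"
  using approx_sup[OF w] unfolding path_dist_def stepper_stop[OF approxD(7) w r] .

lemma approx_push_path:
  assumes w: "w \<in> space M" and \<theta>: "\<And>n. 0 \<le> \<theta> n" "\<And>n. \<theta> n \<le> 1"
  shows "(\<lambda>n. path_dist T s (X w) (b n) (push (a n) (b n) (P n) (\<theta> n) w)) \<longlonglongrightarrow> 0"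
  unfolding path_dist_def push_stop[OF approxD(7,3,4) w]
proof (rule squeeze_zero)
  fix n
  let ?p = "push (a n) (b n) (P n) (\<theta> n) w"
  have c: "stop T s (X w) \<in> D" "P n w \<in> D" "?p \<in> D"
    using cadlag_stop[OF X_D[OF w] approxD(2)] stepperD(7)[OF approxD(7) w] push_D[OF approxD(7,3,4) w] by auto
  show "0 \<le> sup_norm T (\<lambda>u. stop T s (X w) u - ?p u)" by (rule sup_norm_nonneg[OF cadlag_diff[OF c(1,3)] T_nonneg])
  have i: "(\<lambda>u. indicator {b n..T} u *\<^sub>R (\<theta> n *\<^sub>R inc (a n) (b n) w)) \<in> D"
    using b_range[of n] by (intro cadlag_indicator) auto
  have "sup_norm T (\<lambda>u. (stop T s (X w) u - P n w u) - indicator {b n..T} u *\<^sub>R (\<theta> n *\<^sub>R inc (a n) (b n) w))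
    \<le> sup_norm T (\<lambda>u. stop T s (X w) u - P n w u) + sup_norm T (\<lambda>u. indicator {b n..T} u *\<^sub>R (\<theta> n *\<^sub>R inc (a n) (b n) w))"
    by (rule sup_norm_triangle_diff[OF cadlag_diff[OF c(1,2)] i T_nonneg])
  also have "(\<lambda>u. (stop T s (X w) u - P n w u) - indicator {b n..T} u *\<^sub>R (\<theta> n *\<^sub>R inc (a n) (b n) w)) = (\<lambda>u. stop T s (X w) u - ?p u)"
    by (simp add: push_def shift_def fun_eq_iff)
  also have "sup_norm T (\<lambda>u. indicator {b n..T} u *\<^sub>R (\<theta> n *\<^sub>R inc (a n) (b n) w)) \<le> norm (\<theta> n *\<^sub>R inc (a n) (b n) w)"
    by (rule sup_norm_indicator_le[OF T_nonneg])
  also have "norm (\<theta> n *\<^sub>R inc (a n) (b n) w) \<le> 1 * norm (inc (a n) (b n) w)"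
    unfolding norm_scaleR using \<theta>[of n] by (intro mult_right_mono) auto
  finally show "sup_norm T (\<lambda>u. stop T s (X w) u - ?p u)
    \<le> sup_norm T (\<lambda>u. stop T s (X w) u - P n w u) + norm (inc (a n) (b n) w)" by simp
next
  show "(\<lambda>n. sup_norm T (\<lambda>u. stop T s (X w) u - P n w u) + norm (inc (a n) (b n) w)) \<longlonglongrightarrow> 0"
    using tendsto_add[OF approx_sup[OF w] inc_conv[OF w]] by simp
qed

lemma approx_hat:
  assumes x: "x \<in> D" "\<And>n. xn n \<in> D" "(\<lambda>n. path_dist T s x (r n) (xn n)) \<longlonglongrightarrow> 0"
    and r: "\<And>n. a n \<le> r n" "\<And>n. r n \<le> b n"
  shows "hat_conv r xn (\<lambda>n. law (P n)) s x (law X)"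
proof (rule hat_conv_law)
  show "r n \<in> {0..T}" for n using r[of n] a_range[of n] b_range[of n] by auto
  show "r \<longlonglongrightarrow> s" by (rule tendsto_sandwich[OF _ _ approxD(5,6)]) (use r in auto)
  show "(\<lambda>n. path_dist T s (X w) (r n) (P n w)) \<longlonglongrightarrow> 0" if "w \<in> space M" for w
    by (rule approx_path[OF that r(1)])
qed (use x approxD(2) dominated_X stepper_dominated[OF approxD(7)] in auto)

lemma approx_push_hat:
  assumes x: "x \<in> D" "\<And>n. xn n \<in> D" "(\<lambda>n. path_dist T s x (b n) (xn n)) \<longlonglongrightarrow> 0"
    and \<theta>: "\<And>n. 0 \<le> \<theta> n" "\<And>n. \<theta> n \<le> 1"
  shows "hat_conv b xn (\<lambda>n. law (push (a n) (b n) (P n) (\<theta> n))) s x (law X)"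
proof (rule hat_conv_law)
  show "(\<lambda>n. path_dist T s (X w) (b n) (push (a n) (b n) (P n) (\<theta> n) w)) \<longlonglongrightarrow> 0" if "w \<in> space M" for w
    by (rule approx_push_path[OF that \<theta>])
qed (use x approxD(2) b_range approxD(6) dominated_X push_dominated[OF approxD(7,3,4) \<theta>] in auto)

end

end

section \<open>Taylor expansion of a smooth functional over one time step\<close>

section \<open>Expansion over one step\<close>

locale smooth_process = brownian_process T M Fil B t X
  for T :: real and M :: "'w measure" and Fil :: "real \<Rightarrow> 'w measure"
    and B :: "real \<Rightarrow> 'w \<Rightarrow> real ^ ('d::finite)" and t X +
  fixes G Gt :: "real \<Rightarrow> 'd path \<Rightarrow> 'd law \<Rightarrow> real"
    and Gw :: "real \<Rightarrow> 'd path \<Rightarrow> 'd law \<Rightarrow> real ^ 'd"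
    and Gww :: "real \<Rightarrow> 'd path \<Rightarrow> 'd law \<Rightarrow> real ^ 'd ^ 'd"
    and Gm :: "real \<Rightarrow> 'd path \<Rightarrow> 'd law \<Rightarrow> 'd path \<Rightarrow> real ^ 'd"
    and Gwm :: "real \<Rightarrow> 'd path \<Rightarrow> 'd law \<Rightarrow> 'd path \<Rightarrow> real ^ 'd ^ 'd"
  assumes G: "smooth G Gt Gw Gww Gm Gwm"
begin

lemma smoothD:
  "right_time_deriv G Gt" "law_line_deriv G Gm"
  "\<And>u \<omega> \<mu>. u\<in>{0..T} \<Longrightarrow> \<omega>\<in>D \<Longrightarrow> \<mu>\<in>PL \<Longrightarrow> has_path_svd T u (\<lambda>\<omega>. G u \<omega> \<mu>) \<omega> (\<lambda>x. Gw u \<omega> \<mu> \<bullet> x)"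
  "\<And>u \<omega> \<mu>. u\<in>{0..T} \<Longrightarrow> \<omega>\<in>D \<Longrightarrow> \<mu>\<in>PL \<Longrightarrow> has_path_svd T u (\<lambda>\<omega>. Gw u \<omega> \<mu>) \<omega> (\<lambda>x. Gww u \<omega> \<mu> *v x)"
  "\<And>u \<omega> \<mu> v. u\<in>{0..T} \<Longrightarrow> \<omega>\<in>D \<Longrightarrow> \<mu>\<in>PL \<Longrightarrow> v \<in> D \<Longrightarrow> has_path_svd T u (Gm u \<omega> \<mu>) v (\<lambda>x. Gwm u \<omega> \<mu> v *v x)"
  "seq_cont3 G" "seq_cont3 Gt" "seq_cont3 Gw" "seq_cont3 Gww" "seq_cont4 Gm" "seq_cont4 Gwm"
  "growth3 G" "growth3 Gt" "growth3 Gw" "growth3 Gww" "growth4 Gm" "growth4 Gwm"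
  using G unfolding smooth_def by blast+

definition time_quot :: "real \<Rightarrow> real \<Rightarrow> ('w \<Rightarrow> 'd path) \<Rightarrow> 'w \<Rightarrow> real" where
  "time_quot a b P w = (G b (P w) (law P) - G a (P w) (law P)) / (b - a)"

text \<open>Path and law are frozen from a on, so only the time argument moves, and the horizontal
  derivative is the right derivative of a function of time on all of [a,b).\<close>

lemma time_mean_value:
  assumes P: "stepper a P" and ab: "a < b" "b \<le> T" and w: "w \<in> space M" and \<eta>: "0 < \<eta>"
  shows "\<exists>r. a \<le> r \<and> r < b \<and> \<bar>time_quot a b P w - k\<bar> \<le> \<bar>Gt r (P w) (law P) - k\<bar> + \<eta>"
  unfolding time_quot_def
proof (rule right_deriv_mean_value[OF ab(1) _ _ \<eta>])
  have PD: "P w \<in> D" by (rule stepperD(7)[OF P w])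
  have dom: "dominated P" by (rule stepper_dominated[OF P])
  have st: "stop T r (P v) = P v" if "v \<in> space M" "a \<le> r" for v r by (rule stepper_stop[OF P that])
  have a0: "a \<in> {0..T}" by (rule stepperD(3)[OF P])
  show "continuous_on {a..b} (\<lambda>s. G s (P w) (law P))"
    unfolding continuous_on_sequentially comp_def
  proof (intro ballI allI impI)
    fix s and r :: "nat \<Rightarrow> real" assume s: "s \<in> {a..b}" and r: "(\<forall>n. r n \<in> {a..b}) \<and> r \<longlonglongrightarrow> s"
    have "hat_conv r (\<lambda>_. P w) (\<lambda>_. law P) s (P w) (law P)"
    proof (rule hat_conv_law)
      have z: "path_dist T s (P v) (r n) (P v) = 0" if "v \<in> space M" for v n
        unfolding path_dist_def using st[OF that] s r by (simp add: T_nonneg)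
      then show "(\<lambda>n. path_dist T s (P w) (r n) (P w)) \<longlonglongrightarrow> 0"
        "\<And>v. v \<in> space M \<Longrightarrow> (\<lambda>n. path_dist T s (P v) (r n) (P v)) \<longlonglongrightarrow> 0" using w by auto
      show "s \<in> {0..T}" using s a0 ab by auto
      show "r n \<in> {0..T}" for n using spec[OF conjunct1[OF r], of n] a0 ab by auto
    qed (use r PD dom in auto)
    then show "(\<lambda>n. G (r n) (P w) (law P)) \<longlonglongrightarrow> G s (P w) (law P)" by (rule seq_cont3D[OF smoothD(6)])
  qed
  fix s assume s: "a \<le> s" "s < b"
  have s0: "s \<in> {0..T}" "s \<in> {0..<T}" using s a0 ab by auto
  have "stop_law T s (law P) = law P"
    unfolding stop_law_law[OF dominatedD(1)[OF dom] s0(1)] by (rule law_cong) (use st s in auto)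
  then show "((\<lambda>h. (G (s + h) (P w) (law P) - G s (P w) (law P)) / h) \<longlongrightarrow> Gt s (P w) (law P)) (at_right 0)"
    using smoothD(1) s0(2) PD dominated_law[OF dom] st[OF w s(1)] unfolding right_time_deriv_def by blast
qed

text \<open>The Taylor remainders are recorded as \<open>e \<parallel>\<Delta>\<parallel>\<^sup>2\<close> with \<open>e\<close> bounded by an oscillation of the second
  derivative; this avoids any measurable choice of intermediate points.\<close>

definition space_rem :: "real \<Rightarrow> real \<Rightarrow> ('w \<Rightarrow> 'd path) \<Rightarrow> 'd law \<Rightarrow> ('w \<Rightarrow> real) \<Rightarrow> bool" where
  "space_rem a b P L e \<longleftrightarrow> e \<in> borel_measurable M \<and>
     (\<forall>w\<in>space M. \<exists>\<theta>. 0 \<le> \<theta> \<and> \<theta> \<le> 1 \<and> \<bar>e w\<bar> \<le> norm (Gww b (push a b P \<theta> w) L - Gww b (P w) L)) \<and>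
     (integrable M (\<lambda>w. e w * (norm (inc a b w))\<^sup>2) \<longrightarrow>
       (\<integral>w. G b (push a b P 1 w) L - G b (P w) L \<partial>M)
        = (b - a) * (1/2 * (\<integral>w. trace (Gww b (P w) L) \<partial>M)) + (\<integral>w. e w * (norm (inc a b w))\<^sup>2 \<partial>M))"

text \<open>\<theta> comes from a mean value theorem for the functional along the interpolated laws
  and is common to all w; \<theta>' comes from one along each path.\<close>

definition law_rem :: "real \<Rightarrow> real \<Rightarrow> ('w \<Rightarrow> 'd path) \<Rightarrow> 'd path \<Rightarrow> real \<Rightarrow> ('w \<Rightarrow> real) \<Rightarrow> bool" where
  "law_rem a b P x \<theta> e \<longleftrightarrow> 0 \<le> \<theta> \<and> \<theta> \<le> 1 \<and> e \<in> borel_measurable M \<and>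
     (\<forall>w\<in>space M. \<exists>\<theta>'. 0 \<le> \<theta>' \<and> \<theta>' \<le> 1 \<and>
        \<bar>e w\<bar> \<le> norm (Gwm b x (law (push a b P \<theta>)) (push a b P \<theta>' w) - Gwm b x (law P) (P w))) \<and>
     (integrable M (\<lambda>w. e w * (norm (inc a b w))\<^sup>2) \<longrightarrow>
       G b x (law (push a b P 1)) - G b x (law P)
        = (b - a) * (1/2 * (\<integral>w. trace (Gwm b x (law P) (P w)) \<partial>M)) + (\<integral>w. e w * (norm (inc a b w))\<^sup>2 \<partial>M))"

text \<open>The law is held at its value after the step, which is a deterministic argument. The
  gradient and Hessian at P are then known at time a, so the linear term has mean zero and the
  quadratic one gives the trace.\<close>

lemma space_expansion:
  assumes P: "stepper a P" and ab: "a < b" "b \<le> T"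
  shows "\<exists>e. space_rem a b P (law (push a b P 1)) e"
proof -
  define L where "L = law (push a b P 1)"
  note r = ab_range[OF P ab]
  have dom: "dominated (push a b P 1)" by (rule push_dominated[OF P ab]) auto
  have LP: "L \<in> PL" unfolding L_def by (rule dominated_law[OF dom])
  define rem where "rem w = G b (push a b P 1 w) L - G b (P w) L - Gw b (P w) L \<bullet> inc a b w
    - 1/2 * (inc a b w \<bullet> (Gww b (P w) L *v inc a b w))" for w
  \<comment> \<open>Where the increment vanishes, so does rem, and division by zero gives 0; hence e
    |\<Delta>|^2 = rem holds everywhere.\<close>
  define e where "e w = rem w / (norm (inc a b w))\<^sup>2" for w
  have inc: "increment a b (inc a b)" by (rule inc_increment[OF r(4) ab])
  have Vm: "(\<lambda>w. Gw b (P w) L $ i) \<in> borel_measurable (Fil a)" for i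
    unfolding L_def by (rule tameD[OF stepperD(5)[OF P] seq_cont3_sup[OF seq_cont3_nth[OF smoothD(8)] r(3) dom]])
  have Vi: "integrable M (\<lambda>w. Gw b (P w) L $ i)" for i
    unfolding L_def by (rule integrable3[OF seq_cont3_nth[OF smoothD(8)] growth3_nth[OF smoothD(14)] r(3) stepperD(6)[OF P] stepper_dominated[OF P] dom])
  have Am: "(\<lambda>w. Gww b (P w) L $ i $ j) \<in> borel_measurable (Fil a)" for i j
    unfolding L_def by (rule tameD[OF stepperD(5)[OF P] seq_cont3_sup[OF seq_cont3_nth[OF seq_cont3_nth[OF smoothD(9)]] r(3) dom]])
  have Ai: "integrable M (\<lambda>w. Gww b (P w) L $ i $ j)" for i j
    unfolding L_def by (rule integrable3[OF seq_cont3_nth[OF seq_cont3_nth[OF smoothD(9)]] growth3_nth[OF growth3_nth[OF smoothD(15)]] r(3) stepperD(6)[OF P] stepper_dominated[OF P] dom])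
  note mean = increment_mean[OF inc Vm Vi] and quad = increment_quadratic[OF inc Am Ai]
  have g1: "integrable M (\<lambda>w. G b (push a b P 1 w) L)"
    unfolding L_def by (rule integrable3[OF smoothD(6,12) r(3) push_tame_M[OF P ab] dom dom])
  have g0: "integrable M (\<lambda>w. G b (P w) L)"
    unfolding L_def by (rule integrable3[OF smoothD(6,12) r(3) stepperD(6)[OF P] stepper_dominated[OF P] dom])
  have remi: "integrable M rem" unfolding rem_def[abs_def]
    by (intro Bochner_Integration.integrable_diff g1 g0 mean(1) integrable_mult_right quad(1))
  have nm: "(\<lambda>w. (norm (inc a b w))\<^sup>2) \<in> borel_measurable M"
    using increment_measurable[OF inc] by measurable
  have em: "e \<in> borel_measurable M" unfolding e_def[abs_def]
    using borel_measurable_integrable[OF remi] nm by (intro borel_measurable_divide)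
  have tay: "\<exists>\<theta>. 0 < \<theta> \<and> \<theta> < 1 \<and> rem w = 1/2 * (inc a b w \<bullet> ((Gww b (push a b P \<theta> w) L - Gww b (P w) L) *v inc a b w))"
    if w: "w \<in> space M" for w
  proof -
    have pD: "shift T b (\<theta> *\<^sub>R inc a b w) (P w) \<in> D" for \<theta> using push_D[OF P ab w] by (simp add: push_def)
    obtain \<theta> where \<theta>: "0 < \<theta>" "\<theta> < 1" "G b (shift T b (inc a b w) (P w)) L - G b (P w) L - Gw b (P w) L \<bullet> inc a b w
        = 1/2 * (inc a b w \<bullet> (Gww b (shift T b (\<theta> *\<^sub>R inc a b w) (P w)) L *v inc a b w))"
      using path_taylor[of T b "\<lambda>\<omega>. G b \<omega> L" "inc a b w" "P w" "\<lambda>\<omega>. Gw b \<omega> L" "\<lambda>\<omega>. Gww b \<omega> L",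
          OF smoothD(3)[OF r(3) pD LP] smoothD(4)[OF r(3) pD LP]] by blast
    then show ?thesis by (intro exI[of _ \<theta>])
      (simp add: rem_def push_def matrix_vector_mult_diff_rdistrib inner_diff_right right_diff_distrib)
  qed
  have eb: "\<exists>\<theta>. 0 \<le> \<theta> \<and> \<theta> \<le> 1 \<and> \<bar>e w\<bar> \<le> norm (Gww b (push a b P \<theta> w) L - Gww b (P w) L)"
    and er: "e w * (norm (inc a b w))\<^sup>2 = rem w" if w: "w \<in> space M" for w
  proof -
    obtain \<theta> where \<theta>: "0 < \<theta>" "\<theta> < 1" "rem w = 1/2 * (inc a b w \<bullet> ((Gww b (push a b P \<theta> w) L - Gww b (P w) L) *v inc a b w))"
      using tay[OF w] by blast
    let ?Q = "Gww b (push a b P \<theta> w) L - Gww b (P w) L"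
    have "\<bar>rem w\<bar> \<le> norm ?Q * (norm (inc a b w))\<^sup>2"
      using quadratic_form_le[of "inc a b w" ?Q] unfolding \<theta>(3) abs_mult
      by (simp add: abs_if split: if_splits) 
    then have "\<bar>e w\<bar> \<le> norm ?Q" unfolding e_def
      by (cases "inc a b w = 0") (simp_all add: abs_divide pos_divide_le_eq)
    then show "\<exists>\<theta>. 0 \<le> \<theta> \<and> \<theta> \<le> 1 \<and> \<bar>e w\<bar> \<le> norm (Gww b (push a b P \<theta> w) L - Gww b (P w) L)"
      using \<theta>(1,2) by (intro exI[of _ \<theta>]) auto
    show "e w * (norm (inc a b w))\<^sup>2 = rem w" using \<theta>(3) unfolding e_def by (cases "inc a b w = 0") simp_all
  qed
  have "(\<integral>w. G b (push a b P 1 w) L - G b (P w) L \<partial>M)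
     = (\<integral>w. rem w + (Gw b (P w) L \<bullet> inc a b w + 1/2 * (inc a b w \<bullet> (Gww b (P w) L *v inc a b w))) \<partial>M)"
    by (rule Bochner_Integration.integral_cong) (simp_all add: rem_def)
  also have "\<dots> = (\<integral>w. rem w \<partial>M) + (0 + 1/2 * ((b - a) * (\<integral>w. trace (Gww b (P w) L) \<partial>M)))"
    using remi mean quad by simp
  also have "(\<integral>w. rem w \<partial>M) = (\<integral>w. e w * (norm (inc a b w))\<^sup>2 \<partial>M)"
    by (rule Bochner_Integration.integral_cong) (simp_all add: er)
  finally show ?thesis using em eb unfolding L_def[symmetric] space_rem_def by (intro exI[of _ e]) simp
qed

text \<open>The line issuing from the state at \<theta> is a piece of the same family, so the
  derivative at 0 for that start is the derivative at \<theta>.\<close>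

lemma law_deriv:
  assumes P: "stepper a P" and ab: "a < b" "b \<le> T" and x: "x \<in> D" and \<theta>: "0 \<le> \<theta>" "\<theta> \<le> 1"
  shows "integrable M (\<lambda>w. Gm b x (law (push a b P \<theta>)) (push a b P \<theta> w) \<bullet> inc a b w)"
    and "((\<lambda>\<theta>. G b x (law (push a b P \<theta>))) has_real_derivative
        (\<integral>w. Gm b x (law (push a b P \<theta>)) (push a b P \<theta> w) \<bullet> inc a b w \<partial>M)) (at \<theta>)"
proof -
  note r = ab_range[OF P ab]
  have *: "integrable M (\<lambda>w. Gm b x (law (push a b P \<theta>)) (push a b P \<theta> w) \<bullet> inc a b w) \<and>
     ((\<lambda>z. G b x (law (\<lambda>w. shift T b (z *\<^sub>R inc a b w) (push a b P \<theta> w)))) has_real_derivative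
        (\<integral>w. Gm b x (law (push a b P \<theta>)) (push a b P \<theta> w) \<bullet> inc a b w \<partial>M)) (at 0)"
    using smoothD(2) r(3) x inc_L2[OF P ab] push_adapted[OF P ab] dominated_law[OF push_dominated[OF P ab \<theta>]]
    unfolding law_line_deriv_def by blast
  then show "integrable M (\<lambda>w. Gm b x (law (push a b P \<theta>)) (push a b P \<theta> w) \<bullet> inc a b w)" by blast
  have "(\<lambda>w. shift T b (z *\<^sub>R inc a b w) (push a b P \<theta> w)) = push a b P (z + \<theta>)" for z
    by (rule ext) (rule push_add[OF P ab])
  with * have "((\<lambda>z. G b x (law (push a b P (z + \<theta>)))) has_real_derivative
        (\<integral>w. Gm b x (law (push a b P \<theta>)) (push a b P \<theta> w) \<bullet> inc a b w \<partial>M)) (at 0)" by simp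
  then show "((\<lambda>\<theta>. G b x (law (push a b P \<theta>))) has_real_derivative
        (\<integral>w. Gm b x (law (push a b P \<theta>)) (push a b P \<theta> w) \<bullet> inc a b w \<partial>M)) (at \<theta>)"
    using DERIV_shift[of "\<lambda>\<theta>. G b x (law (push a b P \<theta>))" _ 0 \<theta>] by simp
qed

text \<open>The derivative in \<theta> is the mean of the measure derivative, taken at the
  interpolated state, paired with \<Delta>. Its value with last argument P contributes mean zero,
  and the change of the last argument away from P contributes \<theta> times a quadratic form in
  \<Delta>. The second order thus comes from the last argument alone.\<close>

lemma law_expansion:
  assumes P: "stepper a P" and ab: "a < b" "b \<le> T" and x: "x \<in> D"
  shows "\<exists>e \<theta>. law_rem a b P x \<theta> e"
proof -
  note r = ab_range[OF P ab]
  have inc: "increment a b (inc a b)" by (rule inc_increment[OF r(4) ab])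
  define L where "L \<theta> = law (push a b P \<theta>)" for \<theta>
  have L0: "L 0 = law P" unfolding L_def push_zero[OF P ab] ..
  have dP: "dominated P" by (rule stepper_dominated[OF P])
  define Q where "Q w = Gwm b x (law P) (P w)" for w
  define c where "c = (b - a) * (\<integral>w. trace (Q w) \<partial>M)"
  have Qm: "(\<lambda>w. Q w $ i $ j) \<in> borel_measurable (Fil a)" for i j
    unfolding Q_def by (rule tameD[OF stepperD(5)[OF P] seq_cont4_sup[OF seq_cont4_nth[OF seq_cont4_nth[OF smoothD(11)]] r(3) dP x]])
  have Qi: "integrable M (\<lambda>w. Q w $ i $ j)" for i j
    unfolding Q_def by (rule integrable4[OF seq_cont4_nth[OF seq_cont4_nth[OF smoothD(11)]] growth4_nth[OF growth4_nth[OF smoothD(17)]] r(3) x stepperD(6)[OF P] dP dP])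
  note quad = increment_quadratic[OF inc Qm Qi]
  let ?D = "\<lambda>\<theta>. \<integral>w. Gm b x (L \<theta>) (push a b P \<theta> w) \<bullet> inc a b w \<partial>M"
  \<comment> \<open>Subtracting \<theta>^2 c / 2, whose derivative is \<theta> c, makes the mean
    value theorem return exactly the deviation from the expected second-order term c / 2.\<close>
  have der: "((\<lambda>\<theta>. G b x (L \<theta>) - \<theta>\<^sup>2 / 2 * c) has_real_derivative ?D \<theta> - \<theta> * c) (at \<theta>)" if "0 \<le> \<theta>" "\<theta> \<le> 1" for \<theta>
    using law_deriv(2)[OF P ab x that] unfolding L_def by (auto intro!: derivative_eq_intros)
  obtain \<theta> where \<theta>: "0 < \<theta>" "\<theta> < 1"
     "(G b x (L 1) - 1\<^sup>2 / 2 * c) - (G b x (L 0) - 0\<^sup>2 / 2 * c) = (1 - 0) * (?D \<theta> - \<theta> * c)"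
    using MVT2[of 0 1 "\<lambda>\<theta>. G b x (L \<theta>) - \<theta>\<^sup>2 / 2 * c" "\<lambda>\<theta>. ?D \<theta> - \<theta> * c"] der by auto
  have d\<theta>: "dominated (push a b P \<theta>)" by (rule push_dominated[OF P ab]) (use \<theta> in auto)
  have LP: "L \<theta> \<in> PL" unfolding L_def by (rule dominated_law[OF d\<theta>])
  have Vm: "(\<lambda>w. Gm b x (L \<theta>) (P w) $ i) \<in> borel_measurable (Fil a)" for i
    unfolding L_def by (rule tameD[OF stepperD(5)[OF P] seq_cont4_sup[OF seq_cont4_nth[OF smoothD(10)] r(3) d\<theta> x]])
  have Vi: "integrable M (\<lambda>w. Gm b x (L \<theta>) (P w) $ i)" for i
    unfolding L_def by (rule integrable4[OF seq_cont4_nth[OF smoothD(10)] growth4_nth[OF smoothD(16)] r(3) x stepperD(6)[OF P] dP d\<theta>])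
  note mean = increment_mean[OF inc Vm Vi]
  define rem where "rem w = Gm b x (L \<theta>) (push a b P \<theta> w) \<bullet> inc a b w - Gm b x (L \<theta>) (P w) \<bullet> inc a b w
     - \<theta> * (inc a b w \<bullet> (Q w *v inc a b w))" for w
  define e where "e w = rem w / (norm (inc a b w))\<^sup>2" for w
  have Gi: "integrable M (\<lambda>w. Gm b x (L \<theta>) (push a b P \<theta> w) \<bullet> inc a b w)"
    unfolding L_def by (rule law_deriv(1)[OF P ab x]) (use \<theta> in auto)
  have remi: "integrable M rem" unfolding rem_def[abs_def]
    by (intro Bochner_Integration.integrable_diff Gi mean(1) integrable_mult_right quad(1))
  have nm: "(\<lambda>w. (norm (inc a b w))\<^sup>2) \<in> borel_measurable M"
    using increment_measurable[OF inc] by measurable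
  have em: "e \<in> borel_measurable M" unfolding e_def[abs_def]
    using borel_measurable_integrable[OF remi] nm by (intro borel_measurable_divide)
  have eb: "\<exists>\<theta>'. 0 \<le> \<theta>' \<and> \<theta>' \<le> 1 \<and> \<bar>e w\<bar> \<le> norm (Gwm b x (L \<theta>) (push a b P \<theta>' w) - Q w)"
    and er: "e w * (norm (inc a b w))\<^sup>2 = rem w" if w: "w \<in> space M" for w
  proof -
    have pD: "shift T b (\<theta> *\<^sub>R inc a b w) (P w) \<in> D" for \<theta> using push_D[OF P ab w] by (simp add: push_def)
    obtain \<theta>' where \<theta>': "0 < \<theta>'" "\<theta>' < \<theta>" "(Gm b x (L \<theta>) (shift T b (\<theta> *\<^sub>R inc a b w) (P w)) - Gm b x (L \<theta>) (P w)) \<bullet> inc a b w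
        = \<theta> * (inc a b w \<bullet> (Gwm b x (L \<theta>) (shift T b (\<theta>' *\<^sub>R inc a b w) (P w)) *v inc a b w))"
      using path_mean_value[of T b "Gm b x (L \<theta>)" "inc a b w" "P w" "Gwm b x (L \<theta>)",
          OF smoothD(5)[OF r(3) x LP pD] \<theta>(1)] by blast
    let ?Q = "Gwm b x (L \<theta>) (push a b P \<theta>' w) - Q w"
    have rq: "rem w = \<theta> * (inc a b w \<bullet> (?Q *v inc a b w))"
      using \<theta>'(3) by (simp add: rem_def push_def matrix_vector_mult_diff_rdistrib inner_diff_right inner_diff_left right_diff_distrib)
    have "\<bar>rem w\<bar> \<le> 1 * (norm ?Q * (norm (inc a b w))\<^sup>2)"
      unfolding rq abs_mult using \<theta>(1,2) by (intro mult_mono quadratic_form_le) auto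
    then have "\<bar>e w\<bar> \<le> norm ?Q" unfolding e_def
      by (cases "inc a b w = 0") (simp_all add: abs_divide pos_divide_le_eq)
    then show "\<exists>\<theta>'. 0 \<le> \<theta>' \<and> \<theta>' \<le> 1 \<and> \<bar>e w\<bar> \<le> norm (Gwm b x (L \<theta>) (push a b P \<theta>' w) - Q w)"
      using \<theta>(1,2) \<theta>'(1,2) by (intro exI[of _ \<theta>']) auto
    show "e w * (norm (inc a b w))\<^sup>2 = rem w" using rq unfolding e_def by (cases "inc a b w = 0") simp_all
  qed
  have "(\<integral>w. e w * (norm (inc a b w))\<^sup>2 \<partial>M) = (\<integral>w. rem w \<partial>M)"
    by (rule Bochner_Integration.integral_cong) (simp_all add: er)
  also have "\<dots> = ?D \<theta> - 0 - \<theta> * c"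
    unfolding rem_def using Gi mean quad by (simp add: c_def)
  finally have "(\<integral>w. e w * (norm (inc a b w))\<^sup>2 \<partial>M) = ?D \<theta> - \<theta> * c" by simp
  then have "G b x (L 1) - G b x (L 0) = c / 2 + (\<integral>w. e w * (norm (inc a b w))\<^sup>2 \<partial>M)"
    using \<theta>(3) by simp
  then have "G b x (law (push a b P 1)) - G b x (law P)
        = (b - a) * (1/2 * (\<integral>w. trace (Gwm b x (law P) (P w)) \<partial>M)) + (\<integral>w. e w * (norm (inc a b w))\<^sup>2 \<partial>M)"
    unfolding L0 by (simp add: L_def c_def Q_def)
  moreover have "\<forall>w\<in>space M. \<exists>\<theta>'. 0 \<le> \<theta>' \<and> \<theta>' \<le> 1 \<and>
        \<bar>e w\<bar> \<le> norm (Gwm b x (law (push a b P \<theta>)) (push a b P \<theta>' w) - Gwm b x (law P) (P w))"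
    using eb unfolding L_def Q_def by blast
  ultimately show ?thesis using em \<theta>(1,2) unfolding law_rem_def by (intro exI[of _ e] exI[of _ \<theta>]) auto
qed

lemma space_remD:
  assumes "space_rem a b P L e"
  shows "e \<in> borel_measurable M"
    "\<And>w. w \<in> space M \<Longrightarrow> \<exists>\<theta>. 0 \<le> \<theta> \<and> \<theta> \<le> 1 \<and> \<bar>e w\<bar> \<le> norm (Gww b (push a b P \<theta> w) L - Gww b (P w) L)"
    "integrable M (\<lambda>w. e w * (norm (inc a b w))\<^sup>2) \<Longrightarrow>
       (\<integral>w. G b (push a b P 1 w) L - G b (P w) L \<partial>M)
        = (b - a) * (1/2 * (\<integral>w. trace (Gww b (P w) L) \<partial>M)) + (\<integral>w. e w * (norm (inc a b w))\<^sup>2 \<partial>M)"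
  using assms unfolding space_rem_def by blast+

lemma law_remD:
  assumes "law_rem a b P x \<theta> e"
  shows "0 \<le> \<theta>" "\<theta> \<le> 1" "e \<in> borel_measurable M"
    "\<And>w. w \<in> space M \<Longrightarrow> \<exists>\<theta>'. 0 \<le> \<theta>' \<and> \<theta>' \<le> 1 \<and>
        \<bar>e w\<bar> \<le> norm (Gwm b x (law (push a b P \<theta>)) (push a b P \<theta>' w) - Gwm b x (law P) (P w))"
    "integrable M (\<lambda>w. e w * (norm (inc a b w))\<^sup>2) \<Longrightarrow>
       G b x (law (push a b P 1)) - G b x (law P)
        = (b - a) * (1/2 * (\<integral>w. trace (Gwm b x (law P) (P w)) \<partial>M)) + (\<integral>w. e w * (norm (inc a b w))\<^sup>2 \<partial>M)"
  using assms unfolding law_rem_def by blast+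

end

lemma mult_add_divide: "h \<noteq> 0 \<Longrightarrow> (h * c + R) / h = c + R / h" for h c R :: real
  by (simp add: add_divide_distrib)

context basis
begin

lemma remainder_integrable:
  fixes e Y :: "'w \<Rightarrow> real"
  assumes "increment a b \<Delta>" "e \<in> borel_measurable M" "integrable M (\<lambda>w. (Y w)\<^sup>2)"
    "\<And>w. w \<in> space M \<Longrightarrow> \<bar>e w\<bar> \<le> Y w"
  shows "integrable M (\<lambda>w. e w * (norm (\<Delta> w))\<^sup>2)"
proof -
  obtain C4 where C4b: "\<forall>a b \<Delta> e Y \<rho>. increment a b \<Delta> \<longrightarrow> e \<in> borel_measurable M \<longrightarrow> integrable M (\<lambda>w. (Y w)\<^sup>2) \<longrightarrow>
     (\<forall>w\<in>space M. \<bar>e w\<bar> \<le> Y w) \<longrightarrow> 0 < \<rho> \<longrightarrow>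
     integrable M (\<lambda>w. (e w)\<^sup>2) \<and> integrable M (\<lambda>w. e w * (norm (\<Delta> w))\<^sup>2) \<and>
     \<bar>\<integral>w. e w * (norm (\<Delta> w))\<^sup>2 \<partial>M\<bar> \<le> (b - a) * (\<rho> * (\<integral>w. (e w)\<^sup>2 \<partial>M) + C4 / \<rho>)"
    using remainder_bound by (elim exE conjE) (rule that)
  from C4b[rule_format, OF assms zero_less_one] show ?thesis by blast
qed

end

section \<open>Bounds and limits for the three parts of one step: time, law and path\<close>

context smooth_process
begin

abbreviation LX :: "'d law" where "LX \<equiv> law X"

lemma X_tame: "tame M X"
  by (rule tame_cpaths[OF X_cpaths]) (use measurable_path_coordD[OF X_measurable] in auto)

lemma time_bound:
  "\<exists>C k. 0 \<le> C \<and> (\<forall>a b P. \<forall>w\<in>space M. stepper a P \<longrightarrow> a < b \<longrightarrow> b \<le> T \<longrightarrow>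
     \<bar>time_quot a b P w\<bar> \<le> C * (1 + 3 * S w) ^ k)"
proof -
  obtain C k where C: "0 \<le> C" "\<And>u \<omega> Z. u \<in> {0..T} \<Longrightarrow> \<omega> \<in> D \<Longrightarrow> dominated Z \<Longrightarrow>
     norm (Gt u \<omega> (law Z)) \<le> C * (1 + sup_norm T \<omega>) ^ k" using growth3_bound[OF smoothD(13)] by blast
  show ?thesis
  proof (intro exI[of _ "C + 1"] exI[of _ k] conjI allI ballI impI)
    fix a b P w assume w: "w \<in> space M" and P: "stepper a P" and ab: "a < b" "b \<le> T"
    have dP: "dominated P" by (rule stepper_dominated[OF P])
    obtain r where r: "a \<le> r" "r < b" "\<bar>time_quot a b P w - 0\<bar> \<le> \<bar>Gt r (P w) (law P) - 0\<bar> + 1"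
      using time_mean_value[OF P ab w, of 1 0] by auto
    have r0: "r \<in> {0..T}" using r ab stepperD(3)[OF P] by auto
    have "\<bar>Gt r (P w) (law P)\<bar> \<le> C * (1 + sup_norm T (P w)) ^ k"
      using C(2)[OF r0 stepperD(7)[OF P w] dP] by simp
    also have "\<dots> \<le> C * (1 + 3 * S w) ^ k" by (intro mult_left_mono dominated_power[OF dP w] C(1))
    finally have "\<bar>time_quot a b P w\<bar> \<le> C * (1 + 3 * S w) ^ k + 1" using r(3) by simp
    moreover have "1 \<le> (1 + 3 * S w) ^ k" using S_nonneg[OF w] by (intro one_le_power) simp
    ultimately show "\<bar>time_quot a b P w\<bar> \<le> (C + 1) * (1 + 3 * S w) ^ k" by (simp add: distrib_right)
  qed (use C(1) in simp)
qed

lemma time_limit: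
  assumes A: "approx s a b P" and w: "w \<in> space M"
  shows "(\<lambda>n. time_quot (a n) (b n) (P n) w) \<longlonglongrightarrow> Gt s (X w) LX"
proof -
  let ?k = "Gt s (X w) LX"
  \<comment> \<open>The slack of the mean value inequality is taken to be 1 / (n + 1), so that it
    disappears in the limit.\<close>
  have "\<exists>r. a n \<le> r \<and> r < b n \<and> \<bar>time_quot (a n) (b n) (P n) w - ?k\<bar> \<le> \<bar>Gt r (P n w) (law (P n)) - ?k\<bar> + inverse (real (Suc n))" for n
    by (rule time_mean_value[OF approxD(7,3,4)[OF A] w]) simp
  then obtain r where r: "\<And>n. a n \<le> r n" "\<And>n. r n < b n"
     "\<And>n. \<bar>time_quot (a n) (b n) (P n) w - ?k\<bar> \<le> \<bar>Gt (r n) (P n w) (law (P n)) - ?k\<bar> + inverse (real (Suc n))" by metis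
  have "hat_conv r (\<lambda>n. P n w) (\<lambda>n. law (P n)) s (X w) LX"
    by (rule approx_hat[OF A X_D[OF w] stepperD(7)[OF approxD(7)[OF A] w] approx_path[OF A w r(1)] r(1) less_imp_le[OF r(2)]])
  from seq_cont3D[OF smoothD(7) this] have "(\<lambda>n. Gt (r n) (P n w) (law (P n)) - ?k) \<longlonglongrightarrow> 0" by (rule LIM_zero)
  from tendsto_add[OF tendsto_rabs_zero[OF this] LIMSEQ_inverse_real_of_nat]
  have "(\<lambda>n. \<bar>Gt (r n) (P n w) (law (P n)) - ?k\<bar> + inverse (real (Suc n))) \<longlonglongrightarrow> 0" by simp
  then have "(\<lambda>n. \<bar>time_quot (a n) (b n) (P n) w - ?k\<bar>) \<longlonglongrightarrow> 0" by (rule squeeze_zero[rotated 2]) (rule abs_ge_zero, rule r(3))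
  then show ?thesis by (rule LIM_zero_cancel[OF tendsto_rabs_zero_cancel])
qed

lemma poly_sq: "integrable M (\<lambda>w. (c * (1 + 3 * S w) ^ k)\<^sup>2)"
  using S_poly[of "k * 2"] by (simp add: power_mult_distrib power_mult)

lemma dominated_convergence_poly:
  assumes m: "\<And>n. f n \<in> borel_measurable M" and le: "\<And>n w. w \<in> space M \<Longrightarrow> \<bar>f n w\<bar> \<le> C * (1 + 3 * S w) ^ k"
    and lim: "\<And>w. w \<in> space M \<Longrightarrow> (\<lambda>n. f n w) \<longlonglongrightarrow> g w"
  shows "(\<lambda>n. \<integral>w. f n w \<partial>M) \<longlonglongrightarrow> (\<integral>w. g w \<partial>M)"
proof (rule integral_dominated_convergence[where w = "\<lambda>w. C * (1 + 3 * S w) ^ k"])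
  show "g \<in> borel_measurable M" by (rule borel_measurable_LIMSEQ_real[OF lim m])
qed (use m le lim integrable_mult_right[OF S_poly] in \<open>auto intro!: AE_I2\<close>)

lemma space_limit:
  assumes A: "approx s a b P"
  defines "L n \<equiv> law (push (a n) (b n) (P n) 1)"
  shows "(\<lambda>n. (\<integral>w. G (b n) (push (a n) (b n) (P n) 1 w) (L n) - G (b n) (P n w) (L n) \<partial>M) / (b n - a n))
     \<longlonglongrightarrow> 1/2 * (\<integral>w. trace (Gww s (X w) LX) \<partial>M)"
proof -
  note D = approxD[OF A]
  have dP: "dominated (P n)" for n by (rule stepper_dominated[OF D(7)])
  have dL: "dominated (push (a n) (b n) (P n) 1)" for n by (rule push_dominated[OF D(7,3,4)]) auto
  have inc: "increment (a n) (b n) (inc (a n) (b n))" for n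
    by (rule inc_increment[OF stepperD(1)[OF D(7)] D(3,4)])
  obtain C k where C: "0 \<le> C" "\<And>u \<omega> Z. u \<in> {0..T} \<Longrightarrow> \<omega> \<in> D \<Longrightarrow> dominated Z \<Longrightarrow>
     norm (Gww u \<omega> (law Z)) \<le> C * (1 + sup_norm T \<omega>) ^ k" using growth3_bound[OF smoothD(15)] by blast
  have Cb: "norm (Gww (b n) (Z w) (L n)) \<le> C * (1 + 3 * S w) ^ k" if "w \<in> space M" "dominated Z" for n w Z
  proof -
    have "norm (Gww (b n) (Z w) (L n)) \<le> C * (1 + sup_norm T (Z w)) ^ k"
      unfolding L_def by (rule C(2)[OF b_range[OF A] dominatedD(2)[OF that(2,1)] dL])
    also have "\<dots> \<le> C * (1 + 3 * S w) ^ k" by (intro mult_left_mono dominated_power[OF that(2,1)] C(1))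
    finally show ?thesis .
  qed
  have "\<forall>n. \<exists>e. space_rem (a n) (b n) (P n) (L n) e"
    unfolding L_def using space_expansion[OF D(7,3,4)] by blast
  then obtain e where e0: "\<And>n. space_rem (a n) (b n) (P n) (L n) (e n)" by metis
  note e = space_remD[OF e0]
  have eY: "\<bar>e n w\<bar> \<le> (2 * C) * (1 + 3 * S w) ^ k" if w: "w \<in> space M" for n w
  proof -
    obtain \<theta> where \<theta>: "0 \<le> \<theta>" "\<theta> \<le> 1" "\<bar>e n w\<bar> \<le> norm (Gww (b n) (push (a n) (b n) (P n) \<theta> w) (L n) - Gww (b n) (P n w) (L n))"
      using e(2)[OF w] by blast
    have "\<bar>e n w\<bar> \<le> norm (Gww (b n) (push (a n) (b n) (P n) \<theta> w) (L n)) + norm (Gww (b n) (P n w) (L n))"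
      using \<theta>(3) norm_triangle_ineq4 by (rule order_trans)
    then show ?thesis using Cb[OF w push_dominated[OF D(7)[of n] D(3)[of n] D(4)[of n] \<theta>(1,2)], of n] Cb[OF w dP[of n], of n] by linarith
  qed
  have Plim: "(\<lambda>n. Gww (b n) (P n w) (L n)) \<longlonglongrightarrow> Gww s (X w) LX" if w: "w \<in> space M" for w
    unfolding L_def
    by (rule seq_cont3D[OF smoothD(9) approx_push_hat[OF A X_D[OF w] stepperD(7)[OF D(7) w] approx_path[OF A w]]])
       (use D(3) in \<open>auto intro: less_imp_le\<close>)
  have elim: "(\<lambda>n. e n w) \<longlonglongrightarrow> 0" if w: "w \<in> space M" for w
  proof -
    obtain \<theta> where \<theta>: "\<And>n. 0 \<le> \<theta> n" "\<And>n. \<theta> n \<le> 1"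
      "\<And>n. \<bar>e n w\<bar> \<le> norm (Gww (b n) (push (a n) (b n) (P n) (\<theta> n) w) (L n) - Gww (b n) (P n w) (L n))"
      using e(2)[OF w] by metis
    have "(\<lambda>n. Gww (b n) (push (a n) (b n) (P n) (\<theta> n) w) (L n)) \<longlonglongrightarrow> Gww s (X w) LX"
      unfolding L_def
      by (rule seq_cont3D[OF smoothD(9) approx_push_hat[OF A X_D[OF w] push_D[OF D(7,3,4) w] approx_push_path[OF A w \<theta>(1,2)]]]) auto
    from tendsto_norm_zero[OF LIM_zero[OF tendsto_diff[OF this Plim[OF w]]]]
    have "(\<lambda>n. norm (Gww (b n) (push (a n) (b n) (P n) (\<theta> n) w) (L n) - Gww (b n) (P n w) (L n))) \<longlonglongrightarrow> 0" by simp
    then have "(\<lambda>n. \<bar>e n w\<bar>) \<longlonglongrightarrow> 0" by (rule squeeze_zero[rotated 2]) (rule abs_ge_zero, rule \<theta>(3))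
    then show ?thesis by (rule tendsto_rabs_zero_cancel)
  qed
  have ei: "integrable M (\<lambda>w. e n w * (norm (inc (a n) (b n) w))\<^sup>2)" for n
    by (rule remainder_integrable[OF inc e(1) poly_sq eY])
  have R: "(\<lambda>n. (\<integral>w. e n w * (norm (inc (a n) (b n) w))\<^sup>2 \<partial>M) / (b n - a n)) \<longlonglongrightarrow> 0"
    by (rule remainder_tendsto[OF inc e(1) poly_sq eY elim])
  have Q: "(\<lambda>n. \<integral>w. trace (Gww (b n) (P n w) (L n)) \<partial>M) \<longlonglongrightarrow> (\<integral>w. trace (Gww s (X w) LX) \<partial>M)"
  proof (rule dominated_convergence_poly)
    show "(\<lambda>w. trace (Gww (b n) (P n w) (L n))) \<in> borel_measurable M" for n
      unfolding L_def by (rule tameD[OF stepperD(6)[OF D(7)] seq_cont3_sup[OF seq_cont3_trace[OF smoothD(9)] b_range[OF A] dL]])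
    fix n w assume w: "w \<in> space M"
    have "\<bar>trace (Gww (b n) (P n w) (L n))\<bar> \<le> real CARD('d) * norm (Gww (b n) (P n w) (L n))" by (rule abs_trace_le)
    also have "\<dots> \<le> real CARD('d) * (C * (1 + 3 * S w) ^ k)" by (intro mult_left_mono Cb[OF w dP]) simp
    finally show "\<bar>trace (Gww (b n) (P n w) (L n))\<bar> \<le> (real CARD('d) * C) * (1 + 3 * S w) ^ k" by (simp add: mult.assoc)
  next
    fix w assume "w \<in> space M"
    from tendsto_trace[OF Plim[OF this]] show "(\<lambda>n. trace (Gww (b n) (P n w) (L n))) \<longlonglongrightarrow> trace (Gww s (X w) LX)" .
  qed
  have "(\<integral>w. G (b n) (push (a n) (b n) (P n) 1 w) (L n) - G (b n) (P n w) (L n) \<partial>M) / (b n - a n)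
    = 1/2 * (\<integral>w. trace (Gww (b n) (P n w) (L n)) \<partial>M) + (\<integral>w. e n w * (norm (inc (a n) (b n) w))\<^sup>2 \<partial>M) / (b n - a n)" for n
    unfolding e(3)[OF ei] by (rule mult_add_divide) (use D(3)[of n] in simp)
  then show ?thesis using tendsto_add[OF tendsto_mult_left[OF Q, of "1/2"] R] by simp
qed

lemma space_bound:
  "\<exists>C\<ge>0. \<forall>a b P. stepper a P \<longrightarrow> a < b \<longrightarrow> b \<le> T \<longrightarrow>
     \<bar>\<integral>w. G b (push a b P 1 w) (law (push a b P 1)) - G b (P w) (law (push a b P 1)) \<partial>M\<bar> \<le> C * (b - a)"
proof -
  obtain C k where C: "0 \<le> C" "\<And>u \<omega> Z. u \<in> {0..T} \<Longrightarrow> \<omega> \<in> D \<Longrightarrow> dominated Z \<Longrightarrow>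
     norm (Gww u \<omega> (law Z)) \<le> C * (1 + sup_norm T \<omega>) ^ k" using growth3_bound[OF smoothD(15)] by blast
  obtain C4 where C4: "C4 \<ge> 0" and C4b: "\<forall>a b \<Delta> e Y \<rho>. increment a b \<Delta> \<longrightarrow> e \<in> borel_measurable M \<longrightarrow> integrable M (\<lambda>w. (Y w)\<^sup>2) \<longrightarrow>
     (\<forall>w\<in>space M. \<bar>e w\<bar> \<le> Y w) \<longrightarrow> 0 < \<rho> \<longrightarrow>
     integrable M (\<lambda>w. (e w)\<^sup>2) \<and> integrable M (\<lambda>w. e w * (norm (\<Delta> w))\<^sup>2) \<and>
     \<bar>\<integral>w. e w * (norm (\<Delta> w))\<^sup>2 \<partial>M\<bar> \<le> (b - a) * (\<rho> * (\<integral>w. (e w)\<^sup>2 \<partial>M) + C4 / \<rho>)"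
    using remainder_bound by (elim exE conjE) (rule that)
  define d where "d = real CARD('d)"
  define K1 where "K1 = (\<integral>w. (1 + 3 * S w) ^ k \<partial>M)"
  define K2 where "K2 = (\<integral>w. ((2 * C) * (1 + 3 * S w) ^ k)\<^sup>2 \<partial>M)"
  have K1: "0 \<le> K1" unfolding K1_def by (intro integral_nonneg_AE AE_I2) (use S_nonneg in auto)
  have K2: "0 \<le> K2" unfolding K2_def by (intro integral_nonneg_AE AE_I2) auto
  show ?thesis
  proof (intro exI[of _ "1/2 * (d * C * K1) + (K2 + C4)"] conjI allI impI)
    show "0 \<le> 1/2 * (d * C * K1) + (K2 + C4)" using K1 K2 C4 C(1) by (simp add: d_def)
    fix a b P assume P: "stepper a P" and ab: "a < b" "b \<le> T"
    define L where "L = law (push a b P 1)"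
    note r = ab_range[OF P ab]
    have dP: "dominated P" by (rule stepper_dominated[OF P])
    have dL: "dominated (push a b P 1)" by (rule push_dominated[OF P ab]) auto
    have inc: "increment a b (inc a b)" by (rule inc_increment[OF r(4) ab])
    have Cb: "norm (Gww b (Z w) L) \<le> C * (1 + 3 * S w) ^ k" if "w \<in> space M" "dominated Z" for w Z
    proof -
      have "norm (Gww b (Z w) L) \<le> C * (1 + sup_norm T (Z w)) ^ k"
        unfolding L_def by (rule C(2)[OF r(3) dominatedD(2)[OF that(2,1)] dL])
      also have "\<dots> \<le> C * (1 + 3 * S w) ^ k" by (intro mult_left_mono dominated_power[OF that(2,1)] C(1))
      finally show ?thesis .
    qed
    obtain e where e0: "space_rem a b P L e" using space_expansion[OF P ab] unfolding L_def by blast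
    note e = space_remD[OF e0]
    have eY: "\<bar>e w\<bar> \<le> (2 * C) * (1 + 3 * S w) ^ k" if w: "w \<in> space M" for w
    proof -
      obtain \<theta> where \<theta>: "0 \<le> \<theta>" "\<theta> \<le> 1" "\<bar>e w\<bar> \<le> norm (Gww b (push a b P \<theta> w) L - Gww b (P w) L)"
        using e(2)[OF w] by blast
      have "\<bar>e w\<bar> \<le> norm (Gww b (push a b P \<theta> w) L) + norm (Gww b (P w) L)"
        using \<theta>(3) norm_triangle_ineq4 by (rule order_trans)
      then show ?thesis using Cb[OF w push_dominated[OF P ab \<theta>(1,2)]] Cb[OF w dP] by linarith
    qed
    have rb: "integrable M (\<lambda>w. (e w)\<^sup>2)" "integrable M (\<lambda>w. e w * (norm (inc a b w))\<^sup>2)"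
      "\<bar>\<integral>w. e w * (norm (inc a b w))\<^sup>2 \<partial>M\<bar> \<le> (b - a) * (1 * (\<integral>w. (e w)\<^sup>2 \<partial>M) + C4 / 1)"
      using C4b[rule_format, OF inc e(1) poly_sq eY zero_less_one] by blast+
    have "(\<integral>w. (e w)\<^sup>2 \<partial>M) \<le> K2" unfolding K2_def
    proof (intro integral_mono rb(1) poly_sq)
      fix w assume "w \<in> space M"
      from power_mono[OF eY[OF this], of 2] show "(e w)\<^sup>2 \<le> (2 * C * (1 + 3 * S w) ^ k)\<^sup>2" by simp
    qed
    then have b1: "\<bar>\<integral>w. e w * (norm (inc a b w))\<^sup>2 \<partial>M\<bar> \<le> (b - a) * (K2 + C4)"
      using rb(3) ab by (intro order_trans[OF rb(3)] mult_left_mono) auto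
    have "\<bar>\<integral>w. trace (Gww b (P w) L) \<partial>M\<bar> \<le> (\<integral>w. (d * C) * (1 + 3 * S w) ^ k \<partial>M)"
    proof (rule order_trans[OF integral_abs_bound], rule integral_mono)
      show "integrable M (\<lambda>w. \<bar>trace (Gww b (P w) L)\<bar>)" unfolding L_def
        by (intro integrable_abs integrable3[OF seq_cont3_trace[OF smoothD(9)] growth3_trace[OF smoothD(15)] r(3) stepperD(6)[OF P] dP dL])
      show "integrable M (\<lambda>w. (d * C) * (1 + 3 * S w) ^ k)" by (intro integrable_mult_right S_poly)
      fix w assume w: "w \<in> space M"
      have "\<bar>trace (Gww b (P w) L)\<bar> \<le> d * norm (Gww b (P w) L)" unfolding d_def by (rule abs_trace_le)
      also have "\<dots> \<le> d * (C * (1 + 3 * S w) ^ k)" by (intro mult_left_mono Cb[OF w dP]) (simp add: d_def)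
      finally show "\<bar>trace (Gww b (P w) L)\<bar> \<le> (d * C) * (1 + 3 * S w) ^ k" by (simp add: mult.assoc)
    qed
    then have b2: "\<bar>\<integral>w. trace (Gww b (P w) L) \<partial>M\<bar> \<le> d * C * K1" by (simp add: K1_def)
    have "\<bar>(b - a) * (1/2 * (\<integral>w. trace (Gww b (P w) L) \<partial>M))\<bar> \<le> (b - a) * (1/2 * (d * C * K1))"
      unfolding abs_mult using ab b2 by (intro mult_mono) auto
    then have "\<bar>\<integral>w. G b (push a b P 1 w) L - G b (P w) L \<partial>M\<bar> \<le> (b - a) * (1/2 * (d * C * K1)) + (b - a) * (K2 + C4)"
      unfolding e(3)[OF rb(2)] using b1 by linarith
    then show "\<bar>\<integral>w. G b (push a b P 1 w) (law (push a b P 1)) - G b (P w) (law (push a b P 1)) \<partial>M\<bar>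
       \<le> (1/2 * (d * C * K1) + (K2 + C4)) * (b - a)" unfolding L_def by (simp add: algebra_simps)
  qed
qed

text \<open>The path argument is a deterministic sequence here. In \<open>step_limit\<close> it is
  the step process at a fixed w, which keeps it separate from the copy that is integrated.\<close>

lemma law_limit:
  assumes A: "approx s a b P" and x: "x \<in> D" "\<And>n. xn n \<in> D" "(\<lambda>n. path_dist T s x (b n) (xn n)) \<longlonglongrightarrow> 0"
    and R: "\<And>n. sup_norm T (xn n) \<le> R"
  shows "(\<lambda>n. (G (b n) (xn n) (law (push (a n) (b n) (P n) 1)) - G (b n) (xn n) (law (P n))) / (b n - a n))
     \<longlonglongrightarrow> 1/2 * (\<integral>v. trace (Gwm s x LX (X v)) \<partial>M)"
proof -
  note D = approxD[OF A]
  have dP: "dominated (P n)" for n by (rule stepper_dominated[OF D(7)])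
  have inc: "increment (a n) (b n) (inc (a n) (b n))" for n
    by (rule inc_increment[OF stepperD(1)[OF D(7)] D(3,4)])
  obtain C k where C: "0 \<le> C" "\<And>u \<omega> Z v. u \<in> {0..T} \<Longrightarrow> \<omega> \<in> D \<Longrightarrow> dominated Z \<Longrightarrow> v \<in> D \<Longrightarrow>
     norm (Gwm u \<omega> (law Z) v) \<le> C * ((1 + sup_norm T \<omega>) ^ k * (1 + sup_norm T v) ^ k)"
    using growth4_bound[OF smoothD(17)] by blast
  define C' where "C' = C * (1 + R) ^ k"
  have x0: "0 \<le> sup_norm T (xn n)" for n by (rule sup_norm_nonneg[OF x(2) T_nonneg])
  have R0: "0 \<le> R" using x0[of 0] R[of 0] by linarith
  have C'0: "0 \<le> C'" using C(1) R0 by (simp add: C'_def)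
  have Cb: "norm (Gwm (b n) (xn n) (law Z') (Z w)) \<le> C' * (1 + 3 * S w) ^ k"
    if "w \<in> space M" "dominated Z" "dominated Z'" for n w Z Z'
  proof -
    have "norm (Gwm (b n) (xn n) (law Z') (Z w)) \<le> C * ((1 + sup_norm T (xn n)) ^ k * (1 + sup_norm T (Z w)) ^ k)"
      by (rule C(2)[OF b_range[OF A] x(2) that(3) dominatedD(2)[OF that(2,1)]])
    also have "\<dots> \<le> C * ((1 + R) ^ k * (1 + 3 * S w) ^ k)"
      using x0[of n] R[of n] sup_norm_nonneg[OF dominatedD(2)[OF that(2,1)] T_nonneg]
      by (intro mult_left_mono mult_mono power_mono dominated_power[OF that(2,1)] C(1)) auto
    finally show ?thesis by (simp add: C'_def mult.assoc)
  qed
  have "\<forall>n. \<exists>e \<theta>. law_rem (a n) (b n) (P n) (xn n) \<theta> e"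
    using law_expansion[OF D(7,3,4) x(2)] by blast
  then obtain e \<theta> where e0: "\<And>n. law_rem (a n) (b n) (P n) (xn n) (\<theta> n) (e n)" by metis
  note e = law_remD[OF e0]
  have dT: "dominated (push (a n) (b n) (P n) (\<theta> n))" for n by (rule push_dominated[OF D(7,3,4) e(1,2)])
  have eY: "\<bar>e n w\<bar> \<le> (2 * C') * (1 + 3 * S w) ^ k" if w: "w \<in> space M" for n w
  proof -
    obtain \<theta>' where \<theta>: "0 \<le> \<theta>'" "\<theta>' \<le> 1" "\<bar>e n w\<bar> \<le> norm (Gwm (b n) (xn n) (law (push (a n) (b n) (P n) (\<theta> n))) (push (a n) (b n) (P n) \<theta>' w) - Gwm (b n) (xn n) (law (P n)) (P n w))"
      using e(4)[OF w] by blast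
    have "\<bar>e n w\<bar> \<le> norm (Gwm (b n) (xn n) (law (push (a n) (b n) (P n) (\<theta> n))) (push (a n) (b n) (P n) \<theta>' w)) + norm (Gwm (b n) (xn n) (law (P n)) (P n w))"
      using \<theta>(3) norm_triangle_ineq4 by (rule order_trans)
    then show ?thesis using Cb[OF w push_dominated[OF D(7)[of n] D(3)[of n] D(4)[of n] \<theta>(1,2)] dT[of n], of n] Cb[OF w dP[of n] dP[of n], of n] by linarith
  qed
  have Plim: "(\<lambda>n. Gwm (b n) (xn n) (law (P n)) (P n w)) \<longlonglongrightarrow> Gwm s x LX (X w)" if w: "w \<in> space M" for w
    by (rule seq_cont4D[OF smoothD(11) approx_hat[OF A x] X_D[OF w] stepperD(7)[OF D(7) w] approx_path[OF A w]])
       (use D(3) in \<open>auto intro: less_imp_le\<close>)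
  have elim: "(\<lambda>n. e n w) \<longlonglongrightarrow> 0" if w: "w \<in> space M" for w
  proof -
    obtain \<theta>' where \<theta>: "\<And>n. 0 \<le> \<theta>' n" "\<And>n. \<theta>' n \<le> 1"
      "\<And>n. \<bar>e n w\<bar> \<le> norm (Gwm (b n) (xn n) (law (push (a n) (b n) (P n) (\<theta> n))) (push (a n) (b n) (P n) (\<theta>' n) w) - Gwm (b n) (xn n) (law (P n)) (P n w))"
      using e(4)[OF w] by metis
    have "(\<lambda>n. Gwm (b n) (xn n) (law (push (a n) (b n) (P n) (\<theta> n))) (push (a n) (b n) (P n) (\<theta>' n) w)) \<longlonglongrightarrow> Gwm s x LX (X w)"
      by (rule seq_cont4D[OF smoothD(11) approx_push_hat[OF A x e(1,2)] X_D[OF w] push_D[OF D(7,3,4) w] approx_push_path[OF A w \<theta>(1,2)]])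
    from tendsto_norm_zero[OF LIM_zero[OF tendsto_diff[OF this Plim[OF w]]]]
    have "(\<lambda>n. norm (Gwm (b n) (xn n) (law (push (a n) (b n) (P n) (\<theta> n))) (push (a n) (b n) (P n) (\<theta>' n) w) - Gwm (b n) (xn n) (law (P n)) (P n w))) \<longlonglongrightarrow> 0" by simp
    then have "(\<lambda>n. \<bar>e n w\<bar>) \<longlonglongrightarrow> 0" by (rule squeeze_zero[rotated 2]) (rule abs_ge_zero, rule \<theta>(3))
    then show ?thesis by (rule tendsto_rabs_zero_cancel)
  qed
  have ei: "integrable M (\<lambda>w. e n w * (norm (inc (a n) (b n) w))\<^sup>2)" for n
    by (rule remainder_integrable[OF inc e(3) poly_sq eY])
  have Rm: "(\<lambda>n. (\<integral>w. e n w * (norm (inc (a n) (b n) w))\<^sup>2 \<partial>M) / (b n - a n)) \<longlonglongrightarrow> 0"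
    by (rule remainder_tendsto[OF inc e(3) poly_sq eY elim])
  have Q: "(\<lambda>n. \<integral>w. trace (Gwm (b n) (xn n) (law (P n)) (P n w)) \<partial>M) \<longlonglongrightarrow> (\<integral>w. trace (Gwm s x LX (X w)) \<partial>M)"
  proof (rule dominated_convergence_poly)
    show "(\<lambda>w. trace (Gwm (b n) (xn n) (law (P n)) (P n w))) \<in> borel_measurable M" for n
      by (rule tameD[OF stepperD(6)[OF D(7)] seq_cont4_sup[OF seq_cont4_trace[OF smoothD(11)] b_range[OF A] dP x(2)]])
    fix n w assume w: "w \<in> space M"
    have "\<bar>trace (Gwm (b n) (xn n) (law (P n)) (P n w))\<bar> \<le> real CARD('d) * norm (Gwm (b n) (xn n) (law (P n)) (P n w))" by (rule abs_trace_le)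
    also have "\<dots> \<le> real CARD('d) * (C' * (1 + 3 * S w) ^ k)" by (intro mult_left_mono Cb[OF w dP dP]) simp
    finally show "\<bar>trace (Gwm (b n) (xn n) (law (P n)) (P n w))\<bar> \<le> (real CARD('d) * C') * (1 + 3 * S w) ^ k" by (simp add: mult.assoc)
  next
    fix w assume "w \<in> space M"
    from tendsto_trace[OF Plim[OF this]] show "(\<lambda>n. trace (Gwm (b n) (xn n) (law (P n)) (P n w))) \<longlonglongrightarrow> trace (Gwm s x LX (X w))" .
  qed
  have "(G (b n) (xn n) (law (push (a n) (b n) (P n) 1)) - G (b n) (xn n) (law (P n))) / (b n - a n)
    = 1/2 * (\<integral>w. trace (Gwm (b n) (xn n) (law (P n)) (P n w)) \<partial>M) + (\<integral>w. e n w * (norm (inc (a n) (b n) w))\<^sup>2 \<partial>M) / (b n - a n)" for n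
    unfolding e(5)[OF ei] by (rule mult_add_divide) (use D(3)[of n] in simp)
  then show ?thesis using tendsto_add[OF tendsto_mult_left[OF Q, of "1/2"] Rm] by simp
qed

lemma law_bound:
  "\<exists>C k. 0 \<le> C \<and> (\<forall>a b P. \<forall>x\<in>D. stepper a P \<longrightarrow> a < b \<longrightarrow> b \<le> T \<longrightarrow>
     \<bar>G b x (law (push a b P 1)) - G b x (law P)\<bar> \<le> C * (1 + sup_norm T x) ^ k * (b - a))"
proof -
  obtain C k where C: "0 \<le> C" "\<And>u \<omega> Z v. u \<in> {0..T} \<Longrightarrow> \<omega> \<in> D \<Longrightarrow> dominated Z \<Longrightarrow> v \<in> D \<Longrightarrow>
     norm (Gwm u \<omega> (law Z) v) \<le> C * ((1 + sup_norm T \<omega>) ^ k * (1 + sup_norm T v) ^ k)"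
    using growth4_bound[OF smoothD(17)] by blast
  obtain C4 where C4: "C4 \<ge> 0" and C4b: "\<forall>a b \<Delta> e Y \<rho>. increment a b \<Delta> \<longrightarrow> e \<in> borel_measurable M \<longrightarrow> integrable M (\<lambda>w. (Y w)\<^sup>2) \<longrightarrow>
     (\<forall>w\<in>space M. \<bar>e w\<bar> \<le> Y w) \<longrightarrow> 0 < \<rho> \<longrightarrow>
     integrable M (\<lambda>w. (e w)\<^sup>2) \<and> integrable M (\<lambda>w. e w * (norm (\<Delta> w))\<^sup>2) \<and>
     \<bar>\<integral>w. e w * (norm (\<Delta> w))\<^sup>2 \<partial>M\<bar> \<le> (b - a) * (\<rho> * (\<integral>w. (e w)\<^sup>2 \<partial>M) + C4 / \<rho>)"
    using remainder_bound by (elim exE conjE) (rule that)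
  define d where "d = real CARD('d)"
  define K1 where "K1 = (\<integral>w. (1 + 3 * S w) ^ k \<partial>M)"
  define K2 where "K2 = (\<integral>w. ((2 * C) * (1 + 3 * S w) ^ k)\<^sup>2 \<partial>M)"
  have K1: "0 \<le> K1" unfolding K1_def by (intro integral_nonneg_AE AE_I2) (use S_nonneg in auto)
  have K2: "0 \<le> K2" unfolding K2_def by (intro integral_nonneg_AE AE_I2) auto
  show ?thesis
  proof (intro exI[of _ "1/2 * (d * C * K1) + (K2 + C4)"] exI[of _ k] conjI allI ballI impI)
    show "0 \<le> 1/2 * (d * C * K1) + (K2 + C4)" using K1 K2 C4 C(1) by (simp add: d_def)
    fix a b P x assume x: "x \<in> D" and P: "stepper a P" and ab: "a < b" "b \<le> T"
    note r = ab_range[OF P ab]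
    define y where "y = (1 + sup_norm T x) ^ k"
    have y: "1 \<le> y" unfolding y_def using sup_norm_nonneg[OF x T_nonneg] by (intro one_le_power) simp
    have dP: "dominated P" by (rule stepper_dominated[OF P])
    have inc: "increment a b (inc a b)" by (rule inc_increment[OF r(4) ab])
    have Cb: "norm (Gwm b x (law Z') (Z w)) \<le> y * (C * (1 + 3 * S w) ^ k)" if "w \<in> space M" "dominated Z" "dominated Z'" for w Z Z'
    proof -
      have "norm (Gwm b x (law Z') (Z w)) \<le> C * (y * (1 + sup_norm T (Z w)) ^ k)"
        unfolding y_def by (rule C(2)[OF r(3) x that(3) dominatedD(2)[OF that(2,1)]])
      also have "\<dots> \<le> C * (y * (1 + 3 * S w) ^ k)"
        using y by (intro mult_left_mono dominated_power[OF that(2,1)] C(1)) auto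
      finally show ?thesis by (simp add: mult_ac)
    qed
    obtain e \<theta> where e0: "law_rem a b P x \<theta> e" using law_expansion[OF P ab x] by blast
    note e = law_remD[OF e0]
    have dT: "dominated (push a b P \<theta>)" by (rule push_dominated[OF P ab e(1,2)])
    have eY: "\<bar>e w\<bar> \<le> y * (2 * C) * (1 + 3 * S w) ^ k" if w: "w \<in> space M" for w
    proof -
      obtain \<theta>' where \<theta>: "0 \<le> \<theta>'" "\<theta>' \<le> 1" "\<bar>e w\<bar> \<le> norm (Gwm b x (law (push a b P \<theta>)) (push a b P \<theta>' w) - Gwm b x (law P) (P w))"
        using e(4)[OF w] by blast
      have "\<bar>e w\<bar> \<le> norm (Gwm b x (law (push a b P \<theta>)) (push a b P \<theta>' w)) + norm (Gwm b x (law P) (P w))"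
        using \<theta>(3) norm_triangle_ineq4 by (rule order_trans)
      then show ?thesis using Cb[OF w push_dominated[OF P ab \<theta>(1,2)] dT] Cb[OF w dP dP] by (simp add: algebra_simps)
    qed
    \<comment> \<open>The weight \<rho> = 1 / y balances the two terms of the remainder bound: e is
      of order y, so both y^2 / y and 1 / (1 / y) are linear in y.\<close>
    have y0: "0 < 1 / y" using y by simp
    have rb: "integrable M (\<lambda>w. (e w)\<^sup>2)" "integrable M (\<lambda>w. e w * (norm (inc a b w))\<^sup>2)"
      "\<bar>\<integral>w. e w * (norm (inc a b w))\<^sup>2 \<partial>M\<bar> \<le> (b - a) * (1 / y * (\<integral>w. (e w)\<^sup>2 \<partial>M) + C4 / (1 / y))"
      using C4b[rule_format, OF inc e(3) poly_sq eY y0] by blast+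
    have "(\<integral>w. (e w)\<^sup>2 \<partial>M) \<le> (\<integral>w. (y * (2 * C) * (1 + 3 * S w) ^ k)\<^sup>2 \<partial>M)"
    proof (intro integral_mono rb(1) poly_sq)
      fix w assume "w \<in> space M"
      from power_mono[OF eY[OF this], of 2] show "(e w)\<^sup>2 \<le> (y * (2 * C) * (1 + 3 * S w) ^ k)\<^sup>2" by simp
    qed
    also have "\<dots> = (\<integral>w. y\<^sup>2 * ((2 * C) * (1 + 3 * S w) ^ k)\<^sup>2 \<partial>M)" by (simp only: power_mult_distrib mult.assoc)
    also have "\<dots> = y\<^sup>2 * K2" unfolding K2_def by simp
    finally have E2: "(\<integral>w. (e w)\<^sup>2 \<partial>M) \<le> y\<^sup>2 * K2" .
    have "1 / y * (\<integral>w. (e w)\<^sup>2 \<partial>M) \<le> 1 / y * (y\<^sup>2 * K2)" using y by (intro mult_left_mono E2) auto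
    then have "1 / y * (\<integral>w. (e w)\<^sup>2 \<partial>M) + C4 / (1 / y) \<le> y * (K2 + C4)"
      using y by (simp add: power2_eq_square algebra_simps)
    then have b1: "\<bar>\<integral>w. e w * (norm (inc a b w))\<^sup>2 \<partial>M\<bar> \<le> (b - a) * (y * (K2 + C4))"
      using ab by (intro order_trans[OF rb(3)] mult_left_mono) auto
    have "\<bar>\<integral>w. trace (Gwm b x (law P) (P w)) \<partial>M\<bar> \<le> (\<integral>w. (y * (d * C)) * (1 + 3 * S w) ^ k \<partial>M)"
    proof (rule order_trans[OF integral_abs_bound], rule integral_mono)
      show "integrable M (\<lambda>w. \<bar>trace (Gwm b x (law P) (P w))\<bar>)"
        by (intro integrable_abs integrable4[OF seq_cont4_trace[OF smoothD(11)] growth4_trace[OF smoothD(17)] r(3) x stepperD(6)[OF P] dP dP])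
      show "integrable M (\<lambda>w. (y * (d * C)) * (1 + 3 * S w) ^ k)" by (intro integrable_mult_right S_poly)
      fix w assume w: "w \<in> space M"
      have "\<bar>trace (Gwm b x (law P) (P w))\<bar> \<le> d * norm (Gwm b x (law P) (P w))" unfolding d_def by (rule abs_trace_le)
      also have "\<dots> \<le> d * (y * (C * (1 + 3 * S w) ^ k))" by (intro mult_left_mono Cb[OF w dP dP]) (simp add: d_def)
      finally show "\<bar>trace (Gwm b x (law P) (P w))\<bar> \<le> (y * (d * C)) * (1 + 3 * S w) ^ k" by (simp add: mult_ac)
    qed
    then have b2: "\<bar>\<integral>w. trace (Gwm b x (law P) (P w)) \<partial>M\<bar> \<le> y * (d * C) * K1" by (simp add: K1_def)
    have "\<bar>(b - a) * (1/2 * (\<integral>w. trace (Gwm b x (law P) (P w)) \<partial>M))\<bar> \<le> (b - a) * (1/2 * (y * (d * C) * K1))"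
      unfolding abs_mult using ab b2 by (intro mult_mono) auto
    then have "\<bar>G b x (law (push a b P 1)) - G b x (law P)\<bar> \<le> (b - a) * (1/2 * (y * (d * C) * K1)) + (b - a) * (y * (K2 + C4))"
      unfolding e(5)[OF rb(2)] using b1 by linarith
    then show "\<bar>G b x (law (push a b P 1)) - G b x (law P)\<bar>
       \<le> (1/2 * (d * C * K1) + (K2 + C4)) * (1 + sup_norm T x) ^ k * (b - a)" unfolding y_def[symmetric] by (simp add: algebra_simps)
  qed
qed

text \<open>The drift of E G(s, X, law X) in Ito's formula; the separate integral over v averages
  over an independent copy of X.\<close>

definition ell :: "real \<Rightarrow> real" where
  "ell s = 1/2 * (\<integral>w. trace (Gww s (X w) LX) \<partial>M) + (\<integral>w. 1/2 * (\<integral>v. trace (Gwm s (X w) LX (X v)) \<partial>M) \<partial>M)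
     + (\<integral>w. Gt s (X w) LX \<partial>M)"

definition step_diff :: "real \<Rightarrow> real \<Rightarrow> ('w \<Rightarrow> 'd path) \<Rightarrow> real" where
  "step_diff a b P = (\<integral>w. G b (push a b P 1 w) (law (push a b P 1)) \<partial>M) - (\<integral>w. G a (P w) (law P) \<partial>M)"

text \<open>Time moves first, with path and law frozen, then the law, then the path. In this order
  the time part falls under the horizontal derivative, and the two spatial parts have their leading
  coefficients evaluated at P, hence known at time a.\<close>

lemma step_decomposition:
  assumes P: "stepper a P" and ab: "a < b" "b \<le> T"
  defines "L \<equiv> law (push a b P 1)"
  shows "step_diff a b P / (b - a) = (\<integral>w. G b (push a b P 1 w) L - G b (P w) L \<partial>M) / (b - a)
     + (\<integral>w. (G b (P w) L - G b (P w) (law P)) / (b - a) \<partial>M) + (\<integral>w. time_quot a b P w \<partial>M)"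
    and "(\<lambda>w. (G b (P w) L - G b (P w) (law P)) / (b - a)) \<in> borel_measurable M"
    and "time_quot a b P \<in> borel_measurable M"
proof -
  note r = ab_range[OF P ab]
  have dP: "dominated P" by (rule stepper_dominated[OF P])
  have dL: "dominated (push a b P 1)" by (rule push_dominated[OF P ab]) auto
  note I = integrable3[OF smoothD(6,12)]
  have i1: "integrable M (\<lambda>w. G b (push a b P 1 w) L)" unfolding L_def by (rule I[OF r(3) push_tame_M[OF P ab] dL dL])
  have i2: "integrable M (\<lambda>w. G b (P w) L)" unfolding L_def by (rule I[OF r(3) stepperD(6)[OF P] dP dL])
  have i3: "integrable M (\<lambda>w. G b (P w) (law P))" by (rule I[OF r(3) stepperD(6)[OF P] dP dP])
  have i4: "integrable M (\<lambda>w. G a (P w) (law P))" by (rule I[OF stepperD(3)[OF P] stepperD(6)[OF P] dP dP])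
  have i23: "integrable M (\<lambda>w. (G b (P w) L - G b (P w) (law P)) / (b - a))"
    by (intro Bochner_Integration.integrable_divide Bochner_Integration.integrable_diff i2 i3)
  then show "(\<lambda>w. (G b (P w) L - G b (P w) (law P)) / (b - a)) \<in> borel_measurable M" by (rule borel_measurable_integrable)
  have i34: "integrable M (time_quot a b P)" unfolding time_quot_def[abs_def]
    by (intro Bochner_Integration.integrable_divide Bochner_Integration.integrable_diff i3 i4)
  then show "time_quot a b P \<in> borel_measurable M" by (rule borel_measurable_integrable)
  have "(\<integral>w. (G b (P w) L - G b (P w) (law P)) / (b - a) \<partial>M) = ((\<integral>w. G b (P w) L \<partial>M) - (\<integral>w. G b (P w) (law P) \<partial>M)) / (b - a)"
    unfolding Bochner_Integration.integral_divide_zero Bochner_Integration.integral_diff[OF i2 i3] ..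
  moreover have "(\<integral>w. time_quot a b P w \<partial>M) = ((\<integral>w. G b (P w) (law P) \<partial>M) - (\<integral>w. G a (P w) (law P) \<partial>M)) / (b - a)"
    unfolding time_quot_def Bochner_Integration.integral_divide_zero Bochner_Integration.integral_diff[OF i3 i4] ..
  ultimately show "step_diff a b P / (b - a) = (\<integral>w. G b (push a b P 1 w) L - G b (P w) L \<partial>M) / (b - a)
     + (\<integral>w. (G b (P w) L - G b (P w) (law P)) / (b - a) \<partial>M) + (\<integral>w. time_quot a b P w \<partial>M)"
    unfolding step_diff_def L_def[symmetric] Bochner_Integration.integral_diff[OF i1 i2]
    by (simp add: diff_divide_distrib)
qed

lemma step_limit:
  assumes A: "approx s a b P"
  shows "(\<lambda>n. step_diff (a n) (b n) (P n) / (b n - a n)) \<longlonglongrightarrow> ell s"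
proof -
  note D = approxD[OF A]
  have dP: "dominated (P n)" for n by (rule stepper_dominated[OF D(7)])
  let ?l = "\<lambda>n w. (G (b n) (P n w) (law (push (a n) (b n) (P n) 1)) - G (b n) (P n w) (law (P n))) / (b n - a n)"
  obtain Ct kt where Ct: "0 \<le> Ct" "\<forall>a b P. \<forall>w\<in>space M. stepper a P \<longrightarrow> a < b \<longrightarrow> b \<le> T \<longrightarrow>
     \<bar>time_quot a b P w\<bar> \<le> Ct * (1 + 3 * S w) ^ kt" using time_bound by blast
  have time: "(\<lambda>n. \<integral>w. time_quot (a n) (b n) (P n) w \<partial>M) \<longlonglongrightarrow> (\<integral>w. Gt s (X w) LX \<partial>M)"
    by (rule dominated_convergence_poly[OF step_decomposition(3)[OF D(7,3,4)] _ time_limit[OF A]])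
       (use Ct(2) D(3,4,7) in blast)
  obtain Cl kl where Cl: "0 \<le> Cl" "\<forall>a b P. \<forall>x\<in>D. stepper a P \<longrightarrow> a < b \<longrightarrow> b \<le> T \<longrightarrow>
     \<bar>G b x (law (push a b P 1)) - G b x (law P)\<bar> \<le> Cl * (1 + sup_norm T x) ^ kl * (b - a)" using law_bound by blast
  have law: "(\<lambda>n. \<integral>w. ?l n w \<partial>M) \<longlonglongrightarrow> (\<integral>w. 1/2 * (\<integral>v. trace (Gwm s (X w) LX (X v)) \<partial>M) \<partial>M)"
  proof (rule dominated_convergence_poly[OF step_decomposition(2)[OF D(7,3,4)]])
    fix n w assume w: "w \<in> space M"
    have h: "0 < b n - a n" using D(3)[of n] by simp
    have "\<bar>G (b n) (P n w) (law (push (a n) (b n) (P n) 1)) - G (b n) (P n w) (law (P n))\<bar> \<le> Cl * (1 + sup_norm T (P n w)) ^ kl * (b n - a n)"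
      using Cl(2) D(3,4,7) stepperD(7)[OF D(7) w] by blast
    then have "\<bar>?l n w\<bar> \<le> Cl * (1 + sup_norm T (P n w)) ^ kl" using h by (simp add: abs_divide pos_divide_le_eq)
    also have "\<dots> \<le> Cl * (1 + 3 * S w) ^ kl" by (intro mult_left_mono dominated_power[OF dP w] Cl(1))
    finally show "\<bar>?l n w\<bar> \<le> Cl * (1 + 3 * S w) ^ kl" .
  next
    fix w assume w: "w \<in> space M"
    show "(\<lambda>n. ?l n w) \<longlonglongrightarrow> 1/2 * (\<integral>v. trace (Gwm s (X w) LX (X v)) \<partial>M)"
      by (rule law_limit[OF A X_D[OF w] stepperD(7)[OF D(7) w] approx_path[OF A w] stepperD(9)[OF D(7) w]])
         (use D(3) in \<open>auto intro: less_imp_le\<close>)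
  qed
  show ?thesis unfolding step_decomposition(1)[OF D(7,3,4)] ell_def
    by (intro tendsto_add space_limit[OF A] law time)
qed

text \<open>\<open>tame\<close> handles one path argument at a time, and here two occur.
  Measurability in w comes instead from writing the inner integral as a pointwise limit of
  difference quotients in the law.\<close>

lemma inner_integrable:
  assumes A: "approx s a b P"
  shows "integrable M (\<lambda>w. 1/2 * (\<integral>v. trace (Gwm s (X w) LX (X v)) \<partial>M))"
proof -
  note D = approxD[OF A]
  have dP: "dominated (P n)" for n by (rule stepper_dominated[OF D(7)])
  let ?l = "\<lambda>n w. (G (b n) (P n w) (law (push (a n) (b n) (P n) 1)) - G (b n) (P n w) (law (P n))) / (b n - a n)"
  obtain Cl kl where Cl: "0 \<le> Cl" "\<forall>a b P. \<forall>x\<in>D. stepper a P \<longrightarrow> a < b \<longrightarrow> b \<le> T \<longrightarrow>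
     \<bar>G b x (law (push a b P 1)) - G b x (law P)\<bar> \<le> Cl * (1 + sup_norm T x) ^ kl * (b - a)" using law_bound by blast
  have bnd: "\<bar>?l n w\<bar> \<le> Cl * (1 + 3 * S w) ^ kl" if w: "w \<in> space M" for n w
  proof -
    have h: "0 < b n - a n" using D(3)[of n] by simp
    have "\<bar>G (b n) (P n w) (law (push (a n) (b n) (P n) 1)) - G (b n) (P n w) (law (P n))\<bar> \<le> Cl * (1 + sup_norm T (P n w)) ^ kl * (b n - a n)"
      using Cl(2) D(3,4,7) stepperD(7)[OF D(7) w] by blast
    then have "\<bar>?l n w\<bar> \<le> Cl * (1 + sup_norm T (P n w)) ^ kl" using h by (simp add: abs_divide pos_divide_le_eq)
    also have "\<dots> \<le> Cl * (1 + 3 * S w) ^ kl" by (intro mult_left_mono dominated_power[OF dP w] Cl(1))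
    finally show ?thesis .
  qed
  have lim: "(\<lambda>n. ?l n w) \<longlonglongrightarrow> 1/2 * (\<integral>v. trace (Gwm s (X w) LX (X v)) \<partial>M)" if w: "w \<in> space M" for w
    by (rule law_limit[OF A X_D[OF w] stepperD(7)[OF D(7) w] approx_path[OF A w] stepperD(9)[OF D(7) w]])
       (use D(3) in \<open>auto intro: less_imp_le\<close>)
  note m = step_decomposition(2)[OF D(7,3,4)]
  show ?thesis
  proof (rule integrable_dominated_convergence[where s = ?l and w = "\<lambda>w. Cl * (1 + 3 * S w) ^ kl"])
    show "(\<lambda>w. 1/2 * (\<integral>v. trace (Gwm s (X w) LX (X v)) \<partial>M)) \<in> borel_measurable M"
      by (rule borel_measurable_LIMSEQ_real[OF lim m])
  qed (use m bnd lim integrable_mult_right[OF S_poly] in \<open>auto intro!: AE_I2\<close>)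
qed

text \<open>One constant for all steps serves as majorant in the passage to the limit over the whole
  time interval.\<close>

lemma step_bound:
  "\<exists>C\<ge>0. \<forall>a b P. stepper a P \<longrightarrow> a < b \<longrightarrow> b \<le> T \<longrightarrow> \<bar>step_diff a b P / (b - a)\<bar> \<le> C"
proof -
  obtain Ct kt where Ct: "0 \<le> Ct" "\<forall>a b P. \<forall>w\<in>space M. stepper a P \<longrightarrow> a < b \<longrightarrow> b \<le> T \<longrightarrow>
     \<bar>time_quot a b P w\<bar> \<le> Ct * (1 + 3 * S w) ^ kt" using time_bound by blast
  obtain Cl kl where Cl: "0 \<le> Cl" "\<forall>a b P. \<forall>x\<in>D. stepper a P \<longrightarrow> a < b \<longrightarrow> b \<le> T \<longrightarrow>
     \<bar>G b x (law (push a b P 1)) - G b x (law P)\<bar> \<le> Cl * (1 + sup_norm T x) ^ kl * (b - a)" using law_bound by blast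
  obtain Cs where Cs: "0 \<le> Cs" "\<forall>a b P. stepper a P \<longrightarrow> a < b \<longrightarrow> b \<le> T \<longrightarrow>
     \<bar>\<integral>w. G b (push a b P 1 w) (law (push a b P 1)) - G b (P w) (law (push a b P 1)) \<partial>M\<bar> \<le> Cs * (b - a)"
    using space_bound by blast
  have ib: "\<bar>\<integral>w. f w \<partial>M\<bar> \<le> C * (\<integral>w. (1 + 3 * S w) ^ k \<partial>M)"
    if "f \<in> borel_measurable M" "\<And>w. w \<in> space M \<Longrightarrow> \<bar>f w\<bar> \<le> C * (1 + 3 * S w) ^ k" for f C k
  proof -
    have i: "integrable M (\<lambda>w. C * (1 + 3 * S w) ^ k)" by (intro integrable_mult_right S_poly)
    have fi: "integrable M f" 
      by (rule Bochner_Integration.integrable_bound[OF i that(1)], intro AE_I2)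
         (use that(2) in \<open>fastforce intro: order_trans[OF _ abs_ge_self]\<close>)
    have "\<bar>\<integral>w. f w \<partial>M\<bar> \<le> (\<integral>w. \<bar>f w\<bar> \<partial>M)" by (rule integral_abs_bound)
    also have "\<dots> \<le> (\<integral>w. C * (1 + 3 * S w) ^ k \<partial>M)" using fi i that(2) by (intro integral_mono) auto
    finally show ?thesis by simp
  qed
  let ?K = "\<lambda>k. \<integral>w. (1 + 3 * S w) ^ k \<partial>M"
  have K: "0 \<le> ?K k" for k by (intro integral_nonneg_AE AE_I2) (use S_nonneg in auto)
  show ?thesis
  proof (intro exI[of _ "Cs + Cl * ?K kl + Ct * ?K kt"] conjI allI impI)
    show "0 \<le> Cs + Cl * ?K kl + Ct * ?K kt" using Cs(1) Cl(1) Ct(1) K by simp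
    fix a b P assume P: "stepper a P" and ab: "a < b" "b \<le> T"
    have dP: "dominated P" by (rule stepper_dominated[OF P])
    have h: "0 < b - a" using ab by simp
    have 1: "\<bar>(\<integral>w. G b (push a b P 1 w) (law (push a b P 1)) - G b (P w) (law (push a b P 1)) \<partial>M) / (b - a)\<bar> \<le> Cs"
      using Cs(2) P ab h by (simp add: abs_divide pos_divide_le_eq)
    have 2: "\<bar>\<integral>w. (G b (P w) (law (push a b P 1)) - G b (P w) (law P)) / (b - a) \<partial>M\<bar> \<le> Cl * ?K kl"
    proof (rule ib[OF step_decomposition(2)[OF P ab]])
      fix w assume w: "w \<in> space M"
      have "\<bar>G b (P w) (law (push a b P 1)) - G b (P w) (law P)\<bar> \<le> Cl * (1 + sup_norm T (P w)) ^ kl * (b - a)"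
        using Cl(2) P ab stepperD(7)[OF P w] by blast
      then have "\<bar>(G b (P w) (law (push a b P 1)) - G b (P w) (law P)) / (b - a)\<bar> \<le> Cl * (1 + sup_norm T (P w)) ^ kl"
        using h by (simp add: abs_divide pos_divide_le_eq)
      also have "\<dots> \<le> Cl * (1 + 3 * S w) ^ kl" by (intro mult_left_mono dominated_power[OF dP w] Cl(1))
      finally show "\<bar>(G b (P w) (law (push a b P 1)) - G b (P w) (law P)) / (b - a)\<bar> \<le> Cl * (1 + 3 * S w) ^ kl" .
    qed
    have 3: "\<bar>\<integral>w. time_quot a b P w \<partial>M\<bar> \<le> Ct * ?K kt"
      by (rule ib[OF step_decomposition(3)[OF P ab]]) (use Ct(2) P ab in blast)
    show "\<bar>step_diff a b P / (b - a)\<bar> \<le> Cs + Cl * ?K kl + Ct * ?K kt"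
      unfolding step_decomposition(1)[OF P ab] using 1 2 3 by linarith
  qed
qed

end

section \<open>Summation over the grid and passage to the limit\<close>

section \<open>The expectation formula\<close>

context brownian_process
begin

lemma stepper_start:
  assumes r: "r \<in> {t..T}"
  shows "stepper r (\<lambda>w. stop T r (X w))"
proof -
  have r0: "r \<in> {0..T}" using r t_range by auto
  have coord: "(\<lambda>w. stop T r (X w) s) \<in> borel_measurable (Fil (min s r))" if s: "s \<in> {0..T}" for s
  proof -
    have "(\<lambda>w. X w (min s r)) \<in> borel_measurable (Fil (min s r))"
      using X s r0 unfolding brownian_after_def by auto
    then show ?thesis using s by (simp add: stop_def)
  qed
  show ?thesis unfolding stepper_def
  proof (intro conjI ballI)
    show "t \<le> r" "r \<le> T" using r by auto
    show "adapted_cadlag T M Fil (\<lambda>w. stop T r (X w))"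
      unfolding adapted_cadlag_def
      using cadlag_stop[OF X_D r0] borel_Fil_mono[OF coord min.cobounded1] by blast
    show "tame (Fil r) (\<lambda>w. stop T r (X w))"
    proof (rule tame_cpaths)
      show "stop T r (X w) \<in> cpaths T" if "w \<in> space (Fil r)" for w
        using cpaths_stop[OF X_cpaths r0] that by (simp add: space_F)
      show "(\<lambda>w. stop T r (X w) s) \<in> borel_measurable (Fil r)" if "s \<in> {0..T}" for s
        by (rule borel_Fil_mono[OF coord[OF that] min.cobounded2])
    qed
    fix w assume w: "w \<in> space M"
    show "stop T r (stop T r (X w)) = stop T r (X w)" using r0 by (simp add: stop_stop)
    show "sup_norm T (stop T r (X w)) \<le> S w"
      unfolding S_def using sup_norm_stop_le[OF X_D[OF w] _ T_nonneg] r0 by simp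
  qed
qed

text \<open>A single jump yields only the bound 3 S. The bound S is passed in as a hypothesis, to be
  discharged by the fact that a discretised path takes only values of X.\<close>

lemma stepper_push:
  assumes P: "stepper a P" and ab: "a < b" "b \<le> T"
    and le: "\<And>w. w \<in> space M \<Longrightarrow> sup_norm T (push a b P 1 w) \<le> S w"
  shows "stepper b (push a b P 1)"
  unfolding stepper_def
  using ab_range[OF P ab] ab(2) push_adapted[OF P ab] push_tame[OF P ab] push_stop[OF P ab] le by blast

definition grid :: "real \<Rightarrow> nat \<Rightarrow> nat \<Rightarrow> real" where
  "grid r n j = r + real j * ((T - r) / real (Suc n))"

definition walk :: "real \<Rightarrow> nat \<Rightarrow> nat \<Rightarrow> 'w \<Rightarrow> 'd path" where
  "walk r n j w = disc T (grid r n) (X w) j"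

text \<open>The number of the grid cell that contains s.\<close>

definition idx :: "real \<Rightarrow> nat \<Rightarrow> real \<Rightarrow> nat" where
  "idx r n s = nat \<lfloor>(s - r) / ((T - r) / real (Suc n))\<rfloor>"

context
  fixes r assumes r: "r \<in> {t..<T}"
begin

lemma mesh_pos: "0 < (T - r) / real (Suc n)" using r by simp

lemma grid_0: "grid r n 0 = r" by (simp add: grid_def)

lemma grid_T: "grid r n (Suc n) = T" unfolding grid_def by (simp del: of_nat_Suc)

lemma grid_Suc: "grid r n (Suc j) = grid r n j + (T - r) / real (Suc n)"
  unfolding grid_def of_nat_Suc[of j] by (simp only: distrib_right mult_1 add_ac)

lemma grid_less: "grid r n j < grid r n (Suc j)" unfolding grid_Suc using mesh_pos[of n] by simp

lemma grid_mono: "mono (grid r n)"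
  unfolding mono_iff_le_Suc using grid_less by (auto intro: less_imp_le)

lemma grid_le_T: "j \<le> Suc n \<Longrightarrow> grid r n j \<le> T"
  using monoD[OF grid_mono[of n], of j "Suc n"] grid_T[of n] by simp

lemma grid_ge: "r \<le> grid r n j" using monoD[OF grid_mono, of 0 j] grid_0 by simp

lemma grid_nonneg: "0 \<le> grid r n j" using grid_ge[of n j] r t_range by auto

lemma walk_0: "walk r n 0 = (\<lambda>w. stop T r (X w))"
  by (simp add: walk_def grid_0 fun_eq_iff)

lemma walk_Suc: "walk r n (Suc j) = push (grid r n j) (grid r n (Suc j)) (walk r n j) 1"
  by (simp add: walk_def push_def inc_def fun_eq_iff)

lemma walk_stepper: "j \<le> Suc n \<Longrightarrow> stepper (grid r n j) (walk r n j)"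
proof (induction j)
  case 0 then show ?case using stepper_start[of r] r by (simp add: walk_0 grid_0)
next
  case (Suc j)
  have P: "stepper (grid r n j) (walk r n j)" using Suc by simp
  have le: "grid r n (Suc j) \<le> T" by (rule grid_le_T[OF Suc.prems])
  show ?case unfolding walk_Suc
  proof (rule stepper_push[OF P grid_less le])
    fix w assume w: "w \<in> space M"
    have "sup_norm T (walk r n (Suc j) w) \<le> S w" unfolding walk_def S_def
    proof (rule disc_norm_le[OF X_D[OF w] grid_mono grid_nonneg _ T_nonneg])
      fix i assume "i \<le> Suc j" then show "grid r n i \<le> T" using Suc.prems by (intro grid_le_T) simp
    qed
    then show "sup_norm T (push (grid r n j) (grid r n (Suc j)) (walk r n j) 1 w) \<le> S w" unfolding walk_Suc .
  qed
qed

lemma mesh_tendsto: "(\<lambda>n. (T - r) / real (Suc n)) \<longlonglongrightarrow> 0"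
  using tendsto_mult_right[OF LIMSEQ_inverse_real_of_nat, of "T - r"] by (simp add: divide_inverse mult.commute)

lemma walk_near:
  assumes w: "w \<in> space M" and j: "\<And>n. j n \<le> Suc n"
  shows "(\<lambda>n. sup_norm T (\<lambda>u. walk r n (j n) w u - stop T (grid r n (j n)) (X w) u)) \<longlonglongrightarrow> 0"
proof (rule LIMSEQ_I)
  fix e :: real assume e: "0 < e"
  obtain h where h: "0 < h" "\<And>u v. u \<in> {0..T} \<Longrightarrow> v \<in> {0..T} \<Longrightarrow> \<bar>u - v\<bar> \<le> h \<Longrightarrow> norm (X w u - X w v) \<le> e/2"
    using cpaths_uniform[OF X_cpaths[OF w], of "e/2"] e by auto
  have "\<forall>\<^sub>F n in sequentially. (T - r) / real (Suc n) < h" using mesh_tendsto h(1) by (rule order_tendstoD)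
  then obtain N where N: "\<And>n. n \<ge> N \<Longrightarrow> (T - r) / real (Suc n) < h" unfolding eventually_sequentially by blast
  have "norm (sup_norm T (\<lambda>u. walk r n (j n) w u - stop T (grid r n (j n)) (X w) u) - 0) < e" if n: "n \<ge> N" for n
  proof -
    have "sup_norm T (\<lambda>u. walk r n (j n) w u - stop T (grid r n (j n)) (X w) u) \<le> e / 2"
      unfolding walk_def
    proof (rule disc_near[OF grid_mono grid_nonneg grid_le_T[OF j] _ h T_nonneg])
      fix i show "grid r n (Suc i) \<le> grid r n i + h" unfolding grid_Suc using N[OF n] by simp
    qed
    moreover have "0 \<le> sup_norm T (\<lambda>u. walk r n (j n) w u - stop T (grid r n (j n)) (X w) u)"
    proof (rule sup_norm_nonneg[OF cadlag_diff T_nonneg])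
      show "walk r n (j n) w \<in> D" by (rule stepperD(7)[OF walk_stepper[OF j] w])
      show "stop T (grid r n (j n)) (X w) \<in> D"
        by (rule cadlag_stop[OF X_D[OF w]]) (use grid_nonneg grid_le_T[OF j] in auto)
    qed
    ultimately show ?thesis using e by simp
  qed
  then show "\<exists>no. \<forall>n\<ge>no. norm (sup_norm T (\<lambda>u. walk r n (j n) w u - stop T (grid r n (j n)) (X w) u) - 0) < e" by blast
qed

lemma idx_bounds:
  assumes s: "s \<in> {r..<T}"
  shows "idx r n s \<le> n" "grid r n (idx r n s) \<le> s" "s < grid r n (Suc (idx r n s))"
proof -
  define h where "h = (T - r) / real (Suc n)"
  have h: "0 < h" using mesh_pos by (simp add: h_def)
  have q: "0 \<le> (s - r) / h" using s h by simp
  have i1: "real (idx r n s) \<le> (s - r) / h" unfolding idx_def h_def[symmetric] using q by simp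
  have i2: "(s - r) / h < real (idx r n s) + 1" unfolding idx_def h_def[symmetric] using q by linarith
  show 1: "grid r n (idx r n s) \<le> s" using i1 h unfolding grid_def h_def[symmetric] by (simp add: pos_le_divide_eq)
  show "s < grid r n (Suc (idx r n s))" using i2 h unfolding grid_def h_def[symmetric] by (simp add: pos_divide_less_eq add.commute)
  show "idx r n s \<le> n"
  proof (rule ccontr)
    assume "\<not> idx r n s \<le> n"
    then have "T \<le> grid r n (idx r n s)" using monoD[OF grid_mono, of "Suc n" "idx r n s" n] grid_T by simp
    then show False using 1 s by simp
  qed
qed

lemma idx_unique:
  assumes "grid r n m < s" "s < grid r n (Suc m)"
  shows "idx r n s = m"
proof -
  define h where "h = (T - r) / real (Suc n)"
  have h: "0 < h" using mesh_pos by (simp add: h_def)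
  have "real m < (s - r) / h" using assms(1) h unfolding grid_def h_def[symmetric] by (simp add: pos_less_divide_eq)
  moreover have "(s - r) / h < real m + 1" using assms(2) h unfolding grid_def h_def[symmetric] by (simp add: pos_divide_less_eq add.commute)
  ultimately have "\<lfloor>(s - r) / h\<rfloor> = int m" by (intro floor_unique) auto
  then show ?thesis unfolding idx_def h_def[symmetric] by simp
qed

lemma approx_walk:
  assumes s: "s \<in> {r..<T}"
  shows "approx s (\<lambda>n. grid r n (idx r n s)) (\<lambda>n. grid r n (Suc (idx r n s))) (\<lambda>n. walk r n (idx r n s))"
  unfolding approx_def
proof (intro conjI allI ballI)
  note I = idx_bounds[OF s]
  have m: "(\<lambda>n. s - (T - r) / real (Suc n)) \<longlonglongrightarrow> s" "(\<lambda>n. s + (T - r) / real (Suc n)) \<longlonglongrightarrow> s"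
    using tendsto_diff[OF tendsto_const[of s] mesh_tendsto] tendsto_add[OF tendsto_const[of s] mesh_tendsto] by auto
  show "s \<in> {t..T}" using s r by auto
  fix n
  show "grid r n (idx r n s) < grid r n (Suc (idx r n s))" by (rule grid_less)
  show "grid r n (Suc (idx r n s)) \<le> T" by (rule grid_le_T) (use I(1) in simp)
  show "stepper (grid r n (idx r n s)) (walk r n (idx r n s))" by (rule walk_stepper[OF le_SucI[OF I(1)]])
next
  note I = idx_bounds[OF s]
  have m: "(\<lambda>n. s - (T - r) / real (Suc n)) \<longlonglongrightarrow> s" "(\<lambda>n. s + (T - r) / real (Suc n)) \<longlonglongrightarrow> s"
    using tendsto_diff[OF tendsto_const[of s] mesh_tendsto] tendsto_add[OF tendsto_const[of s] mesh_tendsto] by auto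
  show "(\<lambda>n. grid r n (idx r n s)) \<longlonglongrightarrow> s"
  proof (rule tendsto_sandwich[OF _ _ m(1) tendsto_const])
    show "\<forall>\<^sub>F n in sequentially. s - (T - r) / real (Suc n) \<le> grid r n (idx r n s)"
      using I(3)[unfolded grid_Suc] by (intro always_eventually allI) (simp add: diff_le_eq less_imp_le)
  qed (use I(2) in simp)
  show "(\<lambda>n. grid r n (Suc (idx r n s))) \<longlonglongrightarrow> s"
  proof (rule tendsto_sandwich[OF _ _ tendsto_const m(2)])
    show "\<forall>\<^sub>F n in sequentially. grid r n (Suc (idx r n s)) \<le> s + (T - r) / real (Suc n)"
      unfolding grid_Suc using I(2) by simp
    show "\<forall>\<^sub>F n in sequentially. s \<le> grid r n (Suc (idx r n s))" using I(3) by (simp add: less_imp_le)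
  qed
  fix w assume "w \<in> space M"
  then show "(\<lambda>n. sup_norm T (\<lambda>u. walk r n (idx r n s) w u - stop T (grid r n (idx r n s)) (X w) u)) \<longlonglongrightarrow> 0"
    by (rule walk_near) (rule le_SucI[OF I(1)])
qed

end

end

context smooth_process
begin

text \<open>Non-anticipativity is read off from continuity: stopped and unstopped arguments are at
  distance 0 at time r, so a constant sequence has both values as its limit.\<close>

lemma stop_value:
  assumes w: "w \<in> space M" and r: "r \<in> {0..T}" and H: "seq_cont3 (H :: real \<Rightarrow> 'd path \<Rightarrow> 'd law \<Rightarrow> real)"
  shows "H r (stop T r (X w)) (law (\<lambda>w. stop T r (X w))) = H r (X w) LX"
proof -
  have z: "path_dist T r (X v) r (stop T r (X v)) = 0" for v
    unfolding path_dist_def using r by (simp add: stop_stop T_nonneg)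
  have "hat_conv (\<lambda>_::nat. r) (\<lambda>_. stop T r (X w)) (\<lambda>_. law (\<lambda>w. stop T r (X w))) r (X w) LX"
    by (rule hat_conv_law) (use r z X_D[OF w] cadlag_stop[OF X_D[OF w] r] dominated_X dominated_stop[OF dominated_X r] in auto)
  from seq_cont3D[OF H this] show ?thesis by (simp add: LIMSEQ_const_iff)
qed

lemma expectation_continuous:
  "continuous_on {t..T} (\<lambda>s. \<integral>w. G s (X w) LX \<partial>M)"
  unfolding continuous_on_sequentially comp_def
proof (intro ballI allI impI)
  fix s and r :: "nat \<Rightarrow> real" assume s: "s \<in> {t..T}" and r: "(\<forall>n. r n \<in> {t..T}) \<and> r \<longlonglongrightarrow> s"
  have s0: "s \<in> {0..T}" using s t_range by auto
  have r0: "r n \<in> {0..T}" for n using r t_range by (metis atLeastAtMost_iff order_trans)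
  obtain C k where C: "0 \<le> C" "\<And>u \<omega> Z. u \<in> {0..T} \<Longrightarrow> \<omega> \<in> D \<Longrightarrow> dominated Z \<Longrightarrow>
     norm (G u \<omega> (law Z)) \<le> C * (1 + sup_norm T \<omega>) ^ k" using growth3_bound[OF smoothD(12)] by blast
  show "(\<lambda>n. \<integral>w. G (r n) (X w) LX \<partial>M) \<longlonglongrightarrow> (\<integral>w. G s (X w) LX \<partial>M)"
  proof (rule dominated_convergence_poly)
    show "(\<lambda>w. G (r n) (X w) LX) \<in> borel_measurable M" for n
      by (rule tameD[OF X_tame seq_cont3_sup[OF smoothD(6) r0 dominated_X]])
    fix n w assume w: "w \<in> space M"
    have "\<bar>G (r n) (X w) LX\<bar> \<le> C * (1 + sup_norm T (X w)) ^ k" using C(2)[OF r0 X_D[OF w] dominated_X] by simp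
    also have "\<dots> \<le> C * (1 + 3 * S w) ^ k" by (intro mult_left_mono dominated_power[OF dominated_X w] C(1))
    finally show "\<bar>G (r n) (X w) LX\<bar> \<le> C * (1 + 3 * S w) ^ k" .
  next
    fix w assume w: "w \<in> space M"
    have z: "(\<lambda>n. path_dist T s (X v) (r n) (X v)) \<longlonglongrightarrow> 0" if "v \<in> space M" for v
      unfolding path_dist_def using X_stop_conv[OF that r0 s0 conjunct2[OF r]] .
    have "hat_conv r (\<lambda>_. X w) (\<lambda>_. LX) s (X w) LX"
      by (rule hat_conv_law[OF s0 r0 conjunct2[OF r] X_D[OF w] X_D[OF w] z[OF w] dominated_X dominated_X z])
    then show "(\<lambda>n. G (r n) (X w) LX) \<longlonglongrightarrow> G s (X w) LX" by (rule seq_cont3D[OF smoothD(6)])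
  qed
qed

text \<open>The telescoping sum of steps is written as the integral of a piecewise constant function
  of s. Dominated convergence then works at each fixed s and yields the integrability of
  \<open>ell\<close> as well. The value at T is set to the limit.\<close>

definition phi :: "real \<Rightarrow> nat \<Rightarrow> real \<Rightarrow> real" where
  "phi r n s = (if s < T then step_diff (grid r n (idx r n s)) (grid r n (Suc (idx r n s))) (walk r n (idx r n s))
     / (grid r n (Suc (idx r n s)) - grid r n (idx r n s)) else ell T)"

definition val :: "real \<Rightarrow> nat \<Rightarrow> nat \<Rightarrow> real" where
  "val r n j = (\<integral>w. G (grid r n j) (walk r n j w) (law (walk r n j)) \<partial>M)"

lemma phi_integral:
  assumes r: "r \<in> {t..<T}"
  shows "m \<le> Suc n \<Longrightarrow> (phi r n has_integral (val r n m - val r n 0)) {r..grid r n m}"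
proof (induction m)
  case 0
  show ?case unfolding grid_0[OF r] by (simp add: has_integral_refl)
next
  case (Suc m)
  let ?a = "grid r n m" and ?b = "grid r n (Suc m)"
  have ab: "?a < ?b" by (rule grid_less[OF r])
  have bT: "?b \<le> T" by (rule grid_le_T[OF r Suc.prems])
  have sd: "step_diff ?a ?b (walk r n m) = val r n (Suc m) - val r n m"
    unfolding step_diff_def val_def walk_Suc[OF r] ..
  have "((\<lambda>s. step_diff ?a ?b (walk r n m) / (?b - ?a)) has_integral (?b - ?a) *\<^sub>R (step_diff ?a ?b (walk r n m) / (?b - ?a))) {?a..?b}"
    using has_integral_const_real[of "step_diff ?a ?b (walk r n m) / (?b - ?a)" ?a ?b] ab by simp
  then have c: "((\<lambda>s. step_diff ?a ?b (walk r n m) / (?b - ?a)) has_integral (val r n (Suc m) - val r n m)) {?a..?b}"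
    using ab by (simp add: sd)
  \<comment> \<open>\<open>idx\<close> is identified strictly inside the cell, and its two end
    points do not change the integral.\<close>
  have "(phi r n has_integral (val r n (Suc m) - val r n m)) {?a..?b}"
  proof (rule has_integral_spike_finite[OF _ _ c])
    show "finite {?a, ?b}" by simp
    fix s assume "s \<in> {?a..?b} - {?a, ?b}"
    then have s: "?a < s" "s < ?b" by auto
    then show "phi r n s = step_diff ?a ?b (walk r n m) / (?b - ?a)"
      using bT unfolding phi_def idx_unique[OF r s] by simp
  qed
  from has_integral_combine[OF grid_ge[OF r] less_imp_le[OF ab] Suc.IH this] Suc.prems
  show ?case by simp
qed

theorem expectation_formula:
  assumes r: "r \<in> {t..<T}"
  shows "ell integrable_on {r..T}"
    "integral {r..T} ell = (\<integral>w. G T (X w) LX \<partial>M) - (\<integral>w. G r (X w) LX \<partial>M)"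
proof -
  obtain C where C: "C \<ge> 0" "\<forall>a b P. stepper a P \<longrightarrow> a < b \<longrightarrow> b \<le> T \<longrightarrow> \<bar>step_diff a b P / (b - a)\<bar> \<le> C"
    using step_bound by blast
  have I: "(phi r n has_integral (val r n (Suc n) - val r n 0)) {r..T}" for n
    using phi_integral[OF r, of "Suc n" n] grid_T[OF r] by simp
  have bnd: "norm (phi r n s) \<le> max C \<bar>ell T\<bar>" if s: "s \<in> {r..T}" for n s
  proof (cases "s < T")
    case True
    then have s': "s \<in> {r..<T}" using s by auto
    note A = approxD[OF approx_walk[OF r s']]
    have "\<bar>phi r n s\<bar> \<le> C" unfolding phi_def using True C(2) A(3)[of n] A(4)[of n] A(7)[of n] by simp
    then show ?thesis by simp
  next
    case False then show ?thesis by (simp add: phi_def)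
  qed
  have lim: "(\<lambda>n. phi r n s) \<longlonglongrightarrow> ell s" if s: "s \<in> {r..T}" for s
  proof (cases "s < T")
    case True
    then have s': "s \<in> {r..<T}" using s by auto
    show ?thesis unfolding phi_def using step_limit[OF approx_walk[OF r s']] True by simp
  next
    case False
    then have "s = T" using s by auto
    then show ?thesis by (simp add: phi_def)
  qed
  have pi: "phi r n integrable_on {r..T}" for n using I by (rule has_integral_integrable)
  have ci: "(\<lambda>s. max C \<bar>ell T\<bar>) integrable_on {r..T}" by (rule integrable_const_ivl)
  show "ell integrable_on {r..T}"
    by (rule dominated_convergence(1)[OF pi ci bnd lim])
  have L: "(\<lambda>n. integral {r..T} (phi r n)) \<longlonglongrightarrow> integral {r..T} ell"
    by (rule dominated_convergence(2)[OF pi ci bnd lim])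
  have v0: "val r n 0 = (\<integral>w. G r (X w) LX \<partial>M)" for n
    unfolding val_def grid_0[OF r] walk_0[OF r]
    by (rule Bochner_Integration.integral_cong) (use stop_value[OF _ _ smoothD(6), of _ r] r t_range in auto)
  \<comment> \<open>The telescoped sum ends at the value along the step process, so its convergence
    to the value along X at time T has to be shown.\<close>
  have vT: "(\<lambda>n. val r n (Suc n)) \<longlonglongrightarrow> (\<integral>w. G T (X w) LX \<partial>M)"
  proof -
    have st: "stepper T (walk r n (Suc n))" for n using walk_stepper[OF r, of "Suc n" n] grid_T[OF r] by simp
    have TT: "T \<in> {0..T}" using T_nonneg by simp
    have dn: "dominated (walk r n (Suc n))" for n by (rule stepper_dominated[OF st])
    have pd: "(\<lambda>n. path_dist T T (X w) T (walk r n (Suc n) w)) \<longlonglongrightarrow> 0" if w: "w \<in> space M" for w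
      unfolding path_dist_def stepperD(8)[OF st w] 
      using walk_near[OF r w, of Suc] unfolding grid_T[OF r] by (subst sup_norm_minus_commute) simp
    obtain K k where K: "0 \<le> K" "\<And>u \<omega> Z. u \<in> {0..T} \<Longrightarrow> \<omega> \<in> D \<Longrightarrow> dominated Z \<Longrightarrow>
      norm (G u \<omega> (law Z)) \<le> K * (1 + sup_norm T \<omega>) ^ k" using growth3_bound[OF smoothD(12)] by blast
    show ?thesis unfolding val_def grid_T[OF r]
    proof (rule dominated_convergence_poly)
      show "(\<lambda>w. G T (walk r n (Suc n) w) (law (walk r n (Suc n)))) \<in> borel_measurable M" for n
        by (rule tameD[OF stepperD(6)[OF st] seq_cont3_sup[OF smoothD(6) TT dn]])
      fix n w assume w: "w \<in> space M"
      have "\<bar>G T (walk r n (Suc n) w) (law (walk r n (Suc n)))\<bar> \<le> K * (1 + sup_norm T (walk r n (Suc n) w)) ^ k"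
        using K(2)[OF TT stepperD(7)[OF st w] dn] by simp
      also have "\<dots> \<le> K * (1 + 3 * S w) ^ k" by (intro mult_left_mono dominated_power[OF dn w] K(1))
      finally show "\<bar>G T (walk r n (Suc n) w) (law (walk r n (Suc n)))\<bar> \<le> K * (1 + 3 * S w) ^ k" .
    next
      fix w assume w: "w \<in> space M"
      have "hat_conv (\<lambda>_. T) (\<lambda>n. walk r n (Suc n) w) (\<lambda>n. law (walk r n (Suc n))) T (X w) LX"
        by (rule hat_conv_law[OF TT TT tendsto_const X_D[OF w] stepperD(7)[OF st w] pd[OF w] dominated_X dn pd])
      then show "(\<lambda>n. G T (walk r n (Suc n) w) (law (walk r n (Suc n)))) \<longlonglongrightarrow> G T (X w) LX"
        by (rule seq_cont3D[OF smoothD(6)])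
    qed
  qed
  have "(\<lambda>n. integral {r..T} (phi r n)) \<longlonglongrightarrow> (\<integral>w. G T (X w) LX \<partial>M) - (\<integral>w. G r (X w) LX \<partial>M)"
    unfolding integral_unique[OF I] v0 by (intro tendsto_diff vT tendsto_const)
  with L show "integral {r..T} ell = (\<integral>w. G T (X w) LX \<partial>M) - (\<integral>w. G r (X w) LX \<partial>M)"
    by (rule LIMSEQ_unique)
qed

end

section \<open>Energy estimate for the difference of two solutions\<close>

section \<open>The difference of two solutions along a Brownian process\<close>

text \<open>With I the integral of a, the hypotheses give a r \<le> C (I T - I r). Hence exp (C r)
  (I T - I r) is nondecreasing, and it vanishes at T. A lower bound on ell suffices because the
  estimate runs back from T.\<close>

lemma gronwall_backward_zero:
  fixes a ell :: "real \<Rightarrow> real"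
  assumes tT: "t < T" and cont: "continuous_on {t..T} a" and C: "0 \<le> C"
    and eq: "\<And>r. r \<in> {t..<T} \<Longrightarrow> ell integrable_on {r..T} \<and> integral {r..T} ell = a T - a r"
    and le: "\<And>s. s \<in> {t..<T} \<Longrightarrow> - C * a s \<le> ell s" and aT: "a T = 0"
  shows "a t \<le> 0"
proof -
  define I where "I r = integral {t..r} a" for r
  define J where "J = I T"
  have a_int: "a integrable_on {r..r'}" if "t \<le> r" "r' \<le> T" for r r'
    using cont by (intro integrable_continuous_interval continuous_on_subset[OF cont]) (use that in auto)
  have Ia: "integral {r..T} a = J - I r" if "r \<in> {t..T}" for r
    using Henstock_Kurzweil_Integration.integral_combine[of t r T a] that a_int unfolding I_def J_def by auto
  have key: "a r \<le> C * (J - I r)" if r: "r \<in> {t..<T}" for r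
  proof -
    \<comment> \<open>The bound on ell is known only before T; its value at T is replaced by one
      that satisfies the bound.\<close>
    have "integral {r..T} (\<lambda>s. - C * a s) \<le> integral {r..T} (\<lambda>s. if s = T then - C * a T else ell s)"
    proof (rule integral_le)
      have "a integrable_on {r..T}" using a_int[of r T] r by auto
      from integrable_cmul[OF this, of "- C"] show "(\<lambda>s. - C * a s) integrable_on {r..T}" by simp
      show "(\<lambda>s. if s = T then - C * a T else ell s) integrable_on {r..T}"
        by (rule integrable_spike_finite[of "{T}" _ _ ell]) (use eq[OF r] in auto)
      fix s assume "s \<in> {r..T}"
      then show "- C * a s \<le> (if s = T then - C * a T else ell s)" using le[of s] r by auto
    qed
    also have "\<dots> = integral {r..T} ell"
      by (rule integral_spike[of "{T}"]) auto
    finally have "- C * integral {r..T} a \<le> a T - a r" using eq[OF r] by simp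
    then show ?thesis using Ia[of r] r aT by simp
  qed
  define b where "b r = exp (C * r) * (J - I r)" for r
  have Id: "(I has_real_derivative a r) (at r)" if "t < r" "r < T" for r
  proof -
    have "(I has_vector_derivative a r) (at r within {t..T})"
      unfolding I_def by (rule integral_has_vector_derivative[OF cont]) (use that in auto)
    then show ?thesis using that
      by (simp add: at_within_Icc_at has_real_derivative_iff_has_vector_derivative)
  qed
  have Ic: "continuous_on {t..T} I" unfolding I_def
    by (rule indefinite_integral_continuous_1[OF a_int]) auto
  have "b t \<le> b T"
  proof (rule DERIV_nonneg_imp_increasing_open[OF less_imp_le[OF tT]])
    show "continuous_on {t..T} b" unfolding b_def by (intro continuous_intros Ic)
    fix r assume r: "t < r" "r < T"
    have "(b has_real_derivative (exp (C * r) * C * (J - I r) + exp (C * r) * (- a r))) (at r)"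
      unfolding b_def by (rule derivative_eq_intros Id r refl | simp)+
    moreover have "exp (C * r) * C * (J - I r) + exp (C * r) * (- a r) = exp (C * r) * (C * (J - I r) - a r)"
      by (simp add: algebra_simps)
    moreover have "0 \<le> exp (C * r) * (C * (J - I r) - a r)"
      using key[of r] r by simp
    ultimately show "\<exists>y. (b has_real_derivative y) (at r) \<and> 0 \<le> y" by metis
  qed
  also have "b T = 0" by (simp add: b_def J_def)
  finally have "J - I t \<le> 0" by (simp add: b_def mult_le_0_iff)
  then have "C * (J - I t) \<le> 0" using C by (simp add: mult_le_0_iff)
  then show ?thesis using key[of t] tT by simp
qed

lemma trace_scaleR: "trace (c *\<^sub>R A) = c * trace (A :: real ^ 'n ^ 'n)"
  by (simp add: trace_def sum_distrib_left)

lemma bounded_linear_trace: "bounded_linear (trace :: real ^ 'n ^ 'n \<Rightarrow> real)"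
  unfolding trace_def
  by (intro bounded_linear_sum bounded_linear_compose[OF bounded_linear_vec_nth bounded_linear_vec_nth])

lemma (in prob_space) W2R_le:
  fixes f g :: "'a \<Rightarrow> real"
  assumes f: "f \<in> borel_measurable M" and g: "g \<in> borel_measurable M"
    and int: "integrable M (\<lambda>w. (f w - g w)\<^sup>2)"
  shows "W2R (distr M borel f) (distr M borel g) \<le> sqrt (\<integral>w. (f w - g w)\<^sup>2 \<partial>M)"
proof -
  let ?\<pi> = "distr M (borel \<Otimes>\<^sub>M borel) (\<lambda>w. (f w, g w))"
  have m: "(\<lambda>w. (f w, g w)) \<in> measurable M (borel \<Otimes>\<^sub>M borel)" using f g by simp
  have s: "sets (distr M borel f \<Otimes>\<^sub>M distr M borel g) = sets (borel \<Otimes>\<^sub>M borel)"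
    by (rule sets_pair_measure_cong) auto
  have "distr ?\<pi> (distr M borel f) fst = distr ?\<pi> borel fst" by (rule distr_cong) auto
  also have "\<dots> = distr M borel f" using m by (simp add: distr_distr comp_def)
  finally have a: "distr ?\<pi> (distr M borel f) fst = distr M borel f" .
  have "distr ?\<pi> (distr M borel g) snd = distr ?\<pi> borel snd" by (rule distr_cong) auto
  also have "\<dots> = distr M borel g" using m by (simp add: distr_distr comp_def)
  finally have b: "distr ?\<pi> (distr M borel g) snd = distr M borel g" .
  have c: "?\<pi> \<in> couplings (distr M borel f) (distr M borel g)"
    unfolding couplings_def using s a b by auto
  have "(INF \<pi>\<in>couplings (distr M borel f) (distr M borel g). \<integral>\<^sup>+ p. ennreal ((dist (fst p) (snd p))\<^sup>2) \<partial>\<pi>)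
     \<le> (\<integral>\<^sup>+ p. ennreal ((dist (fst p) (snd p))\<^sup>2) \<partial>?\<pi>)"
    by (rule INF_lower[OF c])
  also have "\<dots> = (\<integral>\<^sup>+ w. ennreal ((dist (f w) (g w))\<^sup>2) \<partial>M)"
    using m by (subst nn_integral_distr) auto
  also have "\<dots> = (\<integral>\<^sup>+ w. ennreal ((f w - g w)\<^sup>2) \<partial>M)" by (simp add: dist_real_def)
  also have "\<dots> = ennreal (\<integral>w. (f w - g w)\<^sup>2 \<partial>M)"
    using int by (intro nn_integral_eq_integral) auto
  finally have "enn2real (INF \<pi>\<in>couplings (distr M borel f) (distr M borel g). \<integral>\<^sup>+ p. ennreal ((dist (fst p) (snd p))\<^sup>2) \<partial>\<pi>)
     \<le> (\<integral>w. (f w - g w)\<^sup>2 \<partial>M)"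
    by (intro enn2real_leI) auto
  then show ?thesis unfolding W2R_def wasserstein2_def by simp
qed

context basis
begin

text \<open>Both arguments share time, path and law, which contribute distance 0. The law has the
  form \<open>law Z\<close> because its distance to itself is computed by coupling Z with
  itself.\<close>

lemma driver_lipschitz:
  assumes "H2_driver T M Fil f'"
  obtains L where "0 \<le> L" "\<And>s \<gamma> y z y' z' Z \<nu> \<nu>'. s \<in> {0..T} \<Longrightarrow> \<gamma> \<in> D \<Longrightarrow> Z \<in> measurable M PD \<Longrightarrow> law Z \<in> PL \<Longrightarrow>
     \<nu> \<in> P2R \<Longrightarrow> \<nu>' \<in> P2R \<Longrightarrow>
     \<bar>f' s \<gamma> y z (law Z) \<nu> - f' s \<gamma> y' z' (law Z) \<nu>'\<bar> \<le> L * (\<bar>y - y'\<bar> + norm (z - z') + W2R \<nu> \<nu>')"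
proof -
  let ?S = "\<lambda>t. {t} \<times> D \<times> (UNIV :: real set) \<times> (UNIV :: (real ^ 'd) set) \<times> PL \<times> P2R"
  let ?d = "\<lambda>(t, \<omega>, y, z, \<mu>, \<nu>) (t', \<omega>', y', z', \<mu>', \<nu>').
                 dist_hat T (t, \<omega>, \<mu>) (t', \<omega>', \<mu>') + \<bar>y - y'\<bar> + norm (z - z') + W2R \<nu> \<nu>'"
  have "unif_lip ?d {?S t |t. t \<in> {0..T}} (\<lambda>(t, \<omega>, y, z, \<mu>, \<nu>). f' t \<omega> y z \<mu> \<nu>)"
    using assms unfolding H2_driver_def Let_def by (elim conjE)
  then obtain L where "\<forall>X\<in>{?S t |t. t \<in> {0..T}}. \<forall>p\<in>X. \<forall>q\<in>X.
     dist ((\<lambda>(t, \<omega>, y, z, \<mu>, \<nu>). f' t \<omega> y z \<mu> \<nu>) p) ((\<lambda>(t, \<omega>, y, z, \<mu>, \<nu>). f' t \<omega> y z \<mu> \<nu>) q) \<le> L * ?d p q"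
    unfolding unif_lip_def by (elim exE)
  note L = this[THEN bspec, THEN bspec, THEN bspec]
  show ?thesis
  proof (rule that[of "\<bar>L\<bar>"])
    fix s \<gamma> y z y' z' Z \<nu> \<nu>'
    assume s: "s \<in> {0..T}" and \<gamma>: "\<gamma> \<in> D" and Z: "Z \<in> measurable M PD" "law Z \<in> PL" and \<nu>: "\<nu> \<in> P2R" "\<nu>' \<in> P2R"
    have m: "(\<lambda>w. stop T s (Z w)) \<in> measurable M PD"
      by (rule measurable_compose[OF Z(1) stop_measurable_PD[OF s]])
    have d0: "dist_hat T (s, \<gamma>, law Z) (s, \<gamma>, law Z) = 0"
      unfolding dist_hat_def stop_law_law[OF Z(1) s] by (simp add: path_dist_zero[OF \<gamma> s] stop_law_law[OF Z(1) s] W2_law_refl[OF m])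
    have "dist (f' s \<gamma> y z (law Z) \<nu>) (f' s \<gamma> y' z' (law Z) \<nu>')
      \<le> L * (dist_hat T (s, \<gamma>, law Z) (s, \<gamma>, law Z) + \<bar>y - y'\<bar> + norm (z - z') + W2R \<nu> \<nu>')"
      using L[of "?S s" "(s, \<gamma>, y, z, law Z, \<nu>)" "(s, \<gamma>, y', z', law Z, \<nu>')"] s \<gamma> Z \<nu> by auto
    also have "\<dots> \<le> \<bar>L\<bar> * (\<bar>y - y'\<bar> + norm (z - z') + W2R \<nu> \<nu>')"
      unfolding d0 by (intro mult_mono) (auto simp: W2R_def wasserstein2_def)
    finally show "\<bar>f' s \<gamma> y z (law Z) \<nu> - f' s \<gamma> y' z' (law Z) \<nu>'\<bar> \<le> \<bar>L\<bar> * (\<bar>y - y'\<bar> + norm (z - z') + W2R \<nu> \<nu>')"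
      by (simp add: dist_real_def)
  qed simp
qed

end

section \<open>Two solutions evaluated along one Brownian process\<close>

locale solution_pair = basis T M Fil B
  for T :: real and M :: "'w measure" and Fil :: "real \<Rightarrow> 'w measure"
    and B :: "real \<Rightarrow> 'w \<Rightarrow> real ^ ('d::finite)" +
  fixes f f' :: "real \<Rightarrow> 'd path \<Rightarrow> real \<Rightarrow> real ^ 'd \<Rightarrow> 'd law \<Rightarrow> real measure \<Rightarrow> real"
    and u1 u2 F1 F1t F2 F2t :: "real \<Rightarrow> 'd path \<Rightarrow> 'd law \<Rightarrow> real"
    and F1w F2w :: "real \<Rightarrow> 'd path \<Rightarrow> 'd law \<Rightarrow> real ^ 'd"
    and F1ww F2ww :: "real \<Rightarrow> 'd path \<Rightarrow> 'd law \<Rightarrow> real ^ 'd ^ 'd"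
    and F1m F2m :: "real \<Rightarrow> 'd path \<Rightarrow> 'd law \<Rightarrow> 'd path \<Rightarrow> real ^ 'd"
    and F1wm F2wm :: "real \<Rightarrow> 'd path \<Rightarrow> 'd law \<Rightarrow> 'd path \<Rightarrow> real ^ 'd ^ 'd"
  assumes f': "H2_driver T M Fil f'"
    and f_eq: "\<And>s \<gamma> y z \<mu> \<nu>. s \<in> {0..T} \<Longrightarrow> \<gamma> \<in> cpaths T \<Longrightarrow> \<mu> \<in> P2C T \<Longrightarrow> \<nu> \<in> P2R \<Longrightarrow>
        f s \<gamma> y z \<mu> \<nu> = f' s \<gamma> y z (embed_law T \<mu>) \<nu>"
    and C1: "C1211p T M Fil F1 F1t F1w F1ww F1m F1wm" and C2: "C1211p T M Fil F2 F2t F2w F2ww F2m F2wm"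
    and eq1: "\<And>s \<gamma> \<mu>. s \<in> {0..T} \<Longrightarrow> \<gamma> \<in> cpaths T \<Longrightarrow> \<mu> \<in> P2C T \<Longrightarrow>
        u1 s \<gamma> \<mu> = F1 s \<gamma> (embed_law T \<mu>) \<and> integrable \<mu> (F1wm s \<gamma> (embed_law T \<mu>)) \<and>
        distr \<mu> borel (\<lambda>\<omega>. u1 s \<omega> \<mu>) \<in> P2R \<and>
        F1t s \<gamma> (embed_law T \<mu>) + 1/2 * trace (F1ww s \<gamma> (embed_law T \<mu>))
          + 1/2 * trace (\<integral>v. F1wm s \<gamma> (embed_law T \<mu>) v \<partial>\<mu>)
          + f s \<gamma> (u1 s \<gamma> \<mu>) (F1w s \<gamma> (embed_law T \<mu>)) \<mu> (distr \<mu> borel (\<lambda>\<omega>. u1 s \<omega> \<mu>)) = 0"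
    and eq2: "\<And>s \<gamma> \<mu>. s \<in> {0..T} \<Longrightarrow> \<gamma> \<in> cpaths T \<Longrightarrow> \<mu> \<in> P2C T \<Longrightarrow>
        u2 s \<gamma> \<mu> = F2 s \<gamma> (embed_law T \<mu>) \<and> integrable \<mu> (F2wm s \<gamma> (embed_law T \<mu>)) \<and>
        distr \<mu> borel (\<lambda>\<omega>. u2 s \<omega> \<mu>) \<in> P2R \<and>
        F2t s \<gamma> (embed_law T \<mu>) + 1/2 * trace (F2ww s \<gamma> (embed_law T \<mu>))
          + 1/2 * trace (\<integral>v. F2wm s \<gamma> (embed_law T \<mu>) v \<partial>\<mu>)
          + f s \<gamma> (u2 s \<gamma> \<mu>) (F2w s \<gamma> (embed_law T \<mu>)) \<mu> (distr \<mu> borel (\<lambda>\<omega>. u2 s \<omega> \<mu>)) = 0"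
    and terminal: "\<And>\<gamma> \<mu>. \<gamma> \<in> cpaths T \<Longrightarrow> \<mu> \<in> P2C T \<Longrightarrow> u1 T \<gamma> \<mu> = u2 T \<gamma> \<mu>"
begin

definition V :: "real \<Rightarrow> 'd path \<Rightarrow> 'd law \<Rightarrow> real" where "V s \<omega> \<mu> = F1 s \<omega> \<mu> - F2 s \<omega> \<mu>"

lemmas smooth1 = C1211p_smooth[OF C1] and smooth2 = C1211p_smooth[OF C2]

lemmas smooth_V2 = smooth_square[OF smooth_diff[OF smooth1 smooth2]]

lemma seq_cont3_V: "seq_cont3 V"
  using smooth_diff[OF smooth1 smooth2] unfolding smooth_def V_def[abs_def] by blast

end

locale solution_pair_process =
  solution_pair T M Fil B f f' u1 u2 F1 F1t F2 F2t F1w F2w F1ww F2ww F1m F2m F1wm F2wm + brownian_process T M Fil B t X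
  for T :: real and M :: "'w measure" and Fil :: "real \<Rightarrow> 'w measure"
    and B :: "real \<Rightarrow> 'w \<Rightarrow> real ^ ('d::finite)" and t X
    and f f' u1 u2 F1 F1t F2 F2t F1w F2w F1ww F2ww F1m F2m F1wm F2wm
begin

sublocale V2: smooth_process T M Fil B t X
  "\<lambda>s \<omega> \<mu>. (F1 s \<omega> \<mu> - F2 s \<omega> \<mu>)\<^sup>2"
  "\<lambda>s \<omega> \<mu>. 2 * (F1 s \<omega> \<mu> - F2 s \<omega> \<mu>) * (F1t s \<omega> \<mu> - F2t s \<omega> \<mu>)"
  "\<lambda>s \<omega> \<mu>. (2 * (F1 s \<omega> \<mu> - F2 s \<omega> \<mu>)) *\<^sub>R (F1w s \<omega> \<mu> - F2w s \<omega> \<mu>)"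
  "\<lambda>s \<omega> \<mu>. (2::real) *\<^sub>R outer (F1w s \<omega> \<mu> - F2w s \<omega> \<mu>) (F1w s \<omega> \<mu> - F2w s \<omega> \<mu>)
     + (2 * (F1 s \<omega> \<mu> - F2 s \<omega> \<mu>)) *\<^sub>R (F1ww s \<omega> \<mu> - F2ww s \<omega> \<mu>)"
  "\<lambda>s \<omega> \<mu> v. (2 * (F1 s \<omega> \<mu> - F2 s \<omega> \<mu>)) *\<^sub>R (F1m s \<omega> \<mu> v - F2m s \<omega> \<mu> v)"
  "\<lambda>s \<omega> \<mu> v. (2 * (F1 s \<omega> \<mu> - F2 s \<omega> \<mu>)) *\<^sub>R (F1wm s \<omega> \<mu> v - F2wm s \<omega> \<mu> v)"
  by unfold_locales (rule smooth_V2)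

abbreviation PC :: "'d law" where "PC \<equiv> path_space (cpaths T)"

text \<open>The equation is stated for laws on continuous paths, the expansion for laws on cadlag
  paths; \<open>embed_law\<close> takes this law to \<open>law X\<close>.\<close>

definition \<mu>C :: "'d law" where "\<mu>C = distr M PC X"

lemma X_PC: "X \<in> measurable M PC"
  by (rule measurable_path_space[OF X_cpaths measurable_path_coordD[OF X_measurable]])

lemma id_PC: "(\<lambda>\<omega>. \<omega>) \<in> measurable PC PD"
  by (rule measurable_path_space) (auto simp: cpaths_cadlag measurable_path_coord)

lemma embed_\<mu>C: "embed_law T \<mu>C = law X"
  unfolding embed_law_def \<mu>C_def path_law_def distr_distr[OF id_PC X_PC] by (simp add: comp_def)

lemma \<mu>C_P2C: "\<mu>C \<in> P2C T"
proof -
  have "sup_norm T \<in> borel_measurable PC"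
    by (rule sup_norm_measurable) (auto simp: T_nonneg measurable_path_coord cpaths_cadlag)
  then show ?thesis unfolding P2_def \<mu>C_def
    using X_PC dominated_sq_integrable[OF dominated_X] by (auto intro!: prob_space_distr simp: integrable_distr_eq)
qed

text \<open>The identity on continuous paths is tame, so continuous functionals are measurable for
  the coordinate sigma-algebra there.\<close>

lemma functional_PC:
  assumes "seq_cont3 (H :: real \<Rightarrow> 'd path \<Rightarrow> 'd law \<Rightarrow> real)" "s \<in> {0..T}"
  shows "(\<lambda>\<omega>. H s \<omega> (law X)) \<in> borel_measurable PC"
proof -
  have "tame PC (\<lambda>\<omega>. \<omega>)" by (rule tame_cpaths) (auto simp: measurable_path_coord)
  then show ?thesis by (rule tameD) (rule seq_cont3_sup[OF assms dominated_X])
qed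

definition energy :: "real \<Rightarrow> real" where
  "energy s = (\<integral>w. (F1 s (X w) (law X) - F2 s (X w) (law X))\<^sup>2 \<partial>M)"

lemma energy_nonneg: "0 \<le> energy s" unfolding energy_def by (rule integral_nonneg_AE) auto

lemma energy_integrable: "s \<in> {0..T} \<Longrightarrow> integrable M (\<lambda>w. (F1 s (X w) (law X) - F2 s (X w) (law X))\<^sup>2)"
  by (rule integrable3[OF V2.smoothD(6,12) _ V2.X_tame dominated_X dominated_X])

lemma law_of_value:
  assumes s: "s \<in> {0..T}"
  shows "distr \<mu>C borel (\<lambda>\<omega>. u1 s \<omega> \<mu>C) = distr M borel (\<lambda>w. F1 s (X w) (law X))"
    "distr \<mu>C borel (\<lambda>\<omega>. u2 s \<omega> \<mu>C) = distr M borel (\<lambda>w. F2 s (X w) (law X))"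
proof -
  have c: "seq_cont3 F1" "seq_cont3 F2" using smooth1 smooth2 unfolding smooth_def by blast+
  have sp: "space \<mu>C = cpaths T" by (simp add: \<mu>C_def)
  have "distr \<mu>C borel (\<lambda>\<omega>. u1 s \<omega> \<mu>C) = distr \<mu>C borel (\<lambda>\<omega>. F1 s \<omega> (law X))"
    by (rule distr_cong[OF refl refl]) (use conjunct1[OF eq1[OF s _ \<mu>C_P2C]] sp in \<open>simp add: embed_\<mu>C\<close>)
  then show "distr \<mu>C borel (\<lambda>\<omega>. u1 s \<omega> \<mu>C) = distr M borel (\<lambda>w. F1 s (X w) (law X))"
    unfolding \<mu>C_def distr_distr[OF functional_PC[OF c(1) s] X_PC] by (simp add: comp_def)
  have "distr \<mu>C borel (\<lambda>\<omega>. u2 s \<omega> \<mu>C) = distr \<mu>C borel (\<lambda>\<omega>. F2 s \<omega> (law X))"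
    by (rule distr_cong[OF refl refl]) (use conjunct1[OF eq2[OF s _ \<mu>C_P2C]] sp in \<open>simp add: embed_\<mu>C\<close>)
  then show "distr \<mu>C borel (\<lambda>\<omega>. u2 s \<omega> \<mu>C) = distr M borel (\<lambda>w. F2 s (X w) (law X))"
    unfolding \<mu>C_def distr_distr[OF functional_PC[OF c(2) s] X_PC] by (simp add: comp_def)
qed

text \<open>Evaluating both solutions at the same w couples the two laws of values, at cost E
  v^2.\<close>

lemma law_distance:
  assumes s: "s \<in> {0..T}"
  shows "W2R (distr \<mu>C borel (\<lambda>\<omega>. u1 s \<omega> \<mu>C)) (distr \<mu>C borel (\<lambda>\<omega>. u2 s \<omega> \<mu>C)) \<le> sqrt (energy s)"
proof -
  have c: "seq_cont3 F1" "seq_cont3 F2" using smooth1 smooth2 unfolding smooth_def by blast+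
  have m: "(\<lambda>w. F1 s (X w) (law X)) \<in> borel_measurable M" "(\<lambda>w. F2 s (X w) (law X)) \<in> borel_measurable M"
    by (rule tameD[OF V2.X_tame seq_cont3_sup[OF c(1) s dominated_X]], rule tameD[OF V2.X_tame seq_cont3_sup[OF c(2) s dominated_X]])
  show ?thesis unfolding law_of_value[OF s] energy_def by (rule W2R_le[OF m energy_integrable[OF s]])
qed

text \<open>Integrability of the mixed derivative comes with a classical solution; it lets the trace
  pass under the integral and the integral pass from the law to the process.\<close>

lemma trace_wm:
  assumes Q: "integrable \<mu>C (Q :: 'd path \<Rightarrow> real ^ 'd ^ 'd)"
  shows "trace (\<integral>v. Q v \<partial>\<mu>C) = (\<integral>w. trace (Q (X w)) \<partial>M)" "integrable M (\<lambda>w. trace (Q (X w)))"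
proof -
  have m: "Q \<in> borel_measurable PC" using borel_measurable_integrable[OF Q] unfolding \<mu>C_def by simp
  have i: "integrable M (\<lambda>w. Q (X w))" using Q unfolding \<mu>C_def integrable_distr_eq[OF X_PC m] .
  show "integrable M (\<lambda>w. trace (Q (X w)))" by (rule integrable_bounded_linear[OF bounded_linear_trace i])
  have "(\<integral>v. Q v \<partial>\<mu>C) = (\<integral>w. Q (X w) \<partial>M)" unfolding \<mu>C_def by (rule integral_distr[OF X_PC m])
  then show "trace (\<integral>v. Q v \<partial>\<mu>C) = (\<integral>w. trace (Q (X w)) \<partial>M)"
    using integral_bounded_linear[OF bounded_linear_trace i] by simp
qed

text \<open>The gradient term produced by the square absorbs the dependence of the driver on the gradient.\<close>

lemma ell_lower:
  obtains C where "0 \<le> C" "\<And>s. s \<in> {t..<T} \<Longrightarrow> - C * energy s \<le> V2.ell s"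
proof -
  obtain L where L: "0 \<le> L" "\<And>s \<gamma> y z y' z' Z \<nu> \<nu>'. s \<in> {0..T} \<Longrightarrow> \<gamma> \<in> D \<Longrightarrow> Z \<in> measurable M PD \<Longrightarrow> law Z \<in> PL \<Longrightarrow>
     \<nu> \<in> P2R \<Longrightarrow> \<nu>' \<in> P2R \<Longrightarrow>
     \<bar>f' s \<gamma> y z (law Z) \<nu> - f' s \<gamma> y' z' (law Z) \<nu>'\<bar> \<le> L * (\<bar>y - y'\<bar> + norm (z - z') + W2R \<nu> \<nu>')"
    using driver_lipschitz[OF f'] by blast
  \<comment> \<open>The pointwise estimate below costs (3 L + L^2) v^2 plus L times the energy;
    integration adds the two coefficients to 4 L + L^2.\<close>
  show ?thesis
  proof (rule that[of "4 * L + L\<^sup>2"])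
    show "0 \<le> 4 * L + L\<^sup>2" using L(1) by simp
    fix s assume s: "s \<in> {t..<T}"
    then have s0: "s \<in> {0..T}" using t_range by auto
    let ?v = "\<lambda>w. F1 s (X w) (law X) - F2 s (X w) (law X)"
    let ?vt = "\<lambda>w. F1t s (X w) (law X) - F2t s (X w) (law X)"
    let ?vw = "\<lambda>w. F1w s (X w) (law X) - F2w s (X w) (law X)"
    let ?vww = "\<lambda>w. F1ww s (X w) (law X) - F2ww s (X w) (law X)"
    let ?vwm = "\<lambda>w v. F1wm s (X w) (law X) (X v) - F2wm s (X w) (law X) (X v)"
    let ?Gww = "\<lambda>w. (2::real) *\<^sub>R outer (?vw w) (?vw w) + (2 * ?v w) *\<^sub>R ?vww w"
    define h where "h w = 1/2 * trace (?Gww w) + 1/2 * (\<integral>v. trace ((2 * ?v w) *\<^sub>R ?vwm w v) \<partial>M) + 2 * ?v w * ?vt w" for w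
    have s': "s \<in> {t..<T}" by (rule s)
    have tr: "t \<in> {t..<T}" using s by auto
    have i1: "integrable M (\<lambda>w. trace (?Gww w))"
      by (rule integrable3[OF seq_cont3_trace[OF V2.smoothD(9)] growth3_trace[OF V2.smoothD(15)] s0 V2.X_tame dominated_X dominated_X])
    have i2: "integrable M (\<lambda>w. 1/2 * (\<integral>v. trace ((2 * ?v w) *\<^sub>R ?vwm w v) \<partial>M))"
      by (rule V2.inner_integrable[OF approx_walk[OF tr s']])
    have i3: "integrable M (\<lambda>w. 2 * ?v w * ?vt w)"
      by (rule integrable3[OF V2.smoothD(7,13) s0 V2.X_tame dominated_X dominated_X])
    have hi: "integrable M h" unfolding h_def[abs_def]
      by (intro Bochner_Integration.integrable_add integrable_mult_right i1 i2 i3)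
    have ell: "V2.ell s = (\<integral>w. h w \<partial>M)"
      unfolding V2.ell_def h_def using i1 i2 i3 by simp
    have low: "- (3 * L + L\<^sup>2) * (?v w)\<^sup>2 - L * energy s \<le> h w" if w: "w \<in> space M" for w
    proof -
      have xC: "X w \<in> cpaths T" by (rule X_cpaths[OF w])
      note e1 = eq1[OF s0 xC \<mu>C_P2C, unfolded embed_\<mu>C] and e2 = eq2[OF s0 xC \<mu>C_P2C, unfolded embed_\<mu>C]
      have q1: "integrable \<mu>C (F1wm s (X w) (law X))" and q2: "integrable \<mu>C (F2wm s (X w) (law X))"
        using e1 e2 by blast+
      let ?\<nu>1 = "distr \<mu>C borel (\<lambda>\<omega>. u1 s \<omega> \<mu>C)" and ?\<nu>2 = "distr \<mu>C borel (\<lambda>\<omega>. u2 s \<omega> \<mu>C)"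
      have nu: "?\<nu>1 \<in> P2R" "?\<nu>2 \<in> P2R" using e1 e2 by blast+
      have v1: "u1 s (X w) \<mu>C = F1 s (X w) (law X)" and v2: "u2 s (X w) \<mu>C = F2 s (X w) (law X)"
        using e1 e2 by blast+
      define a1 where "a1 = f' s (X w) (F1 s (X w) (law X)) (F1w s (X w) (law X)) (law X) ?\<nu>1"
      define a2 where "a2 = f' s (X w) (F2 s (X w) (law X)) (F2w s (X w) (law X)) (law X) ?\<nu>2"
      have p1: "F1t s (X w) (law X) + 1/2 * trace (F1ww s (X w) (law X)) + 1/2 * (\<integral>v. trace (F1wm s (X w) (law X) (X v)) \<partial>M) + a1 = 0"
        using e1 unfolding trace_wm(1)[OF q1] a1_def by (simp add: f_eq[OF s0 xC \<mu>C_P2C nu(1)] embed_\<mu>C v1)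
      have p2: "F2t s (X w) (law X) + 1/2 * trace (F2ww s (X w) (law X)) + 1/2 * (\<integral>v. trace (F2wm s (X w) (law X) (X v)) \<partial>M) + a2 = 0"
        using e2 unfolding trace_wm(1)[OF q2] a2_def by (simp add: f_eq[OF s0 xC \<mu>C_P2C nu(2)] embed_\<mu>C v2)
      have tr1: "trace (?Gww w) = 2 * (norm (?vw w))\<^sup>2 + 2 * ?v w * (trace (F1ww s (X w) (law X)) - trace (F2ww s (X w) (law X)))"
        unfolding trace_add trace_scaleR trace_outer trace_sub by (simp add: power2_norm_eq_inner)
      have tr2: "(\<integral>v. trace ((2 * ?v w) *\<^sub>R ?vwm w v) \<partial>M)
         = 2 * ?v w * ((\<integral>v. trace (F1wm s (X w) (law X) (X v)) \<partial>M) - (\<integral>v. trace (F2wm s (X w) (law X) (X v)) \<partial>M))"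
        unfolding trace_scaleR trace_sub using trace_wm(2)[OF q1] trace_wm(2)[OF q2] by simp
      have "h w = (norm (?vw w))\<^sup>2 + 2 * ?v w * (?vt w
          + 1/2 * (trace (F1ww s (X w) (law X)) - trace (F2ww s (X w) (law X)))
          + 1/2 * ((\<integral>v. trace (F1wm s (X w) (law X) (X v)) \<partial>M) - (\<integral>v. trace (F2wm s (X w) (law X) (X v)) \<partial>M)))"
        unfolding h_def tr1 tr2 by (simp add: algebra_simps)
      also have "?vt w
          + 1/2 * (trace (F1ww s (X w) (law X)) - trace (F2ww s (X w) (law X)))
          + 1/2 * ((\<integral>v. trace (F1wm s (X w) (law X) (X v)) \<partial>M) - (\<integral>v. trace (F2wm s (X w) (law X) (X v)) \<partial>M)) = a2 - a1"
        using p1 p2 by (simp add: algebra_simps)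
      finally have hw: "h w = (norm (?vw w))\<^sup>2 + 2 * ?v w * (a2 - a1)" .
      define x where "x = \<bar>?v w\<bar>"
      define y where "y = norm (?vw w)"
      define z where "z = sqrt (energy s)"
      have xyz: "0 \<le> x" "0 \<le> y" "0 \<le> z" "z\<^sup>2 = energy s"
        by (auto simp: x_def y_def z_def energy_nonneg)
      have "\<bar>a1 - a2\<bar> \<le> L * (x + y + W2R ?\<nu>1 ?\<nu>2)" unfolding a1_def a2_def x_def y_def
        by (rule L(2)[OF s0 X_D[OF w] X_measurable dominated_law[OF dominated_X] nu])
      also have "\<dots> \<le> L * (x + y + z)"
        unfolding z_def by (intro mult_left_mono add_left_mono law_distance[OF s0] L(1))
      finally have a12: "\<bar>a2 - a1\<bar> \<le> L * (x + y + z)" by (simp add: abs_minus_commute)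
      have "- (2 * ?v w * (a2 - a1)) \<le> \<bar>2 * ?v w * (a2 - a1)\<bar>" by simp
      also have "\<dots> = 2 * x * \<bar>a2 - a1\<bar>" unfolding x_def abs_mult by simp
      also have "\<dots> \<le> 2 * x * (L * (x + y + z))" using xyz by (intro mult_left_mono a12) auto
      also have "\<dots> = 2 * L * x\<^sup>2 + 2 * ((L * x) * y) + L * (2 * (x * z))"
        by (simp add: power2_eq_square algebra_simps)
      \<comment> \<open>The product 2 (L x) y is split so that y^2 comes out with coefficient
        exactly 1, which is the squared gradient available in h.\<close>
      also have "\<dots> \<le> 2 * L * x\<^sup>2 + ((L * x)\<^sup>2 + y\<^sup>2) + L * (x\<^sup>2 + z\<^sup>2)"
        using sum_squares_bound[of "L * x" y] sum_squares_bound[of x z] L(1)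
        by (intro add_mono mult_left_mono order_refl) (simp_all add: mult.assoc)
      finally have low1: "- (2 * ?v w * (a2 - a1)) \<le> (3 * L + L\<^sup>2) * x\<^sup>2 + y\<^sup>2 + L * energy s"
        unfolding xyz(4)[symmetric] by (simp add: algebra_simps power_mult_distrib)
      have "x\<^sup>2 = (?v w)\<^sup>2" by (simp add: x_def)
      from low1[unfolded this y_def] show ?thesis unfolding hw mult_minus_left by linarith
    qed
    have vi: "integrable M (\<lambda>w. (?v w)\<^sup>2)" by (rule energy_integrable[OF s0])
    have "(\<integral>w. - (3 * L + L\<^sup>2) * (?v w)\<^sup>2 - L * energy s \<partial>M) \<le> (\<integral>w. h w \<partial>M)"
      by (rule integral_mono) (use vi hi low in auto)
    moreover have "(\<integral>w. - (3 * L + L\<^sup>2) * (?v w)\<^sup>2 - L * energy s \<partial>M) = - (3 * L + L\<^sup>2) * energy s - L * energy s"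
      using vi by (simp add: energy_def prob_space)
    ultimately show "- (4 * L + L\<^sup>2) * energy s \<le> V2.ell s" unfolding ell by (simp add: algebra_simps)
  qed
qed

theorem difference_vanishes: "AE w in M. V t (X w) (law X) = 0"
proof -
  have T0: "T \<in> {0..T}" using T_nonneg by simp
  have eT: "energy T = 0"
  proof -
    have "F1 T (X w) (law X) - F2 T (X w) (law X) = 0" if w: "w \<in> space M" for w
      using terminal[OF X_cpaths[OF w] \<mu>C_P2C] eq1[OF T0 X_cpaths[OF w] \<mu>C_P2C] eq2[OF T0 X_cpaths[OF w] \<mu>C_P2C]
      by (simp add: embed_\<mu>C)
    then have "energy T = (\<integral>w. 0 \<partial>M)" unfolding energy_def by (intro Bochner_Integration.integral_cong) auto
    then show ?thesis by simp
  qed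
  have "energy t \<le> 0"
  proof (cases "t < T")
    case True
    obtain C where C: "0 \<le> C" "\<And>s. s \<in> {t..<T} \<Longrightarrow> - C * energy s \<le> V2.ell s" using ell_lower by blast
    show ?thesis
    proof (rule gronwall_backward_zero[where a = energy and ell = V2.ell, OF True _ C(1) _ C(2) eT])
      show "continuous_on {t..T} energy" unfolding energy_def by (rule V2.expectation_continuous)
      show "V2.ell integrable_on {r..T} \<and> integral {r..T} V2.ell = energy T - energy r" if "r \<in> {t..<T}" for r
        using V2.expectation_formula[OF that] unfolding energy_def by blast
    qed
  next
    case False
    then have "t = T" using t_range by auto
    then show ?thesis using eT by simp
  qed
  then have "energy t = 0" using energy_nonneg[of t] by simp
  then have "AE w in M. (F1 t (X w) (law X) - F2 t (X w) (law X))\<^sup>2 = 0"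
    unfolding energy_def using energy_integrable[OF t_range] by (subst (asm) integral_nonneg_eq_0_iff_AE) auto
  then show ?thesis unfolding V_def by eventually_elim simp
qed

end

section \<open>Brownian continuation of a given continuous initial segment\<close>

section \<open>Brownian processes with prescribed initial segment\<close>

context basis
begin

text \<open>X follows \<eta> up to t and then adds the increment of B from t. On a null set
  containing the discontinuous paths of B that increment is replaced by 0, and completeness of the
  filtration keeps the result adapted.\<close>

lemma brownian_extension:
  assumes t: "t \<in> {0..T}" and \<eta>: "\<And>w. w \<in> space M \<Longrightarrow> \<eta> w \<in> cpaths T"
    and ad: "\<And>s. s \<in> {0..T} \<Longrightarrow> (\<lambda>w. \<eta> w s) \<in> borel_measurable (Fil s)"
    and R: "\<And>w s. w \<in> space M \<Longrightarrow> s \<in> {0..T} \<Longrightarrow> norm (\<eta> w s) \<le> R"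
  obtains X where "brownian_after t X" "\<And>w. w \<in> space M \<Longrightarrow> stop T t (X w) = stop T t (\<eta> w)"
proof -
  obtain N where N: "N \<in> null_sets M" "{w \<in> space M. \<not> continuous_on {0..T} (\<lambda>t. B t w)} \<subseteq> N"
    using B_continuous unfolding eventually_ae_filter by blast
  have NF: "N \<in> sets (Fil s)" if "0 \<le> s" for s
    using complete_filtration[OF N(1) order_refl] sets_F_mono[OF that] by blast
  define X where "X w s = (if s \<in> {0..T} then \<eta> w (min s t) + (if w \<in> N then 0 else B (max s t) w - B t w) else 0)" for w s
  have cont: "X w \<in> cpaths T" if w: "w \<in> space M" for w
  proof -
    have e: "continuous_on {0..T} (\<lambda>s. \<eta> w (min s t))"
      by (rule continuous_on_compose2[of "{0..T}" "\<eta> w"])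
         (use \<eta>[OF w] t in \<open>auto simp: cpaths_def intro!: continuous_intros\<close>)
    have b: "continuous_on {0..T} (\<lambda>s. B (max s t) w)" if "w \<notin> N"
      by (rule continuous_on_compose2[of "{0..T}" "\<lambda>s. B s w"])
         (use N(2) w that t in \<open>auto intro!: continuous_intros\<close>)
    have "continuous_on {0..T} (\<lambda>s. \<eta> w (min s t) + (if w \<in> N then 0 else B (max s t) w - B t w))"
      using e b by (cases "w \<in> N") (auto intro!: continuous_intros)
    moreover have "continuous_on {0..T} (X w) = continuous_on {0..T} (\<lambda>s. \<eta> w (min s t) + (if w \<in> N then 0 else B (max s t) w - B t w))"
      by (rule continuous_on_cong) (auto simp: X_def)
    ultimately show ?thesis unfolding cpaths_def by (auto simp: X_def)
  qed
  have meas: "(\<lambda>w. X w s) \<in> borel_measurable (Fil s)" if s: "s \<in> {0..T}" for s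
  proof -
    have st: "min s t \<in> {0..T}" using s t by auto
    have e: "(\<lambda>w. \<eta> w (min s t)) \<in> borel_measurable (Fil s)" by (rule borel_Fil_mono[OF ad[OF st]]) simp
    have "(\<lambda>w. if w \<in> N then 0 else B (max s t) w - B t w) \<in> borel_measurable (Fil s)"
    proof (cases "s \<le> t")
      case True
      then have "(\<lambda>w. if w \<in> N then 0 else B (max s t) w - B t w) = (\<lambda>w. 0)" by (simp add: max_def fun_eq_iff)
      then show ?thesis by simp
    next
      case False
      have "B s \<in> borel_measurable (Fil s)" by (rule B_adapted[OF s])
      moreover have "B t \<in> borel_measurable (Fil s)" by (rule borel_Fil_mono[OF B_adapted[OF t]]) (use False in simp)
      moreover have "{w \<in> space (Fil s). w \<in> N} = N" using sets.sets_into_space[OF NF[of s]] s by auto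
      ultimately show ?thesis using False NF[of s] s
        by (intro measurable_If borel_measurable_diff borel_measurable_const) (auto simp: max_def)
    qed
    from borel_measurable_add[OF e this] show ?thesis using s by (simp add: X_def)
  qed
  have b: "brownian_after t X"
    unfolding brownian_after_def
  proof (intro conjI ballI t cont meas allI impI)
    show "\<exists>R. \<forall>w\<in>space M. \<forall>s\<in>{0..t}. norm (X w s) \<le> R"
    proof (intro exI ballI)
      fix w s assume w: "w \<in> space M" and s: "s \<in> {0..t}"
      then have "X w s = \<eta> w s" using t by (auto simp: X_def max_def min_def)
      then show "norm (X w s) \<le> R" using R[OF w, of s] s t by simp
    qed
    fix a b assume ab: "t \<le> a" "a < b" "b \<le> T"
    have "AE w in M. w \<notin> N" by (rule AE_not_in[OF N(1)])
    then show "AE w in M. X w b - X w a = B b w - B a w"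
      by eventually_elim (use ab t in \<open>simp add: X_def max_def min_def\<close>)
  qed
  moreover have "stop T t (X w) = stop T t (\<eta> w)" for w
    unfolding stop_def fun_eq_iff using t by (auto simp: X_def max_def min_def)
  ultimately show ?thesis by (rule that)
qed

section \<open>Continuous representatives, events of prescribed probability, and truncation\<close>

section \<open>Continuous representatives and small events\<close>

text \<open>For a cadlag path, uniform continuity on the countable grid amounts to continuity on
  [0,T]. All quantifiers on the right are countable, which makes \<open>cpaths T\<close> a
  measurable set.\<close>

lemma cpaths_eq:
  "cpaths T = {\<omega> \<in> D. \<forall>k::nat. \<exists>m::nat. \<forall>p\<in>time_grid T. \<forall>q\<in>time_grid T.
     \<bar>p - q\<bar> < inverse (real (Suc m)) \<longrightarrow> norm (\<omega> p - \<omega> q) \<le> inverse (real (Suc k))}" (is "_ = ?R")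
proof (intro set_eqI iffI)
  fix \<omega> :: "'d path" assume \<omega>: "\<omega> \<in> cpaths T"
  have "\<exists>m::nat. \<forall>p\<in>time_grid T. \<forall>q\<in>time_grid T.
     \<bar>p - q\<bar> < inverse (real (Suc m)) \<longrightarrow> norm (\<omega> p - \<omega> q) \<le> inverse (real (Suc k))" for k :: nat
  proof -
    obtain h where h: "0 < h" "\<And>u v. u \<in> {0..T} \<Longrightarrow> v \<in> {0..T} \<Longrightarrow> \<bar>u - v\<bar> \<le> h \<Longrightarrow> norm (\<omega> u - \<omega> v) \<le> inverse (real (Suc k))"
      using cpaths_uniform[OF \<omega>, of "inverse (real (Suc k))"] by auto
    obtain m where m: "inverse (real (Suc m)) < h" using reals_Archimedean[OF h(1)] by blast
    show ?thesis
      by (rule exI[of _ m]) (use h(2) m time_grid_subset[OF T_nonneg] in \<open>auto simp: subset_iff\<close>)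
  qed
  then show "\<omega> \<in> ?R" using cpaths_cadlag[OF \<omega>] by blast
next
  fix \<omega> :: "'d path" assume R: "\<omega> \<in> ?R"
  then have \<omega>: "\<omega> \<in> D" by blast
  have "continuous_on {0..T} \<omega>"
    unfolding continuous_on_iff
  proof (intro ballI allI impI)
    fix s e :: real assume s: "s \<in> {0..T}" and e: "0 < e"
    \<comment> \<open>Three distances, from s' to q, from q to p and from p to s, must add up to
      less than e; each gets a quarter.\<close>
    obtain k where k: "inverse (real (Suc k)) < e / 4" using reals_Archimedean[of "e/4"] e by auto
    obtain m where m: "\<And>p q. p \<in> time_grid T \<Longrightarrow> q \<in> time_grid T \<Longrightarrow> \<bar>p - q\<bar> < inverse (real (Suc m)) \<Longrightarrow> norm (\<omega> p - \<omega> q) \<le> inverse (real (Suc k))"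
      using R by blast
    \<comment> \<open>Half of the modulus on the grid: p and q lie within d of s and s', to their
      right, and s and s' are within d of each other, so p and q are less than 2 d apart.\<close>
    define d where "d = inverse (real (Suc m)) / 2"
    have d: "0 < d" by (simp add: d_def)
    have "dist (\<omega> s') (\<omega> s) < e" if s': "s' \<in> {0..T}" "dist s' s < d" for s'
    proof -
      have ed: "0 < min d (e/4)" using d e by simp
      obtain p where p: "p \<in> time_grid T" "dist (\<omega> p) (\<omega> s) < min d (e/4)" "s \<le> p" "p < s + min d (e/4)"
        using cadlag_approx_grid[OF \<omega> s ed] by blast
      obtain q where q: "q \<in> time_grid T" "dist (\<omega> q) (\<omega> s') < min d (e/4)" "s' \<le> q" "q < s' + min d (e/4)"
        using cadlag_approx_grid[OF \<omega> s'(1) ed] by blast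
      have "\<bar>p - q\<bar> < 2 * d" using p(3,4) q(3,4) s'(2) by (auto simp: dist_real_def)
      then have "dist (\<omega> p) (\<omega> q) \<le> inverse (real (Suc k))" using m[OF p(1) q(1)] by (simp add: d_def dist_norm)
      moreover have "dist (\<omega> s') (\<omega> s) \<le> dist (\<omega> q) (\<omega> s') + dist (\<omega> p) (\<omega> q) + dist (\<omega> p) (\<omega> s)"
        using dist_triangle[of "\<omega> s'" "\<omega> s" "\<omega> q"] dist_triangle[of "\<omega> q" "\<omega> s" "\<omega> p"] by (simp add: dist_commute)
      ultimately show ?thesis using p(2) q(2) k e unfolding min_less_iff_conj by auto
    qed
    then show "\<exists>d>0. \<forall>s'\<in>{0..T}. dist s' s < d \<longrightarrow> dist (\<omega> s') (\<omega> s) < e" using d by blast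
  qed
  then show "\<omega> \<in> cpaths T" using cadlagD(3)[OF \<omega>] by (auto simp: cpaths_def)
qed

lemma cpaths_sets: "cpaths T \<in> sets PD"
proof -
  have "{\<omega> \<in> space PD. norm (\<omega> p - \<omega> q) \<le> c} \<in> sets PD" for p q and c :: real
  proof -
    have "(\<lambda>\<omega>. norm (\<omega> p - \<omega> q)) \<in> borel_measurable PD"
      by (rule measurable_compose[OF borel_measurable_diff[OF measurable_path_coord measurable_path_coord] borel_measurable_norm])
    then show ?thesis by measurable
  qed
  then have *: "{\<omega> \<in> space PD. \<bar>p - q\<bar> < d \<longrightarrow> norm (\<omega> p - \<omega> q) \<le> c} \<in> sets PD" for p q and c d :: real
    using sets.top[of PD] by (cases "\<bar>p - q\<bar> < d") simp_all
  have "{\<omega> \<in> space PD. \<forall>k::nat. \<exists>m::nat. \<forall>p\<in>time_grid T. \<forall>q\<in>time_grid T.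
     \<bar>p - q\<bar> < inverse (real (Suc m)) \<longrightarrow> norm (\<omega> p - \<omega> q) \<le> inverse (real (Suc k))} \<in> sets PD"
    by (intro sets.sets_Collect_countable_All sets.sets_Collect_countable_Ex
        sets.sets_Collect_countable_All' countable_time_grid *)
  then show ?thesis by (subst cpaths_eq) simp
qed

lemma embed_in_P2D:
  assumes \<mu>: "\<mu> \<in> P2C T"
  shows "embed_law T \<mu> \<in> PL"
proof -
  have s: "sets \<mu> = sets (path_space (cpaths T))" and p: "prob_space \<mu>" and i: "integrable \<mu> (\<lambda>\<omega>. (sup_norm T \<omega>)\<^sup>2)"
    using \<mu> by (auto simp: P2_def)
  have "(\<lambda>\<omega>. \<omega>) \<in> measurable (path_space (cpaths T)) PD"
    by (rule measurable_path_space) (auto simp: cpaths_cadlag measurable_path_coord)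
  then have m: "(\<lambda>\<omega>. \<omega>) \<in> measurable \<mu> PD" using s by (simp cong: measurable_cong_sets)
  show ?thesis unfolding P2_def embed_law_def
    using prob_space.prob_space_distr[OF p m] i m by (simp add: integrable_distr_eq)
qed

text \<open>Richness of the basis gives a cadlag process with this law, whose paths are continuous
  almost surely; the exceptional null set lies in every \<open>Fil s\<close> by completeness, so the
  paths there can be set to zero.\<close>

lemma continuous_representative:
  assumes \<mu>: "\<mu> \<in> P2C T"
  obtains \<eta> where "\<And>w. w \<in> space M \<Longrightarrow> \<eta> w \<in> cpaths T"
    "\<And>s. s \<in> {0..T} \<Longrightarrow> (\<lambda>w. \<eta> w s) \<in> borel_measurable (Fil s)" "law \<eta> = embed_law T \<mu>"
proof -
  obtain \<eta>0 where ad: "adapted_cadlag T M Fil \<eta>0" and l: "law \<eta>0 = embed_law T \<mu>"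
    using rich[OF embed_in_P2D[OF \<mu>]] by blast
  have m0: "\<eta>0 \<in> measurable M PD" by (rule adapted_measurable[OF ad])
  have s: "sets \<mu> = sets (path_space (cpaths T))" and p: "prob_space \<mu>"
    using \<mu> by (auto simp: P2_def)
  have sp: "space \<mu> = cpaths T" using sets_eq_imp_space_eq[OF s] by simp
  have "(\<lambda>\<omega>. \<omega>) \<in> measurable (path_space (cpaths T)) PD"
    by (rule measurable_path_space) (auto simp: cpaths_cadlag measurable_path_coord)
  then have m: "(\<lambda>\<omega>. \<omega>) \<in> measurable \<mu> PD" using s by (simp cong: measurable_cong_sets)
  have "prob (\<eta>0 -` cpaths T \<inter> space M) = measure (law \<eta>0) (cpaths T)"
    unfolding path_law_def by (rule measure_distr[OF m0 cpaths_sets, symmetric])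
  also have "\<dots> = measure \<mu> ((\<lambda>\<omega>. \<omega>) -` cpaths T \<inter> space \<mu>)"
    unfolding l embed_law_def by (rule measure_distr[OF m cpaths_sets])
  also have "\<dots> = 1" using prob_space.prob_space[OF p] sp by simp
  finally have p1: "prob (\<eta>0 -` cpaths T \<inter> space M) = 1" .
  have "AE w in M. w \<in> \<eta>0 -` cpaths T \<inter> space M"
    by (rule AE_prob_1[OF p1])
  then obtain N where N: "N \<in> null_sets M" "{w \<in> space M. \<not> w \<in> \<eta>0 -` cpaths T \<inter> space M} \<subseteq> N"
    unfolding eventually_ae_filter by blast
  have NF: "N \<in> sets (Fil s)" if "0 \<le> s" for s
    using complete_filtration[OF N(1) order_refl] sets_F_mono[OF that] by blast
  define \<eta> where "\<eta> w = (if w \<in> N then (\<lambda>_. 0) else \<eta>0 w)" for w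
  have c: "\<eta> w \<in> cpaths T" if "w \<in> space M" for w
    using N(2) that by (auto simp: \<eta>_def cpaths_def)
  have a: "(\<lambda>w. \<eta> w s) \<in> borel_measurable (Fil s)" if s: "s \<in> {0..T}" for s
  proof -
    have "(\<lambda>w. \<eta>0 w s) \<in> borel_measurable (Fil s)" using ad s by (simp add: adapted_cadlag_def)
    moreover have "{w \<in> space (Fil s). w \<in> N} = N" using sets.sets_into_space[OF NF[of s]] s by auto
    ultimately have "(\<lambda>w. if w \<in> N then 0 else \<eta>0 w s) \<in> borel_measurable (Fil s)"
      using NF[of s] s by (intro measurable_If borel_measurable_const) auto
    moreover have "(\<lambda>w. \<eta> w s) = (\<lambda>w. if w \<in> N then 0 else \<eta>0 w s)" by (auto simp: \<eta>_def)
    ultimately show ?thesis by simp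
  qed
  have ad': "adapted_cadlag T M Fil \<eta>" unfolding adapted_cadlag_def using c a cpaths_cadlag by blast
  have "law \<eta> = law \<eta>0" unfolding path_law_def
  proof (rule distr_cong_AE[OF refl refl _ adapted_measurable[OF ad'] m0])
    show "AE w in M. \<eta> w = \<eta>0 w" using AE_not_in[OF N(1)] by eventually_elim (simp add: \<eta>_def)
  qed
  then show ?thesis using that[OF c a] l by simp
qed

text \<open>The event has to lie in \<open>Fil 0\<close>, whereas atomlessness concerns events of M.
  Richness is therefore applied to the law of a random path that is constant, equal to 0 or to a
  fixed nonzero vector, and the event is read off from its value at time 0.\<close>

lemma small_event:
  assumes p: "0 < p" "p < 1"
  obtains A where "A \<in> sets (Fil 0)" "prob A = p"
proof -
  define one :: "real ^ 'd" where "one = (\<chi> i. 1)"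
  have one: "one \<noteq> 0" by (simp add: one_def vec_eq_iff)
  define c where "c b = (\<lambda>s. if b \<and> s \<in> {0..T} then one else 0)" for b :: bool
  have cC: "c b \<in> cpaths T" for b
  proof -
    have "continuous_on {0..T} (c b) = continuous_on {0..T} (\<lambda>s. if b then one else 0)"
      by (rule continuous_on_cong) (auto simp: c_def)
    then show ?thesis by (auto simp: cpaths_def c_def)
  qed
  let ?P = "measure_pmf (bernoulli_pmf p)"
  have cm: "c \<in> measurable ?P PD" by (rule measurable_path_space) (auto simp: cC cpaths_cadlag)
  define \<nu> where "\<nu> = distr ?P PD c"
  have "\<nu> \<in> PL"
  proof -
    have "finite (set_pmf (bernoulli_pmf p))" by (rule finite_subset[of _ UNIV]) auto
    then have "integrable ?P (\<lambda>b. (sup_norm T (c b))\<^sup>2)" by (rule integrable_measure_pmf_finite)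
    then show ?thesis unfolding P2_def \<nu>_def
      using prob_space.prob_space_distr[OF prob_space_measure_pmf cm] cm by (simp add: integrable_distr_eq)
  qed
  then obtain \<zeta> where ad: "adapted_cadlag T M Fil \<zeta>" and l: "law \<zeta> = \<nu>" using rich by blast
  define E where "E = {\<omega> \<in> space PD. \<omega> 0 \<noteq> 0}"
  have E: "E \<in> sets PD" 
  proof -
    have "(\<lambda>\<omega>. \<omega> 0) -` (- {0}) \<inter> space PD \<in> sets PD"
      by (rule measurable_sets[OF measurable_path_coord]) simp
    also have "(\<lambda>\<omega>. \<omega> 0) -` (- {0}) \<inter> space PD = E" by (auto simp: E_def)
    finally show ?thesis .
  qed
  have z0: "(\<lambda>w. \<zeta> w 0) \<in> borel_measurable (Fil 0)" using ad T_nonneg by (simp add: adapted_cadlag_def)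
  define A where "A = \<zeta> -` E \<inter> space M"
  have A: "A \<in> sets (Fil 0)"
  proof -
    have "(\<lambda>w. \<zeta> w 0) -` (- {0}) \<inter> space (Fil 0) \<in> sets (Fil 0)"
      by (rule measurable_sets[OF z0]) simp
    also have "(\<lambda>w. \<zeta> w 0) -` (- {0}) \<inter> space (Fil 0) = A"
      using ad by (auto simp: A_def E_def space_F adapted_cadlag_def)
    finally show ?thesis .
  qed
  have "prob A = measure (law \<zeta>) E" unfolding path_law_def A_def
    by (rule measure_distr[OF adapted_measurable[OF ad] E, symmetric])
  also have "\<dots> = measure ?P (c -` E \<inter> space ?P)" unfolding l \<nu>_def by (rule measure_distr[OF cm E])
  also have "c -` E \<inter> space ?P = {True}"
    using one T_nonneg cpaths_cadlag[OF cC[of True]] by (auto simp: E_def c_def split: if_splits)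
  also have "measure ?P {True} = p" using p by (simp add: measure_pmf_single)
  finally show ?thesis using that A by blast
qed

text \<open>The counterpart of \<open>hat_conv_law\<close> at a fixed time for processes that share
  no running maximum: mean-square convergence of the stopped processes is supplied directly.\<close>

lemma hat_conv_const_time:
  assumes t: "t \<in> {0..T}" and x: "x \<in> D" "\<And>n. xn n \<in> D" "\<And>n. path_dist T t x t (xn n) = 0"
    and Z: "Z \<in> measurable M PD" "law Z \<in> PL" and Zn: "\<And>n. Zn n \<in> measurable M PD" "\<And>n. law (Zn n) \<in> PL"
    and int: "\<And>n. integrable M (\<lambda>w. (path_dist T t (Z w) t (Zn n w))\<^sup>2)"
    and lim: "(\<lambda>n. \<integral>w. (path_dist T t (Z w) t (Zn n w))\<^sup>2 \<partial>M) \<longlonglongrightarrow> 0"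
  shows "hat_conv (\<lambda>_. t) xn (\<lambda>n. law (Zn n)) t x (law Z)"
proof -
  have m: "(\<lambda>w. stop T t (Z w)) \<in> measurable M PD" "(\<lambda>w. stop T t (Zn n w)) \<in> measurable M PD" for n
    by (rule measurable_compose[OF Z(1) stop_measurable_PD[OF t]], rule measurable_compose[OF Zn(1) stop_measurable_PD[OF t]])
  have sq: "(\<lambda>n. sqrt (\<integral>w. (path_dist T t (Z w) t (Zn n w))\<^sup>2 \<partial>M)) \<longlonglongrightarrow> 0"
    using tendsto_real_sqrt[OF lim] by simp
  have "(\<lambda>n. W2 T (stop_law T t (law Z)) (stop_law T t (law (Zn n)))) \<longlonglongrightarrow> 0"
  proof (rule squeeze_zero[OF W2_nonneg _ sq])
    fix n
    show "W2 T (stop_law T t (law Z)) (stop_law T t (law (Zn n))) \<le> sqrt (\<integral>w. (path_dist T t (Z w) t (Zn n w))\<^sup>2 \<partial>M)"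
      unfolding stop_law_law[OF Z(1) t] stop_law_law[OF Zn(1) t] path_dist_def
      by (rule W2_law_le[OF m int[unfolded path_dist_def]])
  qed
  then show ?thesis unfolding hat_conv_def using t x Z Zn by (simp add: dist_hat_def)
qed

lemma path_dist_measurable:
  assumes "Z \<in> measurable M PD" "Z' \<in> measurable M PD" "t \<in> {0..T}"
  shows "(\<lambda>w. path_dist T t (Z w) t (Z' w)) \<in> borel_measurable M"
  unfolding path_dist_def
  by (rule sup_norm_diff_measurable)
     (rule measurable_compose[OF assms(1) stop_measurable_PD[OF assms(3)]],
      rule measurable_compose[OF assms(2) stop_measurable_PD[OF assms(3)]])

end

text \<open>The radial projection to the ball of radius R. Being continuous, it preserves continuity
  of paths and adaptedness.\<close>

definition radial_clamp :: "real \<Rightarrow> 'a::real_normed_vector \<Rightarrow> 'a" where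
  "radial_clamp R x = (R / max R (norm x)) *\<^sub>R x"

lemma radial_clamp_zero [simp]: "radial_clamp R 0 = 0" by (simp add: radial_clamp_def)

lemma radial_clamp_id: "0 < R \<Longrightarrow> norm x \<le> R \<Longrightarrow> radial_clamp R x = x"
  by (simp add: radial_clamp_def max_def)

lemma norm_radial_clamp_le: "0 < R \<Longrightarrow> norm (radial_clamp R x) \<le> R"
  by (cases "norm x \<le> R") (auto simp: radial_clamp_def max_def)

lemma norm_radial_clamp_diff_le: "0 < R \<Longrightarrow> norm (x - radial_clamp R x) \<le> norm x"
proof -
  assume R: "0 < R"
  define c where "c = R / max R (norm x)"
  have c: "0 \<le> c" "c \<le> 1" using R by (auto simp: c_def)
  have "x - radial_clamp R x = (1 - c) *\<^sub>R x" by (simp add: radial_clamp_def c_def scaleR_diff_left)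
  then have "norm (x - radial_clamp R x) = (1 - c) * norm x" using c by simp
  also have "\<dots> \<le> 1 * norm x" using c by (intro mult_right_mono) auto
  finally show ?thesis by simp
qed

lemma continuous_on_radial_clamp: "0 < R \<Longrightarrow> continuous_on UNIV (radial_clamp R)"
  unfolding radial_clamp_def[abs_def] by (intro continuous_intros) (auto simp: max_def)

section \<open>From almost every path to every path, and from bounded processes to all laws\<close>

section \<open>Uniqueness\<close>

context solution_pair
begin

text \<open>Adding to the law of \<open>\<eta>\<close> a small atom at \<open>\<gamma>\<close> turns the almost sure statement
   into one about the given path.\<close>

lemma difference_zero_bounded:
  assumes t: "t \<in> {0..T}" and \<gamma>: "\<gamma> \<in> cpaths T" and \<eta>: "\<And>w. w \<in> space M \<Longrightarrow> \<eta> w \<in> cpaths T"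
    and ad: "\<And>s. s \<in> {0..T} \<Longrightarrow> (\<lambda>w. \<eta> w s) \<in> borel_measurable (Fil s)"
    and R: "\<And>w s. w \<in> space M \<Longrightarrow> s \<in> {0..T} \<Longrightarrow> norm (\<eta> w s) \<le> R"
  shows "V t \<gamma> (law \<eta>) = 0"
proof -
  have \<gamma>D: "\<gamma> \<in> D" by (rule cpaths_cadlag[OF \<gamma>])
  have \<eta>D: "\<eta> w \<in> D" if "w \<in> space M" for w by (rule cpaths_cadlag[OF \<eta>[OF that]])
  have \<eta>m: "\<eta> \<in> measurable M PD"
    by (rule adapted_measurable) (use \<eta>D ad in \<open>simp add: adapted_cadlag_def\<close>)
  have R0: "0 \<le> R"
  proof -
    obtain w where "w \<in> space M" using not_empty by blast
    from order_trans[OF norm_ge_zero R[OF this, of 0]] show ?thesis using T_nonneg by simp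
  qed
  have \<eta>s: "0 \<le> sup_norm T (\<eta> w)" "sup_norm T (\<eta> w) \<le> R" if "w \<in> space M" for w
    by (rule sup_norm_nonneg[OF \<eta>D[OF that] T_nonneg], rule sup_norm_le[OF T_nonneg R[OF that]])
  have "integrable M (\<lambda>w. (sup_norm T (\<eta> w))\<^sup>2)"
  proof (rule Bochner_Integration.integrable_bound[of _ "\<lambda>_. R\<^sup>2"])
    show "(\<lambda>w. (sup_norm T (\<eta> w))\<^sup>2) \<in> borel_measurable M" using measurable_compose[OF \<eta>m sup_norm_PD] by simp
    show "AE w in M. norm ((sup_norm T (\<eta> w))\<^sup>2) \<le> norm (R\<^sup>2)"
      using \<eta>s by (intro AE_I2) (simp add: power_mono)
  qed simp
  then have \<eta>P: "law \<eta> \<in> PL" by (rule law_in_P2D[OF \<eta>m])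
  have ex: "\<exists>A X. A \<in> sets (Fil 0) \<and> prob A = inverse (real (Suc (Suc n))) \<and> brownian_after t X \<and>
     (\<forall>w\<in>space M. stop T t (X w) = stop T t (if w \<in> A then \<gamma> else \<eta> w))" for n :: nat
  proof -
    \<comment> \<open>Starting at 2 keeps the probability strictly below 1, as
      \<open>small_event\<close> demands.\<close>
    have "inverse (real (Suc (Suc n))) < 1" by (simp add: inverse_less_1_iff)
    then obtain A where A: "A \<in> sets (Fil 0)" "prob A = inverse (real (Suc (Suc n)))"
      using small_event[of "inverse (real (Suc (Suc n)))"] by auto
    let ?\<eta> = "\<lambda>w. if w \<in> A then \<gamma> else \<eta> w"
    obtain X where X: "brownian_after t X" "\<And>w. w \<in> space M \<Longrightarrow> stop T t (X w) = stop T t (?\<eta> w)"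
    proof (rule brownian_extension[OF t])
      show "?\<eta> w \<in> cpaths T" if "w \<in> space M" for w using \<gamma> \<eta>[OF that] by simp
      show "(\<lambda>w. ?\<eta> w s) \<in> borel_measurable (Fil s)" if s: "s \<in> {0..T}" for s
      proof -
        have As: "A \<in> sets (Fil s)" using A(1) sets_F_mono[of 0 s] s by auto
        then have "{w \<in> space (Fil s). w \<in> A} = A" using sets.sets_into_space by blast
        then have "(\<lambda>w. if w \<in> A then \<gamma> s else \<eta> w s) \<in> borel_measurable (Fil s)"
          using As ad[OF s] by (intro measurable_If borel_measurable_const) auto
        moreover have "(\<lambda>w. ?\<eta> w s) = (\<lambda>w. if w \<in> A then \<gamma> s else \<eta> w s)" by auto
        ultimately show ?thesis by simp
      qed
      show "norm (?\<eta> w s) \<le> R + sup_norm T \<gamma>" if "w \<in> space M" "s \<in> {0..T}" for w s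
        using R[OF that] sup_norm_ge[OF \<gamma>D that(2)] sup_norm_nonneg[OF \<gamma>D T_nonneg] R0 by auto
    qed blast
    then show ?thesis using A by blast
  qed
  then obtain A X where AX: "\<And>n. A n \<in> sets (Fil 0)" "\<And>n. prob (A n) = inverse (real (Suc (Suc n)))"
    "\<And>n. brownian_after t (X n)"
    "\<And>n w. w \<in> space M \<Longrightarrow> stop T t (X n w) = stop T t (if w \<in> A n then \<gamma> else \<eta> w)" by metis
  have AM: "A n \<in> events" for n
    using AX(1)[of n] subalg[of 0] T_nonneg by (auto simp: subalgebra_def)
  have Xm: "X n \<in> measurable M PD" for n by (rule adapted_measurable[OF brownian_after_adapted[OF AX(3)]])
  have XP: "law (X n) \<in> PL" for n by (rule law_in_P2D[OF Xm brownian_sup_moment[OF AX(3)]])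
  have zero: "V t \<gamma> (law (X n)) = 0" for n
  proof -
    interpret P: solution_pair_process T M Fil B t "X n" f f' u1 u2 F1 F1t F2 F2t F1w F2w F1ww F2ww F1m F2m F1wm F2wm
      by unfold_locales (rule AX(3))
    \<comment> \<open>The event has positive probability, so it contains a point at which v
      vanishes; up to time t the path at that point is \<gamma>.\<close>
    have "\<exists>w\<in>A n. V t (X n w) (law (X n)) = 0"
    proof (rule ccontr)
      assume neg: "\<not> (\<exists>w\<in>A n. V t (X n w) (law (X n)) = 0)"
      have "AE w in M. w \<notin> A n" using P.difference_vanishes by eventually_elim (use neg in blast)
      then have "prob (A n) = 0" using AM by (simp add: prob_eq_0)
      then show False using AX(2)[of n] by simp
    qed
    then obtain w where w: "w \<in> A n" "V t (X n w) (law (X n)) = 0" by blast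
    have wM: "w \<in> space M" using w(1) sets.sets_into_space[OF AM] by blast
    have d0: "path_dist T t \<gamma> t (X n w) = 0" unfolding path_dist_def AX(4)[OF wM] using w(1) T_nonneg by simp
    have XD: "X n w \<in> D" by (rule P.X_D[OF wM])
    have pz: "path_dist T t (X n v) t (X n v) = 0" for v by (simp add: path_dist_def T_nonneg)
    \<comment> \<open>A constant sequence at distance 0: continuity forces v to have the same value
      at \<gamma> and at X n w.\<close>
    have "hat_conv (\<lambda>_::nat. t) (\<lambda>_. X n w) (\<lambda>_. law (X n)) t \<gamma> (law (X n))"
      by (rule hat_conv_const_time[OF t \<gamma>D XD d0 Xm XP Xm XP]) (simp_all add: pz)
    from seq_cont3D[OF seq_cont3_V this] show ?thesis using w(2) by (simp add: LIMSEQ_const_iff)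
  qed
  define c where "c = R + sup_norm T \<gamma>"
  have c0: "0 \<le> c" using R0 sup_norm_nonneg[OF \<gamma>D T_nonneg] by (simp add: c_def)
  \<comment> \<open>Up to time t the process differs from \<eta> only on \<open>A n\<close>, and
    there by at most c.\<close>
  have le: "(path_dist T t (\<eta> w) t (X n w))\<^sup>2 \<le> indicator (A n) w * c\<^sup>2" if w: "w \<in> space M" for n w
  proof (cases "w \<in> A n")
    case True
    have s: "stop T t (\<eta> w) \<in> D" "stop T t \<gamma> \<in> D" by (intro cadlag_stop \<eta>D[OF w] \<gamma>D t)+
    have "path_dist T t (\<eta> w) t (X n w) \<le> sup_norm T (stop T t (\<eta> w)) + sup_norm T (stop T t \<gamma>)"
      unfolding path_dist_def AX(4)[OF w] using True sup_norm_triangle_diff[OF s T_nonneg] by simp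
    also have "\<dots> \<le> c" unfolding c_def
      using sup_norm_stop_le[OF \<eta>D[OF w] _ T_nonneg, of t] sup_norm_stop_le[OF \<gamma>D _ T_nonneg, of t] \<eta>s(2)[OF w] t by auto
    finally have "path_dist T t (\<eta> w) t (X n w) \<le> c" .
    moreover have "0 \<le> path_dist T t (\<eta> w) t (X n w)" unfolding path_dist_def AX(4)[OF w] using True
      by (simp add: sup_norm_nonneg[OF cadlag_diff[OF s] T_nonneg])
    ultimately show ?thesis using True by (simp add: power_mono)
  next
    case False
    then show ?thesis unfolding path_dist_def AX(4)[OF w] by (simp add: T_nonneg)
  qed
  have bi: "integrable M (\<lambda>w. indicator (A n) w * c\<^sup>2)" for n
    using AM by (intro integrable_mult_left) (simp add: integrable_indicator_iff less_top[symmetric])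
  have int: "integrable M (\<lambda>w. (path_dist T t (\<eta> w) t (X n w))\<^sup>2)" for n
  proof (rule Bochner_Integration.integrable_bound[OF bi[of n]])
    show "(\<lambda>w. (path_dist T t (\<eta> w) t (X n w))\<^sup>2) \<in> borel_measurable M"
      using path_dist_measurable[OF \<eta>m Xm t] by simp
    show "AE w in M. norm ((path_dist T t (\<eta> w) t (X n w))\<^sup>2) \<le> norm (indicator (A n) w * c\<^sup>2)"
      using le by (intro AE_I2) simp
  qed
  have "(\<lambda>n. \<integral>w. (path_dist T t (\<eta> w) t (X n w))\<^sup>2 \<partial>M) \<longlonglongrightarrow> 0"
  proof (rule squeeze_zero)
    fix n
    show "0 \<le> (\<integral>w. (path_dist T t (\<eta> w) t (X n w))\<^sup>2 \<partial>M)" by (rule integral_nonneg_AE) simp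
    have "(\<integral>w. (path_dist T t (\<eta> w) t (X n w))\<^sup>2 \<partial>M) \<le> (\<integral>w. indicator (A n) w * c\<^sup>2 \<partial>M)"
      by (rule integral_mono[OF int bi le])
    also have "\<dots> = inverse (real (Suc (Suc n))) * c\<^sup>2" using AM[of n] AX(2)[of n] by (simp add: Int_absorb2 sets.sets_into_space)
    finally show "(\<integral>w. (path_dist T t (\<eta> w) t (X n w))\<^sup>2 \<partial>M) \<le> inverse (real (Suc (Suc n))) * c\<^sup>2" .
  next
    have "(\<lambda>n. inverse (real (Suc (Suc n)))) \<longlonglongrightarrow> 0" using LIMSEQ_Suc[OF LIMSEQ_inverse_real_of_nat] .
    from tendsto_mult_right[OF this, of "c\<^sup>2"] show "(\<lambda>n. inverse (real (Suc (Suc n))) * c\<^sup>2) \<longlonglongrightarrow> 0" by simp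
  qed
  then have "hat_conv (\<lambda>_. t) (\<lambda>_. \<gamma>) (\<lambda>n. law (X n)) t \<gamma> (law \<eta>)"
    by (intro hat_conv_const_time[OF t \<gamma>D \<gamma>D path_dist_zero[OF \<gamma>D t] \<eta>m \<eta>P Xm XP int])
  from seq_cont3D[OF seq_cont3_V this] show ?thesis unfolding zero by (simp add: LIMSEQ_const_iff)
qed

text \<open>Truncating \<eta> at radius n + 1 changes nothing once the radius exceeds the norm of
  the path. The truncations therefore converge in mean square, with the squared norm of \<eta> as
  majorant, and v passes to the limit by continuity in the law.\<close>

lemma difference_zero:
  assumes t: "t \<in> {0..T}" and \<gamma>: "\<gamma> \<in> cpaths T" and \<mu>: "\<mu> \<in> P2C T"
  shows "V t \<gamma> (embed_law T \<mu>) = 0"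
proof -
  have \<gamma>D: "\<gamma> \<in> D" by (rule cpaths_cadlag[OF \<gamma>])
  obtain \<eta> where \<eta>: "\<And>w. w \<in> space M \<Longrightarrow> \<eta> w \<in> cpaths T"
    "\<And>s. s \<in> {0..T} \<Longrightarrow> (\<lambda>w. \<eta> w s) \<in> borel_measurable (Fil s)" "law \<eta> = embed_law T \<mu>"
    using continuous_representative[OF \<mu>] by blast
  have \<eta>D: "\<eta> w \<in> D" if "w \<in> space M" for w by (rule cpaths_cadlag[OF \<eta>(1)[OF that]])
  have \<eta>m: "\<eta> \<in> measurable M PD"
    by (rule adapted_measurable) (use \<eta>D \<eta>(2) in \<open>simp add: adapted_cadlag_def\<close>)
  have \<eta>P: "law \<eta> \<in> PL" unfolding \<eta>(3) by (rule embed_in_P2D[OF \<mu>])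
  then have sq: "integrable M (\<lambda>w. (sup_norm T (\<eta> w))\<^sup>2)"
    unfolding P2_def path_law_def using \<eta>m by (simp add: integrable_distr_eq)
  define \<eta>n where "\<eta>n n w = (\<lambda>s. radial_clamp (real (Suc n)) (\<eta> w s))" for n w
  have nC: "\<eta>n n w \<in> cpaths T" if w: "w \<in> space M" for n w
  proof -
    have "continuous_on {0..T} (\<lambda>s. radial_clamp (real (Suc n)) (\<eta> w s))"
      by (rule continuous_on_compose2[OF continuous_on_radial_clamp, of _ _ "\<eta> w"]) (use \<eta>(1)[OF w] in \<open>auto simp: cpaths_def\<close>)
    then show ?thesis using \<eta>(1)[OF w] by (auto simp: cpaths_def \<eta>n_def)
  qed
  have nD: "\<eta>n n w \<in> D" if "w \<in> space M" for n w by (rule cpaths_cadlag[OF nC[OF that]])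
  have na: "(\<lambda>w. \<eta>n n w s) \<in> borel_measurable (Fil s)" if "s \<in> {0..T}" for n s
    unfolding \<eta>n_def
    by (rule measurable_compose[OF \<eta>(2)[OF that] borel_measurable_continuous_onI[OF continuous_on_radial_clamp]]) simp
  have nR: "norm (\<eta>n n w s) \<le> real (Suc n)" for n w s unfolding \<eta>n_def by (rule norm_radial_clamp_le) simp
  have nm: "\<eta>n n \<in> measurable M PD" for n
    by (rule adapted_measurable) (use nD na in \<open>simp add: adapted_cadlag_def\<close>)
  have zero: "V t \<gamma> (law (\<eta>n n)) = 0" for n
    by (rule difference_zero_bounded[OF t \<gamma> nC na nR])
  have le: "0 \<le> path_dist T t (\<eta> w) t (\<eta>n n w) \<and> path_dist T t (\<eta> w) t (\<eta>n n w) \<le> sup_norm T (\<lambda>s. \<eta> w s - \<eta>n n w s)"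
    if w: "w \<in> space M" for n w
  proof -
    have "(\<lambda>s. stop T t (\<eta> w) s - stop T t (\<eta>n n w) s) = stop T t (\<lambda>s. \<eta> w s - \<eta>n n w s)" by (simp add: stop_def fun_eq_iff)
    then have "path_dist T t (\<eta> w) t (\<eta>n n w) = sup_norm T (stop T t (\<lambda>s. \<eta> w s - \<eta>n n w s))" by (simp add: path_dist_def)
    then show ?thesis
      using sup_norm_stop_le[OF cadlag_diff[OF \<eta>D[OF w] nD[OF w]], of t n] sup_norm_nonneg[OF cadlag_stop[OF cadlag_diff[OF \<eta>D[OF w] nD[OF w]] t] T_nonneg, of n] t T_nonneg
      by simp
  qed
  have le2: "sup_norm T (\<lambda>s. \<eta> w s - \<eta>n n w s) \<le> sup_norm T (\<eta> w)" if w: "w \<in> space M" for n w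
  proof (rule sup_norm_le[OF T_nonneg])
    fix s assume s: "s \<in> {0..T}"
    have "norm (\<eta> w s - \<eta>n n w s) \<le> norm (\<eta> w s)" unfolding \<eta>n_def by (rule norm_radial_clamp_diff_le) simp
    also have "\<dots> \<le> sup_norm T (\<eta> w)" by (rule sup_norm_ge[OF \<eta>D[OF w] s])
    finally show "norm (\<eta> w s - \<eta>n n w s) \<le> sup_norm T (\<eta> w)" .
  qed
  have nsup: "sup_norm T (\<eta>n n w) \<le> real (Suc n)" if "w \<in> space M" for n w
    by (rule sup_norm_le[OF T_nonneg nR])
  have nP: "law (\<eta>n n) \<in> PL" for n
  proof (rule law_in_P2D[OF nm], rule Bochner_Integration.integrable_bound[of _ "\<lambda>_. (real (Suc n))\<^sup>2"])
    show "(\<lambda>w. (sup_norm T (\<eta>n n w))\<^sup>2) \<in> borel_measurable M" using measurable_compose[OF nm sup_norm_PD] by simp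
    show "AE w in M. norm ((sup_norm T (\<eta>n n w))\<^sup>2) \<le> norm ((real (Suc n))\<^sup>2)"
    proof (rule AE_I2)
      fix w assume w: "w \<in> space M"
      have "(sup_norm T (\<eta>n n w))\<^sup>2 \<le> (real (Suc n))\<^sup>2"
        by (rule power_mono[OF nsup[OF w] sup_norm_nonneg[OF nD[OF w] T_nonneg]])
      then show "norm ((sup_norm T (\<eta>n n w))\<^sup>2) \<le> norm ((real (Suc n))\<^sup>2)" by simp
    qed
  qed simp
  have dle: "(path_dist T t (\<eta> w) t (\<eta>n n w))\<^sup>2 \<le> (sup_norm T (\<eta> w))\<^sup>2" if "w \<in> space M" for n w
    using le[OF that, of n] le2[OF that, of n] by (intro power_mono) auto
  have pm: "(\<lambda>w. (path_dist T t (\<eta> w) t (\<eta>n n w))\<^sup>2) \<in> borel_measurable M" for n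
    using path_dist_measurable[OF \<eta>m nm t] by simp
  have int: "integrable M (\<lambda>w. (path_dist T t (\<eta> w) t (\<eta>n n w))\<^sup>2)" for n
    by (rule Bochner_Integration.integrable_bound[OF sq pm]) (use dle in \<open>auto intro!: AE_I2\<close>)
  have "(\<lambda>n. \<integral>w. (path_dist T t (\<eta> w) t (\<eta>n n w))\<^sup>2 \<partial>M) \<longlonglongrightarrow> (\<integral>w. 0 \<partial>M)"
  proof (rule integral_dominated_convergence[where w = "\<lambda>w. (sup_norm T (\<eta> w))\<^sup>2"])
    show "AE w in M. (\<lambda>n. (path_dist T t (\<eta> w) t (\<eta>n n w))\<^sup>2) \<longlonglongrightarrow> 0"
    proof (rule AE_I2)
      fix w assume w: "w \<in> space M"
      obtain n0 :: nat where n0: "sup_norm T (\<eta> w) \<le> real n0" using real_arch_simple by blast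
      have "path_dist T t (\<eta> w) t (\<eta>n n w) = 0" if n: "n \<ge> n0" for n
      proof -
        have "\<eta>n n w s = \<eta> w s" if s: "s \<in> {0..T}" for s
          unfolding \<eta>n_def using sup_norm_ge[OF \<eta>D[OF w] s] n0 n by (intro radial_clamp_id) auto
        then have "sup_norm T (\<lambda>s. \<eta> w s - \<eta>n n w s) \<le> 0" by (intro sup_norm_le[OF T_nonneg]) simp
        then show ?thesis using le[OF w, of n] by linarith
      qed
      then have "\<forall>\<^sub>F n in sequentially. (path_dist T t (\<eta> w) t (\<eta>n n w))\<^sup>2 = 0"
        unfolding eventually_sequentially by (intro exI[of _ n0]) simp
      then show "(\<lambda>n. (path_dist T t (\<eta> w) t (\<eta>n n w))\<^sup>2) \<longlonglongrightarrow> 0" by (rule tendsto_eventually)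
    qed
    fix n show "AE w in M. norm ((path_dist T t (\<eta> w) t (\<eta>n n w))\<^sup>2) \<le> (sup_norm T (\<eta> w))\<^sup>2"
      using dle by (intro AE_I2) simp
  qed (use sq pm in auto)
  then have lim: "(\<lambda>n. \<integral>w. (path_dist T t (\<eta> w) t (\<eta>n n w))\<^sup>2 \<partial>M) \<longlonglongrightarrow> 0" by simp
  have "hat_conv (\<lambda>_. t) (\<lambda>_. \<gamma>) (\<lambda>n. law (\<eta>n n)) t \<gamma> (law \<eta>)"
    by (rule hat_conv_const_time[OF t \<gamma>D \<gamma>D path_dist_zero[OF \<gamma>D t] \<eta>m \<eta>P nm nP int lim])
  from seq_cont3D[OF seq_cont3_V this] show ?thesis unfolding zero \<eta>(3) by (simp add: LIMSEQ_const_iff)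
qed

end

theorem theorem3p7:
  fixes T :: real
    and M :: "'w measure"
    and Fil :: "real \<Rightarrow> 'w measure"
    and B :: "real \<Rightarrow> 'w \<Rightarrow> real ^ ('d::finite)"
    and f :: "real \<Rightarrow> 'd path \<Rightarrow> real \<Rightarrow> real ^ 'd \<Rightarrow> 'd law \<Rightarrow> real measure \<Rightarrow> real"
    and \<Phi> :: "'d path \<Rightarrow> 'd law \<Rightarrow> real"
    and u1 u2 :: "real \<Rightarrow> 'd path \<Rightarrow> 'd law \<Rightarrow> real"
  assumes "T > 0"
    and "stochastic_basis T M Fil B"
    and "assumption_A2 T M Fil f \<Phi>"
    and "classical_solution T M Fil f \<Phi> u1"
    and "classical_solution T M Fil f \<Phi> u2"
  shows "\<forall>t\<in>{0..T}. \<forall>\<gamma>\<in>cpaths T. \<forall>\<mu>\<in>P2C T. u1 t \<gamma> \<mu> = u2 t \<gamma> \<mu>"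
proof (intro ballI)
  fix t and \<gamma> :: "'d path" and \<mu> :: "'d law" assume t: "t \<in> {0..T}" and \<gamma>: "\<gamma> \<in> cpaths T" and \<mu>: "\<mu> \<in> P2C T"
  obtain f' where f': "H2_driver T M Fil f'"
    "\<forall>t\<in>{0..T}. \<forall>\<gamma>\<in>cpaths T. \<forall>y z. \<forall>\<mu>\<in>P2C T. \<forall>\<nu>\<in>P2R. f t \<gamma> y z \<mu> \<nu> = f' t \<gamma> y z (embed_law T \<mu>) \<nu>"
    using assms(3) unfolding assumption_A2_def by blast
  obtain F1 F1t F1w F1ww F1m F1wm where 1: "C1211p T M Fil F1 F1t F1w F1ww F1m F1wm"
    "\<forall>t\<in>{0..T}. \<forall>\<gamma>\<in>cpaths T. \<forall>\<mu>\<in>P2C T.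
           u1 t \<gamma> \<mu> = F1 t \<gamma> (embed_law T \<mu>) \<and> integrable \<mu> (F1wm t \<gamma> (embed_law T \<mu>)) \<and>
           distr \<mu> borel (\<lambda>\<omega>. u1 t \<omega> \<mu>) \<in> P2R \<and>
           F1t t \<gamma> (embed_law T \<mu>) + 1/2 * trace (F1ww t \<gamma> (embed_law T \<mu>))
             + 1/2 * trace (\<integral>v. F1wm t \<gamma> (embed_law T \<mu>) v \<partial>\<mu>)
             + f t \<gamma> (u1 t \<gamma> \<mu>) (F1w t \<gamma> (embed_law T \<mu>)) \<mu> (distr \<mu> borel (\<lambda>\<omega>. u1 t \<omega> \<mu>)) = 0"
    "\<forall>\<gamma>\<in>cpaths T. \<forall>\<mu>\<in>P2C T. u1 T \<gamma> \<mu> = \<Phi> (stop T T \<gamma>) (stop_law T T \<mu>)"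
    using assms(4) unfolding classical_solution_def by blast
  obtain F2 F2t F2w F2ww F2m F2wm where 2: "C1211p T M Fil F2 F2t F2w F2ww F2m F2wm"
    "\<forall>t\<in>{0..T}. \<forall>\<gamma>\<in>cpaths T. \<forall>\<mu>\<in>P2C T.
           u2 t \<gamma> \<mu> = F2 t \<gamma> (embed_law T \<mu>) \<and> integrable \<mu> (F2wm t \<gamma> (embed_law T \<mu>)) \<and>
           distr \<mu> borel (\<lambda>\<omega>. u2 t \<omega> \<mu>) \<in> P2R \<and>
           F2t t \<gamma> (embed_law T \<mu>) + 1/2 * trace (F2ww t \<gamma> (embed_law T \<mu>))
             + 1/2 * trace (\<integral>v. F2wm t \<gamma> (embed_law T \<mu>) v \<partial>\<mu>)
             + f t \<gamma> (u2 t \<gamma> \<mu>) (F2w t \<gamma> (embed_law T \<mu>)) \<mu> (distr \<mu> borel (\<lambda>\<omega>. u2 t \<omega> \<mu>)) = 0"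
    "\<forall>\<gamma>\<in>cpaths T. \<forall>\<mu>\<in>P2C T. u2 T \<gamma> \<mu> = \<Phi> (stop T T \<gamma>) (stop_law T T \<mu>)"
    using assms(5) unfolding classical_solution_def by blast
  interpret solution_pair T M Fil B f f' u1 u2 F1 F1t F2 F2t F1w F2w F1ww F2ww F1m F2m F1wm F2wm
  proof (intro solution_pair.intro basis.intro basis_axioms.intro solution_pair_axioms.intro assms(1,2) f'(1) 1(1) 2(1))
    show "f s \<gamma> y z \<mu> \<nu> = f' s \<gamma> y z (embed_law T \<mu>) \<nu>"
      if "s \<in> {0..T}" "\<gamma> \<in> cpaths T" "\<mu> \<in> P2C T" "\<nu> \<in> P2R" for s \<gamma> y z \<mu> \<nu> using f'(2) that by blast
    show "u1 T \<gamma> \<mu> = u2 T \<gamma> \<mu>" if "\<gamma> \<in> cpaths T" "\<mu> \<in> P2C T" for \<gamma> \<mu> using 1(3) 2(3) that by simp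
  qed (fact 1(2)[rule_format] 2(2)[rule_format])+
  show "u1 t \<gamma> \<mu> = u2 t \<gamma> \<mu>"
    using difference_zero[OF t \<gamma> \<mu>] eq1[OF t \<gamma> \<mu>] eq2[OF t \<gamma> \<mu>] by (simp add: V_def)
qed

end
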